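(* Let $\mathcal{Q}$ and $\mathcal{Q}'$ be small quantaloids. Then $$\mathcal{Q}\simeq\mathcal{Q}'\ \Longrightarrow\ \mathsf{Ord}(\mathcal{Q})\simeq\mathsf{Ord}(\mathcal{Q}')\ \Longrightarrow\ \mathsf{Mod}(\mathcal{Q})\simeq\mathsf{Mod}(\mathcal{Q}')\ \Longrightarrow\ \mathcal{Z}(\mathcal{Q})\cong\mathcal{Z}(\mathcal{Q}').$$
   Context: $\mathsf{Sup}$ is the category of complete lattices and maps preserving arbitrary suprema. A quantaloid is a $\mathsf{Sup}$-enriched category; it is small when it has a set of objects; a quantale is a one-object quantaloid (a monoid in $\mathsf{Sup}$). Homomorphisms of quantaloids are $\mathsf{Sup}$-functors. $\mathsf{Mod}(\mathcal{Q})$ is the quantaloid of homomorphisms $\mathcal{Q}^{\mathsf{op}}\to\mathsf{Sup}$ and natural transformations, ordered componentwise. The centre $\mathcal{Z}(\mathcal{Q})$ of a quantaloid $\mathcal{Q}$ is the commutative quantale of natural transformations from the identity homomorphism $\mathsf{Id}_{\mathcal{Q}}$ to itself: its elements are the families $(\alpha_A\colon A\to A)_{A\in\mathcal{Q}_0}$ of arrows of $\mathcal{Q}$ with $\alpha_B\circ f=f\circ\alpha_A$ for every $f\colon A\to B$ in $\mathcal{Q}$; multiplication is componentwise composition and suprema are componentwise. $\cong$ is isomorphism of quantales. $\mathsf{Idm}(\mathcal{Q})$ is the quantaloid whose objects are the idempotent arrows of $\mathcal{Q}$; an arrow from $e\colon A\to A$ to $f\colon B\to B$ is a $\mathcal{Q}$-arrow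 $b\colon A\to B$ with $b\circ e=b=f\circ b$; composition and local order are as in $\mathcal{Q}$, and the identity on $e$ is $e$. For a small quantaloid $\mathcal{R}$: an $\mathcal{R}$-category $\mathbb{A}$ is a set $\mathbb{A}_0$ with a type function $t\colon\mathbb{A}_0\to\mathcal{R}_0$ and hom-arrows $\mathbb{A}(a',a)\colon ta\to ta'$ in $\mathcal{R}$ such that $\mathbb{A}(a'',a')\circ\mathbb{A}(a',a)\leq\mathbb{A}(a'',a)$ and $1_{ta}\leq\mathbb{A}(a,a)$. A functor $F\colon\mathbb{A}\to\mathbb{B}$ is a map $\mathbb{A}_0\to\mathbb{B}_0$ with $t(Fa)=ta$ and $\mathbb{A}(a',a)\leq\mathbb{B}(Fa',Fa)$; put $F\leq G$ when $1_{ta}\leq\mathbb{B}(Fa,Ga)$ for all $a$. A distributor $\Phi$ from $\mathbb{A}$ to $\mathbb{B}$ is a family of arrows $\Phi(b,a)\colon ta\to tb$ with $\mathbb{B}(b,b')\circ\Phi(b',a)\leq\Phi(b,a)$ and $\Phi(b,a')\circ\mathbb{A}(a',a)\leq\Phi(b,a)$; composition is $(\Psi\otimes\Phi)(c,a)=\bigvee_b\Psi(c,b)\circ\Phi(b,a)$, the identity on $\mathbb{A}$ has elements $\mathbb{A}(a',a)$, and distributors are ordered elementwise. $\mathbb{C}$ is Cauchy complete if for every $\mathbb{A}$ each left adjoint distributor from $\mathbb{A}$ to $\mathbb{C}$ is of the form $\mathbb{C}(-,F-)$ for some functor $F\colon\mathbb{A}\to\mathbb{C}$. $\mathsf{Cat}_{\mathsf{cc}}(\mathcal{R})$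 is the locally ordered category of Cauchy complete $\mathcal{R}$-categories and functors (the local order need not be antisymmetric). By definition $\mathsf{Ord}(\mathcal{Q})=\mathsf{Cat}_{\mathsf{cc}}(\mathsf{Idm}(\mathcal{Q}))$. The symbol $\simeq$ denotes equivalence of quantaloids between quantaloids, and biequivalence of locally ordered categories between the categories $\mathsf{Ord}$. *)

theory Defs
  imports "HOL-Library.FuncSet" "HOL-Library.Equipollence" "HOL-Algebra.Complete_Lattice"
begin

section \<open>Size\<close>

text \<open>
  A Grothendieck universe is given by a type \<open>'u\<close>: a set (of elements of any type) is small when
  its cardinality is strictly below that of \<open>'u\<close>, and the cardinality of \<open>'u\<close> is required to be
  inaccessible, i.e. smallness is closed under power sets and small unions.  Up to bijection, the
  sets of the universe are the small subsets of \<open>'u\<close>.  (As in SGA 4, the universe of hereditarily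
  finite sets is allowed; it is the case \<open>'u = nat\<close>.)
\<close>

definition small :: "'u itself \<Rightarrow> 'x set \<Rightarrow> bool" where
  "small U X \<longleftrightarrow> X \<prec> (UNIV :: 'u set)"

definition grothendieck_universe :: "'u itself \<Rightarrow> bool" where
  "grothendieck_universe U \<longleftrightarrow>
     (\<forall>X :: 'u set. small U X \<longrightarrow> small U (Pow X)) \<and>
     (\<forall>(I :: 'u set) (X :: 'u \<Rightarrow> 'u set).
        small U I \<and> (\<forall>i\<in>I. small U (X i)) \<longrightarrow> small U (\<Union>i\<in>I. X i))"


section \<open>Locally ordered categories and quantaloids\<close>

text \<open>
  As usual for enriched categories, there is a hom-object for each pair of objects and different
  hom-sets may overlap.  \<open>Comp C X Y Z g f\<close> is the composite of \<open>f : X \<rightarrow> Y\<close> and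
  \<open>g : Y \<rightarrow> Z\<close>.  The values of all fields are irrelevant outside the relevant sets of objects
  and arrows.
\<close>

record ('o, 'a) locat =
  Ob :: "'o set"
  Hom :: "'o \<Rightarrow> 'o \<Rightarrow> 'a set"
  Leq :: "'o \<Rightarrow> 'o \<Rightarrow> 'a \<Rightarrow> 'a \<Rightarrow> bool"
  Comp :: "'o \<Rightarrow> 'o \<Rightarrow> 'o \<Rightarrow> 'a \<Rightarrow> 'a \<Rightarrow> 'a"
  Ident :: "'o \<Rightarrow> 'a"

text \<open>The local order need not be antisymmetric.\<close>

locale locally_ordered_category =
  fixes C :: "('o, 'a) locat"
  assumes Ident_in_Hom: "X \<in> Ob C \<Longrightarrow> Ident C X \<in> Hom C X X"
    and Comp_in_Hom:
      "\<lbrakk>X \<in> Ob C; Y \<in> Ob C; Z \<in> Ob C; f \<in> Hom C X Y; g \<in> Hom C Y Z\<rbrakk>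
       \<Longrightarrow> Comp C X Y Z g f \<in> Hom C X Z"
    and Comp_Ident_right:
      "\<lbrakk>X \<in> Ob C; Y \<in> Ob C; f \<in> Hom C X Y\<rbrakk> \<Longrightarrow> Comp C X X Y f (Ident C X) = f"
    and Comp_Ident_left:
      "\<lbrakk>X \<in> Ob C; Y \<in> Ob C; f \<in> Hom C X Y\<rbrakk> \<Longrightarrow> Comp C X Y Y (Ident C Y) f = f"
    and Comp_assoc:
      "\<lbrakk>W \<in> Ob C; X \<in> Ob C; Y \<in> Ob C; Z \<in> Ob C;
        f \<in> Hom C W X; g \<in> Hom C X Y; h \<in> Hom C Y Z\<rbrakk>
       \<Longrightarrow> Comp C W X Z (Comp C X Y Z h g) f = Comp C W Y Z h (Comp C W X Y g f)"
    and Leq_refl: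
      "\<lbrakk>X \<in> Ob C; Y \<in> Ob C; f \<in> Hom C X Y\<rbrakk> \<Longrightarrow> Leq C X Y f f"
    and Leq_trans:
      "\<lbrakk>X \<in> Ob C; Y \<in> Ob C; f \<in> Hom C X Y; g \<in> Hom C X Y; h \<in> Hom C X Y;
        Leq C X Y f g; Leq C X Y g h\<rbrakk> \<Longrightarrow> Leq C X Y f h"
    and Comp_mono:
      "\<lbrakk>X \<in> Ob C; Y \<in> Ob C; Z \<in> Ob C;
        f \<in> Hom C X Y; f' \<in> Hom C X Y; g \<in> Hom C Y Z; g' \<in> Hom C Y Z;
        Leq C X Y f f'; Leq C Y Z g g'\<rbrakk>
       \<Longrightarrow> Leq C X Z (Comp C X Y Z g f) (Comp C X Y Z g' f')"

definition homlat :: "('o, 'a) locat \<Rightarrow> 'o \<Rightarrow> 'o \<Rightarrow> 'a gorder" where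
  "homlat C X Y = \<lparr>carrier = Hom C X Y, eq = (=), le = Leq C X Y\<rparr>"

locale quantaloid = locally_ordered_category Q for Q :: "('o, 'a) locat" +
  assumes homlat_complete:
      "\<lbrakk>X \<in> Ob Q; Y \<in> Ob Q\<rbrakk> \<Longrightarrow> complete_lattice (homlat Q X Y)"
    and Comp_sup_right:
      "\<lbrakk>X \<in> Ob Q; Y \<in> Ob Q; Z \<in> Ob Q; g \<in> Hom Q Y Z\<rbrakk>
       \<Longrightarrow> sup_pres (homlat Q X Y) (homlat Q X Z) (\<lambda>f. Comp Q X Y Z g f)"
    and Comp_sup_left:
      "\<lbrakk>X \<in> Ob Q; Y \<in> Ob Q; Z \<in> Ob Q; f \<in> Hom Q X Y\<rbrakk>
       \<Longrightarrow> sup_pres (homlat Q Y Z) (homlat Q X Z) (\<lambda>g. Comp Q X Y Z g f)"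

definition small_quantaloid :: "'u itself \<Rightarrow> ('o, 'a) locat \<Rightarrow> bool" where
  "small_quantaloid U Q \<longleftrightarrow>
     quantaloid Q \<and> small U (Ob Q) \<and> (\<forall>X\<in>Ob Q. \<forall>Y\<in>Ob Q. small U (Hom Q X Y))"

definition opq :: "('o, 'a) locat \<Rightarrow> ('o, 'a) locat" where
  "opq Q = \<lparr>Ob = Ob Q,
            Hom = (\<lambda>X Y. Hom Q Y X),
            Leq = (\<lambda>X Y. Leq Q Y X),
            Comp = (\<lambda>X Y Z g f. Comp Q Z Y X f g),
            Ident = Ident Q\<rparr>"


section \<open>Homomorphisms, natural transformations, equivalence of quantaloids\<close>

record ('o, 'a, 'p, 'b) arrow_map =
  FOb :: "'o \<Rightarrow> 'p"
  FArr :: "'o \<Rightarrow> 'o \<Rightarrow> 'a \<Rightarrow> 'b"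

definition identity_map :: "('o, 'a, 'o, 'a) arrow_map" where
  "identity_map = \<lparr>FOb = (\<lambda>X. X), FArr = (\<lambda>X Y f. f)\<rparr>"

definition comp_map ::
  "('p, 'b, 'q, 'c) arrow_map \<Rightarrow> ('o, 'a, 'p, 'b) arrow_map \<Rightarrow> ('o, 'a, 'q, 'c) arrow_map" where
  "comp_map G F = \<lparr>FOb = (\<lambda>X. FOb G (FOb F X)),
                   FArr = (\<lambda>X Y f. FArr G (FOb F X) (FOb F Y) (FArr F X Y f))\<rparr>"

definition homomorphism ::
  "('o, 'a) locat \<Rightarrow> ('p, 'b) locat \<Rightarrow> ('o, 'a, 'p, 'b) arrow_map \<Rightarrow> bool" where
  "homomorphism Q R F \<longleftrightarrow>
     (\<forall>X\<in>Ob Q. FOb F X \<in> Ob R) \<and>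
     (\<forall>X\<in>Ob Q. \<forall>Y\<in>Ob Q. FArr F X Y \<in> Hom Q X Y \<rightarrow> Hom R (FOb F X) (FOb F Y)) \<and>
     (\<forall>X\<in>Ob Q. FArr F X X (Ident Q X) = Ident R (FOb F X)) \<and>
     (\<forall>X\<in>Ob Q. \<forall>Y\<in>Ob Q. \<forall>Z\<in>Ob Q. \<forall>f\<in>Hom Q X Y. \<forall>g\<in>Hom Q Y Z.
        FArr F X Z (Comp Q X Y Z g f)
          = Comp R (FOb F X) (FOb F Y) (FOb F Z) (FArr F Y Z g) (FArr F X Y f)) \<and>
     (\<forall>X\<in>Ob Q. \<forall>Y\<in>Ob Q.
        sup_pres (homlat Q X Y) (homlat R (FOb F X) (FOb F Y)) (FArr F X Y))"

text \<open>Families are extensional on the set of objects, so that they are equal iff componentwise equal.\<close>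

definition nat_trans ::
  "('o, 'a) locat \<Rightarrow> ('p, 'b) locat \<Rightarrow> ('o, 'a, 'p, 'b) arrow_map \<Rightarrow> ('o, 'a, 'p, 'b) arrow_map
   \<Rightarrow> ('o \<Rightarrow> 'b) set" where
  "nat_trans Q R F G =
     {\<alpha> \<in> (\<Pi>\<^sub>E X\<in>Ob Q. Hom R (FOb F X) (FOb G X)).
        \<forall>X\<in>Ob Q. \<forall>Y\<in>Ob Q. \<forall>f\<in>Hom Q X Y.
          Comp R (FOb F X) (FOb F Y) (FOb G Y) (\<alpha> Y) (FArr F X Y f)
            = Comp R (FOb F X) (FOb G X) (FOb G Y) (FArr G X Y f) (\<alpha> X)}"

definition isomorphism_in :: "('o, 'a) locat \<Rightarrow> 'o \<Rightarrow> 'o \<Rightarrow> 'a \<Rightarrow> bool" where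
  "isomorphism_in C X Y f \<longleftrightarrow>
     f \<in> Hom C X Y \<and>
     (\<exists>g\<in>Hom C Y X. Comp C X Y X g f = Ident C X \<and> Comp C Y X Y f g = Ident C Y)"

definition naturally_isomorphic ::
  "('o, 'a) locat \<Rightarrow> ('p, 'b) locat \<Rightarrow> ('o, 'a, 'p, 'b) arrow_map \<Rightarrow> ('o, 'a, 'p, 'b) arrow_map
   \<Rightarrow> bool" where
  "naturally_isomorphic Q R F G \<longleftrightarrow>
     (\<exists>\<alpha>\<in>nat_trans Q R F G. \<forall>X\<in>Ob Q. isomorphism_in R (FOb F X) (FOb G X) (\<alpha> X))"

definition quantaloid_equivalent :: "('o, 'a) locat \<Rightarrow> ('p, 'b) locat \<Rightarrow> bool" where
  "quantaloid_equivalent Q R \<longleftrightarrow>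
     (\<exists>F G. homomorphism Q R F \<and> homomorphism R Q G \<and>
        naturally_isomorphic Q Q identity_map (comp_map G F) \<and>
        naturally_isomorphic R R (comp_map F G) identity_map)"


section \<open>The quantaloid of modules\<close>

definition functor_quantaloid ::
  "('o, 'a) locat \<Rightarrow> ('p, 'b) locat \<Rightarrow> (('o, 'a, 'p, 'b) arrow_map, 'o \<Rightarrow> 'b) locat" where
  "functor_quantaloid Q R =
     \<lparr>Ob = {F. homomorphism Q R F},
      Hom = nat_trans Q R,
      Leq = (\<lambda>F G \<alpha> \<beta>. \<forall>X\<in>Ob Q. Leq R (FOb F X) (FOb G X) (\<alpha> X) (\<beta> X)),
      Comp = (\<lambda>F G H \<beta> \<alpha>. \<lambda>X\<in>Ob Q. Comp R (FOb F X) (FOb G X) (FOb H X) (\<beta> X) (\<alpha> X)),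
      Ident = (\<lambda>F. \<lambda>X\<in>Ob Q. Ident R (FOb F X))\<rparr>"

definition Sup_quantaloid :: "('u gorder, 'u \<Rightarrow> 'u) locat" where
  "Sup_quantaloid =
     \<lparr>Ob = {L. complete_lattice L \<and> small TYPE('u) (carrier L)},
      Hom = (\<lambda>L M. {f \<in> carrier L \<rightarrow>\<^sub>E carrier M. sup_pres L M f}),
      Leq = (\<lambda>L M f g. \<forall>x\<in>carrier L. le M (f x) (g x)),
      Comp = (\<lambda>L M N g f. compose (carrier L) g f),
      Ident = (\<lambda>L. \<lambda>x\<in>carrier L. x)\<rparr>"

definition Mod_quantaloid ::
  "'u itself \<Rightarrow> ('o, 'a) locat
   \<Rightarrow> (('o, 'a, 'u gorder, 'u \<Rightarrow> 'u) arrow_map, 'o \<Rightarrow> 'u \<Rightarrow> 'u) locat" where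
  "Mod_quantaloid U Q = functor_quantaloid (opq Q) Sup_quantaloid"


section \<open>Quantales and the centre\<close>

text \<open>A quantale is a quantaloid with \<open>()\<close> as its only object.\<close>

definition quantale_isomorphic :: "(unit, 'a) locat \<Rightarrow> (unit, 'b) locat \<Rightarrow> bool" where
  "quantale_isomorphic Q R \<longleftrightarrow>
     (\<exists>h. bij_betw h (Hom Q () ()) (Hom R () ()) \<and>
          homomorphism Q R \<lparr>FOb = (\<lambda>_. ()), FArr = (\<lambda>_ _. h)\<rparr>)"

definition endo_quantale :: "('o, 'a) locat \<Rightarrow> 'o \<Rightarrow> (unit, 'a) locat" where
  "endo_quantale C X =
     \<lparr>Ob = UNIV, Hom = (\<lambda>_ _. Hom C X X), Leq = (\<lambda>_ _. Leq C X X),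
      Comp = (\<lambda>_ _ _. Comp C X X X), Ident = (\<lambda>_. Ident C X)\<rparr>"

definition Centre :: "('o, 'a) locat \<Rightarrow> (unit, 'o \<Rightarrow> 'a) locat" where
  "Centre Q = endo_quantale (functor_quantaloid Q Q) identity_map"


section \<open>Splitting idempotents\<close>

text \<open>
  Since hom-sets may overlap, an idempotent is recorded together with the object it lives on.
\<close>

definition Idm :: "('o, 'a) locat \<Rightarrow> ('o \<times> 'a, 'a) locat" where
  "Idm Q =
     \<lparr>Ob = {(X, e). X \<in> Ob Q \<and> e \<in> Hom Q X X \<and> Comp Q X X X e e = e},
      Hom = (\<lambda>(X, e) (Y, f). {b \<in> Hom Q X Y. Comp Q X X Y b e = b \<and> Comp Q X Y Y f b = b}),
      Leq = (\<lambda>(X, e) (Y, f). Leq Q X Y),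
      Comp = (\<lambda>(X, e) (Y, f) (Z, g). Comp Q X Y Z),
      Ident = (\<lambda>(X, e). e)\<rparr>"


section \<open>Enriched categories, functors and distributors\<close>

text \<open>
  \<open>EHom A a' a : Typ A a \<rightarrow> Typ A a'\<close> is the hom-arrow usually written \<open>A(a', a)\<close>; likewise
  a distributor \<open>\<Phi>\<close> from \<open>A\<close> to \<open>B\<close> has elements \<open>\<Phi> b a : Typ A a \<rightarrow> Typ B b\<close>.
\<close>

record ('u, 'o, 'a) ecat =
  Elts :: "'u set"
  Typ :: "'u \<Rightarrow> 'o"
  EHom :: "'u \<Rightarrow> 'u \<Rightarrow> 'a"

definition enriched_category :: "('o, 'a) locat \<Rightarrow> ('u, 'o, 'a) ecat \<Rightarrow> bool" where
  "enriched_category R A \<longleftrightarrow>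
     small TYPE('u) (Elts A) \<and>
     (\<forall>a\<in>Elts A. Typ A a \<in> Ob R) \<and>
     (\<forall>a'\<in>Elts A. \<forall>a\<in>Elts A. EHom A a' a \<in> Hom R (Typ A a) (Typ A a')) \<and>
     (\<forall>a''\<in>Elts A. \<forall>a'\<in>Elts A. \<forall>a\<in>Elts A.
        Leq R (Typ A a) (Typ A a'')
          (Comp R (Typ A a) (Typ A a') (Typ A a'') (EHom A a'' a') (EHom A a' a))
          (EHom A a'' a)) \<and>
     (\<forall>a\<in>Elts A. Leq R (Typ A a) (Typ A a) (Ident R (Typ A a)) (EHom A a a))"

definition enriched_functor ::
  "('o, 'a) locat \<Rightarrow> ('u, 'o, 'a) ecat \<Rightarrow> ('u, 'o, 'a) ecat \<Rightarrow> ('u \<Rightarrow> 'u) \<Rightarrow> bool" where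
  "enriched_functor R A B F \<longleftrightarrow>
     F \<in> Elts A \<rightarrow>\<^sub>E Elts B \<and>
     (\<forall>a\<in>Elts A. Typ B (F a) = Typ A a) \<and>
     (\<forall>a'\<in>Elts A. \<forall>a\<in>Elts A.
        Leq R (Typ A a) (Typ A a') (EHom A a' a) (EHom B (F a') (F a)))"

definition functor_le ::
  "('o, 'a) locat \<Rightarrow> ('u, 'o, 'a) ecat \<Rightarrow> ('u, 'o, 'a) ecat \<Rightarrow> ('u \<Rightarrow> 'u) \<Rightarrow> ('u \<Rightarrow> 'u) \<Rightarrow> bool" where
  "functor_le R A B F G \<longleftrightarrow>
     (\<forall>a\<in>Elts A. Leq R (Typ A a) (Typ A a) (Ident R (Typ A a)) (EHom B (F a) (G a)))"

definition distributor ::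
  "('o, 'a) locat \<Rightarrow> ('u, 'o, 'a) ecat \<Rightarrow> ('u, 'o, 'a) ecat \<Rightarrow> ('u \<Rightarrow> 'u \<Rightarrow> 'a) \<Rightarrow> bool" where
  "distributor R A B \<Phi> \<longleftrightarrow>
     (\<forall>b\<in>Elts B. \<forall>a\<in>Elts A. \<Phi> b a \<in> Hom R (Typ A a) (Typ B b)) \<and>
     (\<forall>b\<in>Elts B. \<forall>b'\<in>Elts B. \<forall>a\<in>Elts A.
        Leq R (Typ A a) (Typ B b)
          (Comp R (Typ A a) (Typ B b') (Typ B b) (EHom B b b') (\<Phi> b' a)) (\<Phi> b a)) \<and>
     (\<forall>b\<in>Elts B. \<forall>a'\<in>Elts A. \<forall>a\<in>Elts A.
        Leq R (Typ A a) (Typ B b)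
          (Comp R (Typ A a) (Typ A a') (Typ B b) (\<Phi> b a') (EHom A a' a)) (\<Phi> b a))"

definition distributor_le ::
  "('o, 'a) locat \<Rightarrow> ('u, 'o, 'a) ecat \<Rightarrow> ('u, 'o, 'a) ecat
   \<Rightarrow> ('u \<Rightarrow> 'u \<Rightarrow> 'a) \<Rightarrow> ('u \<Rightarrow> 'u \<Rightarrow> 'a) \<Rightarrow> bool" where
  "distributor_le R A B \<Phi> \<Psi> \<longleftrightarrow>
     (\<forall>b\<in>Elts B. \<forall>a\<in>Elts A. Leq R (Typ A a) (Typ B b) (\<Phi> b a) (\<Psi> b a))"

definition distributor_comp ::
  "('o, 'a) locat \<Rightarrow> ('u, 'o, 'a) ecat \<Rightarrow> ('u, 'o, 'a) ecat \<Rightarrow> ('u, 'o, 'a) ecat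
   \<Rightarrow> ('u \<Rightarrow> 'u \<Rightarrow> 'a) \<Rightarrow> ('u \<Rightarrow> 'u \<Rightarrow> 'a) \<Rightarrow> 'u \<Rightarrow> 'u \<Rightarrow> 'a" where
  "distributor_comp R A B C \<Psi> \<Phi> c a =
     \<Squnion>\<^bsub>homlat R (Typ A a) (Typ C c)\<^esub>
       ((\<lambda>b. Comp R (Typ A a) (Typ B b) (Typ C c) (\<Psi> c b) (\<Phi> b a)) ` Elts B)"

definition left_adjoint_distributor ::
  "('o, 'a) locat \<Rightarrow> ('u, 'o, 'a) ecat \<Rightarrow> ('u, 'o, 'a) ecat \<Rightarrow> ('u \<Rightarrow> 'u \<Rightarrow> 'a) \<Rightarrow> bool" where
  "left_adjoint_distributor R A B \<Phi> \<longleftrightarrow>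
     distributor R A B \<Phi> \<and>
     (\<exists>\<Psi>. distributor R B A \<Psi> \<and>
        distributor_le R A A (EHom A) (distributor_comp R A B A \<Psi> \<Phi>) \<and>
        distributor_le R B B (distributor_comp R B A B \<Phi> \<Psi>) (EHom B))"

definition cauchy_complete :: "('o, 'a) locat \<Rightarrow> ('u, 'o, 'a) ecat \<Rightarrow> bool" where
  "cauchy_complete R C \<longleftrightarrow>
     (\<forall>(A :: ('u, 'o, 'a) ecat) \<Phi>.
        enriched_category R A \<and> left_adjoint_distributor R A C \<Phi> \<longrightarrow>
        (\<exists>F. enriched_functor R A C F \<and> (\<forall>c\<in>Elts C. \<forall>a\<in>Elts A. \<Phi> c a = EHom C c (F a))))"

definition Cat_cc :: "'u itself \<Rightarrow> ('o, 'a) locat \<Rightarrow> (('u, 'o, 'a) ecat, 'u \<Rightarrow> 'u) locat" where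
  "Cat_cc U R =
     \<lparr>Ob = {A. enriched_category R A \<and> cauchy_complete R A},
      Hom = (\<lambda>A B. {F. enriched_functor R A B F}),
      Leq = functor_le R,
      Comp = (\<lambda>A B C G F. compose (Elts A) G F),
      Ident = (\<lambda>A. \<lambda>a\<in>Elts A. a)\<rparr>"

definition Ord_cat ::
  "'u itself \<Rightarrow> ('o, 'a) locat \<Rightarrow> (('u, 'o \<times> 'a, 'a) ecat, 'u \<Rightarrow> 'u) locat" where
  "Ord_cat U Q = Cat_cc U (Idm Q)"


section \<open>Biequivalence of locally ordered categories\<close>

text \<open>
  All 2-cells are inequalities, so invertible 2-cells are the relation \<open>iso2\<close> and every coherence
  condition holds automatically.
\<close>

definition iso2 :: "('o, 'a) locat \<Rightarrow> 'o \<Rightarrow> 'o \<Rightarrow> 'a \<Rightarrow> 'a \<Rightarrow> bool" where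
  "iso2 C X Y f g \<longleftrightarrow> Leq C X Y f g \<and> Leq C X Y g f"

definition pseudofunctor ::
  "('o, 'a) locat \<Rightarrow> ('p, 'b) locat \<Rightarrow> ('o, 'a, 'p, 'b) arrow_map \<Rightarrow> bool" where
  "pseudofunctor C D F \<longleftrightarrow>
     (\<forall>X\<in>Ob C. FOb F X \<in> Ob D) \<and>
     (\<forall>X\<in>Ob C. \<forall>Y\<in>Ob C. FArr F X Y \<in> Hom C X Y \<rightarrow> Hom D (FOb F X) (FOb F Y)) \<and>
     (\<forall>X\<in>Ob C. \<forall>Y\<in>Ob C. \<forall>f\<in>Hom C X Y. \<forall>g\<in>Hom C X Y.
        Leq C X Y f g \<longrightarrow> Leq D (FOb F X) (FOb F Y) (FArr F X Y f) (FArr F X Y g)) \<and>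
     (\<forall>X\<in>Ob C.
        iso2 D (FOb F X) (FOb F X) (FArr F X X (Ident C X)) (Ident D (FOb F X))) \<and>
     (\<forall>X\<in>Ob C. \<forall>Y\<in>Ob C. \<forall>Z\<in>Ob C. \<forall>f\<in>Hom C X Y. \<forall>g\<in>Hom C Y Z.
        iso2 D (FOb F X) (FOb F Z)
          (FArr F X Z (Comp C X Y Z g f))
          (Comp D (FOb F X) (FOb F Y) (FOb F Z) (FArr F Y Z g) (FArr F X Y f)))"

definition equivalence_in :: "('o, 'a) locat \<Rightarrow> 'o \<Rightarrow> 'o \<Rightarrow> 'a \<Rightarrow> bool" where
  "equivalence_in C X Y f \<longleftrightarrow>
     f \<in> Hom C X Y \<and>
     (\<exists>g\<in>Hom C Y X. iso2 C X X (Comp C X Y X g f) (Ident C X) \<and>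
                    iso2 C Y Y (Comp C Y X Y f g) (Ident C Y))"

definition pseudonaturally_equivalent ::
  "('o, 'a) locat \<Rightarrow> ('p, 'b) locat \<Rightarrow> ('o, 'a, 'p, 'b) arrow_map \<Rightarrow> ('o, 'a, 'p, 'b) arrow_map
   \<Rightarrow> bool" where
  "pseudonaturally_equivalent C D F G \<longleftrightarrow>
     (\<exists>\<tau>. (\<forall>X\<in>Ob C. equivalence_in D (FOb F X) (FOb G X) (\<tau> X)) \<and>
          (\<forall>X\<in>Ob C. \<forall>Y\<in>Ob C. \<forall>f\<in>Hom C X Y.
             iso2 D (FOb F X) (FOb G Y)
               (Comp D (FOb F X) (FOb F Y) (FOb G Y) (\<tau> Y) (FArr F X Y f))
               (Comp D (FOb F X) (FOb G X) (FOb G Y) (FArr G X Y f) (\<tau> X))))"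

definition biequivalent :: "('o, 'a) locat \<Rightarrow> ('p, 'b) locat \<Rightarrow> bool" where
  "biequivalent C D \<longleftrightarrow>
     (\<exists>F G. pseudofunctor C D F \<and> pseudofunctor D C G \<and>
        pseudonaturally_equivalent C C identity_map (comp_map G F) \<and>
        pseudonaturally_equivalent D D (comp_map F G) identity_map)"

end

theory Submission
  imports Defs
begin

text \<open>
The first implication is a change of base. Between quantaloids an equivalence is the same as a
homomorphism that is bijective on hom-lattices and surjective on objects up to isomorphism, a
\<open>weak_equivalence\<close>, and splitting idempotents preserves these
(\<open>Idm_map_weak_equivalence\<close>). An enriched category \<open>A\<close> over \<open>R\<close>
is pulled back along a fully faithful homomorphism \<open>P : S \<rightarrow> R\<close> to the
\<open>S\<close>-category of pairs \<open>(a, X)\<close> with \<open>t a = P X\<close>, and Cauchy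
completeness survives (\<open>pb_cauchy_complete\<close>). Pulling back along an equivalence and then
along its inverse only replaces the type of an element by an isomorphic one. A Cauchy complete category
contains with every element a copy of it at every isomorphic type (\<open>twist_exists\<close>), so the
result is equivalent to \<open>A\<close>: pulling back is a biequivalence
(\<open>Cat_biequivalent\<close>).

For the second, modules are recovered from inside the ordered sheaves. A module \<open>M\<close> on
\<open>R\<close> has a category of elements: pairs \<open>(X, x)\<close> with \<open>x \<in> M
X\<close>, the hom-arrow from \<open>x\<close> to \<open>x'\<close> being the largest \<open>f\<close>
with \<open>x' \<cdot> f \<le> x\<close>. It is cocomplete, in particular Cauchy complete. Module
morphisms are exactly the left adjoint functors between these categories
(\<open>Elmap_realization\<close>), so the locally ordered category of Cauchy complete categories
determines \<open>Mod(R)\<close> as soon as it recognises the categories of elements among its objects.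
They are its absolute retracts, the objects that are a retract of every object into which they are
mapped by an inserter: inserters are fully faithful (\<open>inserter_fully_faithful\<close>), and along
a fully faithful functor the identity of a cocomplete category extends
(\<open>elements_retract\<close>); conversely, every fully faithful functor between Cauchy complete
categories is an inserter (\<open>fully_faithful_inserter\<close>), so that an absolute retract is a
retract of its category of presheaves along the Yoneda embedding, and the retraction makes its elements
into a quotient module of the module of presheaves (\<open>absolute_retract_El\<close>). Left adjoints,
inserters and retracts are invariant under biequivalence, so biequivalent categories of Cauchy complete
categories have equivalent categories of modules (\<open>same_image_equivalent\<close>). This is applied
to \<open>R = Idm(Q)\<close>; idempotents split in sup-lattices, hence a module on \<open>Idm(Q)\<close>
is determined by its restriction to \<open>Q\<close> (\<open>weak_equivalence_restriction\<close>).

The third is a Yoneda argument. A central family of \<open>Q\<close> acts on every module, and by the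
Yoneda lemma every natural family of endomorphisms of all modules arises in this way
(\<open>Centre_Mod\<close>). The centre of a quantaloid is invariant under weak equivalence by
conjugation (\<open>Centre_equivalent\<close>).

Throughout, enriched categories and modules have their elements in a Grothendieck universe, which is
closed under the constructions used here only up to bijection; injections such as \<open>p\<close>,
\<open>k\<close> and \<open>code\<close> choose the elements of the universe that stand for pairs,
presheaves and the like.
\<close>

section \<open>Smallness\<close>

lemma universe_infinite:
 assumes "grothendieck_universe TYPE('u)"
 shows "infinite (UNIV :: 'u set)"
proof
 assume fin: "finite (UNIV :: 'u set)"
 obtain a :: 'u where "a \<in> UNIV" by blast
 let ?X = "UNIV - {a}"
 have "card ?X < card (UNIV :: 'u set)"
  using fin by (intro psubset_card_mono) auto
 then have "small TYPE('u) ?X"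
  unfolding small_def
  using fin by (metis eqpoll_iff_card finite_subset lesspoll_def less_irrefl subset_UNIV subset_imp_lepoll)
 then have "Pow ?X \<prec> (UNIV :: 'u set)"
  using assms by (simp add: grothendieck_universe_def small_def)
 then have "card (Pow ?X) < card (UNIV :: 'u set)"
  using fin by (metis eqpoll_iff_card finite_Diff finite_Pow_iff lepoll_iff_card_le lesspoll_def
    order_neq_le_trans)
 moreover have "card (UNIV :: 'u set) = Suc (card ?X)"
  using fin by (rule card.remove) simp
 moreover have "card ?X < 2 ^ card ?X"
  by (rule less_exp)
 moreover have "card (Pow ?X) = 2 ^ card ?X"
  using fin by (intro card_Pow) simp
 ultimately show False by linarith
qed

lemma small_lepoll: "small U X ==> Y \<lesssim> X ==> small U Y"
 unfolding small_def by (rule lesspoll_trans1)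

lemma small_subset: "small U X ==> Y \<subseteq> X ==> small U Y"
 by (rule small_lepoll[OF _ subset_imp_lepoll])

lemma small_image: "small U X ==> small U (f ` X)"
 by (rule small_lepoll[OF _ image_lepoll])

lemma small_imp_inj:
 assumes "small TYPE('u) X"
 obtains f :: "'x => 'u" where "inj_on f X"
 using assms unfolding small_def lesspoll_def lepoll_def by blast

lemma small_inj_image_iff: "inj_on f X ==> small U (f ` X) \<longleftrightarrow> small U X"
 by (metis inj_on_image_lepoll_2 lepoll_refl small_image small_lepoll)

text \<open>An infinite type is equipotent to its square. The injections obtained in this way code pairs by
 elements of the universe.\<close>

lemma universe_pairing:
 assumes "grothendieck_universe TYPE('u)"
 obtains p :: "'u \<times> 'u => 'u" where "inj p"
proof -
 have "(UNIV :: 'u set) \<times> (UNIV :: 'u set) \<approx> (UNIV :: 'u set)"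
  unfolding eqpoll_iff_card_of_ordIso
  by (rule card_of_Times_same_infinite[OF universe_infinite[OF assms]])
 then obtain p :: "'u \<times> 'u => 'u" where "bij_betw p (UNIV \<times> UNIV) UNIV"
  unfolding eqpoll_def by blast
 then show thesis
  using that[of p] by (simp add: bij_betw_def)
qed

lemma universe_pairing_small:
 assumes "grothendieck_universe TYPE('u)" "small TYPE('u) S"
 obtains p :: "'u \<times> 's => 'u" where "inj_on p (UNIV \<times> S)"
proof -
 obtain q :: "'u \<times> 'u => 'u" where q: "inj q" by (rule universe_pairing[OF assms(1)])
 obtain f :: "'s => 'u" where f: "inj_on f S" by (rule small_imp_inj[OF assms(2)])
 have "inj_on (\<lambda>z. q (fst z, f (snd z))) (UNIV \<times> S)"
 proof (rule inj_onI)
  fix z w assume zw: "z \<in> UNIV \<times> S" "w \<in> UNIV \<times> S" "q (fst z, f (snd z)) = q (fst w, f (snd w))"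
  then have "fst z = fst w" "f (snd z) = f (snd w)" using injD[OF q zw(3)] by simp_all
  then show "z = w" using zw f by (auto simp: prod_eq_iff dest: inj_onD)
 qed
 then show thesis by (rule that)
qed

lemma small_Pow:
 assumes "grothendieck_universe TYPE('u)" "small TYPE('u) X"
 shows "small TYPE('u) (Pow X)"
proof -
 obtain f :: "'a => 'u" where f: "inj_on f X" by (rule small_imp_inj[OF assms(2)])
 have "small TYPE('u) (Pow (f ` X))"
  using assms f by (simp add: grothendieck_universe_def small_image)
 moreover have "Pow (f ` X) = (`) f ` Pow X" by (simp add: image_Pow_surj)
 moreover have "inj_on ((`) f) (Pow X)" using f by (rule inj_on_image_Pow)
 ultimately show ?thesis by (simp add: small_inj_image_iff)
qed

lemma small_Sigma:
 assumes U: "grothendieck_universe TYPE('u)" and I: "small TYPE('u) I"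
  and X: "\<And>i. i \<in> I ==> small TYPE('u) (X i)"
 shows "small TYPE('u) (Sigma I X)"
proof -
 obtain q :: "'u \<times> 'u => 'u" where q: "inj q" by (rule universe_pairing[OF U])
 obtain f :: "'a => 'u" where f: "inj_on f I" by (rule small_imp_inj[OF I])
 have "\<exists>g :: 'b => 'u. inj_on g (X i)" if "i \<in> I" for i
  using small_imp_inj[OF X[OF that]] by blast
 then obtain g :: "'a => 'b => 'u" where g: "\<And>i. i \<in> I ==> inj_on (g i) (X i)" by metis
 define h where "h = (\<lambda>(i, x). q (f i, g i x))"
 have h: "inj_on h (Sigma I X)"
 proof (rule inj_onI)
  fix z w assume zw: "z \<in> Sigma I X" "w \<in> Sigma I X" "h z = h w"
  then have "q (f (fst z), g (fst z) (snd z)) = q (f (fst w), g (fst w) (snd w))"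
   by (simp add: h_def case_prod_beta)
  from injD[OF q this] have eq: "f (fst z) = f (fst w)" "g (fst z) (snd z) = g (fst w) (snd w)"
   by simp_all
  have i: "fst z = fst w" using inj_onD[OF f eq(1)] zw by auto
  have "snd z = snd w" using inj_onD[OF g, of "fst w" "snd z" "snd w"] eq(2) i zw by auto
  with i show "z = w" by (simp add: prod_eq_iff)
 qed
 define Y where "Y j = (let i = inv_into I f j in (\<lambda>x. h (i, x)) ` X i)" for j
 have "small TYPE('u) (Y j)" if "j \<in> f ` I" for j
  using X that by (auto simp: Y_def Let_def f intro: small_image)
 moreover have "small TYPE('u) (f ` I)" using I by (rule small_image)
 ultimately have "small TYPE('u) (\<Union>j\<in>f ` I. Y j)"
  using U unfolding grothendieck_universe_def by blast
 moreover have "(\<Union>j\<in>f ` I. Y j) = h ` Sigma I X"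
  using f by (auto simp: Y_def Let_def)
 ultimately show ?thesis using h by (simp add: small_inj_image_iff)
qed

lemma small_PiE:
 assumes U: "grothendieck_universe TYPE('u)" and I: "small TYPE('u) I"
  and X: "\<And>i. i \<in> I ==> small TYPE('u) (X i)"
 shows "small TYPE('u) (Pi\<^sub>E I X)"
proof (rule small_lepoll)
 show "small TYPE('u) (Pow (Sigma I X))"
  using assms by (intro small_Pow small_Sigma)
 let ?graph = "\<lambda>f. {(i, f i) | i. i \<in> I}"
 have "inj_on ?graph (Pi\<^sub>E I X)"
 proof (rule inj_onI)
  fix f g assume fg: "f \<in> Pi\<^sub>E I X" "g \<in> Pi\<^sub>E I X" "?graph f = ?graph g"
  have "f i = g i" if "i \<in> I" for i
  proof -
   have "(i, f i) \<in> ?graph f" using that by blast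
   then have "(i, f i) \<in> ?graph g" using fg(3) by simp
   then show ?thesis by blast
  qed
  then show "f = g" using fg by (auto intro: PiE_ext)
 qed
 moreover have "?graph ` Pi\<^sub>E I X \<subseteq> Pow (Sigma I X)" by (auto simp: PiE_iff)
 ultimately show "Pi\<^sub>E I X \<lesssim> Pow (Sigma I X)" unfolding lepoll_def by blast
qed

lemma small_finite: "grothendieck_universe TYPE('u) ==> finite X ==> small TYPE('u) X"
 unfolding small_def by (rule finite_lesspoll_infinite[OF universe_infinite])


section \<open>Complete lattices and sup-preserving maps\<close>

text \<open>A relational form of suprema: it can be transported along order isomorphisms, and verified
 before the order is known to be a complete lattice.\<close>

definition lub_in :: "('x, 'm) gorder_scheme => 'x set => 'x => bool" where
 "lub_in L A s \<longleftrightarrow> A \<subseteq> carrier L \<and> s \<in> carrier L \<and> (\<forall>a\<in>A. le L a s) \<and>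
   (\<forall>u\<in>carrier L. (\<forall>a\<in>A. le L a u) --> le L s u)"

lemma is_lub_iff_lub_in: "A \<subseteq> carrier L ==> is_lub L s A \<longleftrightarrow> lub_in L A s"
 unfolding least_def Upper_def lub_in_def by blast

lemma complete_lattice_of_lubs:
 fixes L :: "'x gorder"
 assumes eq: "eq L = (=)"
  and refl: "\<And>x. x \<in> carrier L ==> le L x x"
  and antisym: "\<And>x y. [|x \<in> carrier L; y \<in> carrier L; le L x y; le L y x|] ==> x = y"
  and trans: "\<And>x y z. [|x \<in> carrier L; y \<in> carrier L; z \<in> carrier L; le L x y; le L y z|] ==> le L x z"
  and ex: "\<And>A. A \<subseteq> carrier L ==> \<exists>s. lub_in L A s"
 shows "complete_lattice L"
proof -
 interpret partial_order L
 proof unfold_locales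
  show "x .=\<^bsub>L\<^esub> x" if "x \<in> carrier L" for x by (simp add: eq)
  show "y .=\<^bsub>L\<^esub> x" if "x .=\<^bsub>L\<^esub> y" "x \<in> carrier L" "y \<in> carrier L" for x y
   using that by (simp add: eq)
  show "x .=\<^bsub>L\<^esub> z" if "x .=\<^bsub>L\<^esub> y" "y .=\<^bsub>L\<^esub> z" "x \<in> carrier L" "y \<in> carrier L" "z \<in> carrier L"
   for x y z using that by (simp add: eq)
  show "le L x x" if "x \<in> carrier L" for x using that by (rule refl)
  show "x .=\<^bsub>L\<^esub> y" if "le L x y" "le L y x" "x \<in> carrier L" "y \<in> carrier L" for x y
   using antisym[OF that(3,4,1,2)] by (simp add: eq)
  show "le L x z" if "le L x y" "le L y z" "x \<in> carrier L" "y \<in> carrier L" "z \<in> carrier L" for x y z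
   by (rule trans[OF that(3-5,1-2)])
  show "le L x z \<longleftrightarrow> le L y w"
   if "x .=\<^bsub>L\<^esub> y" "z .=\<^bsub>L\<^esub> w" "x \<in> carrier L" "y \<in> carrier L" "z \<in> carrier L" "w \<in> carrier L"
   for x y z w using that by (simp add: eq)
  show "eq L = (=)" by (rule eq)
 qed
 show ?thesis
 proof (rule complete_latticeI)
  fix A assume A: "A \<subseteq> carrier L"
  then show "\<exists>s. is_lub L s A" using ex by (simp add: is_lub_iff_lub_in)
  have "{l \<in> carrier L. \<forall>a\<in>A. le L l a} \<subseteq> carrier L" by blast
  then obtain s where s: "lub_in L {l \<in> carrier L. \<forall>a\<in>A. le L l a} s" using ex by blast
  have low: "Lower L A = {l \<in> carrier L. \<forall>a\<in>A. le L l a}"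
   using A unfolding Lower_def by blast
  have "le L s a" if a: "a \<in> A" for a
  proof -
   have "\<forall>l\<in>{l \<in> carrier L. \<forall>a\<in>A. le L l a}. le L l a" using a by simp
   moreover have "a \<in> carrier L" using a A by (rule_tac subsetD)
   ultimately show ?thesis using s unfolding lub_in_def by simp
  qed
  then have "s \<in> Lower L A"
   using s unfolding low lub_in_def by simp
  moreover have "\<forall>x\<in>Lower L A. le L x s"
   using s unfolding low lub_in_def by blast
  ultimately have "is_glb L s A"
   unfolding greatest_def by (simp add: low)
  then show "\<exists>s. is_glb L s A" ..
 qed
qed

lemma complete_lattice_refl: "complete_lattice L ==> x \<in> carrier L ==> le L x x"
 by (simp add: complete_lattice_def partial_order_def weak_partial_order.le_refl)

lemma complete_lattice_antisym:
 "[|complete_lattice L; x \<in> carrier L; y \<in> carrier L; le L x y; le L y x|] ==> x = y"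
 using partial_order.le_antisym unfolding complete_lattice_def by metis

lemma complete_lattice_trans:
 "[|complete_lattice L; le L x y; le L y z; x \<in> carrier L; y \<in> carrier L; z \<in> carrier L|] ==> le L x z"
 by (simp add: complete_lattice_def partial_order_def weak_partial_order.le_trans)

lemma sup_lub_in:
 assumes "complete_lattice L" "A \<subseteq> carrier L"
 shows "lub_in L A (\<Squnion>\<^bsub>L\<^esub> A)"
proof -
 interpret complete_lattice L by fact
 show ?thesis using weak.sup_lub[OF assms(2)] is_lub_iff_lub_in[OF assms(2)] by metis
qed

lemma lub_in_eq_sup:
 assumes "complete_lattice L" "lub_in L A s"
 shows "\<Squnion>\<^bsub>L\<^esub> A = s"
proof -
 have "lub_in L A (\<Squnion>\<^bsub>L\<^esub> A)" using assms sup_lub_in lub_in_def by metis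
 then show ?thesis using assms complete_lattice_antisym unfolding lub_in_def by metis
qed

lemma sup_presI:
 assumes "complete_lattice L" "complete_lattice M"
  and "\<And>A s. lub_in L A s ==> lub_in M (f ` A) (f s)"
 shows "sup_pres L M f"
 using assms(1,2) lub_in_eq_sup[OF assms(2) assms(3)] sup_lub_in[OF assms(1)]
 unfolding sup_pres_def by metis

lemma sup_pres_lub_in:
 assumes "sup_pres L M f" "f \<in> carrier L \<rightarrow> carrier M" "lub_in L A s"
 shows "lub_in M (f ` A) (f s)"
proof -
 have c: "complete_lattice L" "complete_lattice M" and A: "A \<subseteq> carrier L"
  using assms by (auto simp: sup_pres_def lub_in_def)
 then have "f s = \<Squnion>\<^bsub>M\<^esub> (f ` A)"
  using assms lub_in_eq_sup unfolding sup_pres_def by metis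
 moreover have "f ` A \<subseteq> carrier M" using A assms(2) by blast
 ultimately show ?thesis using sup_lub_in[OF c(2)] by metis
qed

lemma sup_pres_mono:
 assumes f: "sup_pres L M f" "f \<in> carrier L \<rightarrow> carrier M"
  and xy: "x \<in> carrier L" "y \<in> carrier L" "le L x y"
 shows "le M (f x) (f y)"
proof -
 have "lub_in L {x, y} y"
  using assms complete_lattice_refl by (auto simp: lub_in_def sup_pres_def)
 then have "lub_in M (f ` {x, y}) (f y)" using f by (intro sup_pres_lub_in)
 then show ?thesis by (simp add: lub_in_def)
qed

lemma sup_pres_cong:
 assumes "sup_pres L M f" "\<And>x. x \<in> carrier L ==> f x = g x"
 shows "sup_pres L M g"
proof -
 have "f ` A = g ` A" if "A \<subseteq> carrier L" for A using that assms(2) by (auto simp: image_iff subset_iff)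
 moreover have "f (\<Squnion>\<^bsub>L\<^esub> A) = g (\<Squnion>\<^bsub>L\<^esub> A)" if "A \<subseteq> carrier L" for A
  using that assms sup_lub_in unfolding sup_pres_def lub_in_def by metis
 ultimately show ?thesis using assms(1) by (simp add: sup_pres_def)
qed

lemma sup_pres_comp:
 assumes "sup_pres L M f" "f \<in> carrier L \<rightarrow> carrier M" "sup_pres M N g"
 shows "sup_pres L N (\<lambda>x. g (f x))"
proof -
 have "f ` A \<subseteq> carrier M" if "A \<subseteq> carrier L" for A using that assms(2) by auto
 then show ?thesis using assms by (auto simp: sup_pres_def image_image)
qed

lemma order_iso_lub_in:
 assumes f: "bij_betw f (carrier L) (carrier M)"
  and le: "\<And>x y. [|x \<in> carrier L; y \<in> carrier L|] ==> le M (f x) (f y) \<longleftrightarrow> le L x y"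
  and s: "lub_in L A s"
 shows "lub_in M (f ` A) (f s)"
proof -
 have img: "carrier M = f ` carrier L" using f by (simp add: bij_betw_def)
 have A: "A \<subseteq> carrier L" "s \<in> carrier L" using s by (auto simp: lub_in_def)
 have "le M (f s) (f u)" if "u \<in> carrier L" "\<And>a. a \<in> A ==> le M (f a) (f u)" for u
  using that s A le unfolding lub_in_def by (metis subset_iff)
 then show ?thesis
  using s A le by (auto simp: lub_in_def img subset_iff)
qed

lemma order_iso_sup_pres:
 assumes "complete_lattice L" "complete_lattice M" "bij_betw f (carrier L) (carrier M)"
  and "\<And>x y. [|x \<in> carrier L; y \<in> carrier L|] ==> le M (f x) (f y) \<longleftrightarrow> le L x y"
 shows "sup_pres L M f"
 using assms by (blast intro: sup_presI order_iso_lub_in)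

lemma order_iso_complete_lattice:
 fixes M :: "'y gorder"
 assumes L: "complete_lattice L" and f: "bij_betw f (carrier L) (carrier M)" and eq: "eq M = (=)"
  and le: "\<And>x y. [|x \<in> carrier L; y \<in> carrier L|] ==> le M (f x) (f y) \<longleftrightarrow> le L x y"
 shows "complete_lattice M"
proof (rule complete_lattice_of_lubs)
 have img: "carrier M = f ` carrier L" using f by (simp add: bij_betw_def)
 show "le M x x" if "x \<in> carrier M" for x
 proof -
  from that obtain u where "x = f u" "u \<in> carrier L" unfolding img by blast
  then show ?thesis using le complete_lattice_refl[OF L] by simp
 qed
 show "x = y" if xy: "x \<in> carrier M" "y \<in> carrier M" "le M x y" "le M y x" for x y
 proof -
  obtain u v where u: "x = f u" "u \<in> carrier L" and v: "y = f v" "v \<in> carrier L"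
   using xy unfolding img by blast
  then have "u = v" using complete_lattice_antisym[OF L u(2) v(2)] le xy by simp
  then show ?thesis using u v by simp
 qed
 show "le M x z"
  if xyz: "x \<in> carrier M" "y \<in> carrier M" "z \<in> carrier M" "le M x y" "le M y z" for x y z
 proof -
  obtain u v w where u: "x = f u" "u \<in> carrier L" and v: "y = f v" "v \<in> carrier L"
   and w: "z = f w" "w \<in> carrier L" using xyz unfolding img by blast
  then have "le L u w" using complete_lattice_trans[OF L _ _ u(2) v(2) w(2)] le xyz by simp
  then show ?thesis using le u w by simp
 qed
 show "\<exists>s. lub_in M A s" if A: "A \<subseteq> carrier M" for A
 proof -
  obtain B where B: "B \<subseteq> carrier L" "A = f ` B" using A unfolding img by (rule subset_imageE)
  then show ?thesis using order_iso_lub_in[OF f le sup_lub_in[OF L B(1)]] by auto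
 qed
qed (fact eq)


section \<open>Calculating in locally ordered categories\<close>

text \<open>
 The order together with the membership of both sides: transitivity and monotonicity of
 composition then hold without side conditions.
\<close>

definition ple :: "('o, 'a) locat => 'o => 'o => 'a => 'a => bool" where
 "ple C X Y f g \<longleftrightarrow> X \<in> Ob C \<and> Y \<in> Ob C \<and> f \<in> Hom C X Y \<and> g \<in> Hom C X Y \<and> Leq C X Y f g"

definition pis :: "('o, 'a) locat => 'o => 'o => 'a => 'a => bool" where
 "pis C X Y f g \<longleftrightarrow> ple C X Y f g \<and> ple C X Y g f"

lemma pleD: "ple C X Y f g ==> Leq C X Y f g"
 "ple C X Y f g ==> X \<in> Ob C" "ple C X Y f g ==> Y \<in> Ob C"
 "ple C X Y f g ==> f \<in> Hom C X Y" "ple C X Y f g ==> g \<in> Hom C X Y"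
 by (simp_all add: ple_def)

lemma pleI: "[|Leq C X Y f g; X \<in> Ob C; Y \<in> Ob C; f \<in> Hom C X Y; g \<in> Hom C X Y|] ==> ple C X Y f g"
 by (simp add: ple_def)

lemma pis_iff: "[|X \<in> Ob C; Y \<in> Ob C; f \<in> Hom C X Y; g \<in> Hom C X Y|] ==> pis C X Y f g \<longleftrightarrow> iso2 C X Y f g"
 by (simp add: pis_def ple_def iso2_def)

lemma pis_iso2: "pis C X Y f g ==> iso2 C X Y f g"
 by (simp add: pis_def ple_def iso2_def)

lemma pis_sym: "pis C X Y f g ==> pis C X Y g f"
 by (simp add: pis_def)

context locally_ordered_category
begin

declare Ident_in_Hom [simp] Comp_in_Hom [simp] Comp_Ident_right [simp] Comp_Ident_left [simp]

lemma ple_refl: "[|X \<in> Ob C; Y \<in> Ob C; f \<in> Hom C X Y|] ==> ple C X Y f f"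
 by (simp add: ple_def Leq_refl)

lemma ple_trans [trans]: "ple C X Y f g ==> ple C X Y g h ==> ple C X Y f h"
 unfolding ple_def by (blast intro: Leq_trans)

lemma ple_comp:
 "ple C X Y f f' ==> ple C Y Z g g' ==> ple C X Z (Comp C X Y Z g f) (Comp C X Y Z g' f')"
 unfolding ple_def by (blast intro: Comp_mono Comp_in_Hom)

lemma ple_comp_right:
 "[|ple C X Y f f'; Z \<in> Ob C; g \<in> Hom C Y Z|] ==> ple C X Z (Comp C X Y Z g f) (Comp C X Y Z g f')"
 by (blast intro: ple_comp ple_refl pleD)

lemma ple_comp_left:
 "[|ple C Y Z g g'; X \<in> Ob C; f \<in> Hom C X Y|] ==> ple C X Z (Comp C X Y Z g f) (Comp C X Y Z g' f)"
 by (blast intro: ple_comp ple_refl pleD)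

lemma pis_refl: "[|X \<in> Ob C; Y \<in> Ob C; f \<in> Hom C X Y|] ==> pis C X Y f f"
 by (simp add: pis_def ple_refl)

lemma pis_trans [trans]: "pis C X Y f g ==> pis C X Y g h ==> pis C X Y f h"
 unfolding pis_def by (blast intro: ple_trans)

lemma pis_ple_trans [trans]: "pis C X Y f g ==> ple C X Y g h ==> ple C X Y f h"
 unfolding pis_def by (blast intro: ple_trans)

lemma ple_pis_trans [trans]: "ple C X Y f g ==> pis C X Y g h ==> ple C X Y f h"
 unfolding pis_def by (blast intro: ple_trans)

lemma pis_comp:
 "pis C X Y f f' ==> pis C Y Z g g' ==> pis C X Z (Comp C X Y Z g f) (Comp C X Y Z g' f')"
 unfolding pis_def by (blast intro: ple_comp)

lemma pis_comp_right:
 "[|pis C X Y f f'; Z \<in> Ob C; g \<in> Hom C Y Z|] ==> pis C X Z (Comp C X Y Z g f) (Comp C X Y Z g f')"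
 unfolding pis_def by (blast intro: ple_comp_right)

lemma pis_comp_left:
 "[|pis C Y Z g g'; X \<in> Ob C; f \<in> Hom C X Y|] ==> pis C X Z (Comp C X Y Z g f) (Comp C X Y Z g' f)"
 unfolding pis_def by (blast intro: ple_comp_left)

end


section \<open>Suprema in a quantaloid\<close>

abbreviation hsup :: "('o, 'a) locat => 'o => 'o => 'a set => 'a" where
 "hsup Q X Y A \<equiv> \<Squnion>\<^bsub>homlat Q X Y\<^esub> A"

lemma homlat_simps [simp]:
 "carrier (homlat Q X Y) = Hom Q X Y" "le (homlat Q X Y) = Leq Q X Y" "eq (homlat Q X Y) = (=)"
 by (simp_all add: homlat_def)

context quantaloid
begin

lemma ple_antisym: "ple Q X Y f g ==> ple Q X Y g f ==> f = g"
 unfolding ple_def using complete_lattice_antisym[OF homlat_complete, of X Y f g] by simp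

lemma pis_eq: "pis Q X Y f g ==> f = g"
 unfolding pis_def using ple_antisym by blast

lemma hsup_lub:
 "[|X \<in> Ob Q; Y \<in> Ob Q; A \<subseteq> Hom Q X Y|] ==> lub_in (homlat Q X Y) A (hsup Q X Y A)"
 by (simp add: sup_lub_in homlat_complete)

lemma hsup_in [simp]: "[|X \<in> Ob Q; Y \<in> Ob Q; A \<subseteq> Hom Q X Y|] ==> hsup Q X Y A \<in> Hom Q X Y"
 using hsup_lub unfolding lub_in_def by simp

lemma hsup_upper:
 "[|X \<in> Ob Q; Y \<in> Ob Q; A \<subseteq> Hom Q X Y; f \<in> A|] ==> ple Q X Y f (hsup Q X Y A)"
 using hsup_lub[of X Y A] unfolding lub_in_def ple_def by auto

lemma hsup_least:
 assumes "X \<in> Ob Q" "Y \<in> Ob Q" "g \<in> Hom Q X Y" "\<And>f. f \<in> A ==> ple Q X Y f g"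
 shows "ple Q X Y (hsup Q X Y A) g"
proof -
 have "A \<subseteq> Hom Q X Y" using assms(4) by (auto dest: pleD)
 then show ?thesis using hsup_lub[of X Y A] assms unfolding lub_in_def ple_def by auto
qed

lemma comp_hsup_right:
 "[|X \<in> Ob Q; Y \<in> Ob Q; Z \<in> Ob Q; g \<in> Hom Q Y Z; A \<subseteq> Hom Q X Y|]
  ==> Comp Q X Y Z g (hsup Q X Y A) = hsup Q X Z (Comp Q X Y Z g ` A)"
 using Comp_sup_right unfolding sup_pres_def by simp

lemma comp_hsup_left:
 "[|X \<in> Ob Q; Y \<in> Ob Q; Z \<in> Ob Q; f \<in> Hom Q X Y; A \<subseteq> Hom Q Y Z|]
  ==> Comp Q X Y Z (hsup Q Y Z A) f = hsup Q X Z ((\<lambda>g. Comp Q X Y Z g f) ` A)"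
 using Comp_sup_left unfolding sup_pres_def by simp

lemma comp_hsup_right_le:
 assumes "X \<in> Ob Q" "Y \<in> Ob Q" "Z \<in> Ob Q" "g \<in> Hom Q Y Z" "A \<subseteq> Hom Q X Y" "h \<in> Hom Q X Z"
  and "\<And>f. f \<in> A ==> ple Q X Z (Comp Q X Y Z g f) h"
 shows "ple Q X Z (Comp Q X Y Z g (hsup Q X Y A)) h"
 using assms by (auto simp: comp_hsup_right intro: hsup_least)

lemma comp_hsup_left_le:
 assumes "X \<in> Ob Q" "Y \<in> Ob Q" "Z \<in> Ob Q" "f \<in> Hom Q X Y" "A \<subseteq> Hom Q Y Z" "h \<in> Hom Q X Z"
  and "\<And>g. g \<in> A ==> ple Q X Z (Comp Q X Y Z g f) h"
 shows "ple Q X Z (Comp Q X Y Z (hsup Q Y Z A) f) h"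
 using assms by (auto simp: comp_hsup_left intro: hsup_least)

end

section \<open>Equivalences and adjoints inside a locally ordered category\<close>

definition equiv_pair :: "('o, 'a) locat => 'o => 'o => 'a => 'a => bool" where
 "equiv_pair C X Y f g \<longleftrightarrow> X \<in> Ob C \<and> Y \<in> Ob C \<and> f \<in> Hom C X Y \<and> g \<in> Hom C Y X \<and>
   pis C X X (Comp C X Y X g f) (Ident C X) \<and> pis C Y Y (Comp C Y X Y f g) (Ident C Y)"

definition left_adjoint_in :: "('o, 'a) locat => 'o => 'o => 'a => bool" where
 "left_adjoint_in C X Y f \<longleftrightarrow> f \<in> Hom C X Y \<and>
   (\<exists>g\<in>Hom C Y X. ple C X X (Ident C X) (Comp C X Y X g f) \<and> ple C Y Y (Comp C Y X Y f g) (Ident C Y))"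

lemma equiv_pairD:
 assumes "equiv_pair C X Y f g"
 shows "X \<in> Ob C" "Y \<in> Ob C" "f \<in> Hom C X Y" "g \<in> Hom C Y X"
  "pis C X X (Comp C X Y X g f) (Ident C X)" "pis C Y Y (Comp C Y X Y f g) (Ident C Y)"
 using assms by (auto simp: equiv_pair_def)

lemma equiv_pair_sym: "equiv_pair C X Y f g ==> equiv_pair C Y X g f"
 by (simp add: equiv_pair_def)

context locally_ordered_category
begin

lemma equivalence_in_iff:
 "X \<in> Ob C ==> Y \<in> Ob C ==> equivalence_in C X Y f \<longleftrightarrow> (\<exists>g. equiv_pair C X Y f g)"
 unfolding equivalence_in_def equiv_pair_def by (auto simp: pis_iff)

lemma cancel_section:
 assumes d: "pis C X X (Comp C X Y X d e) (Ident C X)" "e \<in> Hom C X Y" "d \<in> Hom C Y X"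
  and obs: "X \<in> Ob C" "Y \<in> Ob C" "Z \<in> Ob C" and fg: "f \<in> Hom C Z X" "g \<in> Hom C Z X"
  and le: "ple C Z Y (Comp C Z X Y e f) (Comp C Z X Y e g)"
 shows "ple C Z X f g"
proof -
 have *: "pis C Z X (Comp C Z Y X d (Comp C Z X Y e h)) h" if "h \<in> Hom C Z X" for h
  using pis_comp_left[OF d(1) obs(3) that] that d obs by (simp add: Comp_assoc)
 have "pis C Z X f (Comp C Z Y X d (Comp C Z X Y e f))" by (rule pis_sym[OF *[OF fg(1)]])
 also have "ple C Z X \<dots> (Comp C Z Y X d (Comp C Z X Y e g))"
  by (rule ple_comp_right[OF le obs(1) d(3)])
 also have "pis C Z X \<dots> g" by (rule *[OF fg(2)])
 finally show ?thesis .
qed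

lemma cancel_retraction:
 assumes d: "pis C Y Y (Comp C Y X Y e d) (Ident C Y)" "e \<in> Hom C X Y" "d \<in> Hom C Y X"
  and obs: "X \<in> Ob C" "Y \<in> Ob C" "Z \<in> Ob C" and fg: "f \<in> Hom C Y Z" "g \<in> Hom C Y Z"
  and le: "ple C X Z (Comp C X Y Z f e) (Comp C X Y Z g e)"
 shows "ple C Y Z f g"
proof -
 have *: "pis C Y Z (Comp C Y X Z (Comp C X Y Z h e) d) h" if "h \<in> Hom C Y Z" for h
  using pis_comp_right[OF d(1) obs(3) that] that d obs by (simp add: Comp_assoc)
 have "pis C Y Z f (Comp C Y X Z (Comp C X Y Z f e) d)" by (rule pis_sym[OF *[OF fg(1)]])
 also have "ple C Y Z \<dots> (Comp C Y X Z (Comp C X Y Z g e) d)"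
  by (rule ple_comp_left[OF le obs(2) d(3)])
 also have "pis C Y Z \<dots> g" by (rule *[OF fg(2)])
 finally show ?thesis .
qed

lemma equiv_pair_cancel_left:
 assumes "equiv_pair C X Y e d" "Z \<in> Ob C" "f \<in> Hom C Z X" "g \<in> Hom C Z X"
  and "ple C Z Y (Comp C Z X Y e f) (Comp C Z X Y e g)"
 shows "ple C Z X f g"
 using assms by (intro cancel_section[of X Y d e Z f g]) (auto dest: equiv_pairD)

lemma equiv_pair_cancel_right:
 assumes "equiv_pair C X Y e d" "Z \<in> Ob C" "f \<in> Hom C Y Z" "g \<in> Hom C Y Z"
  and "ple C X Z (Comp C X Y Z f e) (Comp C X Y Z g e)"
 shows "ple C Y Z f g"
 using assms by (intro cancel_retraction[of Y X e d Z f g]) (auto dest: equiv_pairD)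

lemma retract_comp:
 assumes obs: "X \<in> Ob C" "Y \<in> Ob C" "Z \<in> Ob C"
  and e: "e \<in> Hom C X Y" "d \<in> Hom C Y X" "pis C X X (Comp C X Y X d e) (Ident C X)"
  and e': "e' \<in> Hom C Y Z" "d' \<in> Hom C Z Y" "pis C Y Y (Comp C Y Z Y d' e') (Ident C Y)"
 shows "pis C X X (Comp C X Z X (Comp C Z Y X d d') (Comp C X Y Z e' e)) (Ident C X)"
proof -
 have "Comp C X Z X (Comp C Z Y X d d') (Comp C X Y Z e' e)
  = Comp C X Y X d (Comp C X Y Y (Comp C Y Z Y d' e') e)"
  using assms by (simp add: Comp_assoc)
 also have "pis C X X \<dots> (Comp C X Y X d (Comp C X Y Y (Ident C Y) e))"
  using assms by (intro pis_comp_right pis_comp_left) auto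
 also have "\<dots> = Comp C X Y X d e" using assms by simp
 also have "pis C X X \<dots> (Ident C X)" by fact
 finally show ?thesis .
qed

lemma equiv_pair_comp:
 assumes "equiv_pair C X Y e d" "equiv_pair C Y Z e' d'"
 shows "equiv_pair C X Z (Comp C X Y Z e' e) (Comp C Z Y X d d')"
 using assms unfolding equiv_pair_def by (auto intro: retract_comp)

lemma left_adjoint_inI:
 "[|f \<in> Hom C X Y; g \<in> Hom C Y X; ple C X X (Ident C X) (Comp C X Y X g f);
  ple C Y Y (Comp C Y X Y f g) (Ident C Y)|] ==> left_adjoint_in C X Y f"
 unfolding left_adjoint_in_def by blast

lemma equiv_pair_left_adjoint: "equiv_pair C X Y e d ==> left_adjoint_in C X Y e"
 unfolding left_adjoint_in_def equiv_pair_def pis_def by blast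

lemma left_adjoint_comp:
 assumes obs: "X \<in> Ob C" "Y \<in> Ob C" "Z \<in> Ob C"
  and "left_adjoint_in C X Y f" "left_adjoint_in C Y Z f'"
 shows "left_adjoint_in C X Z (Comp C X Y Z f' f)"
proof -
 obtain g g' where g: "f \<in> Hom C X Y" "g \<in> Hom C Y X" "ple C X X (Ident C X) (Comp C X Y X g f)"
   "ple C Y Y (Comp C Y X Y f g) (Ident C Y)"
  and g': "f' \<in> Hom C Y Z" "g' \<in> Hom C Z Y" "ple C Y Y (Ident C Y) (Comp C Y Z Y g' f')"
   "ple C Z Z (Comp C Z Y Z f' g') (Ident C Z)"
  using assms unfolding left_adjoint_in_def by blast
 show ?thesis
 proof (rule left_adjoint_inI)
  show "Comp C X Y Z f' f \<in> Hom C X Z" "Comp C Z Y X g g' \<in> Hom C Z X" using g g' obs by auto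
  have "ple C X X (Ident C X) (Comp C X Y X g f)" by fact
  also have "Comp C X Y X g f = Comp C X Y X g (Comp C X Y Y (Ident C Y) f)" using g obs by simp
  also have "ple C X X \<dots> (Comp C X Y X g (Comp C X Y Y (Comp C Y Z Y g' f') f))"
   using g g' obs by (intro ple_comp_right ple_comp_left) auto
  also have "\<dots> = Comp C X Z X (Comp C Z Y X g g') (Comp C X Y Z f' f)"
   using g g' obs by (simp add: Comp_assoc)
  finally show "ple C X X (Ident C X) (Comp C X Z X (Comp C Z Y X g g') (Comp C X Y Z f' f))" .
  have "Comp C Z X Z (Comp C X Y Z f' f) (Comp C Z Y X g g')
   = Comp C Z Y Z f' (Comp C Z Y Y (Comp C Y X Y f g) g')"
   using g g' obs by (simp add: Comp_assoc)
  also have "ple C Z Z \<dots> (Comp C Z Y Z f' (Comp C Z Y Y (Ident C Y) g'))"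
   using g g' obs by (intro ple_comp_right ple_comp_left) auto
  also have "\<dots> = Comp C Z Y Z f' g'" using g' obs by simp
  also have "ple C Z Z \<dots> (Ident C Z)" by fact
  finally show "ple C Z Z (Comp C Z X Z (Comp C X Y Z f' f) (Comp C Z Y X g g')) (Ident C Z)" .
 qed
qed

lemma left_adjoint_pis:
 assumes "left_adjoint_in C X Y f" "pis C X Y f f'"
 shows "left_adjoint_in C X Y f'"
proof -
 obtain g where g: "g \<in> Hom C Y X" "ple C X X (Ident C X) (Comp C X Y X g f)"
   "ple C Y Y (Comp C Y X Y f g) (Ident C Y)"
  using assms(1) unfolding left_adjoint_in_def by blast
 have obs: "X \<in> Ob C" "Y \<in> Ob C" "f' \<in> Hom C X Y" using assms(2) by (auto simp: pis_def ple_def)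
 show ?thesis
  using g obs assms(2)
  by (intro left_adjoint_inI[OF _ g(1)])
   (auto intro: ple_pis_trans pis_ple_trans pis_comp_right pis_comp_left pis_sym)
qed

end


section \<open>Pseudofunctors and pseudonatural equivalences\<close>

locale psf = C: locally_ordered_category C + D: locally_ordered_category D
 for C :: "('o, 'a) locat" and D :: "('p, 'b) locat" +
 fixes F :: "('o, 'a, 'p, 'b) arrow_map"
 assumes pseudo: "pseudofunctor C D F"
begin

lemma ob [simp]: "X \<in> Ob C ==> FOb F X \<in> Ob D"
 using pseudo by (simp add: pseudofunctor_def)

lemma arr [simp]: "[|X \<in> Ob C; Y \<in> Ob C; f \<in> Hom C X Y|] ==> FArr F X Y f \<in> Hom D (FOb F X) (FOb F Y)"
 using pseudo by (auto simp: pseudofunctor_def)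

lemma mono: "ple C X Y f g ==> ple D (FOb F X) (FOb F Y) (FArr F X Y f) (FArr F X Y g)"
 using pseudo unfolding ple_def by (auto simp: pseudofunctor_def)

lemma iso: "pis C X Y f g ==> pis D (FOb F X) (FOb F Y) (FArr F X Y f) (FArr F X Y g)"
 by (simp add: pis_def mono)

lemma ident: "X \<in> Ob C ==> pis D (FOb F X) (FOb F X) (FArr F X X (Ident C X)) (Ident D (FOb F X))"
 using pseudo by (subst pis_iff) (auto simp: pseudofunctor_def Pi_iff)

lemma comp:
 "[|X \<in> Ob C; Y \<in> Ob C; Z \<in> Ob C; f \<in> Hom C X Y; g \<in> Hom C Y Z|] ==>
  pis D (FOb F X) (FOb F Z) (FArr F X Z (Comp C X Y Z g f))
   (Comp D (FOb F X) (FOb F Y) (FOb F Z) (FArr F Y Z g) (FArr F X Y f))"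
 using pseudo by (subst pis_iff) (simp_all add: pseudofunctor_def Pi_iff)

lemma comp_sym:
 "[|X \<in> Ob C; Y \<in> Ob C; Z \<in> Ob C; f \<in> Hom C X Y; g \<in> Hom C Y Z|] ==>
  pis D (FOb F X) (FOb F Z) (Comp D (FOb F X) (FOb F Y) (FOb F Z) (FArr F Y Z g) (FArr F X Y f))
   (FArr F X Z (Comp C X Y Z g f))"
 by (rule pis_sym[OF comp])

lemma comp_ident:
 assumes "X \<in> Ob C" "Y \<in> Ob C" "f \<in> Hom C X Y" "g \<in> Hom C Y X"
  and "pis C X X (Comp C X Y X g f) (Ident C X)"
 shows "pis D (FOb F X) (FOb F X)
  (Comp D (FOb F X) (FOb F Y) (FOb F X) (FArr F Y X g) (FArr F X Y f)) (Ident D (FOb F X))"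
 using D.pis_trans[OF comp_sym D.pis_trans[OF iso ident]] assms by blast

lemma equiv_pair:
 "equiv_pair C X Y f g ==> equiv_pair D (FOb F X) (FOb F Y) (FArr F X Y f) (FArr F Y X g)"
 unfolding equiv_pair_def by (simp add: comp_ident)

lemma left_adjoint:
 assumes "left_adjoint_in C X Y f" "X \<in> Ob C" "Y \<in> Ob C"
 shows "left_adjoint_in D (FOb F X) (FOb F Y) (FArr F X Y f)"
proof -
 obtain g where g: "f \<in> Hom C X Y" "g \<in> Hom C Y X" "ple C X X (Ident C X) (Comp C X Y X g f)"
   "ple C Y Y (Comp C Y X Y f g) (Ident C Y)"
  using assms unfolding left_adjoint_in_def by blast
 show ?thesis
  using g assms(2,3)
  by (intro D.left_adjoint_inI[of _ _ _ "FArr F Y X g"])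
   (auto intro: D.pis_ple_trans[OF pis_sym[OF ident]] D.pis_ple_trans[OF comp_sym]
    D.ple_pis_trans[OF mono comp] D.ple_pis_trans[OF mono ident])
qed

end

lemma pseudofunctor_comp:
 assumes "locally_ordered_category C" "locally_ordered_category D" "locally_ordered_category E"
  and "pseudofunctor C D F" "pseudofunctor D E G"
 shows "pseudofunctor C E (comp_map G F)"
proof -
 interpret F: psf C D F using assms by (simp add: psf_def psf_axioms_def)
 interpret G: psf D E G using assms by (simp add: psf_def psf_axioms_def)
 have "iso2 E (FOb G (FOb F X)) (FOb G (FOb F X))
   (FArr G (FOb F X) (FOb F X) (FArr F X X (Ident C X))) (Ident E (FOb G (FOb F X)))"
  if "X \<in> Ob C" for X
  using that by (intro pis_iso2 G.D.pis_trans[OF G.iso G.ident] F.ident) auto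
 moreover have "iso2 E (FOb G (FOb F X)) (FOb G (FOb F Z))
   (FArr G (FOb F X) (FOb F Z) (FArr F X Z (Comp C X Y Z g f)))
   (Comp E (FOb G (FOb F X)) (FOb G (FOb F Y)) (FOb G (FOb F Z))
     (FArr G (FOb F Y) (FOb F Z) (FArr F Y Z g)) (FArr G (FOb F X) (FOb F Y) (FArr F X Y f)))"
  if "X \<in> Ob C" "Y \<in> Ob C" "Z \<in> Ob C" "f \<in> Hom C X Y" "g \<in> Hom C Y Z" for X Y Z f g
  using that by (intro pis_iso2 G.D.pis_trans[OF G.iso G.comp] F.comp) auto
 moreover have "Leq E (FOb G (FOb F X)) (FOb G (FOb F Y)) (FArr G (FOb F X) (FOb F Y) (FArr F X Y f))
   (FArr G (FOb F X) (FOb F Y) (FArr F X Y g))"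
  if "X \<in> Ob C" "Y \<in> Ob C" "f \<in> Hom C X Y" "g \<in> Hom C X Y" "Leq C X Y f g" for X Y f g
  using G.mono[OF F.mono, of X Y f g] that by (auto simp: ple_def)
 ultimately show ?thesis
  unfolding pseudofunctor_def comp_map_def by simp
qed

lemma identity_map_simps [simp]: "FOb identity_map X = X" "FArr identity_map X Y f = f"
 by (simp_all add: identity_map_def)

lemma comp_map_simps [simp]:
 "FOb (comp_map G F) X = FOb G (FOb F X)"
 "FArr (comp_map G F) X Y f = FArr G (FOb F X) (FOb F Y) (FArr F X Y f)"
 by (simp_all add: comp_map_def)

text \<open>A pseudonatural equivalence with chosen inverses of its components, so that its inverse is again
 of this form.\<close>

definition pseudonat_pair ::
 "('o, 'a) locat => ('p, 'b) locat => ('o, 'a, 'p, 'b) arrow_map => ('o, 'a, 'p, 'b) arrow_map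
  => ('o => 'b) => ('o => 'b) => bool" where
 "pseudonat_pair C D F G \<tau> \<sigma> \<longleftrightarrow>
   (\<forall>X\<in>Ob C. equiv_pair D (FOb F X) (FOb G X) (\<tau> X) (\<sigma> X)) \<and>
   (\<forall>X\<in>Ob C. \<forall>Y\<in>Ob C. \<forall>f\<in>Hom C X Y.
    pis D (FOb F X) (FOb G Y)
     (Comp D (FOb F X) (FOb F Y) (FOb G Y) (\<tau> Y) (FArr F X Y f))
     (Comp D (FOb F X) (FOb G X) (FOb G Y) (FArr G X Y f) (\<tau> X)))"

definition typed_map :: "('o, 'a) locat => ('p, 'b) locat => ('o, 'a, 'p, 'b) arrow_map => bool" where
 "typed_map C D F \<longleftrightarrow> (\<forall>X\<in>Ob C. FOb F X \<in> Ob D) \<and>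
   (\<forall>X\<in>Ob C. \<forall>Y\<in>Ob C. FArr F X Y \<in> Hom C X Y \<rightarrow> Hom D (FOb F X) (FOb F Y))"

lemma typed_map_identity: "typed_map C C identity_map"
 by (simp add: typed_map_def)

lemma pseudofunctor_typed: "pseudofunctor C D F ==> typed_map C D F"
 by (simp add: typed_map_def pseudofunctor_def)

lemma typed_map_comp: "typed_map C D F ==> typed_map D E G ==> typed_map C E (comp_map G F)"
 by (simp add: typed_map_def Pi_iff)

lemma pseudonaturally_equivalent_iff:
 assumes D: "locally_ordered_category D" and F: "typed_map C D F" and G: "typed_map C D G"
 shows "pseudonaturally_equivalent C D F G \<longleftrightarrow> (\<exists>\<tau> \<sigma>. pseudonat_pair C D F G \<tau> \<sigma>)"
proof -
 interpret D: locally_ordered_category D by fact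
 have ob: "FOb F X \<in> Ob D" "FOb G X \<in> Ob D" if "X \<in> Ob C" for X
  using that F G by (simp_all add: typed_map_def Pi_iff)
 have arr: "FArr F X Y f \<in> Hom D (FOb F X) (FOb F Y)" "FArr G X Y f \<in> Hom D (FOb G X) (FOb G Y)"
  if "X \<in> Ob C" "Y \<in> Ob C" "f \<in> Hom C X Y" for X Y f
  using that F G by (simp_all add: typed_map_def Pi_iff)
 show ?thesis
 proof
  assume "pseudonaturally_equivalent C D F G"
  then obtain \<tau> where t: "\<And>X. X \<in> Ob C ==> equivalence_in D (FOb F X) (FOb G X) (\<tau> X)"
   and nat: "\<And>X Y f. [|X \<in> Ob C; Y \<in> Ob C; f \<in> Hom C X Y|] ==>
       iso2 D (FOb F X) (FOb G Y)
        (Comp D (FOb F X) (FOb F Y) (FOb G Y) (\<tau> Y) (FArr F X Y f))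
        (Comp D (FOb F X) (FOb G X) (FOb G Y) (FArr G X Y f) (\<tau> X))"
   unfolding pseudonaturally_equivalent_def by blast
  obtain \<sigma> where \<sigma>: "\<And>X. X \<in> Ob C ==> equiv_pair D (FOb F X) (FOb G X) (\<tau> X) (\<sigma> X)"
   using t by (simp add: D.equivalence_in_iff ob) metis
  have "pseudonat_pair C D F G \<tau> \<sigma>"
   unfolding pseudonat_pair_def using \<sigma> nat ob arr equiv_pairD(3)[OF \<sigma>] by (auto simp: pis_iff)
  then show "\<exists>\<tau> \<sigma>. pseudonat_pair C D F G \<tau> \<sigma>" by blast
 next
  assume "\<exists>\<tau> \<sigma>. pseudonat_pair C D F G \<tau> \<sigma>"
  then obtain \<tau> \<sigma> where "pseudonat_pair C D F G \<tau> \<sigma>" by blast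
  then show "pseudonaturally_equivalent C D F G"
   unfolding pseudonat_pair_def pseudonaturally_equivalent_def
   by (intro exI[of _ \<tau>]) (auto simp: D.equivalence_in_iff ob pis_iso2)
 qed
qed

lemma pseudonat_pair_sym:
 assumes D: "locally_ordered_category D" and F: "typed_map C D F" and G: "typed_map C D G"
  and pn: "pseudonat_pair C D F G \<tau> \<sigma>"
 shows "pseudonat_pair C D G F \<sigma> \<tau>"
proof -
 interpret D: locally_ordered_category D by fact
 have e: "equiv_pair D (FOb F X) (FOb G X) (\<tau> X) (\<sigma> X)" if "X \<in> Ob C" for X
  using pn that by (simp add: pseudonat_pair_def)
 have "pis D (FOb G X) (FOb F Y)
     (Comp D (FOb G X) (FOb G Y) (FOb F Y) (\<sigma> Y) (FArr G X Y f))
     (Comp D (FOb G X) (FOb F X) (FOb F Y) (FArr F X Y f) (\<sigma> X))"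
  if X: "X \<in> Ob C" "Y \<in> Ob C" "f \<in> Hom C X Y" for X Y f
 proof -
  have arr: "FArr F X Y f \<in> Hom D (FOb F X) (FOb F Y)" "FArr G X Y f \<in> Hom D (FOb G X) (FOb G Y)"
   using X F G by (simp_all add: typed_map_def Pi_iff)
  note ex = equiv_pairD[OF e[OF X(1)]] and ey = equiv_pairD[OF e[OF X(2)]]
  have nat: "pis D (FOb F X) (FOb G Y)
     (Comp D (FOb F X) (FOb F Y) (FOb G Y) (\<tau> Y) (FArr F X Y f))
     (Comp D (FOb F X) (FOb G X) (FOb G Y) (FArr G X Y f) (\<tau> X))"
   using pn X by (simp add: pseudonat_pair_def)
  let ?c = "Comp D"
  have "?c (FOb G X) (FOb G Y) (FOb F Y) (\<sigma> Y) (FArr G X Y f)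
   = ?c (FOb G X) (FOb G Y) (FOb F Y) (\<sigma> Y)
     (?c (FOb G X) (FOb G X) (FOb G Y) (FArr G X Y f) (Ident D (FOb G X)))"
   using arr ex ey by simp
  also have "pis D (FOb G X) (FOb F Y) \<dots> (?c (FOb G X) (FOb G Y) (FOb F Y) (\<sigma> Y)
     (?c (FOb G X) (FOb G X) (FOb G Y) (FArr G X Y f)
      (?c (FOb G X) (FOb F X) (FOb G X) (\<tau> X) (\<sigma> X))))"
   using arr ex ey by (intro D.pis_comp_right pis_sym[OF ex(6)]) auto
  also have "\<dots> = ?c (FOb G X) (FOb G Y) (FOb F Y) (\<sigma> Y)
     (?c (FOb G X) (FOb F X) (FOb G Y) (?c (FOb F X) (FOb G X) (FOb G Y) (FArr G X Y f) (\<tau> X)) (\<sigma> X))"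
   using arr ex ey by (simp add: D.Comp_assoc)
  also have "pis D (FOb G X) (FOb F Y) \<dots> (?c (FOb G X) (FOb G Y) (FOb F Y) (\<sigma> Y)
     (?c (FOb G X) (FOb F X) (FOb G Y) (?c (FOb F X) (FOb F Y) (FOb G Y) (\<tau> Y) (FArr F X Y f)) (\<sigma> X)))"
   using arr ex ey by (intro D.pis_comp_right D.pis_comp_left pis_sym[OF nat]) auto
  also have "\<dots> = ?c (FOb G X) (FOb F Y) (FOb F Y) (?c (FOb F Y) (FOb G Y) (FOb F Y) (\<sigma> Y) (\<tau> Y))
     (?c (FOb G X) (FOb F X) (FOb F Y) (FArr F X Y f) (\<sigma> X))"
   using arr ex ey by (simp add: D.Comp_assoc)
  also have "pis D (FOb G X) (FOb F Y) \<dots>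
    (?c (FOb G X) (FOb F Y) (FOb F Y) (Ident D (FOb F Y)) (?c (FOb G X) (FOb F X) (FOb F Y) (FArr F X Y f) (\<sigma> X)))"
   using arr ex ey by (intro D.pis_comp_left ey(5)) auto
  also have "\<dots> = ?c (FOb G X) (FOb F X) (FOb F Y) (FArr F X Y f) (\<sigma> X)"
   using arr ex ey by simp
  finally show ?thesis .
 qed
 then show ?thesis using e by (auto simp: pseudonat_pair_def intro: equiv_pair_sym)
qed

lemma pseudonaturally_equivalent_sym:
 assumes "locally_ordered_category D" "typed_map C D F" "typed_map C D G"
  and "pseudonaturally_equivalent C D F G"
 shows "pseudonaturally_equivalent C D G F"
 using assms pseudonat_pair_sym[OF assms(1,2,3)] by (metis pseudonaturally_equivalent_iff)


section \<open>Biequivalences\<close>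

locale biequivalence_data = F: psf C D F + G: psf D C G
 for C :: "('o, 'a) locat" and D :: "('p, 'b) locat"
  and F :: "('o, 'a, 'p, 'b) arrow_map" and G :: "('p, 'b, 'o, 'a) arrow_map" +
 fixes \<eta> \<eta>i \<epsilon> \<epsilon>i
 assumes unit: "pseudonat_pair C C identity_map (comp_map G F) \<eta> \<eta>i"
  and counit: "pseudonat_pair D D identity_map (comp_map F G) \<epsilon> \<epsilon>i"

lemma biequivalent_data:
 assumes "locally_ordered_category C" "locally_ordered_category D" "biequivalent C D"
 obtains F G \<eta> \<eta>i \<epsilon> \<epsilon>i where "biequivalence_data C D F G \<eta> \<eta>i \<epsilon> \<epsilon>i"
proof -
 obtain F G where FG: "pseudofunctor C D F" "pseudofunctor D C G"
   "pseudonaturally_equivalent C C identity_map (comp_map G F)"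
   "pseudonaturally_equivalent D D (comp_map F G) identity_map"
  using assms unfolding biequivalent_def by blast
 note ty = typed_map_identity pseudofunctor_typed[OF FG(1)] pseudofunctor_typed[OF FG(2)]
 have "pseudonaturally_equivalent D D identity_map (comp_map F G)"
  by (rule pseudonaturally_equivalent_sym[OF assms(2) typed_map_comp[OF ty(3,2)] ty(1) FG(4)])
 then obtain \<epsilon> \<epsilon>i where "pseudonat_pair D D identity_map (comp_map F G) \<epsilon> \<epsilon>i"
  using pseudonaturally_equivalent_iff[OF assms(2) ty(1) typed_map_comp[OF ty(3,2)]] by blast
 moreover obtain \<eta> \<eta>i where "pseudonat_pair C C identity_map (comp_map G F) \<eta> \<eta>i"
  using FG(3) pseudonaturally_equivalent_iff[OF assms(1) ty(1) typed_map_comp[OF ty(2,3)]] by blast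
 ultimately show thesis
  using that assms FG
  by (simp add: biequivalence_data_def biequivalence_data_axioms_def psf_def psf_axioms_def)
qed

context biequivalence_data
begin

lemma swap: "biequivalence_data D C G F \<epsilon> \<epsilon>i \<eta> \<eta>i"
 using unit counit F.psf_axioms G.psf_axioms
 by (simp add: biequivalence_data_def biequivalence_data_axioms_def)

lemma unit_equiv: "X \<in> Ob C ==> equiv_pair C X (FOb G (FOb F X)) (\<eta> X) (\<eta>i X)"
 using unit by (simp add: pseudonat_pair_def)

lemma unit_nat:
 "[|X \<in> Ob C; Y \<in> Ob C; f \<in> Hom C X Y|] ==>
  pis C X (FOb G (FOb F Y)) (Comp C X Y (FOb G (FOb F Y)) (\<eta> Y) f)
   (Comp C X (FOb G (FOb F X)) (FOb G (FOb F Y)) (FArr G (FOb F X) (FOb F Y) (FArr F X Y f)) (\<eta> X))"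
 using unit by (simp add: pseudonat_pair_def)

text \<open>The unit makes \<open>G F f\<close> a conjugate of \<open>f\<close>, so \<open>F f \<le> F
 g\<close> implies \<open>f \<le> g\<close>.\<close>

lemma reflects:
 assumes X: "X \<in> Ob C" "Y \<in> Ob C" "f \<in> Hom C X Y" "g \<in> Hom C X Y"
  and le: "ple D (FOb F X) (FOb F Y) (FArr F X Y f) (FArr F X Y g)"
 shows "ple C X Y f g"
proof (rule F.C.equiv_pair_cancel_left[OF unit_equiv[OF X(2)] X(1,3,4)])
 note e = equiv_pairD[OF unit_equiv[OF X(1)]]
 have "pis C X (FOb G (FOb F Y)) (Comp C X Y (FOb G (FOb F Y)) (\<eta> Y) f)
   (Comp C X (FOb G (FOb F X)) (FOb G (FOb F Y)) (FArr G (FOb F X) (FOb F Y) (FArr F X Y f)) (\<eta> X))"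
  by (rule unit_nat[OF X(1-3)])
 also have "ple C X (FOb G (FOb F Y)) \<dots>
  (Comp C X (FOb G (FOb F X)) (FOb G (FOb F Y)) (FArr G (FOb F X) (FOb F Y) (FArr F X Y g)) (\<eta> X))"
  by (rule F.C.ple_comp_left[OF G.mono[OF le] X(1) e(3)])
 also have "pis C X (FOb G (FOb F Y)) \<dots> (Comp C X Y (FOb G (FOb F Y)) (\<eta> Y) g)"
  by (rule pis_sym[OF unit_nat[OF X(1,2,4)]])
 finally show "ple C X (FOb G (FOb F Y)) (Comp C X Y (FOb G (FOb F Y)) (\<eta> Y) f)
  (Comp C X Y (FOb G (FOb F Y)) (\<eta> Y) g)" .
qed

lemma reflects_pis:
 assumes "X \<in> Ob C" "Y \<in> Ob C" "f \<in> Hom C X Y" "g \<in> Hom C X Y"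
  and "pis D (FOb F X) (FOb F Y) (FArr F X Y f) (FArr F X Y g)"
 shows "pis C X Y f g"
 using assms by (auto simp: pis_def intro: reflects)

text \<open>Conjugating \<open>G h\<close> by the unit gives the preimage \<open>f\<close> of
 \<open>h\<close>; then \<open>G F f\<close> and \<open>G h\<close> are isomorphic, and
 \<open>G\<close> reflects the order.\<close>

lemma full:
 assumes X: "X \<in> Ob C" "Y \<in> Ob C" and h: "h \<in> Hom D (FOb F X) (FOb F Y)"
 obtains f where "f \<in> Hom C X Y" "pis D (FOb F X) (FOb F Y) (FArr F X Y f) h"
proof -
 interpret swap: biequivalence_data D C G F \<epsilon> \<epsilon>i \<eta> \<eta>i by (rule swap)
 note ex = equiv_pairD[OF unit_equiv[OF X(1)]] and ey = equiv_pairD[OF unit_equiv[OF X(2)]]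
 let ?GX = "FOb G (FOb F X)" and ?GY = "FOb G (FOb F Y)"
 let ?Gh = "FArr G (FOb F X) (FOb F Y) h"
 have Gh: "?Gh \<in> Hom C ?GX ?GY" using X h by simp
 define f where "f = Comp C X ?GY Y (\<eta>i Y) (Comp C X ?GX ?GY ?Gh (\<eta> X))"
 have f: "f \<in> Hom C X Y" using Gh ex ey X by (simp add: f_def)
 have "pis C X ?GY (Comp C X ?GX ?GY (FArr G (FOb F X) (FOb F Y) (FArr F X Y f)) (\<eta> X))
   (Comp C X Y ?GY (\<eta> Y) f)"
  by (rule pis_sym[OF unit_nat[OF X f]])
 also have "Comp C X Y ?GY (\<eta> Y) f = Comp C X ?GY ?GY (Comp C ?GY Y ?GY (\<eta> Y) (\<eta>i Y)) (Comp C X ?GX ?GY ?Gh (\<eta> X))"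
  using Gh ex ey X by (simp add: f_def F.C.Comp_assoc)
 also have "pis C X ?GY \<dots> (Comp C X ?GY ?GY (Ident C ?GY) (Comp C X ?GX ?GY ?Gh (\<eta> X)))"
  using Gh ex ey X by (intro F.C.pis_comp_left ey(6)) auto
 also have "\<dots> = Comp C X ?GX ?GY ?Gh (\<eta> X)" using Gh ex ey X by simp
 finally have *: "pis C X ?GY (Comp C X ?GX ?GY (FArr G (FOb F X) (FOb F Y) (FArr F X Y f)) (\<eta> X))
   (Comp C X ?GX ?GY ?Gh (\<eta> X))" .
 have "pis C ?GX ?GY (FArr G (FOb F X) (FOb F Y) (FArr F X Y f)) ?Gh"
  unfolding pis_def
  using X f Gh * ey(2)
  by (auto intro!: F.C.equiv_pair_cancel_right[OF unit_equiv[OF X(1)]] simp: pis_def)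
 then have "pis D (FOb F X) (FOb F Y) (FArr F X Y f) h"
  using X f h by (intro swap.reflects_pis) auto
 then show thesis using f that by blast
qed

lemma surjective:
 "Y \<in> Ob D ==> equiv_pair D Y (FOb F (FOb G Y)) (\<epsilon> Y) (\<epsilon>i Y)"
 using counit by (simp add: pseudonat_pair_def)

end

section \<open>Equivalences of quantaloids\<close>

lemma homomorphismD:
 assumes "homomorphism Q R F"
 shows "X \<in> Ob Q ==> FOb F X \<in> Ob R"
  "[|X \<in> Ob Q; Y \<in> Ob Q; f \<in> Hom Q X Y|] ==> FArr F X Y f \<in> Hom R (FOb F X) (FOb F Y)"
  "X \<in> Ob Q ==> FArr F X X (Ident Q X) = Ident R (FOb F X)"
  "[|X \<in> Ob Q; Y \<in> Ob Q; Z \<in> Ob Q; f \<in> Hom Q X Y; g \<in> Hom Q Y Z|] ==>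
   FArr F X Z (Comp Q X Y Z g f)
     = Comp R (FOb F X) (FOb F Y) (FOb F Z) (FArr F Y Z g) (FArr F X Y f)"
  "[|X \<in> Ob Q; Y \<in> Ob Q|] ==> sup_pres (homlat Q X Y) (homlat R (FOb F X) (FOb F Y)) (FArr F X Y)"
 using assms unfolding homomorphism_def by blast+

lemma homomorphism_mono:
 assumes "homomorphism Q R F" "ple Q X Y f g"
 shows "ple R (FOb F X) (FOb F Y) (FArr F X Y f) (FArr F X Y g)"
 using assms(2) homomorphismD[OF assms(1)] sup_pres_mono[OF homomorphismD(5)[OF assms(1)], of X Y f g]
 by (auto simp: ple_def)

lemma homomorphism_pseudofunctor:
 assumes "homomorphism Q R F" "locally_ordered_category R"
 shows "pseudofunctor Q R F"
proof -
 interpret R: locally_ordered_category R by fact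
 note F = homomorphismD[OF assms(1)]
 show ?thesis
  unfolding pseudofunctor_def iso2_def
  using F homomorphism_mono[OF assms(1)] by (auto simp: ple_def R.Leq_refl)
qed

lemma naturally_isomorphic_pseudo:
 assumes "locally_ordered_category R" "typed_map Q R F" "typed_map Q R G" "naturally_isomorphic Q R F G"
 shows "pseudonaturally_equivalent Q R F G"
proof -
 interpret R: locally_ordered_category R by fact
 obtain \<alpha> where \<alpha>: "\<alpha> \<in> nat_trans Q R F G" "\<And>X. X \<in> Ob Q ==> isomorphism_in R (FOb F X) (FOb G X) (\<alpha> X)"
  using assms(4) unfolding naturally_isomorphic_def by blast
 have "iso2 R X Y f f" if "f \<in> Hom R X Y" "X \<in> Ob R" "Y \<in> Ob R" for X Y f
  using that by (simp add: iso2_def R.Leq_refl)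
 moreover have "equivalence_in R (FOb F X) (FOb G X) (\<alpha> X)" if "X \<in> Ob Q" for X
  using \<alpha>(2)[OF that] assms(2,3) that calculation unfolding isomorphism_in_def equivalence_in_def typed_map_def
  by (metis R.Ident_in_Hom)
 moreover have "Comp R (FOb F X) (FOb F Y) (FOb G Y) (\<alpha> Y) (FArr F X Y f)
      = Comp R (FOb F X) (FOb G X) (FOb G Y) (FArr G X Y f) (\<alpha> X)
   \<and> Comp R (FOb F X) (FOb G X) (FOb G Y) (FArr G X Y f) (\<alpha> X) \<in> Hom R (FOb F X) (FOb G Y)
   \<and> FOb F X \<in> Ob R \<and> FOb G Y \<in> Ob R"
  if "X \<in> Ob Q" "Y \<in> Ob Q" "f \<in> Hom Q X Y" for X Y f
  using \<alpha>(1) that assms(2,3) by (auto simp: nat_trans_def typed_map_def Pi_iff PiE_iff)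
 ultimately show ?thesis unfolding pseudonaturally_equivalent_def by (intro exI[of _ \<alpha>]) auto
qed

lemma quantaloid_equivalent_biequivalent:
 assumes Q: "quantaloid Q" and R: "quantaloid R" and eq: "quantaloid_equivalent Q R"
 obtains F G \<eta> \<eta>i \<epsilon> \<epsilon>i where "biequivalence_data Q R F G \<eta> \<eta>i \<epsilon> \<epsilon>i" "homomorphism Q R F" "homomorphism R Q G"
proof -
 interpret Q: quantaloid Q by fact
 interpret R: quantaloid R by fact
 obtain F G where F: "homomorphism Q R F" and G: "homomorphism R Q G"
  and u: "naturally_isomorphic Q Q identity_map (comp_map G F)"
   "naturally_isomorphic R R (comp_map F G) identity_map"
  using eq unfolding quantaloid_equivalent_def by blast
 have F': "pseudofunctor Q R F" and G': "pseudofunctor R Q G"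
  using F G by (auto intro: homomorphism_pseudofunctor Q.locally_ordered_category_axioms R.locally_ordered_category_axioms)
 note ty = pseudofunctor_typed[OF F'] pseudofunctor_typed[OF G'] typed_map_identity
 have "pseudonaturally_equivalent Q Q identity_map (comp_map G F)"
  by (rule naturally_isomorphic_pseudo[OF Q.locally_ordered_category_axioms ty(3) typed_map_comp[OF ty(1,2)] u(1)])
 then obtain \<eta> \<eta>i where \<eta>: "pseudonat_pair Q Q identity_map (comp_map G F) \<eta> \<eta>i"
  using pseudonaturally_equivalent_iff[OF Q.locally_ordered_category_axioms ty(3) typed_map_comp[OF ty(1,2)]] by blast
 have "pseudonaturally_equivalent R R identity_map (comp_map F G)"
  by (rule pseudonaturally_equivalent_sym[OF R.locally_ordered_category_axioms typed_map_comp[OF ty(2,1)] ty(3)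
    naturally_isomorphic_pseudo[OF R.locally_ordered_category_axioms typed_map_comp[OF ty(2,1)] ty(3) u(2)]])
 then obtain \<epsilon> \<epsilon>i where \<epsilon>: "pseudonat_pair R R identity_map (comp_map F G) \<epsilon> \<epsilon>i"
  using pseudonaturally_equivalent_iff[OF R.locally_ordered_category_axioms ty(3) typed_map_comp[OF ty(2,1)]] by blast
 have "biequivalence_data Q R F G \<eta> \<eta>i \<epsilon> \<epsilon>i"
  using F' G' \<eta> \<epsilon> Q.locally_ordered_category_axioms R.locally_ordered_category_axioms
  by (simp add: biequivalence_data_def biequivalence_data_axioms_def psf_def psf_axioms_def)
 then show thesis using F G by (rule that)
qed

text \<open>An equivalence of quantaloids is bijective on hom-lattices because pseudofunctors are full and
 reflect the order, and the order is antisymmetric.\<close>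

lemma biequivalence_homomorphism:
 assumes "quantaloid Q" "quantaloid R" and "biequivalence_data Q R F G \<eta> \<eta>i \<epsilon> \<epsilon>i"
 shows "homomorphism Q R F"
  and "\<And>X Y. [|X \<in> Ob Q; Y \<in> Ob Q|] ==> bij_betw (FArr F X Y) (Hom Q X Y) (Hom R (FOb F X) (FOb F Y))"
proof -
 interpret Q: quantaloid Q by fact
 interpret R: quantaloid R by fact
 interpret b: biequivalence_data Q R F G \<eta> \<eta>i \<epsilon> \<epsilon>i by fact
 show bij: "bij_betw (FArr F X Y) (Hom Q X Y) (Hom R (FOb F X) (FOb F Y))"
  if X: "X \<in> Ob Q" "Y \<in> Ob Q" for X Y
 proof -
  have "inj_on (FArr F X Y) (Hom Q X Y)"
  proof (rule inj_onI)
   fix f g assume fg: "f \<in> Hom Q X Y" "g \<in> Hom Q X Y" "FArr F X Y f = FArr F X Y g"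
   then have "pis R (FOb F X) (FOb F Y) (FArr F X Y f) (FArr F X Y g)"
    using X by (simp add: R.pis_refl)
   then show "f = g" using X fg b.reflects_pis Q.pis_eq by metis
  qed
  moreover have "h \<in> FArr F X Y ` Hom Q X Y" if "h \<in> Hom R (FOb F X) (FOb F Y)" for h
   using b.full[OF X that] R.pis_eq by (metis imageI)
  ultimately show ?thesis using X by (auto simp: bij_betw_def)
 qed
 have "sup_pres (homlat Q X Y) (homlat R (FOb F X) (FOb F Y)) (FArr F X Y)"
  if X: "X \<in> Ob Q" "Y \<in> Ob Q" for X Y
 proof (rule order_iso_sup_pres)
  show "le (homlat R (FOb F X) (FOb F Y)) (FArr F X Y f) (FArr F X Y g) \<longleftrightarrow> le (homlat Q X Y) f g"
   if "f \<in> carrier (homlat Q X Y)" "g \<in> carrier (homlat Q X Y)" for f g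
   using that X b.reflects[of X Y f g] b.F.mono[of X Y f g] by (auto simp: ple_def)
 qed (use X bij in \<open>simp_all add: Q.homlat_complete R.homlat_complete\<close>)
 then show "homomorphism Q R F"
  unfolding homomorphism_def
  using R.pis_eq[OF b.F.ident] R.pis_eq[OF b.F.comp] by auto
qed

lemma pseudonat_pair_naturally_isomorphic:
 assumes "quantaloid R" "typed_map Q R F" "typed_map Q R G" "pseudonat_pair Q R F G \<tau> \<sigma>"
 shows "naturally_isomorphic Q R F G"
proof -
 interpret R: quantaloid R by fact
 have "isomorphism_in R (FOb F X) (FOb G X) (\<tau> X)" if "X \<in> Ob Q" for X
  using assms(4) that R.pis_eq unfolding pseudonat_pair_def equiv_pair_def isomorphism_in_def by blast
 moreover have "Comp R (FOb F X) (FOb F Y) (FOb G Y) (\<tau> Y) (FArr F X Y f)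
   = Comp R (FOb F X) (FOb G X) (FOb G Y) (FArr G X Y f) (\<tau> X)"
  if "X \<in> Ob Q" "Y \<in> Ob Q" "f \<in> Hom Q X Y" for X Y f
  using assms(4) that by (intro R.pis_eq[of "FOb F X" "FOb G Y"]) (simp add: pseudonat_pair_def)
 moreover have "\<tau> X \<in> Hom R (FOb F X) (FOb G X)" if "X \<in> Ob Q" for X
  using assms(4) that by (simp add: pseudonat_pair_def equiv_pair_def)
 ultimately have "restrict \<tau> (Ob Q) \<in> nat_trans Q R F G"
   and "\<And>X. X \<in> Ob Q ==> isomorphism_in R (FOb F X) (FOb G X) (restrict \<tau> (Ob Q) X)"
  by (simp_all add: nat_trans_def)
 then show ?thesis unfolding naturally_isomorphic_def by blast
qed

text \<open>A homomorphism that is bijective on arrows, reflects the order and reaches every object up to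
 isomorphism; by choice it has an inverse up to natural isomorphism.\<close>

definition weak_equivalence :: "('o, 'a) locat => ('p, 'b) locat => ('o, 'a, 'p, 'b) arrow_map => bool" where
 "weak_equivalence Q R F \<longleftrightarrow> homomorphism Q R F \<and>
   (\<forall>X\<in>Ob Q. \<forall>Y\<in>Ob Q. bij_betw (FArr F X Y) (Hom Q X Y) (Hom R (FOb F X) (FOb F Y))) \<and>
   (\<forall>X\<in>Ob Q. \<forall>Y\<in>Ob Q. \<forall>f\<in>Hom Q X Y. \<forall>g\<in>Hom Q X Y.
    ple R (FOb F X) (FOb F Y) (FArr F X Y f) (FArr F X Y g) --> ple Q X Y f g) \<and>
   (\<forall>Y\<in>Ob R. \<exists>X\<in>Ob Q. \<exists>i j. equiv_pair R Y (FOb F X) i j)"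

lemma weak_equivalenceD:
 assumes "weak_equivalence Q R F"
 shows "homomorphism Q R F"
  and "[|X \<in> Ob Q; Y \<in> Ob Q|] ==> bij_betw (FArr F X Y) (Hom Q X Y) (Hom R (FOb F X) (FOb F Y))"
  and "[|X \<in> Ob Q; Y \<in> Ob Q; f \<in> Hom Q X Y; g \<in> Hom Q X Y;
   ple R (FOb F X) (FOb F Y) (FArr F X Y f) (FArr F X Y g)|] ==> ple Q X Y f g"
  and "Z \<in> Ob R ==> \<exists>X\<in>Ob Q. \<exists>i j. equiv_pair R Z (FOb F X) i j"
 using assms unfolding weak_equivalence_def by blast+

lemma weak_equivalenceI:
 assumes Q: "quantaloid Q" and R: "quantaloid R" and ob: "\<And>X. X \<in> Ob Q ==> FOb F X \<in> Ob R"
  and arr: "\<And>X Y f. [|X \<in> Ob Q; Y \<in> Ob Q; f \<in> Hom Q X Y|] ==> FArr F X Y f \<in> Hom R (FOb F X) (FOb F Y)"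
  and ident: "\<And>X. X \<in> Ob Q ==> FArr F X X (Ident Q X) = Ident R (FOb F X)"
  and comp: "\<And>X Y Z f g. [|X \<in> Ob Q; Y \<in> Ob Q; Z \<in> Ob Q; f \<in> Hom Q X Y; g \<in> Hom Q Y Z|] ==>
   FArr F X Z (Comp Q X Y Z g f) = Comp R (FOb F X) (FOb F Y) (FOb F Z) (FArr F Y Z g) (FArr F X Y f)"
  and le: "\<And>X Y f g. [|X \<in> Ob Q; Y \<in> Ob Q; f \<in> Hom Q X Y; g \<in> Hom Q X Y|] ==>
   ple R (FOb F X) (FOb F Y) (FArr F X Y f) (FArr F X Y g) \<longleftrightarrow> ple Q X Y f g"
  and full: "\<And>X Y h. [|X \<in> Ob Q; Y \<in> Ob Q; h \<in> Hom R (FOb F X) (FOb F Y)|] ==> \<exists>f\<in>Hom Q X Y. FArr F X Y f = h"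
  and es: "\<And>Y. Y \<in> Ob R ==> \<exists>X\<in>Ob Q. \<exists>i j. equiv_pair R Y (FOb F X) i j"
 shows "weak_equivalence Q R F"
proof -
 interpret Q: quantaloid Q by fact
 interpret R: quantaloid R by fact
 have bij: "bij_betw (FArr F X Y) (Hom Q X Y) (Hom R (FOb F X) (FOb F Y))" if X: "X \<in> Ob Q" "Y \<in> Ob Q" for X Y
 proof -
  have "f = g" if fg: "f \<in> Hom Q X Y" "g \<in> Hom Q X Y" "FArr F X Y f = FArr F X Y g" for f g
   using le[OF X fg(1,2)] le[OF X fg(2,1)] R.ple_refl[OF ob ob arr] X fg by (simp add: Q.ple_antisym)
  moreover have "h \<in> FArr F X Y ` Hom Q X Y" if "h \<in> Hom R (FOb F X) (FOb F Y)" for h using full[OF X that] by blast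
  ultimately show ?thesis using arr X by (auto simp: bij_betw_def inj_on_def)
 qed
 have "sup_pres (homlat Q X Y) (homlat R (FOb F X) (FOb F Y)) (FArr F X Y)" if X: "X \<in> Ob Q" "Y \<in> Ob Q" for X Y
  using le[OF X] bij[OF X] ob arr X
  by (intro order_iso_sup_pres) (simp_all add: Q.homlat_complete R.homlat_complete ple_def)
 then have "homomorphism Q R F" unfolding homomorphism_def using ob arr ident comp by simp
 then show ?thesis unfolding weak_equivalence_def using bij le es by blast
qed

text \<open>The inverse sends an object to a chosen preimage up to isomorphism, and an arrow to the preimage
 of its conjugate by the chosen isomorphisms.\<close>

lemma weak_equivalence_inverse:
 assumes Q: "quantaloid Q" and R: "quantaloid R" and F: "weak_equivalence Q R F"
 shows "\<exists>G \<eta> \<eta>i \<epsilon> \<epsilon>i. weak_equivalence R Q G \<and> biequivalence_data Q R F G \<eta> \<eta>i \<epsilon> \<epsilon>i"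
proof -
 interpret Q: quantaloid Q by fact
 interpret R: quantaloid R by fact
 note W = weak_equivalenceD[OF F]
 note FD = homomorphismD[OF W(1)]
 obtain H i j where H: "\<And>Y. Y \<in> Ob R ==> H Y \<in> Ob Q \<and> equiv_pair R Y (FOb F (H Y)) (i Y) (j Y)"
  using W(4) by metis
 have e [simp]: "H Y \<in> Ob Q" "i Y \<in> Hom R Y (FOb F (H Y))" "j Y \<in> Hom R (FOb F (H Y)) Y"
  "Comp R Y (FOb F (H Y)) Y (j Y) (i Y) = Ident R Y"
  "Comp R (FOb F (H Y)) Y (FOb F (H Y)) (i Y) (j Y) = Ident R (FOb F (H Y))" if "Y \<in> Ob R" for Y
  using H[OF that] equiv_pairD[OF conjunct2[OF H[OF that]]] R.pis_eq by blast+
 have cancel: "Comp R Z (FOb F (H Y)) Y (j Y) (Comp R Z Y (FOb F (H Y)) (i Y) f) = f"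
  if "Y \<in> Ob R" "Z \<in> Ob R" "f \<in> Hom R Z Y" for Y Z f
  using that e[OF that(1)] FD(1) by (simp flip: R.Comp_assoc)
 have cancel': "Comp R Z Y (FOb F (H Y)) (i Y) (Comp R Z (FOb F (H Y)) Y (j Y) f) = f"
  if "Y \<in> Ob R" "Z \<in> Ob R" "f \<in> Hom R Z (FOb F (H Y))" for Y Z f
  using that e[OF that(1)] FD(1) by (simp flip: R.Comp_assoc)
 have inj: "f = g" if "X \<in> Ob Q" "Y \<in> Ob Q" "f \<in> Hom Q X Y" "g \<in> Hom Q X Y" "FArr F X Y f = FArr F X Y g" for X Y f g
  using W(2)[OF that(1,2)] that(3-5) by (auto simp: bij_betw_def dest: inj_onD)
 define l where "l X Y = inv_into (Hom Q X Y) (FArr F X Y)" for X Y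
 have l [simp]: "FArr F X Y (l X Y h) = h" "l X Y h \<in> Hom Q X Y"
  if "X \<in> Ob Q" "Y \<in> Ob Q" "h \<in> Hom R (FOb F X) (FOb F Y)" for X Y h
  using W(2)[OF that(1,2)] that(3) unfolding l_def by (auto simp: bij_betw_def f_inv_into_f inv_into_into)
 define c where "c Y Z g = Comp R (FOb F (H Y)) Y (FOb F (H Z)) (Comp R Y Z (FOb F (H Z)) (i Z) g) (j Y)" for Y Z g
 have c [simp]: "c Y Z g \<in> Hom R (FOb F (H Y)) (FOb F (H Z))" if "Y \<in> Ob R" "Z \<in> Ob R" "g \<in> Hom R Y Z" for Y Z g
  using that FD(1) by (simp add: c_def)
 have ci: "Comp R Y (FOb F (H Y)) (FOb F (H Z)) (c Y Z g) (i Y) = Comp R Y Z (FOb F (H Z)) (i Z) g"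
  if "Y \<in> Ob R" "Z \<in> Ob R" "g \<in> Hom R Y Z" for Y Z g
  using that FD(1) by (simp add: c_def R.Comp_assoc)
 have c_le: "ple R (FOb F (H Y)) (FOb F (H Z)) (c Y Z g) (c Y Z g') \<longleftrightarrow> ple R Y Z g g'"
  if Y: "Y \<in> Ob R" "Z \<in> Ob R" "g \<in> Hom R Y Z" "g' \<in> Hom R Y Z" for Y Z g g'
 proof
  assume "ple R (FOb F (H Y)) (FOb F (H Z)) (c Y Z g) (c Y Z g')"
  from R.ple_comp_left[OF this Y(1) e(2)[OF Y(1)]]
  have "ple R Y (FOb F (H Z)) (Comp R Y Z (FOb F (H Z)) (i Z) g) (Comp R Y Z (FOb F (H Z)) (i Z) g')" using Y by (simp add: ci)
  from R.ple_comp_right[OF this Y(2) e(3)[OF Y(2)]] show "ple R Y Z g g'" using Y by (simp add: cancel)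
 qed (unfold c_def, use Y FD(1) in \<open>intro R.ple_comp_left R.ple_comp_right; simp\<close>)
 define G where "G = \<lparr>FOb = H, FArr = (\<lambda>Y Z g. l (H Y) (H Z) (c Y Z g))\<rparr>"
 have G: "FOb G Y = H Y" "FArr G Y Z g = l (H Y) (H Z) (c Y Z g)" for Y Z g by (simp_all add: G_def)
 have FG: "FArr F (H Y) (H Z) (FArr G Y Z g) = c Y Z g" "FArr G Y Z g \<in> Hom Q (H Y) (H Z)"
  if "Y \<in> Ob R" "Z \<in> Ob R" "g \<in> Hom R Y Z" for Y Z g
  using that by (simp_all add: G)
 have GW: "weak_equivalence R Q G"
 proof (rule weak_equivalenceI[OF R Q])
  show "FArr G Y Y (Ident R Y) = Ident Q (FOb G Y)" if Y: "Y \<in> Ob R" for Y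
   by (rule inj[of "H Y" "H Y"]) (use Y FG[OF Y Y] FD(1,3) in \<open>simp_all add: G(1) c_def\<close>)
  show "FArr G X Z (Comp R X Y Z g f) = Comp Q (FOb G X) (FOb G Y) (FOb G Z) (FArr G Y Z g) (FArr G X Y f)"
   if X: "X \<in> Ob R" "Y \<in> Ob R" "Z \<in> Ob R" and f: "f \<in> Hom R X Y" "g \<in> Hom R Y Z" for X Y Z f g
  proof (rule inj[of "H X" "H Z"])
   have "c X Z (Comp R X Y Z g f) = Comp R (FOb F (H X)) (FOb F (H Y)) (FOb F (H Z)) (c Y Z g) (c X Y f)"
    using X f FD(1) by (simp add: c_def R.Comp_assoc cancel)
   then show "FArr F (H X) (H Z) (FArr G X Z (Comp R X Y Z g f))
    = FArr F (H X) (H Z) (Comp Q (FOb G X) (FOb G Y) (FOb G Z) (FArr G Y Z g) (FArr G X Y f))"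
    using X f FG FD(4) by (simp add: G(1))
  qed (use X f FG in \<open>simp_all add: G(1)\<close>)
  show "ple Q (FOb G Y) (FOb G Z) (FArr G Y Z g) (FArr G Y Z g') \<longleftrightarrow> ple R Y Z g g'"
   if Y: "Y \<in> Ob R" "Z \<in> Ob R" and g: "g \<in> Hom R Y Z" "g' \<in> Hom R Y Z" for Y Z g g'
   unfolding c_le[OF Y g, symmetric] FG(1)[OF Y g(1), symmetric] FG(1)[OF Y g(2), symmetric] G(1)
   using W(3)[OF _ _ FG(2)[OF Y g(1)] FG(2)[OF Y g(2)]] homomorphism_mono[OF W(1)] Y by auto
  show "\<exists>g\<in>Hom R Y Z. FArr G Y Z g = f" if Y: "Y \<in> Ob R" "Z \<in> Ob R" and f: "f \<in> Hom Q (FOb G Y) (FOb G Z)" for Y Z f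
  proof
   let ?g = "Comp R Y (FOb F (H Z)) Z (j Z) (Comp R Y (FOb F (H Y)) (FOb F (H Z)) (FArr F (H Y) (H Z) f) (i Y))"
   have f': "f \<in> Hom Q (H Y) (H Z)" using f by (simp add: G)
   have Ff: "FArr F (H Y) (H Z) f \<in> Hom R (FOb F (H Y)) (FOb F (H Z))" using f' Y FD(2) by simp
   show g: "?g \<in> Hom R Y Z" using Ff Y FD(1) by simp
   have "c Y Z ?g = FArr F (H Y) (H Z) f" using Ff Y FD(1) by (simp add: c_def R.Comp_assoc cancel')
   then show "FArr G Y Z ?g = f" using inj[OF _ _ FG(2)[OF Y g] f'] FG(1)[OF Y g] Y by simp
  qed
  show "\<exists>Y\<in>Ob R. \<exists>i j. equiv_pair Q X (FOb G Y) i j" if X: "X \<in> Ob Q" for X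
  proof (intro bexI[of _ "FOb F X"] exI)
   let ?u = "l X (H (FOb F X)) (i (FOb F X))" and ?v = "l (H (FOb F X)) X (j (FOb F X))"
   have "Comp Q X (H (FOb F X)) X ?v ?u = Ident Q X" by (rule inj[of X X]) (use X FD in simp_all)
   moreover have "Comp Q (H (FOb F X)) X (H (FOb F X)) ?u ?v = Ident Q (H (FOb F X))"
    by (rule inj[of "H (FOb F X)" "H (FOb F X)"]) (use X FD in simp_all)
   ultimately show "equiv_pair Q X (FOb G (FOb F X)) ?u ?v"
    unfolding equiv_pair_def using X FD(1) by (simp add: G Q.pis_refl)
  qed (rule FD(1)[OF X])
 qed (use FG in \<open>simp_all add: G(1)\<close>)
 note GD = homomorphismD[OF weak_equivalenceD(1)[OF GW]]
 have "pseudonat_pair R R identity_map (comp_map F G) i j"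
  unfolding pseudonat_pair_def using H FG ci FD(1) by (auto simp: G(1) intro!: R.pis_refl)
 moreover have "pseudonat_pair Q Q identity_map (comp_map G F) (\<lambda>X. l X (H (FOb F X)) (i (FOb F X))) (\<lambda>X. l (H (FOb F X)) X (j (FOb F X)))"
  unfolding pseudonat_pair_def
 proof (intro conjI ballI)
  fix X assume X: "X \<in> Ob Q"
  have "Comp Q X (H (FOb F X)) X (l (H (FOb F X)) X (j (FOb F X))) (l X (H (FOb F X)) (i (FOb F X))) = Ident Q X"
   by (rule inj[of X X]) (use X FD in simp_all)
  moreover have "Comp Q (H (FOb F X)) X (H (FOb F X)) (l X (H (FOb F X)) (i (FOb F X))) (l (H (FOb F X)) X (j (FOb F X)))
   = Ident Q (H (FOb F X))"
   by (rule inj[of "H (FOb F X)" "H (FOb F X)"]) (use X FD in simp_all)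
  ultimately show "equiv_pair Q (FOb identity_map X) (FOb (comp_map G F) X) (l X (H (FOb F X)) (i (FOb F X))) (l (H (FOb F X)) X (j (FOb F X)))"
   unfolding equiv_pair_def using X FD(1) by (simp add: G Q.pis_refl)
 next
  fix X Y f assume X: "X \<in> Ob Q" "Y \<in> Ob Q" and f: "f \<in> Hom Q X Y"
  have "Comp Q X Y (H (FOb F Y)) (l Y (H (FOb F Y)) (i (FOb F Y))) f
   = Comp Q X (H (FOb F X)) (H (FOb F Y)) (FArr G (FOb F X) (FOb F Y) (FArr F X Y f)) (l X (H (FOb F X)) (i (FOb F X)))"
   by (rule inj[of X "H (FOb F Y)"]) (use X f FD FG ci in simp_all)
  then show "pis Q (FOb identity_map X) (FOb (comp_map G F) Y)
   (Comp Q (FOb identity_map X) (FOb identity_map Y) (FOb (comp_map G F) Y) (l Y (H (FOb F Y)) (i (FOb F Y))) (FArr identity_map X Y f))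
   (Comp Q (FOb identity_map X) (FOb (comp_map G F) X) (FOb (comp_map G F) Y) (FArr (comp_map G F) X Y f) (l X (H (FOb F X)) (i (FOb F X))))"
   using X f FD(1,2) FG(2) by (simp add: G(1) Q.pis_refl)
 qed
 ultimately have "biequivalence_data Q R F G (\<lambda>X. l X (H (FOb F X)) (i (FOb F X))) (\<lambda>X. l (H (FOb F X)) X (j (FOb F X))) i j"
  using homomorphism_pseudofunctor[OF W(1) R.locally_ordered_category_axioms]
   homomorphism_pseudofunctor[OF weak_equivalenceD(1)[OF GW] Q.locally_ordered_category_axioms]
   Q.locally_ordered_category_axioms R.locally_ordered_category_axioms
  by (simp add: biequivalence_data_def biequivalence_data_axioms_def psf_def psf_axioms_def)
 then show ?thesis using GW by blast
qed

lemma weak_equivalence_equivalent: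
 assumes Q: "quantaloid Q" and R: "quantaloid R" and "weak_equivalence Q R F"
 shows "quantaloid_equivalent Q R"
proof -
 interpret Q: quantaloid Q by fact
 interpret R: quantaloid R by fact
 obtain G \<eta> \<eta>i \<epsilon> \<epsilon>i where G: "weak_equivalence R Q G" and b: "biequivalence_data Q R F G \<eta> \<eta>i \<epsilon> \<epsilon>i"
  using weak_equivalence_inverse[OF assms] by blast
 interpret b: biequivalence_data Q R F G \<eta> \<eta>i \<epsilon> \<epsilon>i by fact
 note ty = pseudofunctor_typed[OF b.F.pseudo] pseudofunctor_typed[OF b.G.pseudo] typed_map_identity
 have "naturally_isomorphic Q Q identity_map (comp_map G F)"
  by (rule pseudonat_pair_naturally_isomorphic[OF Q ty(3) typed_map_comp[OF ty(1,2)] b.unit])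
 moreover have "naturally_isomorphic R R (comp_map F G) identity_map"
  by (rule pseudonat_pair_naturally_isomorphic[OF R typed_map_comp[OF ty(2,1)] ty(3)
    pseudonat_pair_sym[OF R.locally_ordered_category_axioms ty(3) typed_map_comp[OF ty(2,1)] b.counit]])
 ultimately show ?thesis
  unfolding quantaloid_equivalent_def using weak_equivalenceD(1)[OF assms(3)] weak_equivalenceD(1)[OF G] by blast
qed

lemma equivalent_weak_equivalence:
 assumes Q: "quantaloid Q" and R: "quantaloid R" and "quantaloid_equivalent Q R"
 obtains F where "weak_equivalence Q R F"
proof -
 obtain F G \<eta> \<eta>i \<epsilon> \<epsilon>i where b: "biequivalence_data Q R F G \<eta> \<eta>i \<epsilon> \<epsilon>i"
  using quantaloid_equivalent_biequivalent[OF assms] .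
 interpret b: biequivalence_data Q R F G \<eta> \<eta>i \<epsilon> \<epsilon>i by fact
 interpret b': biequivalence_data R Q G F \<epsilon> \<epsilon>i \<eta> \<eta>i by (rule b.swap)
 have "\<exists>X\<in>Ob Q. \<exists>i j. equiv_pair R Y (FOb F X) i j" if "Y \<in> Ob R" for Y
  using b'.unit_equiv[OF that] b.G.ob[OF that] by auto
 then show thesis
  using biequivalence_homomorphism[OF Q R b] b.reflects by (intro that[of F]) (simp add: weak_equivalence_def)
qed


section \<open>Two locally ordered categories with the same image\<close>

text \<open>\<open>U\<close> identifies \<open>C\<close> with the left adjoint arrows of \<open>K\<close>
 between certain objects. So \<open>C\<close> is determined by the class of these objects, and
 the notion is invariant under biequivalence of \<open>K\<close>.\<close>

definition realizes :: "('o, 'a) locat => ('k, 'c) locat => ('o, 'a, 'k, 'c) arrow_map => bool" where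
 "realizes C K U \<longleftrightarrow> pseudofunctor C K U \<and>
   (\<forall>X\<in>Ob C. \<forall>Y\<in>Ob C. \<forall>f\<in>Hom C X Y. \<forall>g\<in>Hom C X Y.
    ple K (FOb U X) (FOb U Y) (FArr U X Y f) (FArr U X Y g) --> ple C X Y f g) \<and>
   (\<forall>X\<in>Ob C. \<forall>Y\<in>Ob C. \<forall>f\<in>Hom C X Y. left_adjoint_in K (FOb U X) (FOb U Y) (FArr U X Y f)) \<and>
   (\<forall>X\<in>Ob C. \<forall>Y\<in>Ob C. \<forall>h. left_adjoint_in K (FOb U X) (FOb U Y) h -->
    (\<exists>f\<in>Hom C X Y. pis K (FOb U X) (FOb U Y) (FArr U X Y f) h))"

locale realization = U: psf C K U for C :: "('o, 'a) locat" and K :: "('k, 'c) locat" and U +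
 assumes realizes: "realizes C K U"
begin

lemma reflects:
 "[|X \<in> Ob C; Y \<in> Ob C; f \<in> Hom C X Y; g \<in> Hom C X Y;
  ple K (FOb U X) (FOb U Y) (FArr U X Y f) (FArr U X Y g)|] ==> ple C X Y f g"
 using realizes unfolding realizes_def by blast

lemma reflects_pis:
 "[|X \<in> Ob C; Y \<in> Ob C; f \<in> Hom C X Y; g \<in> Hom C X Y;
  pis K (FOb U X) (FOb U Y) (FArr U X Y f) (FArr U X Y g)|] ==> pis C X Y f g"
 unfolding pis_def by (blast intro: reflects)

lemma adj: "[|X \<in> Ob C; Y \<in> Ob C; f \<in> Hom C X Y|] ==> left_adjoint_in K (FOb U X) (FOb U Y) (FArr U X Y f)"
 using realizes unfolding realizes_def by blast

lemma lift:
 assumes "X \<in> Ob C" "Y \<in> Ob C" "left_adjoint_in K (FOb U X) (FOb U Y) h"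
 obtains f where "f \<in> Hom C X Y" "pis K (FOb U X) (FOb U Y) (FArr U X Y f) h"
 using realizes assms unfolding realizes_def by blast

text \<open>Equivalences are left adjoints, so they lift along \<open>U\<close>, and they lift to equivalences because
 \<open>U\<close> reflects the order.\<close>

lemma lift_equiv_pair:
 assumes X: "X \<in> Ob C" "Y \<in> Ob C" and e: "equiv_pair K (FOb U X) (FOb U Y) e d"
 obtains f g where "equiv_pair C X Y f g" "pis K (FOb U X) (FOb U Y) (FArr U X Y f) e"
proof -
 obtain f where f: "f \<in> Hom C X Y" "pis K (FOb U X) (FOb U Y) (FArr U X Y f) e"
  using lift[OF X U.D.equiv_pair_left_adjoint[OF e]] by blast
 obtain g where g: "g \<in> Hom C Y X" "pis K (FOb U Y) (FOb U X) (FArr U Y X g) d"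
  using lift[OF X(2,1) U.D.equiv_pair_left_adjoint[OF equiv_pair_sym[OF e]]] by blast
 have inv: "pis C A A (Comp C A B A q p) (Ident C A)"
  if A: "A \<in> Ob C" "B \<in> Ob C" "p \<in> Hom C A B" "q \<in> Hom C B A"
   and p: "pis K (FOb U A) (FOb U B) (FArr U A B p) p'" and q: "pis K (FOb U B) (FOb U A) (FArr U B A q) q'"
   and qp: "pis K (FOb U A) (FOb U A) (Comp K (FOb U A) (FOb U B) (FOb U A) q' p') (Ident K (FOb U A))"
  for A B p q p' q'
 proof (rule reflects_pis[OF A(1,1)])
  have "pis K (FOb U A) (FOb U A) (FArr U A A (Comp C A B A q p))
   (Comp K (FOb U A) (FOb U B) (FOb U A) (FArr U B A q) (FArr U A B p))"
   by (rule U.comp[OF A(1,2,1,3,4)])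
  also have "pis K (FOb U A) (FOb U A) \<dots> (Comp K (FOb U A) (FOb U B) (FOb U A) q' p')"
   by (rule U.D.pis_comp[OF p q])
  also note qp
  also have "pis K (FOb U A) (FOb U A) (Ident K (FOb U A)) (FArr U A A (Ident C A))"
   by (rule pis_sym[OF U.ident[OF A(1)]])
  finally show "pis K (FOb U A) (FOb U A) (FArr U A A (Comp C A B A q p)) (FArr U A A (Ident C A))" .
 qed (use A in auto)
 have "equiv_pair C X Y f g"
  unfolding equiv_pair_def
  using X f g inv[OF X f(1) g(1) f(2) g(2)] inv[OF X(2,1) g(1) f(1) g(2) f(2)] equiv_pairD[OF e]
  by blast
 then show thesis using f that by blast
qed

end

text \<open>A biequivalence is full up to isomorphism and reflects the order, so it reflects left adjoints:
 an adjoint in the target lifts, and its unit and counit inequalities are reflected.\<close>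

lemma realization_after_biequivalence:
 assumes "realization C K U" and "biequivalence_data K K' F G \<eta> \<eta>i \<epsilon> \<epsilon>i"
 shows "realization C K' (comp_map F U)"
proof -
 interpret r: realization C K U by fact
 interpret b: biequivalence_data K K' F G \<eta> \<eta>i \<epsilon> \<epsilon>i by fact
 interpret b': biequivalence_data K' K G F \<epsilon> \<epsilon>i \<eta> \<eta>i by (rule b.swap)
 have ps: "pseudofunctor C K' (comp_map F U)"
  by (rule pseudofunctor_comp[OF r.U.C.locally_ordered_category_axioms
     r.U.D.locally_ordered_category_axioms b.F.D.locally_ordered_category_axioms
     r.U.pseudo b.F.pseudo])
 have "left_adjoint_in K X Y h"
  if X: "X \<in> Ob K" "Y \<in> Ob K" and h: "h \<in> Hom K X Y"
   and adj: "left_adjoint_in K' (FOb F X) (FOb F Y) (FArr F X Y h)" for X Y h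
 proof -
  obtain k where k: "k \<in> Hom K' (FOb F Y) (FOb F X)"
   "ple K' (FOb F X) (FOb F X) (Ident K' (FOb F X)) (Comp K' (FOb F X) (FOb F Y) (FOb F X) k (FArr F X Y h))"
   "ple K' (FOb F Y) (FOb F Y) (Comp K' (FOb F Y) (FOb F X) (FOb F Y) (FArr F X Y h) k) (Ident K' (FOb F Y))"
   using adj unfolding left_adjoint_in_def by blast
  obtain g where g: "g \<in> Hom K Y X" "pis K' (FOb F Y) (FOb F X) (FArr F Y X g) k"
   using b.full[OF X(2,1) k(1)] by blast
  have Fh: "FArr F X Y h \<in> Hom K' (FOb F X) (FOb F Y)" using X h by simp
  show ?thesis
  proof (rule r.U.D.left_adjoint_inI[OF h g(1)])
   have "pis K' (FOb F X) (FOb F X) (FArr F X X (Ident K X)) (Ident K' (FOb F X))"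
    by (rule b.F.ident[OF X(1)])
   also note k(2)
   also have "pis K' (FOb F X) (FOb F X) (Comp K' (FOb F X) (FOb F Y) (FOb F X) k (FArr F X Y h))
     (Comp K' (FOb F X) (FOb F Y) (FOb F X) (FArr F Y X g) (FArr F X Y h))"
    by (rule b.F.D.pis_comp_left[OF pis_sym[OF g(2)] b.F.ob[OF X(1)] Fh])
   also have "pis K' (FOb F X) (FOb F X) \<dots> (FArr F X X (Comp K X Y X g h))"
    by (rule b.F.comp_sym[OF X X(1) h g(1)])
   finally show "ple K X X (Ident K X) (Comp K X Y X g h)"
    using X h g by (intro b.reflects) auto
   have "pis K' (FOb F Y) (FOb F Y) (FArr F Y Y (Comp K Y X Y h g))
     (Comp K' (FOb F Y) (FOb F X) (FOb F Y) (FArr F X Y h) (FArr F Y X g))"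
    by (rule b.F.comp[OF X(2,1,2) g(1) h])
   also have "pis K' (FOb F Y) (FOb F Y) \<dots> (Comp K' (FOb F Y) (FOb F X) (FOb F Y) (FArr F X Y h) k)"
    by (rule b.F.D.pis_comp_right[OF g(2) b.F.ob[OF X(2)] Fh])
   also note k(3)
   also have "pis K' (FOb F Y) (FOb F Y) (Ident K' (FOb F Y)) (FArr F Y Y (Ident K Y))"
    by (rule pis_sym[OF b.F.ident[OF X(2)]])
   finally show "ple K Y Y (Comp K Y X Y h g) (Ident K Y)"
    using X h g by (intro b.reflects) auto
  qed
 qed
 note left_adjoint_reflected = this
 have "\<exists>f\<in>Hom C X Y. pis K' (FOb F (FOb U X)) (FOb F (FOb U Y))
    (FArr F (FOb U X) (FOb U Y) (FArr U X Y f)) h"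
  if X: "X \<in> Ob C" "Y \<in> Ob C" and h: "left_adjoint_in K' (FOb F (FOb U X)) (FOb F (FOb U Y)) h" for X Y h
 proof -
  have "h \<in> Hom K' (FOb F (FOb U X)) (FOb F (FOb U Y))"
   using h by (simp add: left_adjoint_in_def)
  from b.full[OF r.U.ob[OF X(1)] r.U.ob[OF X(2)] this]
  obtain l where l: "l \<in> Hom K (FOb U X) (FOb U Y)"
   "pis K' (FOb F (FOb U X)) (FOb F (FOb U Y)) (FArr F (FOb U X) (FOb U Y) l) h" by blast
  have "left_adjoint_in K (FOb U X) (FOb U Y) l"
   using X l h
   by (intro left_adjoint_reflected) (auto intro: b.F.D.left_adjoint_pis pis_sym)
  from r.lift[OF X this]
  obtain f where f: "f \<in> Hom C X Y" "pis K (FOb U X) (FOb U Y) (FArr U X Y f) l" by blast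
  then show ?thesis using b.F.D.pis_trans[OF b.F.iso[OF f(2)] l(2)] by blast
 qed
 moreover have "ple C X Y f g"
  if "X \<in> Ob C" "Y \<in> Ob C" "f \<in> Hom C X Y" "g \<in> Hom C X Y"
   "ple K' (FOb F (FOb U X)) (FOb F (FOb U Y)) (FArr F (FOb U X) (FOb U Y) (FArr U X Y f))
    (FArr F (FOb U X) (FOb U Y) (FArr U X Y g))" for X Y f g
  using that by (intro r.reflects b.reflects) auto
 moreover have "left_adjoint_in K' (FOb F (FOb U X)) (FOb F (FOb U Y))
   (FArr F (FOb U X) (FOb U Y) (FArr U X Y f))"
  if "X \<in> Ob C" "Y \<in> Ob C" "f \<in> Hom C X Y" for X Y f
  using that by (intro b.F.left_adjoint r.adj) auto
 ultimately have "realizes C K' (comp_map F U)"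
  using ps unfolding realizes_def by simp
 then show ?thesis
  using ps r.U.C.locally_ordered_category_axioms b.F.D.locally_ordered_category_axioms
  by (simp add: realization_def realization_axioms_def psf_def psf_axioms_def)
qed

text \<open>Two realizations in the same \<open>K\<close>, with a chosen object \<open>H X\<close> of the second for every object \<open>X\<close>
 of the first such that both are sent to equivalent objects of \<open>K\<close>.\<close>

locale realization_span = U: realization C K U + V: realization D K V
 for C :: "('o, 'a) locat" and D :: "('p, 'b) locat" and K :: "('k, 'c) locat" and U V +
 fixes H :: "'o => 'p" and e d :: "'o => 'c"
 assumes qC: "quantaloid C" and qD: "quantaloid D" and H [simp]: "X \<in> Ob C ==> H X \<in> Ob D"
  and e: "X \<in> Ob C ==> equiv_pair K (FOb U X) (FOb V (H X)) (e X) (d X)"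
begin

lemma e_in [simp]: "X \<in> Ob C ==> e X \<in> Hom K (FOb U X) (FOb V (H X))"
 by (rule equiv_pairD[OF e])

text \<open>\<open>f'\<close> is the transport of \<open>f\<close> along the chosen equivalences.\<close>

definition square :: "'o => 'o => 'a => 'b => bool" where
 "square X Y f f' \<longleftrightarrow> f' \<in> Hom D (H X) (H Y) \<and>
   pis K (FOb U X) (FOb V (H Y))
    (Comp K (FOb U X) (FOb V (H X)) (FOb V (H Y)) (FArr V (H X) (H Y) f') (e X))
    (Comp K (FOb U X) (FOb U Y) (FOb V (H Y)) (e Y) (FArr U X Y f))"

lemma square_exists:
 assumes X: "X \<in> Ob C" "Y \<in> Ob C" "f \<in> Hom C X Y"
 shows "\<exists>f'. square X Y f f'"
proof -
 note ex = equiv_pairD[OF e[OF X(1)]] and ey = equiv_pairD[OF e[OF X(2)]]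
 let ?h = "Comp K (FOb V (H X)) (FOb U X) (FOb V (H Y))
   (Comp K (FOb U X) (FOb U Y) (FOb V (H Y)) (e Y) (FArr U X Y f)) (d X)"
 have "left_adjoint_in K (FOb V (H X)) (FOb V (H Y)) ?h"
  using X by (intro U.U.D.left_adjoint_comp U.adj U.U.D.equiv_pair_left_adjoint[OF e]
    U.U.D.equiv_pair_left_adjoint[OF equiv_pair_sym[OF e]]) auto
 from V.lift[OF H[OF X(1)] H[OF X(2)] this]
 obtain f' where f': "f' \<in> Hom D (H X) (H Y)"
   "pis K (FOb V (H X)) (FOb V (H Y)) (FArr V (H X) (H Y) f') ?h" by blast
 have "pis K (FOb U X) (FOb V (H Y))
    (Comp K (FOb U X) (FOb V (H X)) (FOb V (H Y)) (FArr V (H X) (H Y) f') (e X))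
    (Comp K (FOb U X) (FOb V (H X)) (FOb V (H Y)) ?h (e X))"
  by (rule U.U.D.pis_comp_left[OF f'(2) ex(1,3)])
 also have "Comp K (FOb U X) (FOb V (H X)) (FOb V (H Y)) ?h (e X)
   = Comp K (FOb U X) (FOb U X) (FOb V (H Y)) (Comp K (FOb U X) (FOb U Y) (FOb V (H Y)) (e Y) (FArr U X Y f))
     (Comp K (FOb U X) (FOb V (H X)) (FOb U X) (d X) (e X))"
  using X ex ey by (simp add: U.U.D.Comp_assoc)
 also have "pis K (FOb U X) (FOb V (H Y)) \<dots> (Comp K (FOb U X) (FOb U X) (FOb V (H Y))
   (Comp K (FOb U X) (FOb U Y) (FOb V (H Y)) (e Y) (FArr U X Y f)) (Ident K (FOb U X)))"
  using X ex ey by (intro U.U.D.pis_comp_right ex(5)) auto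
 also have "\<dots> = Comp K (FOb U X) (FOb U Y) (FOb V (H Y)) (e Y) (FArr U X Y f)"
  using X ex ey by simp
 finally show ?thesis using f' unfolding square_def by blast
qed

lemma square_ple:
 assumes X: "X \<in> Ob C" "Y \<in> Ob C" and f: "f \<in> Hom C X Y" "g \<in> Hom C X Y" and sq: "square X Y f f'" "square X Y g g'"
 shows "ple D (H X) (H Y) f' g' \<longleftrightarrow> ple C X Y f g"
proof -
 have f': "f' \<in> Hom D (H X) (H Y)" "g' \<in> Hom D (H X) (H Y)" using sq by (simp_all add: square_def)
 note ex = equiv_pairD[OF e[OF X(1)]] and ey = equiv_pairD[OF e[OF X(2)]]
 have "ple D (H X) (H Y) f' g' \<longleftrightarrow> ple K (FOb U X) (FOb V (H Y))
    (Comp K (FOb U X) (FOb V (H X)) (FOb V (H Y)) (FArr V (H X) (H Y) f') (e X))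
    (Comp K (FOb U X) (FOb V (H X)) (FOb V (H Y)) (FArr V (H X) (H Y) g') (e X))"
 proof
  assume "ple D (H X) (H Y) f' g'"
  then show "ple K (FOb U X) (FOb V (H Y))
    (Comp K (FOb U X) (FOb V (H X)) (FOb V (H Y)) (FArr V (H X) (H Y) f') (e X))
    (Comp K (FOb U X) (FOb V (H X)) (FOb V (H Y)) (FArr V (H X) (H Y) g') (e X))"
   by (rule U.U.D.ple_comp_left[OF V.U.mono ex(1,3)])
 qed (rule V.reflects[OF H H f' U.U.D.equiv_pair_cancel_right[OF e[OF X(1)]]], use X f' in auto)
 also have "\<dots> \<longleftrightarrow> ple K (FOb U X) (FOb V (H Y))
    (Comp K (FOb U X) (FOb U Y) (FOb V (H Y)) (e Y) (FArr U X Y f))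
    (Comp K (FOb U X) (FOb U Y) (FOb V (H Y)) (e Y) (FArr U X Y g))"
  using sq U.U.D.ple_trans unfolding square_def pis_def by blast
 also have "\<dots> \<longleftrightarrow> ple C X Y f g"
 proof
  assume "ple C X Y f g"
  then show "ple K (FOb U X) (FOb V (H Y)) (Comp K (FOb U X) (FOb U Y) (FOb V (H Y)) (e Y) (FArr U X Y f))
    (Comp K (FOb U X) (FOb U Y) (FOb V (H Y)) (e Y) (FArr U X Y g))"
   by (rule U.U.D.ple_comp_right[OF U.U.mono ey(2,3)])
 qed (rule U.reflects[OF X f U.U.D.equiv_pair_cancel_left[OF e[OF X(2)]]], use X f in auto)
 finally show ?thesis .
qed

lemma square_comp:
 assumes X: "X \<in> Ob C" "Y \<in> Ob C" "Z \<in> Ob C" and f: "f \<in> Hom C X Y" "g \<in> Hom C Y Z"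
  and sq: "square X Y f f'" "square Y Z g g'"
 shows "square X Z (Comp C X Y Z g f) (Comp D (H X) (H Y) (H Z) g' f')"
proof -
 let ?c = "Comp K"
 have f': "f' \<in> Hom D (H X) (H Y)" "g' \<in> Hom D (H Y) (H Z)" using sq by (simp_all add: square_def)
 have "pis K (FOb U X) (FOb V (H Z))
    (?c (FOb U X) (FOb V (H X)) (FOb V (H Z)) (FArr V (H X) (H Z) (Comp D (H X) (H Y) (H Z) g' f')) (e X))
    (?c (FOb U X) (FOb V (H X)) (FOb V (H Z))
     (?c (FOb V (H X)) (FOb V (H Y)) (FOb V (H Z)) (FArr V (H Y) (H Z) g') (FArr V (H X) (H Y) f')) (e X))"
  using X f' by (intro U.U.D.pis_comp_left V.U.comp) auto
 also have "\<dots> = ?c (FOb U X) (FOb V (H Y)) (FOb V (H Z)) (FArr V (H Y) (H Z) g')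
    (?c (FOb U X) (FOb V (H X)) (FOb V (H Y)) (FArr V (H X) (H Y) f') (e X))"
  using X f' by (simp add: U.U.D.Comp_assoc)
 also have "pis K (FOb U X) (FOb V (H Z)) \<dots> (?c (FOb U X) (FOb V (H Y)) (FOb V (H Z)) (FArr V (H Y) (H Z) g')
    (?c (FOb U X) (FOb U Y) (FOb V (H Y)) (e Y) (FArr U X Y f)))"
  using X f' sq by (intro U.U.D.pis_comp_right) (auto simp: square_def)
 also have "\<dots> = ?c (FOb U X) (FOb U Y) (FOb V (H Z))
    (?c (FOb U Y) (FOb V (H Y)) (FOb V (H Z)) (FArr V (H Y) (H Z) g') (e Y)) (FArr U X Y f)"
  using X f f' by (simp add: U.U.D.Comp_assoc)
 also have "pis K (FOb U X) (FOb V (H Z)) \<dots> (?c (FOb U X) (FOb U Y) (FOb V (H Z))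
    (?c (FOb U Y) (FOb U Z) (FOb V (H Z)) (e Z) (FArr U Y Z g)) (FArr U X Y f))"
  using X f sq by (intro U.U.D.pis_comp_left) (auto simp: square_def)
 also have "\<dots> = ?c (FOb U X) (FOb U Z) (FOb V (H Z)) (e Z)
    (?c (FOb U X) (FOb U Y) (FOb U Z) (FArr U Y Z g) (FArr U X Y f))"
  using X f f' by (simp add: U.U.D.Comp_assoc)
 also have "pis K (FOb U X) (FOb V (H Z)) \<dots> (?c (FOb U X) (FOb U Z) (FOb V (H Z)) (e Z)
    (FArr U X Z (Comp C X Y Z g f)))"
  using X f by (intro U.U.D.pis_comp_right U.U.comp_sym) auto
 finally show ?thesis using X f' unfolding square_def by simp
qed

lemma square_ident:
 assumes X: "X \<in> Ob C"
 shows "square X X (Ident C X) (Ident D (H X))"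
proof -
 note ex = equiv_pairD[OF e[OF X(1)]]
 have "pis K (FOb U X) (FOb V (H X))
    (Comp K (FOb U X) (FOb V (H X)) (FOb V (H X)) (FArr V (H X) (H X) (Ident D (H X))) (e X))
    (Comp K (FOb U X) (FOb V (H X)) (FOb V (H X)) (Ident K (FOb V (H X))) (e X))"
  using X by (intro U.U.D.pis_comp_left V.U.ident) auto
 also have "\<dots> = Comp K (FOb U X) (FOb U X) (FOb V (H X)) (e X) (Ident K (FOb U X))" using ex by simp
 also have "pis K (FOb U X) (FOb V (H X)) \<dots>
    (Comp K (FOb U X) (FOb U X) (FOb V (H X)) (e X) (FArr U X X (Ident C X)))"
  using X by (intro U.U.D.pis_comp_right pis_sym[OF U.U.ident]) auto
 finally show ?thesis using X by (simp add: square_def)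
qed

lemma square_full:
 assumes X: "X \<in> Ob C" "Y \<in> Ob C" and f': "f' \<in> Hom D (H X) (H Y)"
 shows "\<exists>f\<in>Hom C X Y. square X Y f f'"
proof -
 note ex = equiv_pairD[OF e[OF X(1)]] and ey = equiv_pairD[OF e[OF X(2)]]
 let ?k = "Comp K (FOb U X) (FOb V (H X)) (FOb V (H Y)) (FArr V (H X) (H Y) f') (e X)"
 let ?h = "Comp K (FOb U X) (FOb V (H Y)) (FOb U Y) (d Y) ?k"
 have "left_adjoint_in K (FOb U X) (FOb U Y) ?h"
  using X f' by (intro U.U.D.left_adjoint_comp V.adj U.U.D.equiv_pair_left_adjoint[OF e]
    U.U.D.equiv_pair_left_adjoint[OF equiv_pair_sym[OF e]]) auto
 then obtain f where f: "f \<in> Hom C X Y" "pis K (FOb U X) (FOb U Y) (FArr U X Y f) ?h" using U.lift[OF X] by blast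
 have k: "?k \<in> Hom K (FOb U X) (FOb V (H Y))" using X f' ex by simp
 have "pis K (FOb U X) (FOb V (H Y)) (Comp K (FOb U X) (FOb U Y) (FOb V (H Y)) (e Y) (FArr U X Y f))
   (Comp K (FOb U X) (FOb U Y) (FOb V (H Y)) (e Y) ?h)"
  by (rule U.U.D.pis_comp_right[OF f(2) ey(2,3)])
 also have "\<dots> = Comp K (FOb U X) (FOb V (H Y)) (FOb V (H Y)) (Comp K (FOb V (H Y)) (FOb U Y) (FOb V (H Y)) (e Y) (d Y)) ?k"
  by (rule U.U.D.Comp_assoc[symmetric, OF ex(1) ey(2,1,2) k ey(4,3)])
 also have "pis K (FOb U X) (FOb V (H Y)) \<dots> (Comp K (FOb U X) (FOb V (H Y)) (FOb V (H Y)) (Ident K (FOb V (H Y))) ?k)"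
  by (rule U.U.D.pis_comp_left[OF ey(6) ex(1) k])
 also have "\<dots> = ?k" using k X by simp
 finally show ?thesis using f f' unfolding square_def by (blast intro: pis_sym)
qed

definition transport :: "('o, 'a, 'p, 'b) arrow_map" where
 "transport = \<lparr>FOb = H, FArr = (\<lambda>X Y f. SOME f'. square X Y f f')\<rparr>"

lemma transport_simps [simp]: "FOb transport X = H X"
 by (simp add: transport_def)

lemma transport_square: "[|X \<in> Ob C; Y \<in> Ob C; f \<in> Hom C X Y|] ==> square X Y f (FArr transport X Y f)"
 unfolding transport_def by (simp add: someI_ex[OF square_exists])

text \<open>The order of \<open>D\<close> is antisymmetric, so the arrow \<open>f'\<close> is unique; this
 is what makes the transport strictly functorial.\<close>

lemma transport_eq:
 assumes X: "X \<in> Ob C" "Y \<in> Ob C" "f \<in> Hom C X Y" and sq: "square X Y f f'"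
 shows "FArr transport X Y f = f'"
 using square_ple[OF X(1,2,3,3) transport_square[OF X] sq] square_ple[OF X(1,2,3,3) sq transport_square[OF X]]
  U.U.C.ple_refl[OF X] quantaloid.ple_antisym[OF qD] by blast

lemma weak_equivalence_transport:
 assumes VU: "\<And>Y. Y \<in> Ob D ==> \<exists>X\<in>Ob C. \<exists>e d. equiv_pair K (FOb V Y) (FOb U X) e d"
 shows "weak_equivalence C D transport"
proof (rule weak_equivalenceI[OF qC qD])
 show "\<exists>X\<in>Ob C. \<exists>i j. equiv_pair D Y (FOb transport X) i j" if Y: "Y \<in> Ob D" for Y
 proof -
  obtain X e' d' where X: "X \<in> Ob C" "equiv_pair K (FOb V Y) (FOb U X) e' d'" using VU[OF Y] by blast
  show ?thesis using V.lift_equiv_pair[OF Y H[OF X(1)] U.U.D.equiv_pair_comp[OF X(2) e[OF X(1)]]] X(1) by (metis transport_simps)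
 qed
 show "FArr transport X X (Ident C X) = Ident D (FOb transport X)" if "X \<in> Ob C" for X
  using that transport_eq[OF _ _ _ square_ident] by simp
 show "FArr transport X Z (Comp C X Y Z g f)
  = Comp D (FOb transport X) (FOb transport Y) (FOb transport Z) (FArr transport Y Z g) (FArr transport X Y f)"
  if "X \<in> Ob C" "Y \<in> Ob C" "Z \<in> Ob C" "f \<in> Hom C X Y" "g \<in> Hom C Y Z" for X Y Z f g
  using that transport_eq[OF _ _ _ square_comp[OF _ _ _ _ _ transport_square transport_square]] by simp
 show "ple D (FOb transport X) (FOb transport Y) (FArr transport X Y f) (FArr transport X Y g) \<longleftrightarrow> ple C X Y f g"
  if "X \<in> Ob C" "Y \<in> Ob C" "f \<in> Hom C X Y" "g \<in> Hom C X Y" for X Y f g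
  using that square_ple[OF _ _ _ _ transport_square transport_square] by simp
 show "\<exists>f\<in>Hom C X Y. FArr transport X Y f = h" if "X \<in> Ob C" "Y \<in> Ob C" "h \<in> Hom D (FOb transport X) (FOb transport Y)" for X Y h
  using square_full[OF that(1,2), of h] that(3) transport_eq[OF that(1,2)] by (metis transport_simps)
qed (use transport_square in \<open>auto simp: square_def\<close>)

end

lemma same_image_equivalent:
 assumes q: "quantaloid C" "quantaloid D" and U: "realization C K U" and V: "realization D K V"
  and UV: "\<And>X. X \<in> Ob C ==> \<exists>Y\<in>Ob D. \<exists>e d. equiv_pair K (FOb U X) (FOb V Y) e d"
  and VU: "\<And>Y. Y \<in> Ob D ==> \<exists>X\<in>Ob C. \<exists>e d. equiv_pair K (FOb V Y) (FOb U X) e d"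
 shows "quantaloid_equivalent C D"
proof -
 obtain H e d where H: "\<And>X. X \<in> Ob C ==> H X \<in> Ob D \<and> equiv_pair K (FOb U X) (FOb V (H X)) (e X) (d X)"
  using UV by metis
 interpret S: realization_span C D K U V H e d
  using U V H q by (simp add: realization_span_def realization_span_axioms_def)
 show ?thesis by (rule weak_equivalence_equivalent[OF q S.weak_equivalence_transport[OF VU]])
qed

section \<open>The quantaloids of sup-lattices, of homomorphisms and of natural transformations\<close>

abbreviation "SL \<equiv> Sup_quantaloid"

abbreviation "Fun \<equiv> functor_quantaloid"

lemma opq_simps [simp]:
 "Ob (opq Q) = Ob Q" "Hom (opq Q) X Y = Hom Q Y X" "Leq (opq Q) X Y = Leq Q Y X"
 "Comp (opq Q) X Y Z g f = Comp Q Z Y X f g" "Ident (opq Q) = Ident Q"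
 by (simp_all add: opq_def)

lemma homlat_opq [simp]: "homlat (opq Q) X Y = homlat Q Y X"
 by (simp add: homlat_def)

lemma Sup_quantaloid_simps [simp]:
 "Ob (SL :: ('u gorder, 'u => 'u) locat) = {L. complete_lattice L \<and> small TYPE('u) (carrier L)}"
 "Hom SL L M = {f \<in> carrier L \<rightarrow>\<^sub>E carrier M. sup_pres L M f}"
 "Leq SL L M f g \<longleftrightarrow> (\<forall>x\<in>carrier L. le M (f x) (g x))"
 "Comp SL L M N g f = compose (carrier L) g f"
 "Ident SL L = (\<lambda>x\<in>carrier L. x)"
 by (simp_all add: Sup_quantaloid_def)

lemma lub_in_le: "lub_in L A s ==> lub_in L A t ==> le L s t"
 unfolding lub_in_def by blast

text \<open>Suprema of sup-preserving maps are computed pointwise, and then also those of natural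
 transformations; composition preserves them in each variable, which is what makes homomorphisms
 into sup-lattices a quantaloid.\<close>

lemma Sup_lub_pointwise:
 assumes M: "complete_lattice M" and S: "S \<subseteq> Hom SL L M" and s: "s \<in> Hom SL L M"
  and pw: "\<And>x. x \<in> carrier L ==> lub_in M ((\<lambda>f. f x) ` S) (s x)"
 shows "lub_in (homlat SL L M) S s"
proof -
 have "\<forall>x\<in>carrier L. le M (f x) (s x)" if "f \<in> S" for f
  using pw that unfolding lub_in_def by blast
 moreover have "\<forall>x\<in>carrier L. le M (s x) (u x)"
  if u: "u \<in> Hom SL L M" "\<forall>f\<in>S. \<forall>x\<in>carrier L. le M (f x) (u x)" for u
 proof
  fix x assume x: "x \<in> carrier L"
  then have "u x \<in> carrier M" using u by auto
  then show "le M (s x) (u x)" using pw[OF x] u x unfolding lub_in_def by blast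
 qed
 ultimately show ?thesis unfolding lub_in_def using S s by (simp del: Sup_quantaloid_simps(2))
qed

lemma Sup_pointwise_sup_in:
 assumes L: "complete_lattice L" and M: "complete_lattice M" and S: "S \<subseteq> Hom SL L M"
 shows "(\<lambda>x\<in>carrier L. \<Squnion>\<^bsub>M\<^esub> ((\<lambda>f. f x) ` S)) \<in> Hom SL L M"
  and "\<And>x. x \<in> carrier L ==> lub_in M ((\<lambda>f. f x) ` S) (\<Squnion>\<^bsub>M\<^esub> ((\<lambda>f. f x) ` S))"
proof -
 define s where "s = (\<lambda>x\<in>carrier L. \<Squnion>\<^bsub>M\<^esub> ((\<lambda>f. f x) ` S))"
 have fS: "f \<in> carrier L \<rightarrow> carrier M" "sup_pres L M f" if "f \<in> S" for f using S that by auto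
 have img: "(\<lambda>f. f x) ` S \<subseteq> carrier M" if "x \<in> carrier L" for x using that fS by blast
 show lub: "lub_in M ((\<lambda>f. f x) ` S) (\<Squnion>\<^bsub>M\<^esub> ((\<lambda>f. f x) ` S))" if "x \<in> carrier L" for x
  using sup_lub_in[OF M img[OF that]] .
 have s_lub: "lub_in M ((\<lambda>f. f x) ` S) (s x)" if "x \<in> carrier L" for x
  using lub[OF that] that by (simp add: s_def)
 have s_in: "s x \<in> carrier M" if "x \<in> carrier L" for x using s_lub[OF that] by (simp add: lub_in_def)
 have "sup_pres L M s"
 proof (rule sup_presI[OF L M])
  fix A a assume a: "lub_in L A a"
  have A: "A \<subseteq> carrier L" and aL: "a \<in> carrier L" using a by (simp_all add: lub_in_def)
  have fa: "lub_in M (f ` A) (f a)" if "f \<in> S" for f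
   using sup_pres_lub_in[OF fS(2)[OF that] fS(1)[OF that] a] .
  have fs: "le M (f x) (s x)" if "f \<in> S" "x \<in> carrier L" for f x
   using s_lub[OF that(2)] that by (simp add: lub_in_def)
  have least: "le M (s x) u" if "x \<in> carrier L" "u \<in> carrier M" "\<And>f. f \<in> S ==> le M (f x) u" for x u
   using s_lub[OF that(1)] that by (simp add: lub_in_def)
  have "le M (s x) (s a)" if x: "x \<in> A" for x
  proof (rule least)
   show "x \<in> carrier L" using x A by blast
   show "s a \<in> carrier M" by (rule s_in[OF aL])
   fix f assume f: "f \<in> S"
   have "le M (f x) (f a)" using fa[OF f] x by (simp add: lub_in_def)
   moreover note fs[OF f aL]
   ultimately show "le M (f x) (s a)"
    using complete_lattice_trans[OF M, of "f x" "f a" "s a"] funcset_mem[OF fS(1)[OF f]] subsetD[OF A x] aL s_in[OF aL] by simp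
  qed
  moreover have "le M (s a) u" if u: "u \<in> carrier M" "\<forall>y\<in>s ` A. le M y u" for u
  proof (rule least[OF aL u(1)])
   fix f assume f: "f \<in> S"
   have "le M (f x) u" if x: "x \<in> A" for x
   proof -
    have xL: "x \<in> carrier L" using x A by blast
    have "le M (s x) u" using u(2) x by blast
    with fs[OF f xL] show ?thesis
     using complete_lattice_trans[OF M, of "f x" "s x" u] funcset_mem[OF fS(1)[OF f] xL] s_in[OF xL] u(1) by simp
   qed
   then show "le M (f a) u" using fa[OF f] u(1) unfolding lub_in_def by blast
  qed
  ultimately show "lub_in M (s ` A) (s a)"
   using A aL s_in unfolding lub_in_def by blast
 qed
 moreover have "s \<in> carrier L \<rightarrow>\<^sub>E carrier M" using s_in by (auto simp: s_def)
 ultimately show "(\<lambda>x\<in>carrier L. \<Squnion>\<^bsub>M\<^esub> ((\<lambda>f. f x) ` S)) \<in> Hom SL L M"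
  by (simp flip: s_def)
qed

lemma Sup_pointwise_lub:
 assumes L: "complete_lattice L" and M: "complete_lattice M"
  and s: "lub_in (homlat SL L M) S s" and x: "x \<in> carrier L"
 shows "lub_in M ((\<lambda>f. f x) ` S) (s x)"
proof -
 have S: "S \<subseteq> Hom SL L M" and sH: "s \<in> Hom SL L M"
  using s by (simp_all add: lub_in_def)
 let ?t = "\<lambda>x\<in>carrier L. \<Squnion>\<^bsub>M\<^esub> ((\<lambda>f. f x) ` S)"
 note t = Sup_pointwise_sup_in[OF L M S]
 have t_lub: "lub_in (homlat SL L M) S ?t"
  by (rule Sup_lub_pointwise[OF M S t(1)]) (use t(2) in simp)
 have "\<forall>x\<in>carrier L. le M (s x) (?t x)" "\<forall>x\<in>carrier L. le M (?t x) (s x)"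
  using lub_in_le[OF s t_lub] lub_in_le[OF t_lub s] by simp_all
 then have "le M (s x) (?t x)" "le M (?t x) (s x)" using x by blast+
 moreover have "s x \<in> carrier M" "?t x \<in> carrier M" using sH t(1) x by auto
 ultimately have "s x = ?t x" using complete_lattice_antisym[OF M] by metis
 then show ?thesis using t(2)[OF x] x by simp
qed

lemma Sup_comp_in:
 fixes L M N :: "'u gorder"
 assumes "f \<in> Hom SL L M" "g \<in> Hom SL M N"
 shows "compose (carrier L) g f \<in> Hom SL L N"
proof -
 have "sup_pres L N (\<lambda>x. g (f x))" using assms by (intro sup_pres_comp[of L M f N g]) auto
 then have "sup_pres L N (compose (carrier L) g f)" by (rule sup_pres_cong) (simp add: compose_def)
 then show ?thesis using assms by (auto simp: compose_def)
qed

lemma locally_ordered_category_Sup: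
 "locally_ordered_category (SL :: ('u gorder, 'u => 'u) locat)"
proof
  fix X :: "'u gorder" assume X: "X \<in> Ob SL"
  have "sup_pres X X (\<lambda>x\<in>carrier X. x)"
   using X by (intro sup_presI) (auto simp: lub_in_def subset_iff)
  then show "Ident SL X \<in> Hom SL X X" by auto
 next
  fix X Y Z :: "'u gorder" and f g
  assume "f \<in> Hom SL X Y" "g \<in> Hom SL Y Z"
  then show "Comp SL X Y Z g f \<in> Hom SL X Z"
   using Sup_comp_in by (simp del: Sup_quantaloid_simps(2))
 next
  fix X Y :: "'u gorder" and f assume "f \<in> Hom SL X Y"
  then have "f \<in> carrier X \<rightarrow>\<^sub>E carrier Y" by simp
  then show "Comp SL X X Y f (Ident SL X) = f"
    and "Comp SL X Y Y (Ident SL Y) f = f"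
   by (auto simp: compose_def fun_eq_iff PiE_iff extensional_def)
 next
  fix W X Y Z :: "'u gorder" and f g h
  assume "f \<in> Hom SL W X"
  then have "f \<in> carrier W \<rightarrow> carrier X" by auto
  then show "Comp SL W X Z (Comp SL X Y Z h g) f
    = Comp SL W Y Z h (Comp SL W X Y g f)"
   by (auto simp: compose_def fun_eq_iff)
 next
  fix X Y :: "'u gorder" and f
  assume "Y \<in> Ob SL" "f \<in> Hom SL X Y"
  then show "Leq SL X Y f f" by (auto intro!: complete_lattice_refl)
 next
  fix X Y :: "'u gorder" and f g h
  assume Y: "Y \<in> Ob SL" and fgh: "f \<in> Hom SL X Y" "g \<in> Hom SL X Y"
   "h \<in> Hom SL X Y" and le: "Leq SL X Y f g" "Leq SL X Y g h"
  have "le Y (f x) (h x)" if x: "x \<in> carrier X" for x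
  proof -
   have "f x \<in> carrier Y" "g x \<in> carrier Y" "h x \<in> carrier Y" using fgh x by auto
   then show ?thesis using complete_lattice_trans[of Y "f x" "g x" "h x"] Y le x by simp
  qed
  then show "Leq SL X Y f h" by simp
 next
  fix X Y Z :: "'u gorder" and f f' g g'
  assume Z: "Z \<in> Ob SL" and f: "f \<in> Hom SL X Y" "f' \<in> Hom SL X Y"
   and g: "g \<in> Hom SL Y Z" "g' \<in> Hom SL Y Z"
   and le: "Leq SL X Y f f'" "Leq SL Y Z g g'"
  have "le Z (g (f x)) (g' (f' x))" if x: "x \<in> carrier X" for x
  proof -
   have "f x \<in> carrier Y" "f' x \<in> carrier Y" using f x by auto
   then have "le Z (g (f x)) (g (f' x))" "le Z (g (f' x)) (g' (f' x))"
    "g (f x) \<in> carrier Z" "g (f' x) \<in> carrier Z" "g' (f' x) \<in> carrier Z"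
    using g le x sup_pres_mono[of Y Z g "f x" "f' x"] by auto
   then show ?thesis
    using Z complete_lattice_trans[of Z "g (f x)" "g (f' x)" "g' (f' x)"] by simp
  qed
  then show "Leq SL X Z (Comp SL X Y Z g f) (Comp SL X Y Z g' f')"
   by (simp add: compose_def)
qed

lemma Sup_hom_complete:
 fixes X Y :: "'u gorder"
 assumes XY: "complete_lattice X" "complete_lattice Y"
 shows "complete_lattice (homlat SL X Y)"
  proof (rule complete_lattice_of_lubs)
   fix f assume f: "f \<in> carrier (homlat SL X Y)"
   have "le Y (f x) (f x)" if "x \<in> carrier X" for x
    using f that by (intro complete_lattice_refl[OF XY(2)]) auto
   then show "le (homlat SL X Y) f f" by simp
  next
   fix f g assume fg: "f \<in> carrier (homlat SL X Y)" "g \<in> carrier (homlat SL X Y)"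
    "le (homlat SL X Y) f g" "le (homlat SL X Y) g f"
   then have f: "f \<in> carrier X \<rightarrow>\<^sub>E carrier Y" "g \<in> carrier X \<rightarrow>\<^sub>E carrier Y" by simp_all
   have "f x = g x" if "x \<in> carrier X" for x
    using fg f that by (intro complete_lattice_antisym[OF XY(2)]) auto
   then show "f = g" using f by (intro PiE_ext)
  next
   fix f g h assume fgh: "f \<in> carrier (homlat SL X Y)" "g \<in> carrier (homlat SL X Y)"
    "h \<in> carrier (homlat SL X Y)"
    "le (homlat SL X Y) f g" "le (homlat SL X Y) g h"
   have "le Y (f x) (h x)" if x: "x \<in> carrier X" for x
   proof -
    have "f x \<in> carrier Y" "g x \<in> carrier Y" "h x \<in> carrier Y" using fgh x by auto
    then show ?thesis using complete_lattice_trans[OF XY(2), of "f x" "g x" "h x"] fgh x by simp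
   qed
   then show "le (homlat SL X Y) f h" by simp
  next
   fix S assume "S \<subseteq> carrier (homlat SL X Y)"
   then have S: "S \<subseteq> Hom SL X Y" by (simp del: Sup_quantaloid_simps)
   note s = Sup_pointwise_sup_in[OF XY S]
   have "lub_in (homlat SL X Y) S (\<lambda>x\<in>carrier X. \<Squnion>\<^bsub>Y\<^esub> ((\<lambda>f. f x) ` S))"
    by (rule Sup_lub_pointwise[OF XY(2) S s(1)]) (use s(2) in simp)
   then show "\<exists>s. lub_in (homlat SL X Y) S s" by blast
  qed simp

lemma quantaloid_Sup: "quantaloid (SL :: ('u gorder, 'u => 'u) locat)"
proof (intro quantaloid.intro[OF locally_ordered_category_Sup] quantaloid_axioms.intro)
 fix X Y :: "'u gorder" assume "X \<in> Ob SL" "Y \<in> Ob SL"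
 then show "complete_lattice (homlat SL X Y)" by (intro Sup_hom_complete) simp_all
next
 fix X Y Z :: "'u gorder" and g
 assume ob: "X \<in> Ob SL" "Y \<in> Ob SL" "Z \<in> Ob SL"
  and g: "g \<in> Hom SL Y Z"
 then have XYZ: "complete_lattice X" "complete_lattice Y" "complete_lattice Z" by simp_all
 show "sup_pres (homlat SL X Y) (homlat SL X Z) (\<lambda>f. Comp SL X Y Z g f)"
 proof (rule sup_presI[OF Sup_hom_complete[OF XYZ(1,2)] Sup_hom_complete[OF XYZ(1,3)]])
  fix S s assume s: "lub_in (homlat SL X Y) S s"
  then have S: "S \<subseteq> Hom SL X Y" "s \<in> Hom SL X Y" by (simp_all add: lub_in_def)
  show "lub_in (homlat SL X Z) ((\<lambda>f. Comp SL X Y Z g f) ` S) (Comp SL X Y Z g s)"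
  proof (rule Sup_lub_pointwise[OF XYZ(3)])
   fix x assume x: "x \<in> carrier X"
   have "lub_in Z (g ` ((\<lambda>f. f x) ` S)) (g (s x))"
    using g by (intro sup_pres_lub_in[OF _ _ Sup_pointwise_lub[OF XYZ(1,2) s x]]) auto
   then show "lub_in Z ((\<lambda>f. f x) ` (\<lambda>f. Comp SL X Y Z g f) ` S) (Comp SL X Y Z g s x)"
    using x by (simp add: image_image compose_def)
  qed (use Sup_comp_in[OF _ g] S in \<open>auto simp del: Sup_quantaloid_simps(2)\<close>)
 qed
next
 fix X Y Z :: "'u gorder" and f
 assume ob: "X \<in> Ob SL" "Y \<in> Ob SL" "Z \<in> Ob SL"
  and f: "f \<in> Hom SL X Y"
 then have XYZ: "complete_lattice X" "complete_lattice Y" "complete_lattice Z" by simp_all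
 show "sup_pres (homlat SL Y Z) (homlat SL X Z) (\<lambda>g. Comp SL X Y Z g f)"
 proof (rule sup_presI[OF Sup_hom_complete[OF XYZ(2,3)] Sup_hom_complete[OF XYZ(1,3)]])
  fix S s assume s: "lub_in (homlat SL Y Z) S s"
  then have S: "S \<subseteq> Hom SL Y Z" "s \<in> Hom SL Y Z" by (simp_all add: lub_in_def)
  show "lub_in (homlat SL X Z) ((\<lambda>g. Comp SL X Y Z g f) ` S) (Comp SL X Y Z s f)"
  proof (rule Sup_lub_pointwise[OF XYZ(3)])
   fix x assume x: "x \<in> carrier X"
   then have "f x \<in> carrier Y" using f by auto
   from Sup_pointwise_lub[OF XYZ(2,3) s this]
   show "lub_in Z ((\<lambda>g. g x) ` (\<lambda>g. Comp SL X Y Z g f) ` S) (Comp SL X Y Z s f x)"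
    using x by (simp add: image_image compose_def)
  qed (use Sup_comp_in[OF f] S in \<open>auto simp del: Sup_quantaloid_simps(2)\<close>)
 qed
qed

lemma functor_quantaloid_simps [simp]:
 "Ob (Fun Q R) = {F. homomorphism Q R F}"
 "Hom (Fun Q R) = nat_trans Q R"
 "Leq (Fun Q R) F G \<alpha> \<beta> \<longleftrightarrow> (\<forall>X\<in>Ob Q. Leq R (FOb F X) (FOb G X) (\<alpha> X) (\<beta> X))"
 "Comp (Fun Q R) F G H \<beta> \<alpha> = (\<lambda>X\<in>Ob Q. Comp R (FOb F X) (FOb G X) (FOb H X) (\<beta> X) (\<alpha> X))"
 "Ident (Fun Q R) F = (\<lambda>X\<in>Ob Q. Ident R (FOb F X))"
 by (simp_all add: functor_quantaloid_def)

lemma nat_transD: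
 assumes "\<alpha> \<in> nat_trans Q R F G"
 shows "X \<in> Ob Q ==> \<alpha> X \<in> Hom R (FOb F X) (FOb G X)"
  "[|X \<in> Ob Q; Y \<in> Ob Q; f \<in> Hom Q X Y|] ==>
   Comp R (FOb F X) (FOb F Y) (FOb G Y) (\<alpha> Y) (FArr F X Y f)
      = Comp R (FOb F X) (FOb G X) (FOb G Y) (FArr G X Y f) (\<alpha> X)"
  "\<alpha> \<in> extensional (Ob Q)"
 using assms by (auto simp: nat_trans_def PiE_def)

lemma nat_transI:
 assumes "\<alpha> \<in> extensional (Ob Q)" "\<And>X. X \<in> Ob Q ==> \<alpha> X \<in> Hom R (FOb F X) (FOb G X)"
  "\<And>X Y f. [|X \<in> Ob Q; Y \<in> Ob Q; f \<in> Hom Q X Y|] ==>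
   Comp R (FOb F X) (FOb F Y) (FOb G Y) (\<alpha> Y) (FArr F X Y f)
      = Comp R (FOb F X) (FOb G X) (FOb G Y) (FArr G X Y f) (\<alpha> X)"
 shows "\<alpha> \<in> nat_trans Q R F G"
 using assms by (simp add: nat_trans_def PiE_def Pi_iff)

lemma nat_trans_eqI:
 assumes "\<alpha> \<in> nat_trans Q R F G" "\<beta> \<in> nat_trans Q R F' G'" "\<And>X. X \<in> Ob Q ==> \<alpha> X = \<beta> X"
 shows "\<alpha> = \<beta>"
 by (rule extensionalityI[OF nat_transD(3)[OF assms(1)] nat_transD(3)[OF assms(2)] assms(3)])

context quantaloid
begin

context
 fixes P :: "('p, 'b) locat" and F G :: "('p, 'b, 'o, 'a) arrow_map"
 assumes F: "homomorphism P Q F" and G: "homomorphism P Q G"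
begin

lemma nat_trans_lub_pointwise:
 assumes S: "S \<subseteq> nat_trans P Q F G" and s: "s \<in> nat_trans P Q F G"
  and pw: "\<And>X. X \<in> Ob P ==> lub_in (homlat Q (FOb F X) (FOb G X)) ((\<lambda>\<alpha>. \<alpha> X) ` S) (s X)"
 shows "lub_in (homlat (Fun P Q) F G) S s"
proof -
 have "\<forall>X\<in>Ob P. Leq Q (FOb F X) (FOb G X) (\<alpha> X) (s X)" if "\<alpha> \<in> S" for \<alpha>
  using pw that unfolding lub_in_def by auto
 moreover have "\<forall>X\<in>Ob P. Leq Q (FOb F X) (FOb G X) (s X) (u X)"
  if u: "u \<in> nat_trans P Q F G" "\<forall>\<alpha>\<in>S. \<forall>X\<in>Ob P. Leq Q (FOb F X) (FOb G X) (\<alpha> X) (u X)" for u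
  using pw u nat_transD(1)[OF u(1)] unfolding lub_in_def by auto
 ultimately show ?thesis unfolding lub_in_def using S s by simp
qed

lemma nat_trans_sup:
 assumes S: "S \<subseteq> nat_trans P Q F G"
 shows "(\<lambda>X\<in>Ob P. hsup Q (FOb F X) (FOb G X) ((\<lambda>\<alpha>. \<alpha> X) ` S)) \<in> nat_trans P Q F G"
proof (rule nat_transI)
 have img: "(\<lambda>\<alpha>. \<alpha> X) ` S \<subseteq> Hom Q (FOb F X) (FOb G X)" if "X \<in> Ob P" for X
  using S nat_transD(1)[OF _ that] by blast
 let ?s = "\<lambda>X\<in>Ob P. hsup Q (FOb F X) (FOb G X) ((\<lambda>\<alpha>. \<alpha> X) ` S)"
 note obs = homomorphismD(1,2)[OF F] homomorphismD(1,2)[OF G]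
 show "?s X \<in> Hom Q (FOb F X) (FOb G X)" if "X \<in> Ob P" for X
  using that img obs by simp
 fix X Y f assume X: "X \<in> Ob P" "Y \<in> Ob P" and f: "f \<in> Hom P X Y"
 have "Comp Q (FOb F X) (FOb F Y) (FOb G Y) (?s Y) (FArr F X Y f)
  = hsup Q (FOb F X) (FOb G Y) ((\<lambda>\<alpha>. Comp Q (FOb F X) (FOb F Y) (FOb G Y) (\<alpha> Y) (FArr F X Y f)) ` S)"
  using X f obs img by (simp add: comp_hsup_left image_image)
 also have "(\<lambda>\<alpha>. Comp Q (FOb F X) (FOb F Y) (FOb G Y) (\<alpha> Y) (FArr F X Y f)) ` S
  = (\<lambda>\<alpha>. Comp Q (FOb F X) (FOb G X) (FOb G Y) (FArr G X Y f) (\<alpha> X)) ` S"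
  using nat_transD(2)[of _ P Q F G, OF _ X f] S by (intro image_cong) auto
 also have "hsup Q (FOb F X) (FOb G Y) \<dots> = Comp Q (FOb F X) (FOb G X) (FOb G Y) (FArr G X Y f) (?s X)"
  using X f obs img by (simp add: comp_hsup_right image_image)
 finally show "Comp Q (FOb F X) (FOb F Y) (FOb G Y) (?s Y) (FArr F X Y f)
  = Comp Q (FOb F X) (FOb G X) (FOb G Y) (FArr G X Y f) (?s X)" .
qed simp

lemma nat_trans_sup_lub:
 assumes S: "S \<subseteq> nat_trans P Q F G"
 shows "lub_in (homlat (Fun P Q) F G) S (\<lambda>X\<in>Ob P. hsup Q (FOb F X) (FOb G X) ((\<lambda>\<alpha>. \<alpha> X) ` S))"
proof (rule nat_trans_lub_pointwise[OF S nat_trans_sup[OF S]])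
 fix X assume X: "X \<in> Ob P"
 have "(\<lambda>\<alpha>. \<alpha> X) ` S \<subseteq> Hom Q (FOb F X) (FOb G X)" using S nat_transD(1)[OF _ X] by blast
 then show "lub_in (homlat Q (FOb F X) (FOb G X)) ((\<lambda>\<alpha>. \<alpha> X) ` S)
   ((\<lambda>X\<in>Ob P. hsup Q (FOb F X) (FOb G X) ((\<lambda>\<alpha>. \<alpha> X) ` S)) X)"
  using X homomorphismD(1)[OF F] homomorphismD(1)[OF G] by (simp add: hsup_lub)
qed

lemma nat_trans_complete: "complete_lattice (homlat (Fun P Q) F G)"
proof (rule complete_lattice_of_lubs)
 note obs = homomorphismD(1)[OF F] homomorphismD(1)[OF G]
 show "le (homlat (Fun P Q) F G) \<alpha> \<alpha>" if "\<alpha> \<in> carrier (homlat (Fun P Q) F G)" for \<alpha>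
  using that nat_transD(1)[of \<alpha> P Q F G] obs by (auto intro: Leq_refl)
 show "\<alpha> = \<beta>" if "\<alpha> \<in> carrier (homlat (Fun P Q) F G)" "\<beta> \<in> carrier (homlat (Fun P Q) F G)"
  "le (homlat (Fun P Q) F G) \<alpha> \<beta>" "le (homlat (Fun P Q) F G) \<beta> \<alpha>" for \<alpha> \<beta>
 proof (rule nat_trans_eqI)
  show ab: "\<alpha> \<in> nat_trans P Q F G" "\<beta> \<in> nat_trans P Q F G" using that by simp_all
  show "\<alpha> X = \<beta> X" if X: "X \<in> Ob P" for X
   using ab nat_transD(1) X obs \<open>le _ \<alpha> \<beta>\<close> \<open>le _ \<beta> \<alpha>\<close>
   by (intro ple_antisym[of "FOb F X" "FOb G X"]) (auto simp: ple_def)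
 qed
 show "le (homlat (Fun P Q) F G) \<alpha> \<gamma>"
  if "\<alpha> \<in> carrier (homlat (Fun P Q) F G)" "\<beta> \<in> carrier (homlat (Fun P Q) F G)"
   "\<gamma> \<in> carrier (homlat (Fun P Q) F G)"
  "le (homlat (Fun P Q) F G) \<alpha> \<beta>" "le (homlat (Fun P Q) F G) \<beta> \<gamma>" for \<alpha> \<beta> \<gamma>
 proof -
  have "Leq Q (FOb F X) (FOb G X) (\<alpha> X) (\<gamma> X)" if X: "X \<in> Ob P" for X
  proof (rule Leq_trans[OF obs(1)[OF X] obs(2)[OF X]])
   show "\<alpha> X \<in> Hom Q (FOb F X) (FOb G X)" "\<beta> X \<in> Hom Q (FOb F X) (FOb G X)"
    "\<gamma> X \<in> Hom Q (FOb F X) (FOb G X)"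
    using \<open>\<alpha> \<in> _\<close> \<open>\<beta> \<in> _\<close> \<open>\<gamma> \<in> _\<close> nat_transD(1)[of _ P Q F G X] X by simp_all
   show "Leq Q (FOb F X) (FOb G X) (\<alpha> X) (\<beta> X)" "Leq Q (FOb F X) (FOb G X) (\<beta> X) (\<gamma> X)"
    using \<open>le _ \<alpha> \<beta>\<close> \<open>le _ \<beta> \<gamma>\<close> X by simp_all
  qed
  then show ?thesis by simp
 qed
 show "\<exists>s. lub_in (homlat (Fun P Q) F G) S s" if "S \<subseteq> carrier (homlat (Fun P Q) F G)" for S
  using nat_trans_sup_lub that by auto
qed simp

lemma nat_trans_pointwise_lub:
 assumes s: "lub_in (homlat (Fun P Q) F G) S s" and X: "X \<in> Ob P"
 shows "lub_in (homlat Q (FOb F X) (FOb G X)) ((\<lambda>\<alpha>. \<alpha> X) ` S) (s X)"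
proof -
 have S: "S \<subseteq> nat_trans P Q F G" using s by (simp add: lub_in_def)
 have "s = (\<lambda>X\<in>Ob P. hsup Q (FOb F X) (FOb G X) ((\<lambda>\<alpha>. \<alpha> X) ` S))"
  using lub_in_eq_sup[OF nat_trans_complete s] lub_in_eq_sup[OF nat_trans_complete nat_trans_sup_lub[OF S]] by simp
 moreover have "(\<lambda>\<alpha>. \<alpha> X) ` S \<subseteq> Hom Q (FOb F X) (FOb G X)" using S nat_transD(1)[OF _ X] by blast
 ultimately show ?thesis
  using X homomorphismD(1)[OF F] homomorphismD(1)[OF G] by (simp add: hsup_lub)
qed

end

lemma nat_trans_comp:
 assumes F: "homomorphism P Q F" and G: "homomorphism P Q G" and H: "homomorphism P Q H"
  and \<alpha>: "\<alpha> \<in> nat_trans P Q F G" and \<beta>: "\<beta> \<in> nat_trans P Q G H"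
 shows "(\<lambda>X\<in>Ob P. Comp Q (FOb F X) (FOb G X) (FOb H X) (\<beta> X) (\<alpha> X)) \<in> nat_trans P Q F H"
proof (rule nat_transI)
 note obs = homomorphismD(1,2)[OF F] homomorphismD(1,2)[OF G] homomorphismD(1,2)[OF H]
 note a = nat_transD(1)[OF \<alpha>] and b = nat_transD(1)[OF \<beta>]
 let ?c = "\<lambda>X\<in>Ob P. Comp Q (FOb F X) (FOb G X) (FOb H X) (\<beta> X) (\<alpha> X)"
 show "?c X \<in> Hom Q (FOb F X) (FOb H X)" if "X \<in> Ob P" for X
  using that obs a b by simp
 fix X Y f assume X: "X \<in> Ob P" "Y \<in> Ob P" and f: "f \<in> Hom P X Y"
 have "Comp Q (FOb F X) (FOb F Y) (FOb H Y) (?c Y) (FArr F X Y f)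
  = Comp Q (FOb F X) (FOb G Y) (FOb H Y) (\<beta> Y) (Comp Q (FOb F X) (FOb F Y) (FOb G Y) (\<alpha> Y) (FArr F X Y f))"
  using X f obs a b by (simp add: Comp_assoc)
 also have "\<dots> = Comp Q (FOb F X) (FOb G X) (FOb H Y) (Comp Q (FOb G X) (FOb G Y) (FOb H Y) (\<beta> Y) (FArr G X Y f)) (\<alpha> X)"
  using X f obs a b by (simp add: Comp_assoc nat_transD(2)[OF \<alpha> X f])
 also have "\<dots> = Comp Q (FOb F X) (FOb H X) (FOb H Y) (FArr H X Y f) (?c X)"
  using X f obs a b by (simp add: Comp_assoc nat_transD(2)[OF \<beta> X f])
 finally show "Comp Q (FOb F X) (FOb F Y) (FOb H Y) (?c Y) (FArr F X Y f)
  = Comp Q (FOb F X) (FOb H X) (FOb H Y) (FArr H X Y f) (?c X)" .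
qed simp

lemma locally_ordered_category_functors: "locally_ordered_category (Fun P Q)"
proof
 note hD = homomorphismD
 fix F assume "F \<in> Ob (Fun P Q)"
 then have F: "homomorphism P Q F" by simp
 show "Ident (Fun P Q) F \<in> Hom (Fun P Q) F F"
  using hD(1,2)[OF F] by (auto intro!: nat_transI)
next
 fix F G H \<alpha> \<beta>
 assume "F \<in> Ob (Fun P Q)" "G \<in> Ob (Fun P Q)" "H \<in> Ob (Fun P Q)"
  "\<alpha> \<in> Hom (Fun P Q) F G" "\<beta> \<in> Hom (Fun P Q) G H"
 then show "Comp (Fun P Q) F G H \<beta> \<alpha> \<in> Hom (Fun P Q) F H"
  by (simp add: nat_trans_comp)
next
 fix F G \<alpha> assume "F \<in> Ob (Fun P Q)" "G \<in> Ob (Fun P Q)"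
  "\<alpha> \<in> Hom (Fun P Q) F G"
 then have F: "homomorphism P Q F" and G: "homomorphism P Q G" and a: "\<alpha> \<in> nat_trans P Q F G" by simp_all
 show "Comp (Fun P Q) F F G \<alpha> (Ident (Fun P Q) F) = \<alpha>"
  and "Comp (Fun P Q) F G G (Ident (Fun P Q) G) \<alpha> = \<alpha>"
  using homomorphismD(1)[OF F] homomorphismD(1)[OF G] nat_transD(1,3)[OF a]
  by (auto intro!: extensionalityI[of _ "Ob P"])
next
 fix F G H K \<alpha> \<beta> \<gamma>
 assume ob: "F \<in> Ob (Fun P Q)" "G \<in> Ob (Fun P Q)" "H \<in> Ob (Fun P Q)"
  "K \<in> Ob (Fun P Q)" and a: "\<alpha> \<in> Hom (Fun P Q) F G"
  and b: "\<beta> \<in> Hom (Fun P Q) G H" and c: "\<gamma> \<in> Hom (Fun P Q) H K"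
 then show "Comp (Fun P Q) F G K (Comp (Fun P Q) G H K \<gamma> \<beta>) \<alpha>
  = Comp (Fun P Q) F H K \<gamma> (Comp (Fun P Q) F G H \<beta> \<alpha>)"
  using homomorphismD(1) nat_transD(1)
  by (auto intro!: extensionalityI[of _ "Ob P"] simp: Comp_assoc[OF homomorphismD(1) homomorphismD(1) homomorphismD(1) homomorphismD(1) nat_transD(1) nat_transD(1) nat_transD(1)])
next
 fix F G \<alpha> assume "F \<in> Ob (Fun P Q)" "G \<in> Ob (Fun P Q)"
  "\<alpha> \<in> Hom (Fun P Q) F G"
 then show "Leq (Fun P Q) F G \<alpha> \<alpha>"
  using complete_lattice_refl[OF nat_trans_complete, of P F G \<alpha>] by simp
next
 fix F G \<alpha> \<beta> \<gamma> assume "F \<in> Ob (Fun P Q)" "G \<in> Ob (Fun P Q)"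
  "\<alpha> \<in> Hom (Fun P Q) F G" "\<beta> \<in> Hom (Fun P Q) F G" "\<gamma> \<in> Hom (Fun P Q) F G"
  "Leq (Fun P Q) F G \<alpha> \<beta>" "Leq (Fun P Q) F G \<beta> \<gamma>"
 then show "Leq (Fun P Q) F G \<alpha> \<gamma>"
  using complete_lattice_trans[OF nat_trans_complete, of P F G \<alpha> \<beta> \<gamma>] by simp
next
 fix F G H \<alpha> \<alpha>' \<beta> \<beta>'
 assume ob: "F \<in> Ob (Fun P Q)" "G \<in> Ob (Fun P Q)" "H \<in> Ob (Fun P Q)"
  and a: "\<alpha> \<in> Hom (Fun P Q) F G" "\<alpha>' \<in> Hom (Fun P Q) F G"
  and b: "\<beta> \<in> Hom (Fun P Q) G H" "\<beta>' \<in> Hom (Fun P Q) G H"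
  and le: "Leq (Fun P Q) F G \<alpha> \<alpha>'" "Leq (Fun P Q) G H \<beta> \<beta>'"
 have F: "homomorphism P Q F" "homomorphism P Q G" "homomorphism P Q H" using ob by simp_all
 have ab: "\<alpha> \<in> nat_trans P Q F G" "\<alpha>' \<in> nat_trans P Q F G" "\<beta> \<in> nat_trans P Q G H" "\<beta>' \<in> nat_trans P Q G H"
  using a b by simp_all
 show "Leq (Fun P Q) F H (Comp (Fun P Q) F G H \<beta> \<alpha>)
  (Comp (Fun P Q) F G H \<beta>' \<alpha>')"
  using le homomorphismD(1)[OF F(1)] homomorphismD(1)[OF F(2)] homomorphismD(1)[OF F(3)]
   nat_transD(1)[OF ab(1)] nat_transD(1)[OF ab(2)] nat_transD(1)[OF ab(3)] nat_transD(1)[OF ab(4)]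
  by (auto intro!: Comp_mono)
qed

lemma quantaloid_functors: "quantaloid (Fun P Q)"
proof (intro quantaloid.intro[OF locally_ordered_category_functors] quantaloid_axioms.intro)
 fix F G assume "F \<in> Ob (Fun P Q)" "G \<in> Ob (Fun P Q)"
 then show "complete_lattice (homlat (Fun P Q) F G)" by (simp add: nat_trans_complete)
next
 fix F G H \<beta>
 assume ob: "F \<in> Ob (Fun P Q)" "G \<in> Ob (Fun P Q)" "H \<in> Ob (Fun P Q)"
  and b: "\<beta> \<in> Hom (Fun P Q) G H"
 have F: "homomorphism P Q F" "homomorphism P Q G" "homomorphism P Q H" using ob by simp_all
 have \<beta>: "\<beta> \<in> nat_trans P Q G H" using b by simp
 show "sup_pres (homlat (Fun P Q) F G) (homlat (Fun P Q) F H)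
   (\<lambda>\<alpha>. Comp (Fun P Q) F G H \<beta> \<alpha>)"
 proof (rule sup_presI[OF nat_trans_complete[OF F(1,2)] nat_trans_complete[OF F(1,3)]])
  fix S s assume s: "lub_in (homlat (Fun P Q) F G) S s"
  then have S: "S \<subseteq> nat_trans P Q F G" "s \<in> nat_trans P Q F G" by (simp_all add: lub_in_def)
  show "lub_in (homlat (Fun P Q) F H) ((\<lambda>\<alpha>. Comp (Fun P Q) F G H \<beta> \<alpha>) ` S)
   (Comp (Fun P Q) F G H \<beta> s)"
  proof (rule nat_trans_lub_pointwise[OF F(1,3)])
   fix X assume X: "X \<in> Ob P"
   have "lub_in (homlat Q (FOb F X) (FOb H X)) (Comp Q (FOb F X) (FOb G X) (FOb H X) (\<beta> X) ` ((\<lambda>\<alpha>. \<alpha> X) ` S))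
    (Comp Q (FOb F X) (FOb G X) (FOb H X) (\<beta> X) (s X))"
    using X homomorphismD(1)[OF F(1)] homomorphismD(1)[OF F(2)] homomorphismD(1)[OF F(3)] nat_transD(1)[OF \<beta> X]
    by (intro sup_pres_lub_in[OF Comp_sup_right _ nat_trans_pointwise_lub[OF F(1,2) s X]]) auto
   then show "lub_in (homlat Q (FOb F X) (FOb H X))
     ((\<lambda>\<alpha>. \<alpha> X) ` (\<lambda>\<alpha>. Comp (Fun P Q) F G H \<beta> \<alpha>) ` S) (Comp (Fun P Q) F G H \<beta> s X)"
    using X by (simp add: image_image)
  qed (use nat_trans_comp[OF F _ \<beta>] S in auto)
 qed
next
 fix F G H \<alpha>
 assume ob: "F \<in> Ob (Fun P Q)" "G \<in> Ob (Fun P Q)" "H \<in> Ob (Fun P Q)"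
  and a: "\<alpha> \<in> Hom (Fun P Q) F G"
 have F: "homomorphism P Q F" "homomorphism P Q G" "homomorphism P Q H" using ob by simp_all
 have \<alpha>: "\<alpha> \<in> nat_trans P Q F G" using a by simp
 show "sup_pres (homlat (Fun P Q) G H) (homlat (Fun P Q) F H)
   (\<lambda>\<beta>. Comp (Fun P Q) F G H \<beta> \<alpha>)"
 proof (rule sup_presI[OF nat_trans_complete[OF F(2,3)] nat_trans_complete[OF F(1,3)]])
  fix S s assume s: "lub_in (homlat (Fun P Q) G H) S s"
  then have S: "S \<subseteq> nat_trans P Q G H" "s \<in> nat_trans P Q G H" by (simp_all add: lub_in_def)
  show "lub_in (homlat (Fun P Q) F H) ((\<lambda>\<beta>. Comp (Fun P Q) F G H \<beta> \<alpha>) ` S)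
   (Comp (Fun P Q) F G H s \<alpha>)"
  proof (rule nat_trans_lub_pointwise[OF F(1,3)])
   fix X assume X: "X \<in> Ob P"
   have "lub_in (homlat Q (FOb F X) (FOb H X)) ((\<lambda>g. Comp Q (FOb F X) (FOb G X) (FOb H X) g (\<alpha> X)) ` ((\<lambda>\<alpha>. \<alpha> X) ` S))
    (Comp Q (FOb F X) (FOb G X) (FOb H X) (s X) (\<alpha> X))"
    using X homomorphismD(1)[OF F(1)] homomorphismD(1)[OF F(2)] homomorphismD(1)[OF F(3)] nat_transD(1)[OF \<alpha> X]
    by (intro sup_pres_lub_in[OF Comp_sup_left _ nat_trans_pointwise_lub[OF F(2,3) s X]]) auto
   then show "lub_in (homlat Q (FOb F X) (FOb H X))
     ((\<lambda>\<alpha>. \<alpha> X) ` (\<lambda>\<beta>. Comp (Fun P Q) F G H \<beta> \<alpha>) ` S) (Comp (Fun P Q) F G H s \<alpha> X)"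
    using X by (simp add: image_image)
  qed (use nat_trans_comp[OF F \<alpha>] S in auto)
 qed
qed

end

lemma quantaloid_Mod: "quantaloid (Mod_quantaloid U Q)"
 unfolding Mod_quantaloid_def by (rule quantaloid.quantaloid_functors[OF quantaloid_Sup])

section \<open>Modules as families of sup-lattices with an action\<close>

text \<open>A homomorphism from \<open>Q\<^sup>o\<^sup>p\<close> to sup-lattices in elementary terms. The
 carriers may be of any type, so that hom-lattices, presheaves and fixed points of idempotents
 are instances.\<close>

locale sup_module = quantaloid Q for Q :: "('o, 'a) locat" +
 fixes lat :: "'o => 'x gorder" and act :: "'o => 'o => 'a => 'x => 'x"
 assumes lat: "X \<in> Ob Q ==> complete_lattice (lat X)"
  and act_in: "[|X \<in> Ob Q; Y \<in> Ob Q; f \<in> Hom Q X Y; y \<in> carrier (lat Y)|] ==> act X Y f y \<in> carrier (lat X)"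
  and act_id: "[|X \<in> Ob Q; x \<in> carrier (lat X)|] ==> act X X (Ident Q X) x = x"
  and act_comp: "[|X \<in> Ob Q; Y \<in> Ob Q; Z \<in> Ob Q; f \<in> Hom Q X Y; g \<in> Hom Q Y Z; z \<in> carrier (lat Z)|]
    ==> act X Z (Comp Q X Y Z g f) z = act X Y f (act Y Z g z)"
  and act_sup: "[|X \<in> Ob Q; Y \<in> Ob Q; f \<in> Hom Q X Y; lub_in (lat Y) A y|]
    ==> lub_in (lat X) (act X Y f ` A) (act X Y f y)"
  and act_hsup: "[|X \<in> Ob Q; Y \<in> Ob Q; y \<in> carrier (lat Y); lub_in (homlat Q X Y) S s|]
    ==> lub_in (lat X) ((\<lambda>f. act X Y f y) ` S) (act X Y s y)"

lemma Mod_simps [simp]: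
 "Ob (Mod_quantaloid U Q) = {M. homomorphism (opq Q) SL M}"
 "Hom (Mod_quantaloid U Q) = nat_trans (opq Q) SL"
 "Leq (Mod_quantaloid U Q) F G \<alpha> \<beta> \<longleftrightarrow> (\<forall>X\<in>Ob Q. \<forall>x\<in>carrier (FOb F X). le (FOb G X) (\<alpha> X x) (\<beta> X x))"
 "Comp (Mod_quantaloid U Q) F G H \<beta> \<alpha> = (\<lambda>X\<in>Ob Q. compose (carrier (FOb F X)) (\<beta> X) (\<alpha> X))"
 "Ident (Mod_quantaloid U Q) F = (\<lambda>X\<in>Ob Q. \<lambda>x\<in>carrier (FOb F X). x)"
 by (simp_all add: Mod_quantaloid_def)

lemma Mod_object_small:
 fixes M :: "('o, 'a, 'u gorder, 'u => 'u) arrow_map"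
 assumes "homomorphism (opq Q) SL M" "X \<in> Ob Q"
 shows "small TYPE('u) (carrier (FOb M X))"
 using homomorphismD(1)[OF assms(1)] assms(2) by simp

lemma Mod_object_sup_module:
 fixes M :: "('o, 'a, 'u gorder, 'u => 'u) arrow_map"
 assumes Q: "quantaloid Q" and M: "homomorphism (opq Q) SL M"
 shows "sup_module Q (FOb M) (\<lambda>X Y. FArr M Y X)"
proof (intro sup_module.intro[OF Q] sup_module_axioms.intro)
 interpret Q: quantaloid Q by fact
 note MD = homomorphismD[OF M]
 show lat: "complete_lattice (FOb M X)" if "X \<in> Ob Q" for X using MD(1)[of X] that by simp
 have arr: "FArr M Y X f \<in> Hom SL (FOb M Y) (FOb M X)"
  if "X \<in> Ob Q" "Y \<in> Ob Q" "f \<in> Hom Q X Y" for X Y f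
  using MD(2)[of Y X f] that by simp
 show "FArr M Y X f y \<in> carrier (FOb M X)"
  if "X \<in> Ob Q" "Y \<in> Ob Q" "f \<in> Hom Q X Y" "y \<in> carrier (FOb M Y)" for X Y f y
  using arr[OF that(1-3)] that(4) by auto
 show "FArr M X X (Ident Q X) x = x" if "X \<in> Ob Q" "x \<in> carrier (FOb M X)" for X x
  using MD(3)[of X] that by simp
 show "FArr M Z X (Comp Q X Y Z g f) z = FArr M Y X f (FArr M Z Y g z)"
  if "X \<in> Ob Q" "Y \<in> Ob Q" "Z \<in> Ob Q" "f \<in> Hom Q X Y" "g \<in> Hom Q Y Z" "z \<in> carrier (FOb M Z)" for X Y Z f g z
  using MD(4)[of Z Y X g f] that by (simp add: compose_def)
 show "lub_in (FOb M X) (FArr M Y X f ` A) (FArr M Y X f y)"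
  if "X \<in> Ob Q" "Y \<in> Ob Q" "f \<in> Hom Q X Y" "lub_in (FOb M Y) A y" for X Y f A y
  using arr[OF that(1-3)] that(4) by (intro sup_pres_lub_in[of "FOb M Y"]) auto
 show "lub_in (FOb M X) ((\<lambda>f. FArr M Y X f y) ` S) (FArr M Y X s y)"
  if X: "X \<in> Ob Q" "Y \<in> Ob Q" and y: "y \<in> carrier (FOb M Y)" and s: "lub_in (homlat Q X Y) S s" for X Y y S s
 proof -
  have "lub_in (homlat SL (FOb M Y) (FOb M X)) (FArr M Y X ` S) (FArr M Y X s)"
  proof (rule sup_pres_lub_in)
   show "sup_pres (homlat Q X Y) (homlat SL (FOb M Y) (FOb M X)) (FArr M Y X)"
    using MD(5)[of Y X] X by simp
   show "FArr M Y X \<in> carrier (homlat Q X Y) \<rightarrow> carrier (homlat SL (FOb M Y) (FOb M X))"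
    using arr X by (auto simp del: Sup_quantaloid_simps)
  qed (rule s)
  from Sup_pointwise_lub[OF lat[OF X(2)] lat[OF X(1)] this y]
  show ?thesis by (simp add: image_image)
 qed
qed

lemma Mod_hom_iff:
 assumes "quantaloid Q" and M: "homomorphism (opq Q) SL M"
  and N: "homomorphism (opq Q) SL N"
 shows "\<alpha> \<in> nat_trans (opq Q) SL M N \<longleftrightarrow>
  \<alpha> \<in> extensional (Ob Q) \<and>
  (\<forall>X\<in>Ob Q. \<alpha> X \<in> carrier (FOb M X) \<rightarrow>\<^sub>E carrier (FOb N X) \<and>
    (\<forall>A s. lub_in (FOb M X) A s --> lub_in (FOb N X) (\<alpha> X ` A) (\<alpha> X s))) \<and>
  (\<forall>X\<in>Ob Q. \<forall>Y\<in>Ob Q. \<forall>f\<in>Hom Q X Y. \<forall>y\<in>carrier (FOb M Y).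
    \<alpha> X (FArr M Y X f y) = FArr N Y X f (\<alpha> Y y))" (is "?L \<longleftrightarrow> ?R")
proof -
 interpret M: sup_module Q "FOb M" "\<lambda>X Y. FArr M Y X" by (rule Mod_object_sup_module[OF assms(1) M])
 interpret N: sup_module Q "FOb N" "\<lambda>X Y. FArr N Y X" by (rule Mod_object_sup_module[OF assms(1) N])
 have sp: "sup_pres (FOb M X) (FOb N X) h \<longleftrightarrow> (\<forall>A s. lub_in (FOb M X) A s --> lub_in (FOb N X) (h ` A) (h s))"
  if "X \<in> Ob Q" "h \<in> carrier (FOb M X) \<rightarrow>\<^sub>E carrier (FOb N X)" for X h
 proof
  assume "sup_pres (FOb M X) (FOb N X) h"
  then show "\<forall>A s. lub_in (FOb M X) A s --> lub_in (FOb N X) (h ` A) (h s)"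
   using that by (auto intro: sup_pres_lub_in)
 qed (use that M.lat N.lat in \<open>auto intro: sup_presI\<close>)
 have nat: "compose (carrier (FOb M Y)) (\<alpha> X) (FArr M Y X f) = compose (carrier (FOb M Y)) (FArr N Y X f) (\<alpha> Y)
   \<longleftrightarrow> (\<forall>y\<in>carrier (FOb M Y). \<alpha> X (FArr M Y X f y) = FArr N Y X f (\<alpha> Y y))" for X Y f
  by (auto simp: compose_def fun_eq_iff restrict_def)
 have hom: "\<alpha> X \<in> Hom SL (FOb M X) (FOb N X) \<longleftrightarrow> \<alpha> X \<in> carrier (FOb M X) \<rightarrow>\<^sub>E carrier (FOb N X) \<and>
    (\<forall>A s. lub_in (FOb M X) A s --> lub_in (FOb N X) (\<alpha> X ` A) (\<alpha> X s))" if "X \<in> Ob Q" for X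
  using sp[OF that] by auto
 have "?L \<longleftrightarrow> \<alpha> \<in> extensional (Ob Q) \<and> (\<forall>X\<in>Ob Q. \<alpha> X \<in> Hom SL (FOb M X) (FOb N X)) \<and>
   (\<forall>Y\<in>Ob Q. \<forall>X\<in>Ob Q. \<forall>f\<in>Hom Q X Y.
    compose (carrier (FOb M Y)) (\<alpha> X) (FArr M Y X f) = compose (carrier (FOb M Y)) (FArr N Y X f) (\<alpha> Y))"
  unfolding nat_trans_def PiE_def Pi_iff opq_simps Sup_quantaloid_simps(4) mem_Collect_eq by blast
 also have "\<dots> \<longleftrightarrow> ?R"
  unfolding nat using hom by (simp del: Sup_quantaloid_simps(2)) blast
 finally show ?thesis .
qed

lemma Mod_homD:
 assumes "quantaloid Q" "homomorphism (opq Q) SL M" "homomorphism (opq Q) SL N"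
  and "\<alpha> \<in> nat_trans (opq Q) SL M N"
 shows "\<alpha> \<in> extensional (Ob Q)"
  and "X \<in> Ob Q ==> \<alpha> X \<in> carrier (FOb M X) \<rightarrow>\<^sub>E carrier (FOb N X)"
  and "[|X \<in> Ob Q; x \<in> carrier (FOb M X)|] ==> \<alpha> X x \<in> carrier (FOb N X)"
  and "[|X \<in> Ob Q; lub_in (FOb M X) A s|] ==> lub_in (FOb N X) (\<alpha> X ` A) (\<alpha> X s)"
  and "[|X \<in> Ob Q; Y \<in> Ob Q; f \<in> Hom Q X Y; y \<in> carrier (FOb M Y)|] ==>
    \<alpha> X (FArr M Y X f y) = FArr N Y X f (\<alpha> Y y)"
 using assms(4) unfolding Mod_hom_iff[OF assms(1-3)] by blast+

text \<open>A module over arbitrary small carriers is isomorphic to one carried by subsets of the universe.\<close>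

locale small_sup_module = sup_module Q lat act
 for Q :: "('o, 'a) locat" and lat :: "'o => 'x gorder" and act +
 fixes code :: "'o => 'x => 'u"
 assumes small_car: "X \<in> Ob Q ==> small TYPE('u) (carrier (lat X))"
  and code: "X \<in> Ob Q ==> inj_on (code X) (carrier (lat X))"
begin

definition decode :: "'o => 'u => 'x" where
 "decode X = inv_into (carrier (lat X)) (code X)"

definition coded :: "('o, 'a, 'u gorder, 'u => 'u) arrow_map" where
 "coded = \<lparr>FOb = (\<lambda>X. \<lparr>carrier = code X ` carrier (lat X), eq = (=), le = (\<lambda>u v. le (lat X) (decode X u) (decode X v))\<rparr>),
      FArr = (\<lambda>Y X f. \<lambda>u\<in>code Y ` carrier (lat Y). code X (act X Y f (decode Y u)))\<rparr>"

lemma decode_code [simp]: "[|X \<in> Ob Q; x \<in> carrier (lat X)|] ==> decode X (code X x) = x"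
 using code by (simp add: decode_def)

lemma coded_simps [simp]:
 "carrier (FOb coded X) = code X ` carrier (lat X)"
 "le (FOb coded X) u v \<longleftrightarrow> le (lat X) (decode X u) (decode X v)"
 "eq (FOb coded X) = (=)"
 by (simp_all add: coded_def)

lemma coded_act [simp]:
 "[|Y \<in> Ob Q; y \<in> carrier (lat Y)|] ==> FArr coded Y X f (code Y y) = code X (act X Y f y)"
 by (simp add: coded_def)

lemma code_bij: "X \<in> Ob Q ==> bij_betw (code X) (carrier (lat X)) (carrier (FOb coded X))"
 using code by (simp add: bij_betw_def)

lemma coded_lat: "X \<in> Ob Q ==> complete_lattice (FOb coded X)"
 using lat code_bij by (intro order_iso_complete_lattice[of "lat X" "code X"]) auto

lemma code_lub: "[|X \<in> Ob Q; lub_in (lat X) A s|] ==> lub_in (FOb coded X) (code X ` A) (code X s)"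
 using code_bij by (intro order_iso_lub_in[of "code X" "lat X"]) auto

lemma decode_lub:
 assumes X: "X \<in> Ob Q" and s: "lub_in (FOb coded X) B t"
 obtains A s where "B = code X ` A" "t = code X s" "lub_in (lat X) A s"
proof -
 have "B \<subseteq> code X ` carrier (lat X)" using s by (simp add: lub_in_def)
 then obtain A where A: "A \<subseteq> carrier (lat X)" "B = code X ` A" by (rule subset_imageE)
 have l: "lub_in (lat X) A (\<Squnion>\<^bsub>lat X\<^esub> A)" by (rule sup_lub_in[OF lat[OF X] A(1)])
 have "t = code X (\<Squnion>\<^bsub>lat X\<^esub> A)"
  using lub_in_eq_sup[OF coded_lat[OF X] s] lub_in_eq_sup[OF coded_lat[OF X] code_lub[OF X l]] A by simp
 then show thesis using that A l by blast
qed

lemma coded_arr: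
 assumes X: "X \<in> Ob Q" "Y \<in> Ob Q" and f: "f \<in> Hom Q X Y"
 shows "FArr coded Y X f \<in> Hom SL (FOb coded Y) (FOb coded X)"
proof -
 have "sup_pres (FOb coded Y) (FOb coded X) (FArr coded Y X f)"
 proof (rule sup_presI[OF coded_lat coded_lat])
  fix B t assume "lub_in (FOb coded Y) B t"
  then obtain A s where A: "B = code Y ` A" "t = code Y s" "lub_in (lat Y) A s"
   using decode_lub[OF X(2)] by metis
  have s: "s \<in> carrier (lat Y)" "A \<subseteq> carrier (lat Y)" using A(3) by (simp_all add: lub_in_def)
  have "FArr coded Y X f ` B = code X ` (act X Y f ` A)"
   using s X by (auto simp: A(1) image_image subset_iff intro!: image_cong)
  moreover have "FArr coded Y X f t = code X (act X Y f s)" using s X by (simp add: A(2))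
  ultimately show "lub_in (FOb coded X) (FArr coded Y X f ` B) (FArr coded Y X f t)"
   using code_lub[OF X(1) act_sup[OF X f A(3)]] by simp
 qed (use X in auto)
 moreover have "FArr coded Y X f \<in> carrier (FOb coded Y) \<rightarrow>\<^sub>E carrier (FOb coded X)"
  using act_in[OF X f] X by (auto simp: coded_def)
 ultimately show ?thesis by simp
qed

lemma coded_homomorphism: "homomorphism (opq Q) SL coded"
proof -
 have "FOb coded X \<in> Ob SL" if "X \<in> Ob Q" for X
  using that coded_lat small_car by (simp add: small_image)
 moreover have "FArr coded X X (Ident Q X) = Ident SL (FOb coded X)" if "X \<in> Ob Q" for X
  using that by (auto simp: coded_def fun_eq_iff restrict_def act_id)
 moreover have "FArr coded Z X (Comp Q X Y Z g f)
   = Comp SL (FOb coded Z) (FOb coded Y) (FOb coded X) (FArr coded Y X f) (FArr coded Z Y g)"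
  if "X \<in> Ob Q" "Y \<in> Ob Q" "Z \<in> Ob Q" "f \<in> Hom Q X Y" "g \<in> Hom Q Y Z" for X Y Z f g
 proof
  fix u
  show "FArr coded Z X (Comp Q X Y Z g f) u
   = Comp SL (FOb coded Z) (FOb coded Y) (FOb coded X) (FArr coded Y X f) (FArr coded Z Y g) u"
  proof (cases "u \<in> code Z ` carrier (lat Z)")
   case True
   then obtain z where "u = code Z z" "z \<in> carrier (lat Z)" by blast
   then show ?thesis using that by (simp add: compose_def act_comp act_in)
  next
   case False
   then show ?thesis by (simp add: compose_def) (simp add: coded_def)
  qed
 qed
 moreover have "sup_pres (homlat Q X Y) (homlat SL (FOb coded Y) (FOb coded X)) (FArr coded Y X)"
  if X: "X \<in> Ob Q" "Y \<in> Ob Q" for X Y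
 proof (rule sup_presI[OF homlat_complete[OF X] Sup_hom_complete[OF coded_lat[OF X(2)] coded_lat[OF X(1)]]])
  fix S s assume s: "lub_in (homlat Q X Y) S s"
  then have S: "S \<subseteq> Hom Q X Y" "s \<in> Hom Q X Y" by (simp_all add: lub_in_def)
  show "lub_in (homlat SL (FOb coded Y) (FOb coded X)) (FArr coded Y X ` S) (FArr coded Y X s)"
  proof (rule Sup_lub_pointwise[OF coded_lat[OF X(1)]])
   show "FArr coded Y X ` S \<subseteq> Hom SL (FOb coded Y) (FOb coded X)"
    using coded_arr[OF X] S by blast
   show "FArr coded Y X s \<in> Hom SL (FOb coded Y) (FOb coded X)"
    using coded_arr[OF X] S by blast
   fix u assume "u \<in> carrier (FOb coded Y)"
   then obtain y where y: "u = code Y y" "y \<in> carrier (lat Y)" by auto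
   have "lub_in (FOb coded X) (code X ` ((\<lambda>f. act X Y f y) ` S)) (code X (act X Y s y))"
    by (rule code_lub[OF X(1) act_hsup[OF X y(2) s]])
   then show "lub_in (FOb coded X) ((\<lambda>g. g u) ` FArr coded Y X ` S) (FArr coded Y X s u)"
    using y X by (simp add: image_image)
  qed
 qed
 ultimately show ?thesis
  unfolding homomorphism_def using coded_arr by (simp del: Sup_quantaloid_simps)
qed

end

lemma small_sup_module_exists:
 fixes lat :: "'o => 'x gorder"
 assumes "sup_module Q lat act" "\<And>X. X \<in> Ob Q ==> small TYPE('u) (carrier (lat X))"
 obtains code :: "'o => 'x => 'u" where "small_sup_module Q lat act code"
proof -
 have "\<exists>c :: 'x => 'u. inj_on c (carrier (lat X))" if "X \<in> Ob Q" for X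
  using small_imp_inj[OF assms(2)[OF that]] by blast
 then obtain code :: "'o => 'x => 'u" where "\<And>X. X \<in> Ob Q ==> inj_on (code X) (carrier (lat X))" by metis
 with assms show thesis by (intro that small_sup_module.intro small_sup_module_axioms.intro) blast+
qed

text \<open>The representable module \<open>Q(-, B)\<close>, acted on by precomposition.\<close>

lemma representable_sup_module:
 assumes "quantaloid Q" "B \<in> Ob Q"
 shows "sup_module Q (\<lambda>X. homlat Q X B) (\<lambda>X Y f y. Comp Q X Y B y f)"
proof -
 interpret quantaloid Q by fact
 show ?thesis
  using assms(2)
  by (intro sup_module.intro sup_module_axioms.intro)
   (auto simp: Comp_assoc homlat_complete quantaloid_axioms
    intro: sup_pres_lub_in[OF Comp_sup_left] sup_pres_lub_in[OF Comp_sup_right])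
qed

section \<open>The centre\<close>

lemma homomorphism_identity: "quantaloid Q ==> homomorphism Q Q identity_map"
 by (auto simp: homomorphism_def quantaloid.homlat_complete intro!: sup_presI)

definition central :: "('o, 'a) locat => ('o => 'a) set" where
 "central Q = {\<alpha> \<in> \<Pi>\<^sub>E X\<in>Ob Q. Hom Q X X.
   \<forall>X\<in>Ob Q. \<forall>Y\<in>Ob Q. \<forall>f\<in>Hom Q X Y. Comp Q X Y Y (\<alpha> Y) f = Comp Q X X Y f (\<alpha> X)}"

lemma centralI:
 assumes "\<alpha> \<in> extensional (Ob Q)" "\<And>X. X \<in> Ob Q ==> \<alpha> X \<in> Hom Q X X"
  "\<And>X Y f. [|X \<in> Ob Q; Y \<in> Ob Q; f \<in> Hom Q X Y|] ==> Comp Q X Y Y (\<alpha> Y) f = Comp Q X X Y f (\<alpha> X)"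
 shows "\<alpha> \<in> central Q"
 using assms by (simp add: central_def PiE_def Pi_iff)

lemma centralD:
 assumes "\<alpha> \<in> central Q"
 shows "X \<in> Ob Q ==> \<alpha> X \<in> Hom Q X X"
  "[|X \<in> Ob Q; Y \<in> Ob Q; f \<in> Hom Q X Y|] ==> Comp Q X Y Y (\<alpha> Y) f = Comp Q X X Y f (\<alpha> X)"
  "\<alpha> \<in> extensional (Ob Q)"
 using assms by (auto simp: central_def PiE_def)

lemma Centre_simps [simp]:
 "Ob (Centre Q) = UNIV" "Hom (Centre Q) u v = central Q"
 "Leq (Centre Q) u v \<alpha> \<beta> \<longleftrightarrow> (\<forall>X\<in>Ob Q. Leq Q X X (\<alpha> X) (\<beta> X))"
 "Comp (Centre Q) u v w \<beta> \<alpha> = (\<lambda>X\<in>Ob Q. Comp Q X X X (\<beta> X) (\<alpha> X))"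
 "Ident (Centre Q) u = (\<lambda>X\<in>Ob Q. Ident Q X)"
 by (simp_all add: Centre_def endo_quantale_def nat_trans_def central_def)

lemma quantaloid_endo:
 assumes "quantaloid C" "X \<in> Ob C" shows "quantaloid (endo_quantale C X)"
proof -
 interpret quantaloid C by fact
 have h: "homlat (endo_quantale C X) u v = homlat C X X" for u v
  by (simp add: homlat_def endo_quantale_def)
 have s: "Ob (endo_quantale C X) = UNIV" "Hom (endo_quantale C X) u v = Hom C X X"
  "Leq (endo_quantale C X) u v = Leq C X X" "Comp (endo_quantale C X) u v w = Comp C X X X"
  "Ident (endo_quantale C X) u = Ident C X" for u v w
  by (simp_all add: endo_quantale_def)
 show ?thesis
  using assms(2)
  by (intro quantaloid.intro locally_ordered_category.intro quantaloid_axioms.intro)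
   (auto simp: s h Comp_assoc Leq_refl homlat_complete Comp_sup_left Comp_sup_right intro: Leq_trans Comp_mono)
qed

lemma quantaloid_Centre: "quantaloid Q ==> quantaloid (Centre Q)"
 unfolding Centre_def
 by (intro quantaloid_endo quantaloid.quantaloid_functors) (simp_all add: homomorphism_identity)

text \<open>Isomorphisms of quantales are obtained from total and surjective relations that respect the
 order and the monoid structure: unlike bijections they can be reversed and composed without effort,
 and antisymmetry of the orders makes such a relation the graph of an isomorphism.\<close>

definition correspondence :: "(unit, 'a) locat => (unit, 'b) locat => ('a => 'b => bool) => bool" where
 "correspondence Q R \<rho> \<longleftrightarrow> (\<forall>f\<in>Hom Q () (). \<exists>g\<in>Hom R () (). \<rho> f g) \<and> (\<forall>g\<in>Hom R () (). \<exists>f\<in>Hom Q () (). \<rho> f g) \<and>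
   \<rho> (Ident Q ()) (Ident R ()) \<and>
   (\<forall>f\<in>Hom Q () (). \<forall>f'\<in>Hom Q () (). \<forall>g\<in>Hom R () (). \<forall>g'\<in>Hom R () (). \<rho> f g --> \<rho> f' g' -->
    \<rho> (Comp Q () () () f' f) (Comp R () () () g' g) \<and> (Leq Q () () f f' \<longleftrightarrow> Leq R () () g g'))"

lemma correspondenceD:
 assumes "correspondence Q R \<rho>"
 shows "f \<in> Hom Q () () ==> \<exists>g\<in>Hom R () (). \<rho> f g" "g \<in> Hom R () () ==> \<exists>f\<in>Hom Q () (). \<rho> f g"
  "\<rho> (Ident Q ()) (Ident R ())"
  "[|f \<in> Hom Q () (); f' \<in> Hom Q () (); g \<in> Hom R () (); g' \<in> Hom R () (); \<rho> f g; \<rho> f' g'|] ==>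
   \<rho> (Comp Q () () () f' f) (Comp R () () () g' g) \<and> (Leq Q () () f f' \<longleftrightarrow> Leq R () () g g')"
 using assms unfolding correspondence_def by blast+

lemma correspondence_converse: "correspondence Q R \<rho> ==> correspondence R Q (\<lambda>g f. \<rho> f g)"
 unfolding correspondence_def by blast

lemma correspondence_comp:
 assumes "quantaloid R" "Ob R = UNIV" and \<rho>: "correspondence Q R \<rho>" and \<sigma>: "correspondence R S \<sigma>"
 shows "correspondence Q S (\<lambda>f h. \<exists>g\<in>Hom R () (). \<rho> f g \<and> \<sigma> g h)"
proof -
 interpret R: quantaloid R by fact
 have R: "Ident R () \<in> Hom R () ()" "\<And>f g. [|f \<in> Hom R () (); g \<in> Hom R () ()|] ==> Comp R () () () g f \<in> Hom R () ()"
  using assms(2) by simp_all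
 note \<rho> = correspondenceD[OF \<rho>] and \<sigma> = correspondenceD[OF \<sigma>]
 show ?thesis
  unfolding correspondence_def
 proof (intro conjI ballI impI)
  fix f f' h h' assume fh: "f \<in> Hom Q () ()" "f' \<in> Hom Q () ()" "h \<in> Hom S () ()" "h' \<in> Hom S () ()"
   and "\<exists>g\<in>Hom R () (). \<rho> f g \<and> \<sigma> g h" "\<exists>g\<in>Hom R () (). \<rho> f' g \<and> \<sigma> g h'"
  then obtain g g' where g: "g \<in> Hom R () ()" "\<rho> f g" "\<sigma> g h" "g' \<in> Hom R () ()" "\<rho> f' g'" "\<sigma> g' h'" by blast
  note 1 = \<rho>(4)[OF fh(1,2) g(1,4,2,5)] and 2 = \<sigma>(4)[OF g(1,4) fh(3,4) g(3,6)]
  then show "\<exists>g\<in>Hom R () (). \<rho> (Comp Q () () () f' f) g \<and> \<sigma> g (Comp S () () () h' h)" using R(2)[OF g(1,4)] by blast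
  show "Leq Q () () f f' \<longleftrightarrow> Leq S () () h h'" using 1 2 by blast
 next
  show "\<exists>h\<in>Hom S () (). \<exists>g\<in>Hom R () (). \<rho> f g \<and> \<sigma> g h" if "f \<in> Hom Q () ()" for f
   using \<rho>(1)[OF that] \<sigma>(1) by meson
  show "\<exists>f\<in>Hom Q () (). \<exists>g\<in>Hom R () (). \<rho> f g \<and> \<sigma> g h" if "h \<in> Hom S () ()" for h
   using \<sigma>(2)[OF that] \<rho>(2) by meson
  show "\<exists>g\<in>Hom R () (). \<rho> (Ident Q ()) g \<and> \<sigma> g (Ident S ())" using \<rho>(3) \<sigma>(3) R(1) by (intro bexI[of _ "Ident R ()"]) simp_all
 qed
qed

lemma correspondence_isomorphic:
 assumes Q: "quantaloid Q" and R: "quantaloid R" and ob: "Ob Q = UNIV" "Ob R = UNIV" and \<rho>: "correspondence Q R \<rho>"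
 shows "quantale_isomorphic Q R"
proof -
 interpret Q: quantaloid Q by fact
 interpret R: quantaloid R by fact
 note tot = correspondenceD(1)[OF \<rho>] and sur = correspondenceD(2)[OF \<rho>] and one = correspondenceD(3)[OF \<rho>]
  and \<rho> = correspondenceD(4)[OF \<rho>]
 obtain h where h: "\<And>f. f \<in> Hom Q () () ==> h f \<in> Hom R () () \<and> \<rho> f (h f)" using tot by metis
 have antisym: "f = g" if "f \<in> Hom Q () ()" "g \<in> Hom Q () ()" "Leq Q () () f g" "Leq Q () () g f" for f g
  using Q.ple_antisym[of "()" "()" f g] that ob by (simp add: ple_def)
 have uniq: "h f = g" if f: "f \<in> Hom Q () ()" and g: "g \<in> Hom R () ()" "\<rho> f g" for f g
  using R.ple_antisym[of "()" "()" "h f" g] \<rho>[OF f f _ g(1) _ g(2)] \<rho>[OF f f g(1) _ g(2)] h[OF f] g Q.Leq_refl[of "()" "()" f] f ob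
  by (simp add: ple_def)
 have le: "Leq R () () (h f) (h f') \<longleftrightarrow> Leq Q () () f f'" if "f \<in> Hom Q () ()" "f' \<in> Hom Q () ()" for f f'
  using \<rho>[of f f' "h f" "h f'"] h that by blast
 have bij: "bij_betw h (Hom Q () ()) (Hom R () ())"
  unfolding bij_betw_def
 proof
  show "inj_on h (Hom Q () ())"
   using antisym le R.Leq_refl[of "()" "()"] h ob by (intro inj_onI) (metis UNIV_I)
  show "h ` Hom Q () () = Hom R () ()" using h sur uniq by (auto simp: image_iff) metis
 qed
 have "sup_pres (homlat Q () ()) (homlat R () ()) h"
  by (rule order_iso_sup_pres) (use le bij ob Q.homlat_complete R.homlat_complete in auto)
 then show ?thesis
  unfolding quantale_isomorphic_def homomorphism_def using bij h uniq one \<rho> ob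
  by (intro exI[of _ h]) auto
qed

lemma Centre_correspondenceI:
 assumes "\<And>\<alpha>. \<alpha> \<in> central Q ==> \<exists>\<beta>\<in>central R. \<rho> \<alpha> \<beta>" "\<And>\<beta>. \<beta> \<in> central R ==> \<exists>\<alpha>\<in>central Q. \<rho> \<alpha> \<beta>"
  and "\<rho> (\<lambda>X\<in>Ob Q. Ident Q X) (\<lambda>Y\<in>Ob R. Ident R Y)"
  and "\<And>\<alpha> \<alpha>' \<beta> \<beta>'. [|\<alpha> \<in> central Q; \<alpha>' \<in> central Q; \<beta> \<in> central R; \<beta>' \<in> central R; \<rho> \<alpha> \<beta>; \<rho> \<alpha>' \<beta>'|] ==>
   \<rho> (\<lambda>X\<in>Ob Q. Comp Q X X X (\<alpha>' X) (\<alpha> X)) (\<lambda>Y\<in>Ob R. Comp R Y Y Y (\<beta>' Y) (\<beta> Y)) \<and>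
   ((\<forall>X\<in>Ob Q. Leq Q X X (\<alpha> X) (\<alpha>' X)) \<longleftrightarrow> (\<forall>Y\<in>Ob R. Leq R Y Y (\<beta> Y) (\<beta>' Y)))"
 shows "correspondence (Centre Q) (Centre R) \<rho>"
 unfolding correspondence_def Centre_simps using assms by simp

text \<open>A central family of \<open>Q\<close> corresponds to one of \<open>R\<close> when the weak equivalence \<open>F\<close> carries
 the one to the other; the components of the latter at objects outside the image of \<open>F\<close> are
 conjugates of those at the image.\<close>

lemma Centre_equivalent:
 assumes Q: "quantaloid Q" and R: "quantaloid R" and F: "weak_equivalence Q R F"
 shows "\<exists>\<rho>. correspondence (Centre Q) (Centre R) \<rho>"
proof -
 interpret Q: quantaloid Q by fact
 interpret R: quantaloid R by fact
 note W = weak_equivalenceD[OF F]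
 note FD = homomorphismD[OF W(1)]
 obtain H i j where H: "\<And>Y. Y \<in> Ob R ==> H Y \<in> Ob Q \<and> equiv_pair R Y (FOb F (H Y)) (i Y) (j Y)"
  using W(4) by metis
 have e [simp]: "H Y \<in> Ob Q" "i Y \<in> Hom R Y (FOb F (H Y))" "j Y \<in> Hom R (FOb F (H Y)) Y"
  "Comp R Y (FOb F (H Y)) Y (j Y) (i Y) = Ident R Y"
  "Comp R (FOb F (H Y)) Y (FOb F (H Y)) (i Y) (j Y) = Ident R (FOb F (H Y))" if "Y \<in> Ob R" for Y
  using H[OF that] equiv_pairD[OF conjunct2[OF H[OF that]]] R.pis_eq by blast+
 have cancel: "Comp R Z (FOb F (H Y)) Y (j Y) (Comp R Z Y (FOb F (H Y)) (i Y) f) = f"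
  if "Y \<in> Ob R" "Z \<in> Ob R" "f \<in> Hom R Z Y" for Y Z f
  using that e[OF that(1)] FD(1) by (simp flip: R.Comp_assoc)
 have cancel': "Comp R Z Y (FOb F (H Y)) (i Y) (Comp R Z (FOb F (H Y)) Y (j Y) f) = f"
  if "Y \<in> Ob R" "Z \<in> Ob R" "f \<in> Hom R Z (FOb F (H Y))" for Y Z f
  using that e[OF that(1)] FD(1) by (simp flip: R.Comp_assoc)
 have inj: "f = g" if "X \<in> Ob Q" "Y \<in> Ob Q" "f \<in> Hom Q X Y" "g \<in> Hom Q X Y" "FArr F X Y f = FArr F X Y g" for X Y f g
  using W(2)[OF that(1,2)] that(3-5) by (auto simp: bij_betw_def dest: inj_onD)
 have lift: "\<exists>f\<in>Hom Q X Y. FArr F X Y f = h" if "X \<in> Ob Q" "Y \<in> Ob Q" "h \<in> Hom R (FOb F X) (FOb F Y)" for X Y h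
  using W(2)[OF that(1,2)] that(3) unfolding bij_betw_def by (metis imageE)
 have recover: "\<beta> Y = Comp R Y (FOb F (H Y)) Y (j Y) (Comp R Y (FOb F (H Y)) (FOb F (H Y)) (\<beta> (FOb F (H Y))) (i Y))"
  if \<beta>: "\<beta> \<in> central R" and Y: "Y \<in> Ob R" for \<beta> Y
  using Y FD(1) centralD(1)[OF \<beta> Y] by (simp add: centralD(2)[OF \<beta> Y _ e(2)[OF Y]] cancel)
 show ?thesis
 proof (rule exI, rule Centre_correspondenceI[where \<rho> = "\<lambda>\<alpha> \<beta>. \<forall>X\<in>Ob Q. FArr F X X (\<alpha> X) = \<beta> (FOb F X)"])
  fix \<alpha> assume \<alpha>: "\<alpha> \<in> central Q"
  define b where "b Y = Comp R Y (FOb F (H Y)) Y (j Y) (Comp R Y (FOb F (H Y)) (FOb F (H Y)) (FArr F (H Y) (H Y) (\<alpha> (H Y))) (i Y))" for Y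
  have Fa [simp]: "FArr F X X (\<alpha> X) \<in> Hom R (FOb F X) (FOb F X)" if "X \<in> Ob Q" for X using that FD(2) centralD(1)[OF \<alpha>] by simp
  have b [simp]: "b Y \<in> Hom R Y Y" if "Y \<in> Ob R" for Y using that FD(1) by (simp add: b_def)
  have nat: "Comp R (FOb F X) (FOb F Y) (FOb F Y) (FArr F Y Y (\<alpha> Y)) h = Comp R (FOb F X) (FOb F X) (FOb F Y) h (FArr F X X (\<alpha> X))"
   if X: "X \<in> Ob Q" "Y \<in> Ob Q" and h: "h \<in> Hom R (FOb F X) (FOb F Y)" for X Y h
   using lift[OF X h] X centralD(1)[OF \<alpha>] centralD(2)[OF \<alpha>] FD(4) by metis
  \<comment> \<open>the conjugate does not depend on the chosen isomorphism\<close>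
  have conj: "Comp R Y (FOb F X) (FOb F X) (FArr F X X (\<alpha> X)) g = Comp R Y Y (FOb F X) g (b Y)"
   if Y: "Y \<in> Ob R" and X: "X \<in> Ob Q" and g: "g \<in> Hom R Y (FOb F X)" for X Y g
  proof -
   let ?g = "Comp R (FOb F (H Y)) Y (FOb F X) g (j Y)"
   have "Comp R Y Y (FOb F X) g (b Y) = Comp R Y (FOb F (H Y)) (FOb F X)
     (Comp R (FOb F (H Y)) (FOb F (H Y)) (FOb F X) ?g (FArr F (H Y) (H Y) (\<alpha> (H Y)))) (i Y)"
    using X Y g FD(1) by (simp add: b_def R.Comp_assoc)
   also have "\<dots> = Comp R Y (FOb F (H Y)) (FOb F X) (Comp R (FOb F (H Y)) (FOb F X) (FOb F X) (FArr F X X (\<alpha> X)) ?g) (i Y)"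
    using nat[of "H Y" X ?g] X Y g FD(1) by simp
   also have "\<dots> = Comp R Y (FOb F X) (FOb F X) (FArr F X X (\<alpha> X)) g"
    using X Y g FD(1) by (simp add: R.Comp_assoc)
   finally show ?thesis by simp
  qed
  have "restrict b (Ob R) \<in> central R"
  proof (rule centralI)
   fix Y Z g assume Y: "Y \<in> Ob R" "Z \<in> Ob R" and g: "g \<in> Hom R Y Z"
   have "Comp R Y Z (FOb F (H Z)) (i Z) (Comp R Y Z Z (b Z) g) = Comp R Y Z (FOb F (H Z)) (i Z) (Comp R Y Y Z g (b Y))"
    using Y g FD(1) conj[OF Y(2) e(1) e(2)] conj[of Y "H Z" "Comp R Y Z (FOb F (H Z)) (i Z) g"] by (simp flip: R.Comp_assoc)
   from arg_cong[OF this, of "Comp R Y (FOb F (H Z)) Z (j Z)"] have "Comp R Y Z Z (b Z) g = Comp R Y Y Z g (b Y)"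
    using Y g by (simp add: cancel)
   then show "Comp R Y Z Z (restrict b (Ob R) Z) g = Comp R Y Y Z g (restrict b (Ob R) Y)" using Y by simp
  qed auto
  moreover have "FArr F X X (\<alpha> X) = b (FOb F X)" if X: "X \<in> Ob Q" for X
   using conj[of "FOb F X" X "Ident R (FOb F X)"] X FD(1) by simp
  ultimately show "\<exists>\<beta>\<in>central R. \<forall>X\<in>Ob Q. FArr F X X (\<alpha> X) = \<beta> (FOb F X)" using FD(1) by (intro bexI[of _ "restrict b (Ob R)"]) auto
 next
  fix \<beta> assume \<beta>: "\<beta> \<in> central R"
  obtain a where a: "\<And>X. X \<in> Ob Q ==> a X \<in> Hom Q X X \<and> FArr F X X (a X) = \<beta> (FOb F X)"
   using bchoice[of "Ob Q" "\<lambda>X f. f \<in> Hom Q X X \<and> FArr F X X f = \<beta> (FOb F X)"] lift centralD(1)[OF \<beta>] FD(1) by blast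
  have "restrict a (Ob Q) \<in> central Q"
  proof (rule centralI)
   fix X Y f assume X: "X \<in> Ob Q" "Y \<in> Ob Q" and f: "f \<in> Hom Q X Y"
   show "Comp Q X Y Y (restrict a (Ob Q) Y) f = Comp Q X X Y f (restrict a (Ob Q) X)"
    using X f a[OF X(1)] a[OF X(2)] FD(1,2) centralD(2)[OF \<beta>, of "FOb F X" "FOb F Y" "FArr F X Y f"]
    by (intro inj[OF X]) (simp_all add: FD(4))
  qed (use a in auto)
  then show "\<exists>\<alpha>\<in>central Q. \<forall>X\<in>Ob Q. FArr F X X (\<alpha> X) = \<beta> (FOb F X)" using a by (intro bexI[of _ "restrict a (Ob Q)"]) auto
 next
  fix \<alpha> \<alpha>' \<beta> \<beta>' assume \<alpha>: "\<alpha> \<in> central Q" "\<alpha>' \<in> central Q" and \<beta>: "\<beta> \<in> central R" "\<beta>' \<in> central R"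
   and F: "\<forall>X\<in>Ob Q. FArr F X X (\<alpha> X) = \<beta> (FOb F X)" "\<forall>X\<in>Ob Q. FArr F X X (\<alpha>' X) = \<beta>' (FOb F X)"
  note in_Hom = centralD(1)[OF \<alpha>(1)] centralD(1)[OF \<alpha>(2)] centralD(1)[OF \<beta>(1)] centralD(1)[OF \<beta>(2)]
  have "ple R (FOb F X) (FOb F X) (\<beta> (FOb F X)) (\<beta>' (FOb F X)) \<longleftrightarrow> ple Q X X (\<alpha> X) (\<alpha>' X)" if X: "X \<in> Ob Q" for X
   using W(3)[OF X X in_Hom(1)[OF X] in_Hom(2)[OF X]] homomorphism_mono[OF W(1), of X X "\<alpha> X" "\<alpha>' X"] F X by auto
  moreover have "ple R Y Y (\<beta> Y) (\<beta>' Y)" if Y: "Y \<in> Ob R" and "ple R (FOb F (H Y)) (FOb F (H Y)) (\<beta> (FOb F (H Y))) (\<beta>' (FOb F (H Y)))" for Y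
   unfolding recover[OF \<beta>(1) Y] recover[OF \<beta>(2) Y] using that by (intro R.ple_comp_right R.ple_comp_left) auto
  ultimately have "(\<forall>X\<in>Ob Q. ple Q X X (\<alpha> X) (\<alpha>' X)) \<longleftrightarrow> (\<forall>Y\<in>Ob R. ple R Y Y (\<beta> Y) (\<beta>' Y))" using e(1) FD(1) by blast
  then show "(\<forall>X\<in>Ob Q. FArr F X X ((\<lambda>X\<in>Ob Q. Comp Q X X X (\<alpha>' X) (\<alpha> X)) X) = (\<lambda>Y\<in>Ob R. Comp R Y Y Y (\<beta>' Y) (\<beta> Y)) (FOb F X)) \<and>
   ((\<forall>X\<in>Ob Q. Leq Q X X (\<alpha> X) (\<alpha>' X)) \<longleftrightarrow> (\<forall>Y\<in>Ob R. Leq R Y Y (\<beta> Y) (\<beta>' Y)))"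
   using in_Hom F FD(1,4) by (simp add: ple_def)
 qed (use FD(1,3) in simp)
qed

text \<open>The centre of the module category: a central family acts on every module, and a natural
 family of endomorphisms of all modules is determined by its value on the identities, which
 generate the representable modules.\<close>

lemma Centre_Mod:
 fixes Q :: "('o, 'a) locat"
 assumes sm: "small_quantaloid TYPE('u) Q"
 shows "\<exists>\<rho>. correspondence (Centre Q) (Centre (Mod_quantaloid TYPE('u) Q)) \<rho>"
proof -
 have Q: "quantaloid Q" using sm by (simp add: small_quantaloid_def)
 interpret Q: quantaloid Q by fact
 let ?Mod = "Mod_quantaloid TYPE('u) Q"
 have Mod: "quantaloid ?Mod" by (rule quantaloid_Mod)
 note sup_mod = Mod_object_sup_module[OF Q]
 define h :: "('o => 'a) => ('o, 'a, 'u gorder, 'u => 'u) arrow_map => 'o => 'u => 'u"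
  where "h \<alpha> = (\<lambda>M\<in>Ob ?Mod. \<lambda>X\<in>Ob Q. FArr M X X (\<alpha> X))" for \<alpha>
 have h_app: "h \<alpha> M X = FArr M X X (\<alpha> X)" if "homomorphism (opq Q) SL M" "X \<in> Ob Q" for \<alpha> M X
  using that by (simp add: h_def)
 have h_in: "h \<alpha> M \<in> nat_trans (opq Q) SL M M"
  if \<alpha>: "\<alpha> \<in> central Q" and M: "homomorphism (opq Q) SL M" for \<alpha> M
 proof -
  interpret M: sup_module Q "FOb M" "\<lambda>X Y. FArr M Y X" by (rule sup_mod[OF M])
  note a = centralD(1)[OF \<alpha>]
  have "FArr M X X (\<alpha> X) \<in> carrier (FOb M X) \<rightarrow>\<^sub>E carrier (FOb M X)" if "X \<in> Ob Q" for X
   using homomorphismD(2)[OF M, of X X "\<alpha> X"] that a by simp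
  moreover have "FArr M X X (\<alpha> X) (FArr M Y X f y) = FArr M Y X f (FArr M Y Y (\<alpha> Y) y)"
   if "X \<in> Ob Q" "Y \<in> Ob Q" "f \<in> Hom Q X Y" "y \<in> carrier (FOb M Y)" for X Y f y
   using that a centralD(2)[OF \<alpha> that(1-3)] by (simp flip: M.act_comp)
  ultimately show ?thesis
   unfolding Mod_hom_iff[OF Q M M] using a M M.act_sup by (simp add: h_def)
 qed
 have h_central: "h \<alpha> \<in> central ?Mod" if \<alpha>: "\<alpha> \<in> central Q" for \<alpha>
 proof (rule centralI)
  fix M N \<gamma> assume MN: "M \<in> Ob ?Mod" "N \<in> Ob ?Mod" and g: "\<gamma> \<in> Hom ?Mod M N"
  then have M: "homomorphism (opq Q) SL M" and N: "homomorphism (opq Q) SL N"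
   and \<gamma>: "\<gamma> \<in> nat_trans (opq Q) SL M N" by simp_all
  have "compose (carrier (FOb M X)) (h \<alpha> N X) (\<gamma> X) = compose (carrier (FOb M X)) (\<gamma> X) (h \<alpha> M X)"
   if X: "X \<in> Ob Q" for X
   using Mod_homD(5)[OF Q M N \<gamma> X X centralD(1)[OF \<alpha> X]] X
   by (auto simp: h_app M N compose_def fun_eq_iff restrict_def)
  then show "Comp ?Mod M N N (h \<alpha> N) \<gamma> = Comp ?Mod M M N \<gamma> (h \<alpha> M)"
   by (auto simp: fun_eq_iff restrict_def)
 qed (use h_in[OF that] in \<open>auto simp: h_def\<close>)
 have "\<exists>code :: 'o => 'a => 'u. small_sup_module Q (\<lambda>X. homlat Q X B) (\<lambda>X Y f y. Comp Q X Y B y f) code"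
  if "B \<in> Ob Q" for B
 proof -
  have "small TYPE('u) (carrier (homlat Q X B))" if "X \<in> Ob Q" for X
   using sm that \<open>B \<in> Ob Q\<close> by (simp add: small_quantaloid_def)
  from small_sup_module_exists[OF representable_sup_module[OF Q that] this] show ?thesis by blast
 qed
 then obtain code :: "'o => 'o => 'a => 'u"
  where code: "\<And>B. B \<in> Ob Q ==> small_sup_module Q (\<lambda>X. homlat Q X B) (\<lambda>X Y f y. Comp Q X Y B y f) (code B)"
  by metis
 define rep where "rep B = small_sup_module.coded (\<lambda>X. homlat Q X B) (\<lambda>X Y f y. Comp Q X Y B y f) (code B)" for B
 have rep: "homomorphism (opq Q) SL (rep B)" if "B \<in> Ob Q" for B
  unfolding rep_def by (rule small_sup_module.coded_homomorphism[OF code[OF that]])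
 have rep_car: "carrier (FOb (rep B) X) = code B X ` Hom Q X B" if "B \<in> Ob Q" for B X
  unfolding rep_def using small_sup_module.coded_simps(1)[OF code[OF that]] by simp
 have rep_act: "FArr (rep B) Y X f (code B Y y) = code B X (Comp Q X Y B y f)"
  if "B \<in> Ob Q" "Y \<in> Ob Q" "y \<in> Hom Q Y B" for B X Y f y
  unfolding rep_def using small_sup_module.coded_act[OF code[OF that(1)]] that by simp
 define dec where "dec B X = inv_into (Hom Q X B) (code B X)" for B X
 have dec [simp]: "dec B X (code B X f) = f" if "B \<in> Ob Q" "X \<in> Ob Q" "f \<in> Hom Q X B" for B X f
  using small_sup_module.code[OF code[OF that(1)] that(2)] that(3) by (simp add: dec_def)
 \<comment> \<open>the Yoneda correspondence\<close>
 define yon where "yon M B x = (\<lambda>X\<in>Ob Q. \<lambda>u\<in>code B X ` Hom Q X B. FArr M B X (dec B X u) x)"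
  for M :: "('o, 'a, 'u gorder, 'u => 'u) arrow_map" and B x
 have yon_app: "yon M B x X (code B X f) = FArr M B X f x"
  if "B \<in> Ob Q" "X \<in> Ob Q" "f \<in> Hom Q X B" for M B x X f
  using that by (simp add: yon_def)
 have yon: "yon M B x \<in> nat_trans (opq Q) SL (rep B) M"
  if B: "B \<in> Ob Q" and M: "homomorphism (opq Q) SL M" and x: "x \<in> carrier (FOb M B)" for M B x
 proof -
  interpret M: sup_module Q "FOb M" "\<lambda>X Y. FArr M Y X" by (rule sup_mod[OF M])
  interpret r: small_sup_module Q "\<lambda>X. homlat Q X B" "\<lambda>X Y f y. Comp Q X Y B y f" "code B" by (rule code[OF B])
  have "yon M B x X \<in> carrier (FOb (rep B) X) \<rightarrow>\<^sub>E carrier (FOb M X)" if "X \<in> Ob Q" for X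
   using that B x M.act_in by (auto simp: rep_car yon_def)
  moreover have "lub_in (FOb M X) (yon M B x X ` A) (yon M B x X t)"
   if X: "X \<in> Ob Q" and t: "lub_in (FOb (rep B) X) A t" for X A t
  proof -
   obtain S s where S: "A = code B X ` S" "t = code B X s" "lub_in (homlat Q X B) S s"
    using r.decode_lub[OF X, of A t] t unfolding rep_def by blast
   have Ss: "S \<subseteq> Hom Q X B" "s \<in> Hom Q X B" using S(3) by (simp_all add: lub_in_def)
   have "yon M B x X ` A = (\<lambda>f. FArr M B X f x) ` S"
    unfolding S(1) image_image using Ss(1) by (intro image_cong) (auto simp: yon_app[OF B X])
   moreover have "yon M B x X t = FArr M B X s x" using Ss by (simp add: S(2) yon_app B X)
   ultimately show ?thesis using M.act_hsup[OF X B x S(3)] by simp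
  qed
  moreover have "yon M B x X (FArr (rep B) Y X f u) = FArr M Y X f (yon M B x Y u)"
   if X: "X \<in> Ob Q" "Y \<in> Ob Q" and f: "f \<in> Hom Q X Y" and u: "u \<in> carrier (FOb (rep B) Y)" for X Y f u
  proof -
   obtain y where y: "u = code B Y y" "y \<in> Hom Q Y B" using u by (auto simp: rep_car B)
   then show ?thesis using X f B x by (simp add: rep_act yon_app M.act_comp)
  qed
  moreover have "yon M B x \<in> extensional (Ob Q)" by (simp add: yon_def)
  ultimately show ?thesis unfolding Mod_hom_iff[OF Q rep[OF B] M] by blast
 qed
 \<comment> \<open>hence a central family is given by elements of the endomorphism lattices\<close>
 have one_in: "code B B (Ident Q B) \<in> carrier (FOb (rep B) B)" if "B \<in> Ob Q" for B
  using that by (auto simp: rep_car)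
 have central_value: "\<beta> M B x = FArr M B B (dec B B (\<beta> (rep B) B (code B B (Ident Q B)))) x"
   and central_value_in: "dec B B (\<beta> (rep B) B (code B B (Ident Q B))) \<in> Hom Q B B"
    "code B B (dec B B (\<beta> (rep B) B (code B B (Ident Q B)))) = \<beta> (rep B) B (code B B (Ident Q B))"
  if \<beta>: "\<beta> \<in> central ?Mod" and B: "B \<in> Ob Q" and M: "homomorphism (opq Q) SL M"
   and x: "x \<in> carrier (FOb M B)" for \<beta> M B x
 proof -
  interpret M: sup_module Q "FOb M" "\<lambda>X Y. FArr M Y X" by (rule sup_mod[OF M])
  have \<beta>r: "\<beta> (rep B) \<in> nat_trans (opq Q) SL (rep B) (rep B)"
   using centralD(1)[OF \<beta>, of "rep B"] rep[OF B] by simp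
  have "\<beta> (rep B) B (code B B (Ident Q B)) \<in> carrier (FOb (rep B) B)"
   by (rule Mod_homD(3)[OF Q rep[OF B] rep[OF B] \<beta>r B one_in[OF B]])
  then obtain a where a: "\<beta> (rep B) B (code B B (Ident Q B)) = code B B a" "a \<in> Hom Q B B"
   by (auto simp: rep_car B)
  show "dec B B (\<beta> (rep B) B (code B B (Ident Q B))) \<in> Hom Q B B"
    "code B B (dec B B (\<beta> (rep B) B (code B B (Ident Q B)))) = \<beta> (rep B) B (code B B (Ident Q B))"
   using a B by simp_all
  have "Comp ?Mod (rep B) M M (\<beta> M) (yon M B x) = Comp ?Mod (rep B) (rep B) M (yon M B x) (\<beta> (rep B))"
   using centralD(2)[OF \<beta>, of "rep B" M "yon M B x"] rep[OF B] M yon[OF B M x] by simp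
  then have "\<beta> M B (yon M B x B (code B B (Ident Q B))) = yon M B x B (\<beta> (rep B) B (code B B (Ident Q B)))"
   using B one_in[OF B] by (simp add: fun_eq_iff restrict_def compose_def split: if_splits)
  then show "\<beta> M B x = FArr M B B (dec B B (\<beta> (rep B) B (code B B (Ident Q B)))) x"
   using a B x by (simp add: yon_app M.act_id)
 qed
 have surj: "\<exists>\<alpha>\<in>central Q. h \<alpha> = \<beta>" if \<beta>: "\<beta> \<in> central ?Mod" for \<beta>
 proof -
  define \<alpha> where "\<alpha> = (\<lambda>B\<in>Ob Q. dec B B (\<beta> (rep B) B (code B B (Ident Q B))))"
  have \<alpha>_in: "\<alpha> B \<in> Hom Q B B" if B: "B \<in> Ob Q" for B
   using central_value_in(1)[OF \<beta> B rep[OF B] one_in[OF B]] B by (simp add: \<alpha>_def)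
  have \<beta>_one: "\<beta> (rep B) B (code B B (Ident Q B)) = code B B (\<alpha> B)" if B: "B \<in> Ob Q" for B
   using central_value_in(2)[OF \<beta> B rep[OF B] one_in[OF B]] B by (simp add: \<alpha>_def)
  have val: "\<beta> M B x = FArr M B B (\<alpha> B) x"
   if "B \<in> Ob Q" "homomorphism (opq Q) SL M" "x \<in> carrier (FOb M B)" for M B x
   using central_value[OF \<beta> that] that(1) by (simp add: \<alpha>_def)
  have "\<alpha> \<in> central Q"
  proof (rule centralI)
   fix A B f assume A: "A \<in> Ob Q" and B: "B \<in> Ob Q" and f: "f \<in> Hom Q A B"
   have \<beta>r: "\<beta> (rep B) \<in> nat_trans (opq Q) SL (rep B) (rep B)"
    using centralD(1)[OF \<beta>, of "rep B"] rep[OF B] by simp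
   have cf: "code B A f \<in> carrier (FOb (rep B) A)" using f by (simp add: rep_car B)
   have "\<beta> (rep B) A (code B A f) = code B A (Comp Q A A B f (\<alpha> A))"
    using A B f \<alpha>_in by (simp add: val[OF A rep[OF B] cf] rep_act)
   moreover have "\<beta> (rep B) A (FArr (rep B) B A f (code B B (Ident Q B)))
     = FArr (rep B) B A f (\<beta> (rep B) B (code B B (Ident Q B)))"
    by (rule Mod_homD(5)[OF Q rep[OF B] rep[OF B] \<beta>r A B f one_in[OF B]])
   then have "\<beta> (rep B) A (code B A f) = code B A (Comp Q A B B (\<alpha> B) f)"
    using A B f \<alpha>_in by (simp add: rep_act \<beta>_one)
   ultimately have "dec B A (code B A (Comp Q A B B (\<alpha> B) f)) = dec B A (code B A (Comp Q A A B f (\<alpha> A)))"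
    by simp
   then show "Comp Q A B B (\<alpha> B) f = Comp Q A A B f (\<alpha> A)" using A B f \<alpha>_in by simp
  qed (use \<alpha>_in in \<open>auto simp: \<alpha>_def\<close>)
  moreover have "h \<alpha> = \<beta>"
  proof (rule extensionalityI[of _ "Ob ?Mod"])
   show "\<beta> \<in> extensional (Ob ?Mod)" by (rule centralD(3)[OF \<beta>])
   fix M assume "M \<in> Ob ?Mod"
   then have M: "homomorphism (opq Q) SL M" by simp
   have \<beta>M: "\<beta> M \<in> nat_trans (opq Q) SL M M" using centralD(1)[OF \<beta>, of M] M by simp
   note hM = h_in[OF \<open>\<alpha> \<in> central Q\<close> M]
   show "h \<alpha> M = \<beta> M"
   proof (rule nat_trans_eqI[OF hM \<beta>M])
    fix X assume "X \<in> Ob (opq Q)"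
    then have X: "X \<in> Ob Q" by simp
    show "h \<alpha> M X = \<beta> M X"
     by (rule PiE_ext[OF Mod_homD(2)[OF Q M M hM X] Mod_homD(2)[OF Q M M \<beta>M X]])
      (simp add: val[OF X M] h_app[OF M X])
   qed
  qed (simp add: h_def)
  ultimately show ?thesis by blast
 qed
 show ?thesis
 proof (rule exI, rule Centre_correspondenceI[where \<rho> = "\<lambda>\<alpha> \<beta>. h \<alpha> = \<beta>"])
  have "FArr M X X (Ident Q X) = (\<lambda>x\<in>carrier (FOb M X). x)" if "M \<in> Ob ?Mod" "X \<in> Ob Q" for M X
   using homomorphismD(3)[of "opq Q" SL M X] that by simp
  then show "h (\<lambda>X\<in>Ob Q. Ident Q X) = (\<lambda>M\<in>Ob ?Mod. Ident ?Mod M)"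
   by (auto simp: h_def fun_eq_iff restrict_def)
  fix \<alpha> \<alpha>' \<beta> \<beta>' assume \<alpha>: "\<alpha> \<in> central Q" "\<alpha>' \<in> central Q" and \<beta>: "h \<alpha> = \<beta>" "h \<alpha>' = \<beta>'"
  note a = centralD(1)[OF \<alpha>(1)] centralD(1)[OF \<alpha>(2)]
  \<comment> \<open>contravariance of modules is harmless because the centre is commutative\<close>
  have "FArr M X X (Comp Q X X X (\<alpha>' X) (\<alpha> X)) = compose (carrier (FOb M X)) (FArr M X X (\<alpha>' X)) (FArr M X X (\<alpha> X))"
   if "M \<in> Ob ?Mod" and X: "X \<in> Ob Q" for M X
   using homomorphismD(4)[of "opq Q" SL M X X X "\<alpha> X" "\<alpha>' X"] that a[OF X] centralD(2)[OF \<alpha>(2) X X a(1)[OF X]] by simp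
  then have "h (\<lambda>X\<in>Ob Q. Comp Q X X X (\<alpha>' X) (\<alpha> X)) = (\<lambda>M\<in>Ob ?Mod. Comp ?Mod M M M (\<beta>' M) (\<beta> M))"
   unfolding \<beta>[symmetric] by (auto simp: h_def fun_eq_iff restrict_def)
  moreover have "(\<forall>X\<in>Ob Q. Leq Q X X (\<alpha> X) (\<alpha>' X)) \<longleftrightarrow> (\<forall>M\<in>Ob ?Mod. Leq ?Mod M M (\<beta> M) (\<beta>' M))"
  proof
   assume le: "\<forall>X\<in>Ob Q. Leq Q X X (\<alpha> X) (\<alpha>' X)"
   have "le (FOb M X) (FArr M X X (\<alpha> X) x) (FArr M X X (\<alpha>' X) x)"
    if M: "homomorphism (opq Q) SL M" and X: "X \<in> Ob Q" and x: "x \<in> carrier (FOb M X)" for M X x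
   proof -
    interpret M: sup_module Q "FOb M" "\<lambda>X Y. FArr M Y X" by (rule sup_mod[OF M])
    have "lub_in (homlat Q X X) {\<alpha> X, \<alpha>' X} (\<alpha>' X)"
     using le X a[OF X] by (auto simp: lub_in_def Q.Leq_refl)
    from M.act_hsup[OF X X x this] show ?thesis by (simp add: lub_in_def)
   qed
   then show "\<forall>M\<in>Ob ?Mod. Leq ?Mod M M (\<beta> M) (\<beta>' M)" by (auto simp: h_app simp flip: \<beta>)
  next
   assume le: "\<forall>M\<in>Ob ?Mod. Leq ?Mod M M (\<beta> M) (\<beta>' M)"
   show "\<forall>X\<in>Ob Q. Leq Q X X (\<alpha> X) (\<alpha>' X)"
   proof
    fix B assume B: "B \<in> Ob Q"
    interpret r: small_sup_module Q "\<lambda>X. homlat Q X B" "\<lambda>X Y f y. Comp Q X Y B y f" "code B" by (rule code[OF B])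
    have "le (FOb (rep B) B) (h \<alpha> (rep B) B (code B B (Ident Q B))) (h \<alpha>' (rep B) B (code B B (Ident Q B)))"
     using le rep[OF B] B one_in[OF B] by (simp add: \<beta>)
    then have "le (FOb (rep B) B) (code B B (\<alpha> B)) (code B B (\<alpha>' B))"
     using B a[OF B] by (simp add: h_app rep rep_act)
    then show "Leq Q B B (\<alpha> B) (\<alpha>' B)" using B a[OF B] by (simp add: rep_def)
   qed
  qed
  ultimately show "h (\<lambda>X\<in>Ob Q. Comp Q X X X (\<alpha>' X) (\<alpha> X)) = (\<lambda>M\<in>Ob ?Mod. Comp ?Mod M M M (\<beta>' M) (\<beta> M)) \<and>
   ((\<forall>X\<in>Ob Q. Leq Q X X (\<alpha> X) (\<alpha>' X)) \<longleftrightarrow> (\<forall>M\<in>Ob ?Mod. Leq ?Mod M M (\<beta> M) (\<beta>' M)))" ..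
 next
  show "\<exists>\<beta>\<in>central ?Mod. h \<alpha> = \<beta>" if "\<alpha> \<in> central Q" for \<alpha> using h_central[OF that] by simp
  show "\<exists>\<alpha>\<in>central Q. h \<alpha> = \<beta>" if "\<beta> \<in> central ?Mod" for \<beta> using surj[OF that] .
 qed
qed

theorem Mod_equivalent_imp_Centre_isomorphic:
 fixes Q :: "('o, 'a) locat" and Q' :: "('p, 'b) locat"
 assumes Q: "small_quantaloid TYPE('u) Q" and Q': "small_quantaloid TYPE('u) Q'"
  and eq: "quantaloid_equivalent (Mod_quantaloid TYPE('u) Q) (Mod_quantaloid TYPE('u) Q')"
 shows "quantale_isomorphic (Centre Q) (Centre Q')"
proof -
 have qq: "quantaloid Q" "quantaloid Q'" using Q Q' by (simp_all add: small_quantaloid_def)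
 obtain F where "weak_equivalence (Mod_quantaloid TYPE('u) Q) (Mod_quantaloid TYPE('u) Q') F"
  by (rule equivalent_weak_equivalence[OF quantaloid_Mod quantaloid_Mod eq])
 from Centre_equivalent[OF quantaloid_Mod quantaloid_Mod this]
 obtain \<sigma> where \<sigma>: "correspondence (Centre (Mod_quantaloid TYPE('u) Q)) (Centre (Mod_quantaloid TYPE('u) Q')) \<sigma>" by blast
 obtain \<rho> \<rho>' where \<rho>: "correspondence (Centre Q) (Centre (Mod_quantaloid TYPE('u) Q)) \<rho>"
  "correspondence (Centre Q') (Centre (Mod_quantaloid TYPE('u) Q')) \<rho>'"
  using Centre_Mod[OF Q] Centre_Mod[OF Q'] by blast
 note comp = correspondence_comp[OF quantaloid_Centre[OF quantaloid_Mod] Centre_simps(1)]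
 show ?thesis
  by (rule correspondence_isomorphic[OF quantaloid_Centre[OF qq(1)] quantaloid_Centre[OF qq(2)] Centre_simps(1) Centre_simps(1)
    comp[OF comp[OF \<rho>(1) \<sigma>] correspondence_converse[OF \<rho>(2)]]])
qed

section \<open>Splitting idempotents\<close>

lemma Idm_simps [simp]:
 "Ob (Idm Q) = {p. fst p \<in> Ob Q \<and> snd p \<in> Hom Q (fst p) (fst p) \<and>
   Comp Q (fst p) (fst p) (fst p) (snd p) (snd p) = snd p}"
 "Hom (Idm Q) p q = {b \<in> Hom Q (fst p) (fst q). Comp Q (fst p) (fst p) (fst q) b (snd p) = b \<and>
   Comp Q (fst p) (fst q) (fst q) (snd q) b = b}"
 "Leq (Idm Q) p q = Leq Q (fst p) (fst q)"
 "Comp (Idm Q) p q r = Comp Q (fst p) (fst q) (fst r)"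
 "Ident (Idm Q) p = snd p"
 by (auto simp: Idm_def case_prod_beta)

context quantaloid
begin

lemma Idm_hsup:
 assumes p: "p \<in> Ob (Idm Q)" and q: "q \<in> Ob (Idm Q)" and A: "A \<subseteq> Hom (Idm Q) p q"
 shows "hsup Q (fst p) (fst q) A \<in> Hom (Idm Q) p q"
  and "lub_in (homlat (Idm Q) p q) A (hsup Q (fst p) (fst q) A)"
proof -
 have AQ: "A \<subseteq> Hom Q (fst p) (fst q)" using A by auto
 have "(\<lambda>b. Comp Q (fst p) (fst p) (fst q) b (snd p)) ` A = A"
   "(\<lambda>b. Comp Q (fst p) (fst q) (fst q) (snd q) b) ` A = A"
  using A by (auto simp: image_iff subset_iff)
 then show s: "hsup Q (fst p) (fst q) A \<in> Hom (Idm Q) p q"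
  using p q AQ by (simp add: comp_hsup_left comp_hsup_right)
 show "lub_in (homlat (Idm Q) p q) A (hsup Q (fst p) (fst q) A)"
  using s A hsup_lub[of "fst p" "fst q" A] p q AQ unfolding lub_in_def by auto
qed

lemma Idm_lub:
 assumes p: "p \<in> Ob (Idm Q)" and q: "q \<in> Ob (Idm Q)" and s: "lub_in (homlat (Idm Q) p q) A s"
 shows "lub_in (homlat Q (fst p) (fst q)) A s"
proof -
 have A: "A \<subseteq> Hom (Idm Q) p q" "s \<in> Hom (Idm Q) p q" using s by (simp_all add: lub_in_def)
 have "Leq Q (fst p) (fst q) s (hsup Q (fst p) (fst q) A)" "Leq Q (fst p) (fst q) (hsup Q (fst p) (fst q) A) s"
  using lub_in_le[OF s Idm_hsup(2)[OF p q A(1)]] lub_in_le[OF Idm_hsup(2)[OF p q A(1)] s] by simp_all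
 then have "s = hsup Q (fst p) (fst q) A"
  using Idm_hsup(1)[OF p q A(1)] A p q by (intro ple_antisym[of "fst p" "fst q"]) (auto simp: ple_def)
 moreover have "A \<subseteq> Hom Q (fst p) (fst q)" using A by auto
 ultimately show ?thesis using hsup_lub p q by simp
qed

lemma locally_ordered_category_Idm: "locally_ordered_category (Idm Q)"
proof
 fix p q r f g
 assume "p \<in> Ob (Idm Q)" "q \<in> Ob (Idm Q)" "r \<in> Ob (Idm Q)" "f \<in> Hom (Idm Q) p q" "g \<in> Hom (Idm Q) q r"
 then have pqr: "fst p \<in> Ob Q" "fst q \<in> Ob Q" "fst r \<in> Ob Q" "snd p \<in> Hom Q (fst p) (fst p)"
  "snd r \<in> Hom Q (fst r) (fst r)"
  and f: "f \<in> Hom Q (fst p) (fst q)" "Comp Q (fst p) (fst p) (fst q) f (snd p) = f"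
  and g: "g \<in> Hom Q (fst q) (fst r)" "Comp Q (fst q) (fst r) (fst r) (snd r) g = g" by simp_all
 have "Comp Q (fst p) (fst p) (fst r) (Comp Q (fst p) (fst q) (fst r) g f) (snd p)
   = Comp Q (fst p) (fst q) (fst r) g f"
  using pqr f g by (simp add: Comp_assoc)
 moreover have "Comp Q (fst p) (fst r) (fst r) (snd r) (Comp Q (fst p) (fst q) (fst r) g f)
   = Comp Q (fst p) (fst q) (fst r) (Comp Q (fst q) (fst r) (fst r) (snd r) g) f"
  using pqr f(1) g(1) by (simp add: Comp_assoc)
 ultimately show "Comp (Idm Q) p q r g f \<in> Hom (Idm Q) p r"
  using pqr f g by simp
next
 fix p q f g h
 assume "p \<in> Ob (Idm Q)" "q \<in> Ob (Idm Q)" "f \<in> Hom (Idm Q) p q" "g \<in> Hom (Idm Q) p q" "h \<in> Hom (Idm Q) p q"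
  "Leq (Idm Q) p q f g" "Leq (Idm Q) p q g h"
 then show "Leq (Idm Q) p q f h" using Leq_trans[of "fst p" "fst q" f g h] by simp
qed (auto simp: Comp_assoc Leq_refl intro: Comp_mono)

lemma quantaloid_Idm: "quantaloid (Idm Q)"
proof (intro quantaloid.intro locally_ordered_category_Idm quantaloid_axioms.intro)
 interpret I: locally_ordered_category "Idm Q" by (rule locally_ordered_category_Idm)
 show lat: "complete_lattice (homlat (Idm Q) p q)" if pq: "p \<in> Ob (Idm Q)" "q \<in> Ob (Idm Q)" for p q
 proof (rule complete_lattice_of_lubs)
  show "x = y" if "x \<in> carrier (homlat (Idm Q) p q)" "y \<in> carrier (homlat (Idm Q) p q)"
   "le (homlat (Idm Q) p q) x y" "le (homlat (Idm Q) p q) y x" for x y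
   using pq that by (intro ple_antisym[of "fst p" "fst q"]) (auto simp: ple_def)
  show "le (homlat (Idm Q) p q) x z"
   if "x \<in> carrier (homlat (Idm Q) p q)" "y \<in> carrier (homlat (Idm Q) p q)" "z \<in> carrier (homlat (Idm Q) p q)"
   "le (homlat (Idm Q) p q) x y" "le (homlat (Idm Q) p q) y z" for x y z
   using I.Leq_trans[OF pq, of x y z] that by (simp del: Idm_simps)
  show "\<exists>s. lub_in (homlat (Idm Q) p q) A s" if "A \<subseteq> carrier (homlat (Idm Q) p q)" for A
   using Idm_hsup(2)[OF pq, of A] that by auto
 qed (use pq in \<open>auto simp: Leq_refl\<close>)
 fix p q r g
 assume pqr: "p \<in> Ob (Idm Q)" "q \<in> Ob (Idm Q)" "r \<in> Ob (Idm Q)"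
 {
  assume g: "g \<in> Hom (Idm Q) q r"
  show "sup_pres (homlat (Idm Q) p q) (homlat (Idm Q) p r) (\<lambda>f. Comp (Idm Q) p q r g f)"
  proof (rule sup_presI[OF lat[OF pqr(1,2)] lat[OF pqr(1,3)]])
   fix A s assume s: "lub_in (homlat (Idm Q) p q) A s"
   have "lub_in (homlat Q (fst p) (fst r)) (Comp Q (fst p) (fst q) (fst r) g ` A) (Comp Q (fst p) (fst q) (fst r) g s)"
    using pqr g by (intro sup_pres_lub_in[OF Comp_sup_right _ Idm_lub[OF pqr(1,2) s]]) auto
   moreover have "Comp (Idm Q) p q r g f \<in> Hom (Idm Q) p r" if "f \<in> Hom (Idm Q) p q" for f
    by (rule I.Comp_in_Hom[OF pqr that g])
   ultimately show "lub_in (homlat (Idm Q) p r) ((\<lambda>f. Comp (Idm Q) p q r g f) ` A) (Comp (Idm Q) p q r g s)"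
    using s unfolding lub_in_def by auto
  qed
 next
  fix f assume f: "f \<in> Hom (Idm Q) p q"
  show "sup_pres (homlat (Idm Q) q r) (homlat (Idm Q) p r) (\<lambda>g. Comp (Idm Q) p q r g f)"
  proof (rule sup_presI[OF lat[OF pqr(2,3)] lat[OF pqr(1,3)]])
   fix A s assume s: "lub_in (homlat (Idm Q) q r) A s"
   have "lub_in (homlat Q (fst p) (fst r)) ((\<lambda>g. Comp Q (fst p) (fst q) (fst r) g f) ` A) (Comp Q (fst p) (fst q) (fst r) s f)"
    using pqr f by (intro sup_pres_lub_in[OF Comp_sup_left _ Idm_lub[OF pqr(2,3) s]]) auto
   moreover have "Comp (Idm Q) p q r g f \<in> Hom (Idm Q) p r" if "g \<in> Hom (Idm Q) q r" for g
    by (rule I.Comp_in_Hom[OF pqr f that])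
   ultimately show "lub_in (homlat (Idm Q) p r) ((\<lambda>g. Comp (Idm Q) p q r g f) ` A) (Comp (Idm Q) p q r s f)"
    using s unfolding lub_in_def by auto
  qed
 }
qed

end

lemma small_quantaloid_Idm:
 assumes U: "grothendieck_universe TYPE('u)" and Q: "small_quantaloid TYPE('u) Q"
 shows "small_quantaloid TYPE('u) (Idm Q)"
proof -
 have sm: "small TYPE('u) (Ob Q)" "\<And>X Y. [|X \<in> Ob Q; Y \<in> Ob Q|] ==> small TYPE('u) (Hom Q X Y)"
  and "quantaloid Q" using Q by (auto simp: small_quantaloid_def)
 have "small TYPE('u) (SIGMA X:Ob Q. Hom Q X X)" using sm by (intro small_Sigma[OF U]) auto
 then have "small TYPE('u) (Ob (Idm Q))" by (rule small_subset) auto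
 moreover have "small TYPE('u) (Hom (Idm Q) p q)" if "p \<in> Ob (Idm Q)" "q \<in> Ob (Idm Q)" for p q
  using that by (intro small_subset[OF sm(2)[of "fst p" "fst q"]]) auto
 ultimately show ?thesis
  using quantaloid.quantaloid_Idm[OF \<open>quantaloid Q\<close>] by (auto simp: small_quantaloid_def simp del: Idm_simps)
qed

definition Idm_map :: "('o, 'a, 'p, 'b) arrow_map => ('o \<times> 'a, 'a, 'p \<times> 'b, 'b) arrow_map" where
 "Idm_map F = \<lparr>FOb = (\<lambda>p. (FOb F (fst p), FArr F (fst p) (fst p) (snd p))),
        FArr = (\<lambda>p q. FArr F (fst p) (fst q))\<rparr>"

lemma Idm_map_simps [simp]:
 "FOb (Idm_map F) p = (FOb F (fst p), FArr F (fst p) (fst p) (snd p))"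
 "FArr (Idm_map F) p q = FArr F (fst p) (fst q)"
 by (simp_all add: Idm_map_def)

text \<open>An idempotent \<open>e\<close> on an object isomorphic to \<open>F X\<close> is conjugate to an
 idempotent on \<open>F X\<close>, which is the image of one on \<open>X\<close>; the conjugating
 arrows cut down by \<open>e\<close> are an isomorphism of idempotents.\<close>

lemma Idm_map_weak_equivalence:
 fixes Q :: "('o, 'a) locat" and R :: "('p, 'b) locat"
 assumes Q: "quantaloid Q" and R: "quantaloid R" and F: "weak_equivalence Q R F"
 shows "weak_equivalence (Idm Q) (Idm R) (Idm_map F)"
proof -
 interpret Q: quantaloid Q by fact
 interpret R: quantaloid R by fact
 note W = weak_equivalenceD[OF F]
 note FD = homomorphismD[OF W(1)]
 have comp: "Comp R (FOb F X) (FOb F Y) (FOb F Z) (FArr F Y Z g) (FArr F X Y f) = FArr F X Z (Comp Q X Y Z g f)"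
  if "X \<in> Ob Q" "Y \<in> Ob Q" "Z \<in> Ob Q" "f \<in> Hom Q X Y" "g \<in> Hom Q Y Z" for X Y Z f g
  using FD(4) that by simp
 have inj: "FArr F X Y f = FArr F X Y g \<longleftrightarrow> f = g" if "X \<in> Ob Q" "Y \<in> Ob Q" "f \<in> Hom Q X Y" "g \<in> Hom Q X Y" for X Y f g
  using W(2)[OF that(1,2)] that(3,4) by (auto simp: bij_betw_def inj_on_eq_iff)
 have lift: "\<exists>f\<in>Hom Q X Y. FArr F X Y f = h" if "X \<in> Ob Q" "Y \<in> Ob Q" "h \<in> Hom R (FOb F X) (FOb F Y)" for X Y h
  using W(2)[OF that(1,2)] that(3) unfolding bij_betw_def by (metis imageE)
 have ob: "FOb (Idm_map F) p \<in> Ob (Idm R)" if "p \<in> Ob (Idm Q)" for p using that FD(1,2) by (simp add: comp)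
 have arr: "FArr (Idm_map F) p q b \<in> Hom (Idm R) (FOb (Idm_map F) p) (FOb (Idm_map F) q) \<longleftrightarrow> b \<in> Hom (Idm Q) p q"
  if "p \<in> Ob (Idm Q)" "q \<in> Ob (Idm Q)" "b \<in> Hom Q (fst p) (fst q)" for p q b
  using that FD(2) by (simp add: comp inj)
 show ?thesis
 proof (rule weak_equivalenceI[OF Q.quantaloid_Idm R.quantaloid_Idm ob])
  fix p q b b' assume p: "p \<in> Ob (Idm Q)" "q \<in> Ob (Idm Q)" and b: "b \<in> Hom (Idm Q) p q" "b' \<in> Hom (Idm Q) p q"
  have bQ: "b \<in> Hom Q (fst p) (fst q)" "b' \<in> Hom Q (fst p) (fst q)" "fst p \<in> Ob Q" "fst q \<in> Ob Q" using p b by simp_all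
  have "ple (Idm R) (FOb (Idm_map F) p) (FOb (Idm_map F) q) (FArr (Idm_map F) p q b) (FArr (Idm_map F) p q b')
   \<longleftrightarrow> ple R (FOb F (fst p)) (FOb F (fst q)) (FArr F (fst p) (fst q) b) (FArr F (fst p) (fst q) b')"
   using ob p b bQ FD(1,2) arr[OF p bQ(1)] arr[OF p bQ(2)] unfolding ple_def by simp
  also have "\<dots> \<longleftrightarrow> ple Q (fst p) (fst q) b b'"
   using W(3)[OF bQ(3,4,1,2)] homomorphism_mono[OF W(1)] by blast
  also have "\<dots> \<longleftrightarrow> ple (Idm Q) p q b b'" using p b by (simp add: ple_def)
  finally show "ple (Idm R) (FOb (Idm_map F) p) (FOb (Idm_map F) q) (FArr (Idm_map F) p q b) (FArr (Idm_map F) p q b')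
   \<longleftrightarrow> ple (Idm Q) p q b b'" .
 next
  fix p q h assume p: "p \<in> Ob (Idm Q)" "q \<in> Ob (Idm Q)" and h: "h \<in> Hom (Idm R) (FOb (Idm_map F) p) (FOb (Idm_map F) q)"
  obtain b where b: "b \<in> Hom Q (fst p) (fst q)" "FArr F (fst p) (fst q) b = h" using lift[of "fst p" "fst q" h] p h by auto
  then show "\<exists>b\<in>Hom (Idm Q) p q. FArr (Idm_map F) p q b = h" using arr[OF p b(1)] h by (intro bexI[of _ b]) (simp_all del: Idm_simps)
 next
  fix r assume r: "r \<in> Ob (Idm R)"
  let ?Y = "fst r" and ?u = "snd r"
  have Y: "?Y \<in> Ob R" "?u \<in> Hom R ?Y ?Y" "Comp R ?Y ?Y ?Y ?u ?u = ?u" using r by simp_all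
  obtain X i j where X: "X \<in> Ob Q" and e: "equiv_pair R ?Y (FOb F X) i j" using W(4)[OF Y(1)] by blast
  note e = equiv_pairD[OF e]
  have ji: "Comp R ?Y (FOb F X) ?Y j i = Ident R ?Y" using R.pis_eq[OF e(5)] .
  have cancel: "Comp R Z (FOb F X) ?Y j (Comp R Z ?Y (FOb F X) i f) = f" "Comp R Z ?Y ?Y ?u (Comp R Z ?Y ?Y ?u f) = Comp R Z ?Y ?Y ?u f"
   if "Z \<in> Ob R" "f \<in> Hom R Z ?Y" for Z f
   using that Y e ji by (simp_all flip: R.Comp_assoc)
  let ?v = "Comp R (FOb F X) ?Y (FOb F X) i (Comp R (FOb F X) ?Y ?Y ?u j)"
  let ?s = "Comp R ?Y ?Y (FOb F X) i ?u" and ?t = "Comp R (FOb F X) ?Y ?Y ?u j"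
  have v: "?v \<in> Hom R (FOb F X) (FOb F X)" using Y e by simp
  have vv: "Comp R (FOb F X) (FOb F X) (FOb F X) ?v ?v = ?v" using Y e by (simp add: R.Comp_assoc cancel)
  obtain w where w: "w \<in> Hom Q X X" "FArr F X X w = ?v" using lift[OF X X v] by blast
  have ww: "Comp Q X X X w w = w"
   using inj[of X X "Comp Q X X X w w" w] X w vv FD(4)[OF X X X w(1) w(1)] by simp
  have p: "(X, w) \<in> Ob (Idm Q)" using X w ww by simp
  have "?s \<in> Hom (Idm R) r (FOb (Idm_map F) (X, w))" "?t \<in> Hom (Idm R) (FOb (Idm_map F) (X, w)) r"
   "Comp R ?Y (FOb F X) ?Y ?t ?s = ?u" "Comp R (FOb F X) ?Y (FOb F X) ?s ?t = ?v"
   using Y e w(2) by (simp_all add: R.Comp_assoc cancel)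
  then have "equiv_pair (Idm R) r (FOb (Idm_map F) (X, w)) ?s ?t"
   unfolding equiv_pair_def using r ob[OF p] Y v vv w(2) by (auto simp: pis_def ple_def R.Leq_refl)
  then show "\<exists>p\<in>Ob (Idm Q). \<exists>i j. equiv_pair (Idm R) r (FOb (Idm_map F) p) i j" using p by blast
 qed (use arr FD(1-4) in \<open>simp_all del: Idm_simps(2)\<close>, simp_all)
qed

lemma homomorphism_comp:
 assumes F: "homomorphism Q R F" and G: "homomorphism R S G"
 shows "homomorphism Q S (comp_map G F)"
proof -
 note FD = homomorphismD[OF F] and GD = homomorphismD[OF G]
 have "sup_pres (homlat Q X Y) (homlat S (FOb G (FOb F X)) (FOb G (FOb F Y)))
   (\<lambda>f. FArr G (FOb F X) (FOb F Y) (FArr F X Y f))" if "X \<in> Ob Q" "Y \<in> Ob Q" for X Y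
  using that FD GD by (intro sup_pres_comp[OF FD(5)]) auto
 moreover have "FArr (comp_map G F) X Y = (\<lambda>f. FArr G (FOb F X) (FOb F Y) (FArr F X Y f))" for X Y
  by (rule ext) simp
 ultimately show ?thesis unfolding homomorphism_def using FD GD by (auto simp: Pi_iff)
qed

section \<open>Enriched categories and distributors, elementwise\<close>

text \<open>The underlying order of an enriched category, in which only elements of the same type are
 comparable. Functors are compared through it pointwise.\<close>

definition eleq :: "('o, 'a) locat => ('u, 'o, 'a) ecat => 'u => 'u => bool" where
 "eleq R A a b \<longleftrightarrow> a \<in> Elts A \<and> b \<in> Elts A \<and> Typ A a = Typ A b \<and>
   ple R (Typ A a) (Typ A a) (Ident R (Typ A a)) (EHom A a b)"

lemma ecatD:
 assumes "enriched_category R (A :: ('u, 'o, 'a) ecat)"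
 shows "small TYPE('u) (Elts A)" "a \<in> Elts A ==> Typ A a \<in> Ob R"
  "[|a' \<in> Elts A; a \<in> Elts A|] ==> EHom A a' a \<in> Hom R (Typ A a) (Typ A a')"
 using assms unfolding enriched_category_def by blast+

context quantaloid
begin

lemma ecat_comp:
 assumes "enriched_category Q A" "a'' \<in> Elts A" "a' \<in> Elts A" "a \<in> Elts A"
 shows "ple Q (Typ A a) (Typ A a'') (Comp Q (Typ A a) (Typ A a') (Typ A a'') (EHom A a'' a') (EHom A a' a)) (EHom A a'' a)"
 using assms ecatD[OF assms(1)] by (intro pleI) (auto simp: enriched_category_def)

lemma ecat_id:
 assumes "enriched_category Q A" "a \<in> Elts A"
 shows "ple Q (Typ A a) (Typ A a) (Ident Q (Typ A a)) (EHom A a a)"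
 using assms ecatD[OF assms(1)] by (intro pleI) (auto simp: enriched_category_def)

lemma enriched_categoryI:
 assumes "small TYPE('u) (Elts (A :: ('u, 'o, 'a) ecat))" "\<And>a. a \<in> Elts A ==> Typ A a \<in> Ob Q"
  "\<And>a' a. [|a' \<in> Elts A; a \<in> Elts A|] ==> EHom A a' a \<in> Hom Q (Typ A a) (Typ A a')"
  "\<And>a'' a' a. [|a'' \<in> Elts A; a' \<in> Elts A; a \<in> Elts A|] ==>
   ple Q (Typ A a) (Typ A a'') (Comp Q (Typ A a) (Typ A a') (Typ A a'') (EHom A a'' a') (EHom A a' a)) (EHom A a'' a)"
  "\<And>a. a \<in> Elts A ==> ple Q (Typ A a) (Typ A a) (Ident Q (Typ A a)) (EHom A a a)"
 shows "enriched_category Q A"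
 unfolding enriched_category_def using assms(1-3) pleD(1)[OF assms(4)] pleD(1)[OF assms(5)] by blast

lemma eleq_refl: "enriched_category Q A ==> a \<in> Elts A ==> eleq Q A a a"
 by (simp add: eleq_def ecat_id)

lemma eleq_right:
 assumes A: "enriched_category Q A" and ab: "eleq Q A a b" and c: "c \<in> Elts A"
 shows "ple Q (Typ A a) (Typ A c) (EHom A c a) (EHom A c b)"
proof -
 have e: "a \<in> Elts A" "b \<in> Elts A" "Typ A b = Typ A a" "ple Q (Typ A a) (Typ A a) (Ident Q (Typ A a)) (EHom A a b)"
  using ab by (auto simp: eleq_def)
 note AD = ecatD(2,3)[OF A]
 have "EHom A c a = Comp Q (Typ A a) (Typ A a) (Typ A c) (EHom A c a) (Ident Q (Typ A a))"
  using AD e c by simp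
 also have "ple Q (Typ A a) (Typ A c) \<dots> (Comp Q (Typ A a) (Typ A a) (Typ A c) (EHom A c a) (EHom A a b))"
  using AD e c by (intro ple_comp_right) auto
 also have "ple Q (Typ A a) (Typ A c) \<dots> (EHom A c b)"
  using ecat_comp[OF A c e(1,2)] e by simp
 finally show ?thesis .
qed

lemma eleq_left:
 assumes A: "enriched_category Q A" and ab: "eleq Q A a b" and c: "c \<in> Elts A"
 shows "ple Q (Typ A c) (Typ A a) (EHom A b c) (EHom A a c)"
proof -
 have e: "a \<in> Elts A" "b \<in> Elts A" "Typ A b = Typ A a" "ple Q (Typ A a) (Typ A a) (Ident Q (Typ A a)) (EHom A a b)"
  using ab by (auto simp: eleq_def)
 have h: "EHom A b c \<in> Hom Q (Typ A c) (Typ A a)" using ecatD(3)[OF A e(2) c] e(3) by simp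
 note AD = ecatD(2,3)[OF A]
 have "EHom A b c = Comp Q (Typ A c) (Typ A a) (Typ A a) (Ident Q (Typ A a)) (EHom A b c)"
  using AD e(1) c h by simp
 also have "ple Q (Typ A c) (Typ A a) \<dots> (Comp Q (Typ A c) (Typ A a) (Typ A a) (EHom A a b) (EHom A b c))"
  using AD e(1,4) c h by (intro ple_comp_left) auto
 also have "ple Q (Typ A c) (Typ A a) \<dots> (EHom A a c)"
  using ecat_comp[OF A e(1,2) c] e by simp
 finally show ?thesis .
qed

lemma eleq_trans:
 assumes A: "enriched_category Q A" and ab: "eleq Q A a b" and bc: "eleq Q A b c"
 shows "eleq Q A a c"
proof -
 have e: "a \<in> Elts A" "b \<in> Elts A" "c \<in> Elts A" "Typ A b = Typ A a" "Typ A c = Typ A a"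
  "ple Q (Typ A a) (Typ A a) (Ident Q (Typ A a)) (EHom A a b)"
  using ab bc by (auto simp: eleq_def)
 have "ple Q (Typ A a) (Typ A a) (EHom A a b) (EHom A a c)"
  using eleq_right[OF A bc e(1)] e by simp
 then show ?thesis using ple_trans[OF e(6)] e by (simp add: eleq_def)
qed

lemma functor_in: "enriched_functor Q A B F ==> a \<in> Elts A ==> F a \<in> Elts B"
 by (auto simp: enriched_functor_def)

lemma functor_typ: "enriched_functor Q A B F ==> a \<in> Elts A ==> Typ B (F a) = Typ A a"
 by (simp add: enriched_functor_def)

lemma functor_hom_in:
 assumes "enriched_category Q B" "enriched_functor Q A B F" "a' \<in> Elts A" "a \<in> Elts A"
 shows "EHom B (F a') (F a) \<in> Hom Q (Typ A a) (Typ A a')"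
 using ecatD(3)[OF assms(1) functor_in[OF assms(2,3)] functor_in[OF assms(2,4)]] functor_typ[OF assms(2)] assms(3,4) by simp

lemma functor_ple:
 assumes "enriched_category Q A" "enriched_category Q B" "enriched_functor Q A B F" "a' \<in> Elts A" "a \<in> Elts A"
 shows "ple Q (Typ A a) (Typ A a') (EHom A a' a) (EHom B (F a') (F a))"
 using assms ecatD[OF assms(1)] functor_hom_in[OF assms(2-5)]
 by (intro pleI) (auto simp: enriched_functor_def)

lemma functorI:
 assumes "F \<in> extensional (Elts A)" "\<And>a. a \<in> Elts A ==> F a \<in> Elts B" "\<And>a. a \<in> Elts A ==> Typ B (F a) = Typ A a"
  "\<And>a' a. [|a' \<in> Elts A; a \<in> Elts A|] ==> ple Q (Typ A a) (Typ A a') (EHom A a' a) (EHom B (F a') (F a))"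
 shows "enriched_functor Q A B F"
 using assms by (auto simp: enriched_functor_def PiE_def ple_def)

lemma functor_eleq:
 assumes "enriched_category Q A" "enriched_category Q B" "enriched_functor Q A B F" "eleq Q A a b"
 shows "eleq Q B (F a) (F b)"
 using assms(4) functor_in[OF assms(3)] functor_typ[OF assms(3)] functor_ple[OF assms(1-3), of a b]
 unfolding eleq_def by (auto intro: ple_trans)

lemma functor_le_iff:
 assumes "enriched_category Q B" "enriched_functor Q A B F" "enriched_functor Q A B G" "enriched_category Q A"
 shows "functor_le Q A B F G \<longleftrightarrow> (\<forall>a\<in>Elts A. eleq Q B (F a) (G a))"
proof -
 have "EHom B (F a) (G a) \<in> Hom Q (Typ A a) (Typ A a)" if "a \<in> Elts A" for a
  using ecatD(3)[OF assms(1) functor_in[OF assms(2) that] functor_in[OF assms(3) that]] that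
   functor_typ[OF assms(2)] functor_typ[OF assms(3)] by simp
 then show ?thesis
  using functor_in[OF assms(2)] functor_in[OF assms(3)] functor_typ[OF assms(2)] functor_typ[OF assms(3)] ecatD(2)[OF assms(4)]
  by (auto simp: functor_le_def eleq_def ple_def)
qed

lemma functor_comp:
 assumes A: "enriched_category Q A" and B: "enriched_category Q B" and C: "enriched_category Q C"
  and F: "enriched_functor Q A B F" and G: "enriched_functor Q B C G"
 shows "enriched_functor Q A C (compose (Elts A) G F)"
proof (rule functorI)
 fix a' a assume a: "a' \<in> Elts A" "a \<in> Elts A"
 have "ple Q (Typ A a) (Typ A a') (EHom A a' a) (EHom B (F a') (F a))" by (rule functor_ple[OF A B F a])
 also have "ple Q (Typ A a) (Typ A a') \<dots> (EHom C (G (F a')) (G (F a)))"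
  using functor_ple[OF B C G functor_in[OF F a(1)] functor_in[OF F a(2)]] functor_typ[OF F] a by simp
 finally show "ple Q (Typ A a) (Typ A a') (EHom A a' a) (EHom C (compose (Elts A) G F a') (compose (Elts A) G F a))"
  using a by (simp add: compose_def)
qed (use functor_in[OF F] functor_in[OF G] functor_typ[OF F] functor_typ[OF G] in \<open>auto simp: compose_def\<close>)

lemma functor_id: "enriched_category Q A ==> enriched_functor Q A A (\<lambda>a\<in>Elts A. a)"
 using ecatD(2,3) by (intro functorI) (auto intro!: ple_refl)

text \<open>A family of arrows \<open>\<phi>\<^sub>i : X \<rightarrow> t (J i)\<close> and \<open>\<psi>\<^sub>i : t (J i) \<rightarrow> X\<close> generates an
 adjoint pair of distributors between \<open>B\<close> and the one-object category of type \<open>X\<close>. Since it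
 need not be closed under the action of \<open>B\<close>, such data are transported along functors without
 effort.\<close>

definition adj_family :: "'u set => ('u => 'u) => ('u, 'o, 'a) ecat => 'o => ('u => 'a) => ('u => 'a) => bool" where
 "adj_family I J B X \<phi> \<psi> \<longleftrightarrow> X \<in> Ob Q \<and>
   (\<forall>i\<in>I. J i \<in> Elts B \<and> \<phi> i \<in> Hom Q X (Typ B (J i)) \<and> \<psi> i \<in> Hom Q (Typ B (J i)) X) \<and>
   ple Q X X (Ident Q X) (hsup Q X X ((\<lambda>i. Comp Q X (Typ B (J i)) X (\<psi> i) (\<phi> i)) ` I)) \<and>
   (\<forall>i\<in>I. \<forall>i'\<in>I. ple Q (Typ B (J i')) (Typ B (J i))
    (Comp Q (Typ B (J i')) X (Typ B (J i)) (\<phi> i) (\<psi> i')) (EHom B (J i) (J i')))"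

lemma adj_familyD:
 assumes "adj_family I J B X \<phi> \<psi>"
 shows "X \<in> Ob Q" "i \<in> I ==> J i \<in> Elts B" "i \<in> I ==> \<phi> i \<in> Hom Q X (Typ B (J i))" "i \<in> I ==> \<psi> i \<in> Hom Q (Typ B (J i)) X"
  "ple Q X X (Ident Q X) (hsup Q X X ((\<lambda>i. Comp Q X (Typ B (J i)) X (\<psi> i) (\<phi> i)) ` I))"
  "[|i \<in> I; i' \<in> I|] ==> ple Q (Typ B (J i')) (Typ B (J i)) (Comp Q (Typ B (J i')) X (Typ B (J i)) (\<phi> i) (\<psi> i')) (EHom B (J i) (J i'))"
 using assms unfolding adj_family_def by blast+

text \<open>An inequality between arrows out of \<open>X\<close> can be tested after composing with all
 \<open>\<psi>\<^sub>i \<circ> \<phi>\<^sub>i\<close>, because their supremum lies above the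
 identity and composition preserves suprema.\<close>

lemma adj_family_unit:
 assumes B: "enriched_category Q B" and ad: "adj_family I J B X \<phi> \<psi>"
  and Z: "Z \<in> Ob Q" and f: "f \<in> Hom Q X Z" and g: "g \<in> Hom Q X Z"
  and le: "\<And>i. i \<in> I ==> ple Q X Z (Comp Q X (Typ B (J i)) Z (Comp Q (Typ B (J i)) X Z f (\<psi> i)) (\<phi> i)) g"
 shows "ple Q X Z f g"
proof -
 note D = adj_familyD[OF ad]
 let ?S = "(\<lambda>i. Comp Q X (Typ B (J i)) X (\<psi> i) (\<phi> i)) ` I"
 have "f = Comp Q X X Z f (Ident Q X)" using D(1) Z f by simp
 also have "ple Q X Z \<dots> (Comp Q X X Z f (hsup Q X X ?S))" by (rule ple_comp_right[OF D(5) Z f])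
 also have "ple Q X Z \<dots> g"
 proof (rule comp_hsup_right_le)
  fix h assume "h \<in> ?S"
  then obtain i where "i \<in> I" "h = Comp Q X (Typ B (J i)) X (\<psi> i) (\<phi> i)" by blast
  then show "ple Q X Z (Comp Q X X Z f h) g"
   using le[of i] D(1-4) Z f ecatD(2)[OF B] by (simp add: Comp_assoc)
 qed (use D(1-4) Z f g ecatD(2)[OF B] in auto)
 finally show ?thesis .
qed

text \<open>The distributors \<open>\<Phi> b = \<Squnion>\<^sub>i B(b, J i) \<circ> \<phi>\<^sub>i\<close>
 and \<open>\<Psi> b = \<Squnion>\<^sub>i \<psi>\<^sub>i \<circ> B(J i, b)\<close> between
 \<open>B\<close> and the one-object category of type \<open>X\<close> are adjoint, and
 \<open>c\<close> is the element that represents \<open>\<Phi>\<close>.\<close>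

lemma cauchy_complete_family:
 fixes B :: "('u, 'o, 'a) ecat"
 assumes U: "grothendieck_universe TYPE('u)" and cc: "cauchy_complete Q B" and B: "enriched_category Q B"
  and ad: "adj_family I J B X \<phi> \<psi>"
 shows "\<exists>c\<in>Elts B. Typ B c = X \<and>
  (\<forall>i\<in>I. ple Q X (Typ B (J i)) (\<phi> i) (EHom B (J i) c) \<and> ple Q (Typ B (J i)) X (\<psi> i) (EHom B c (J i)))"
proof -
 note D = adj_familyD[OF ad] and BD = ecatD(2,3)[OF B]
 define One :: "('u, 'o, 'a) ecat" where "One = \<lparr>Elts = {undefined}, Typ = (\<lambda>_. X), EHom = (\<lambda>_ _. Ident Q X)\<rparr>"
 have One: "enriched_category Q One"
  using D(1) small_finite[OF U, of "{undefined}"] by (intro enriched_categoryI) (auto simp: One_def intro!: ple_refl)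
 let ?S = "\<lambda>b. (\<lambda>i. Comp Q X (Typ B (J i)) (Typ B b) (EHom B b (J i)) (\<phi> i)) ` I"
 let ?T = "\<lambda>b. (\<lambda>i. Comp Q (Typ B b) (Typ B (J i)) X (\<psi> i) (EHom B (J i) b)) ` I"
 have S: "?S b \<subseteq> Hom Q X (Typ B b)" "?T b \<subseteq> Hom Q (Typ B b) X" if "b \<in> Elts B" for b using that D(1-4) BD by auto
 define \<Phi> where "\<Phi> b = hsup Q X (Typ B b) (?S b)" for b
 define \<Psi> where "\<Psi> b = hsup Q (Typ B b) X (?T b)" for b
 have in_Hom: "\<Phi> b \<in> Hom Q X (Typ B b)" "\<Psi> b \<in> Hom Q (Typ B b) X" if "b \<in> Elts B" for b
  unfolding \<Phi>_def \<Psi>_def using that S[OF that] D(1) BD(1) by (auto intro: hsup_in)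
 have upper: "ple Q X (Typ B b) (Comp Q X (Typ B (J i)) (Typ B b) (EHom B b (J i)) (\<phi> i)) (\<Phi> b)"
   "ple Q (Typ B b) X (Comp Q (Typ B b) (Typ B (J i)) X (\<psi> i) (EHom B (J i) b)) (\<Psi> b)" if "i \<in> I" "b \<in> Elts B" for i b
  unfolding \<Phi>_def \<Psi>_def using that S[OF that(2)] D(1) BD(1) by (auto intro!: hsup_upper)
 have phi_le: "ple Q X (Typ B (J i)) (\<phi> i) (\<Phi> (J i))" and psi_le: "ple Q (Typ B (J i)) X (\<psi> i) (\<Psi> (J i))" if i: "i \<in> I" for i
  using ple_trans[OF ple_comp_left[OF ecat_id[OF B D(2)[OF i]] D(1) D(3)[OF i]] upper(1)[OF i D(2)[OF i]]]
   ple_trans[OF ple_comp_right[OF ecat_id[OF B D(2)[OF i]] D(1) D(4)[OF i]] upper(2)[OF i D(2)[OF i]]] i D(1-4) BD(1) by simp_all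
 have 1: "ple Q X (Typ B b) (Comp Q X (Typ B b') (Typ B b) (EHom B b b') (\<Phi> b')) (\<Phi> b)" if b: "b \<in> Elts B" "b' \<in> Elts B" for b b'
  unfolding \<Phi>_def[of b']
 proof (rule comp_hsup_right_le)
  fix f assume "f \<in> ?S b'"
  then obtain i where i: "i \<in> I" "f = Comp Q X (Typ B (J i)) (Typ B b') (EHom B b' (J i)) (\<phi> i)" by blast
  have "Comp Q X (Typ B b') (Typ B b) (EHom B b b') f
   = Comp Q X (Typ B (J i)) (Typ B b) (Comp Q (Typ B (J i)) (Typ B b') (Typ B b) (EHom B b b') (EHom B b' (J i))) (\<phi> i)"
   using i b D(1-4) BD by (simp add: Comp_assoc)
  also have "ple Q X (Typ B b) \<dots> (Comp Q X (Typ B (J i)) (Typ B b) (EHom B b (J i)) (\<phi> i))"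
   by (rule ple_comp_left[OF ecat_comp[OF B b D(2)[OF i(1)]] D(1) D(3)[OF i(1)]])
  also note upper(1)[OF i(1) b(1)]
  finally show "ple Q X (Typ B b) (Comp Q X (Typ B b') (Typ B b) (EHom B b b') f) (\<Phi> b)" .
 qed (use b D(1) BD S in_Hom in auto)
 have 2: "ple Q (Typ B b) X (Comp Q (Typ B b) (Typ B b') X (\<Psi> b') (EHom B b' b)) (\<Psi> b)" if b: "b' \<in> Elts B" "b \<in> Elts B" for b b'
  unfolding \<Psi>_def[of b']
 proof (rule comp_hsup_left_le)
  fix f assume "f \<in> ?T b'"
  then obtain i where i: "i \<in> I" "f = Comp Q (Typ B b') (Typ B (J i)) X (\<psi> i) (EHom B (J i) b')" by blast
  have "Comp Q (Typ B b) (Typ B b') X f (EHom B b' b)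
   = Comp Q (Typ B b) (Typ B (J i)) X (\<psi> i) (Comp Q (Typ B b) (Typ B b') (Typ B (J i)) (EHom B (J i) b') (EHom B b' b))"
   using i b D(1-4) BD by (simp add: Comp_assoc)
  also have "ple Q (Typ B b) X \<dots> (Comp Q (Typ B b) (Typ B (J i)) X (\<psi> i) (EHom B (J i) b))"
   by (rule ple_comp_right[OF ecat_comp[OF B D(2)[OF i(1)] b] D(1) D(4)[OF i(1)]])
  also note upper(2)[OF i(1) b(2)]
  finally show "ple Q (Typ B b) X (Comp Q (Typ B b) (Typ B b') X f (EHom B b' b)) (\<Psi> b)" .
 qed (use b D(1) BD S in_Hom in auto)
 have 3: "ple Q X X (Ident Q X) (hsup Q X X ((\<lambda>b. Comp Q X (Typ B b) X (\<Psi> b) (\<Phi> b)) ` Elts B))"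
 proof (rule adj_family_unit[OF B ad D(1)])
  fix i assume i: "i \<in> I"
  have "ple Q X X (Comp Q X (Typ B (J i)) X (\<psi> i) (\<phi> i)) (Comp Q X (Typ B (J i)) X (\<Psi> (J i)) (\<Phi> (J i)))"
   by (rule ple_comp[OF phi_le[OF i] psi_le[OF i]])
  also have "ple Q X X \<dots> (hsup Q X X ((\<lambda>b. Comp Q X (Typ B b) X (\<Psi> b) (\<Phi> b)) ` Elts B))"
   using in_Hom D(1) BD(1) by (intro hsup_upper[OF D(1) D(1) _ imageI[OF D(2)[OF i]]]) auto
  finally show "ple Q X X (Comp Q X (Typ B (J i)) X (Comp Q (Typ B (J i)) X X (Ident Q X) (\<psi> i)) (\<phi> i))
   (hsup Q X X ((\<lambda>b. Comp Q X (Typ B b) X (\<Psi> b) (\<Phi> b)) ` Elts B))" using i D(1-4) BD(1) by simp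
 qed (use D(1) BD(1) in_Hom in \<open>auto intro!: hsup_in\<close>)
 have below: "ple Q (Typ B b') (Typ B b) (Comp Q (Typ B b') X (Typ B b) (\<Phi> b) f) (EHom B b b')"
  if b: "b \<in> Elts B" "b' \<in> Elts B" and f: "f \<in> Hom Q (Typ B b') X"
   and le: "\<And>i. i \<in> I ==> ple Q (Typ B b') (Typ B (J i)) (Comp Q (Typ B b') X (Typ B (J i)) (\<phi> i) f) (EHom B (J i) b')" for b b' f
  unfolding \<Phi>_def
 proof (rule comp_hsup_left_le)
  fix g assume "g \<in> ?S b"
  then obtain i where i: "i \<in> I" "g = Comp Q X (Typ B (J i)) (Typ B b) (EHom B b (J i)) (\<phi> i)" by blast
  have "Comp Q (Typ B b') X (Typ B b) g f = Comp Q (Typ B b') (Typ B (J i)) (Typ B b) (EHom B b (J i)) (Comp Q (Typ B b') X (Typ B (J i)) (\<phi> i) f)"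
   using i b f D(1-4) BD by (simp add: Comp_assoc)
  also have "ple Q (Typ B b') (Typ B b) \<dots> (Comp Q (Typ B b') (Typ B (J i)) (Typ B b) (EHom B b (J i)) (EHom B (J i) b'))"
   using i b D(2) BD by (intro ple_comp_right[OF le]) auto
  also note ecat_comp[OF B b(1) D(2)[OF i(1)] b(2)]
  finally show "ple Q (Typ B b') (Typ B b) (Comp Q (Typ B b') X (Typ B b) g f) (EHom B b b')" .
 qed (use b f D(1) BD S in auto)
 have 4: "ple Q (Typ B b') (Typ B b) (Comp Q (Typ B b') X (Typ B b) (\<Phi> b) (\<Psi> b')) (EHom B b b')" if b: "b \<in> Elts B" "b' \<in> Elts B" for b b'
 proof (rule below[OF b in_Hom(2)[OF b(2)]])
  fix i assume i: "i \<in> I"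
  show "ple Q (Typ B b') (Typ B (J i)) (Comp Q (Typ B b') X (Typ B (J i)) (\<phi> i) (\<Psi> b')) (EHom B (J i) b')"
   unfolding \<Psi>_def
  proof (rule comp_hsup_right_le)
   fix f assume "f \<in> ?T b'"
   then obtain i' where i': "i' \<in> I" "f = Comp Q (Typ B b') (Typ B (J i')) X (\<psi> i') (EHom B (J i') b')" by blast
   have "Comp Q (Typ B b') X (Typ B (J i)) (\<phi> i) f
    = Comp Q (Typ B b') (Typ B (J i')) (Typ B (J i)) (Comp Q (Typ B (J i')) X (Typ B (J i)) (\<phi> i) (\<psi> i')) (EHom B (J i') b')"
    using i i' b D(1-4) BD by (simp add: Comp_assoc)
   also have "ple Q (Typ B b') (Typ B (J i)) \<dots> (Comp Q (Typ B b') (Typ B (J i')) (Typ B (J i)) (EHom B (J i) (J i')) (EHom B (J i') b'))"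
    using i' b D(2) BD by (intro ple_comp_left[OF D(6)[OF i i'(1)]]) auto
   also note ecat_comp[OF B D(2)[OF i] D(2)[OF i'(1)] b(2)]
   finally show "ple Q (Typ B b') (Typ B (J i)) (Comp Q (Typ B b') X (Typ B (J i)) (\<phi> i) f) (EHom B (J i) b')" .
  qed (use i b D(1-4) BD S in auto)
 qed
 have "left_adjoint_distributor Q One B (\<lambda>b _. \<Phi> b)"
  unfolding left_adjoint_distributor_def
 proof (intro conjI exI[of _ "\<lambda>_ b. \<Psi> b"])
  show "distributor Q One B (\<lambda>b _. \<Phi> b)" "distributor Q B One (\<lambda>_ b. \<Psi> b)"
   using in_Hom D(1) BD(1) pleD(1)[OF 1] pleD(1)[OF 2] by (auto simp: distributor_def One_def Leq_refl)
  show "distributor_le Q One One (EHom One) (distributor_comp Q One B One (\<lambda>_ b. \<Psi> b) (\<lambda>b _. \<Phi> b))"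
   using pleD(1)[OF 3] by (simp add: distributor_le_def distributor_comp_def One_def)
  have "hsup Q (Typ B b') (Typ B b) {f} = f" if "b \<in> Elts B" "b' \<in> Elts B" "f \<in> Hom Q (Typ B b') (Typ B b)" for b b' f
   using that BD(1) by (intro lub_in_eq_sup[OF homlat_complete]) (auto simp: lub_in_def Leq_refl)
  then show "distributor_le Q B B (distributor_comp Q B One B (\<lambda>b _. \<Phi> b) (\<lambda>_ b. \<Psi> b)) (EHom B)"
   using pleD(1)[OF 4] in_Hom D(1) BD(1) by (simp add: distributor_le_def distributor_comp_def One_def)
 qed
 then obtain F where F: "enriched_functor Q One B F" "\<And>b. b \<in> Elts B ==> \<Phi> b = EHom B b (F undefined)"
  using cc One unfolding cauchy_complete_def by (force simp: One_def)
 let ?c = "F undefined"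
 have c: "?c \<in> Elts B" "Typ B ?c = X" using F(1) by (auto simp: enriched_functor_def One_def)
 have "ple Q (Typ B (J i)) X (\<psi> i) (EHom B ?c (J i))" if i: "i \<in> I" for i
 proof -
  have "\<psi> i = Comp Q (Typ B (J i)) X X (Ident Q X) (\<psi> i)" using i D(1-4) BD(1) by simp
  also have "ple Q (Typ B (J i)) X \<dots> (Comp Q (Typ B (J i)) X X (\<Phi> ?c) (\<psi> i))"
   using ecat_id[OF B c(1)] c i D(2,4) BD(1) by (intro ple_comp_left) (auto simp: F(2)[OF c(1)])
  also have "ple Q (Typ B (J i)) X \<dots> (EHom B ?c (J i))"
   using below[OF c(1) D(2)[OF i] D(4)[OF i]] D(6)[OF _ i] c(2) by simp
  finally show ?thesis .
 qed
 then show ?thesis using c phi_le F(2) D(2) by (intro bexI[of _ ?c]) auto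
qed

text \<open>Each column of a left adjoint distributor is a generating family. The element \<open>c\<close>
 obtained for it represents the column: one inequality is the bound on \<open>\<phi>\<close>, the
 other follows from the bound on \<open>\<psi>\<close> by the unit.\<close>

lemma cauchy_completeI:
 fixes C :: "('u, 'o, 'a) ecat"
 assumes C: "enriched_category Q C"
  and ex: "\<And>X \<phi> \<psi>. adj_family (Elts C) (\<lambda>c. c) C X \<phi> \<psi> ==> \<exists>c\<in>Elts C. Typ C c = X \<and>
   (\<forall>b\<in>Elts C. ple Q X (Typ C b) (\<phi> b) (EHom C b c) \<and> ple Q (Typ C b) X (\<psi> b) (EHom C c b))"
 shows "cauchy_complete Q C"
 unfolding cauchy_complete_def
proof (intro allI impI, elim conjE)
 fix A :: "('u, 'o, 'a) ecat" and \<Phi>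
 assume A: "enriched_category Q A" and "left_adjoint_distributor Q A C \<Phi>"
 then obtain \<Psi> where ph: "distributor Q A C \<Phi>" and ps: "distributor Q C A \<Psi>"
  and unit: "distributor_le Q A A (EHom A) (distributor_comp Q A C A \<Psi> \<Phi>)"
  and counit: "distributor_le Q C C (distributor_comp Q C A C \<Phi> \<Psi>) (EHom C)"
  unfolding left_adjoint_distributor_def by blast
 note AD = ecatD(2,3)[OF A] and CD = ecatD(2,3)[OF C]
 have h: "\<Phi> c a \<in> Hom Q (Typ A a) (Typ C c)" "\<Psi> a c \<in> Hom Q (Typ C c) (Typ A a)" if "c \<in> Elts C" "a \<in> Elts A" for c a
  using ph ps that by (auto simp: distributor_def)
 have ad: "adj_family (Elts C) (\<lambda>c. c) C (Typ A a) (\<lambda>c. \<Phi> c a) (\<Psi> a)" if a: "a \<in> Elts A" for a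
  unfolding adj_family_def
 proof (intro conjI ballI)
  have "ple Q (Typ A a) (Typ A a) (EHom A a a) (distributor_comp Q A C A \<Psi> \<Phi> a a)"
   using unit a AD CD h unfolding distributor_le_def distributor_comp_def by (intro pleI hsup_in) auto
  then show "ple Q (Typ A a) (Typ A a) (Ident Q (Typ A a))
    (hsup Q (Typ A a) (Typ A a) ((\<lambda>i. Comp Q (Typ A a) (Typ C i) (Typ A a) (\<Psi> a i) (\<Phi> i a)) ` Elts C))"
   unfolding distributor_comp_def by (rule ple_trans[OF ecat_id[OF A a]])
  fix c c' assume c: "c \<in> Elts C" "c' \<in> Elts C"
  let ?S = "(\<lambda>a. Comp Q (Typ C c') (Typ A a) (Typ C c) (\<Phi> c a) (\<Psi> a c')) ` Elts A"
  have S: "?S \<subseteq> Hom Q (Typ C c') (Typ C c)" using c h AD CD by auto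
  have "ple Q (Typ C c') (Typ C c) (Comp Q (Typ C c') (Typ A a) (Typ C c) (\<Phi> c a) (\<Psi> a c')) (hsup Q (Typ C c') (Typ C c) ?S)"
   using c a S CD by (intro hsup_upper) auto
  also have "ple Q (Typ C c') (Typ C c) \<dots> (EHom C c c')"
   using counit c CD S by (intro pleI hsup_in) (auto simp: distributor_le_def distributor_comp_def)
  finally show "ple Q (Typ C c') (Typ C c) (Comp Q (Typ C c') (Typ A a) (Typ C c) (\<Phi> c a) (\<Psi> a c')) (EHom C c c')" .
 qed (use a h AD in auto)
 obtain F where F: "\<And>a. a \<in> Elts A ==> F a \<in> Elts C \<and> Typ C (F a) = Typ A a \<and> (\<forall>b\<in>Elts C.
   ple Q (Typ A a) (Typ C b) (\<Phi> b a) (EHom C b (F a)) \<and> ple Q (Typ C b) (Typ A a) (\<Psi> a b) (EHom C (F a) b))"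
  using ex[OF ad] by metis
 have rep: "\<Phi> c a = EHom C c (F a)" if c: "c \<in> Elts C" and a: "a \<in> Elts A" for c a
 proof (rule ple_antisym)
  note Fa = F[OF a]
  have e: "EHom C c (F a) \<in> Hom Q (Typ A a) (Typ C c)" using CD(2)[OF c, of "F a"] Fa by simp
  show "ple Q (Typ A a) (Typ C c) (\<Phi> c a) (EHom C c (F a))" using Fa c by blast
  show "ple Q (Typ A a) (Typ C c) (EHom C c (F a)) (\<Phi> c a)"
  proof (rule adj_family_unit[OF C ad[OF a] CD(1)[OF c] e h(1)[OF c a]])
   fix b assume b: "b \<in> Elts C"
   have "ple Q (Typ C b) (Typ C c) (Comp Q (Typ C b) (Typ A a) (Typ C c) (EHom C c (F a)) (\<Psi> a b))
    (Comp Q (Typ C b) (Typ A a) (Typ C c) (EHom C c (F a)) (EHom C (F a) b))"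
    using Fa b c e CD(1) by (intro ple_comp_right) auto
   also have "ple Q (Typ C b) (Typ C c) \<dots> (EHom C c b)" using ecat_comp[OF C c _ b, of "F a"] Fa by simp
   finally have "ple Q (Typ A a) (Typ C c) (Comp Q (Typ A a) (Typ C b) (Typ C c) (Comp Q (Typ C b) (Typ A a) (Typ C c) (EHom C c (F a)) (\<Psi> a b)) (\<Phi> b a))
    (Comp Q (Typ A a) (Typ C b) (Typ C c) (EHom C c b) (\<Phi> b a))"
    using a b h AD by (intro ple_comp_left) auto
   also have "ple Q (Typ A a) (Typ C c) \<dots> (\<Phi> c a)" using ph a b c h AD CD by (intro pleI) (auto simp: distributor_def)
   finally show "ple Q (Typ A a) (Typ C c) (Comp Q (Typ A a) (Typ C b) (Typ C c) (Comp Q (Typ C b) (Typ A a) (Typ C c) (EHom C c (F a)) (\<Psi> a b)) (\<Phi> b a)) (\<Phi> c a)" .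
  qed
 qed
 have "enriched_functor Q A C (restrict F (Elts A))"
 proof (rule functorI)
  fix a' a assume a: "a' \<in> Elts A" "a \<in> Elts A"
  note Fa = F[OF a(1)]
  have "EHom A a' a = Comp Q (Typ A a) (Typ A a') (Typ A a') (Ident Q (Typ A a')) (EHom A a' a)" using AD a by simp
  also have "ple Q (Typ A a) (Typ A a') \<dots> (Comp Q (Typ A a) (Typ A a') (Typ A a') (\<Phi> (F a') a') (EHom A a' a))"
   using ecat_id[OF C, of "F a'"] rep[of "F a'" a'] Fa AD a by (intro ple_comp_left) auto
  also have "ple Q (Typ A a) (Typ A a') \<dots> (\<Phi> (F a') a)"
   using ph a Fa AD h[of "F a'"] by (intro pleI) (auto simp: distributor_def)
  finally show "ple Q (Typ A a) (Typ A a') (EHom A a' a) (EHom C (restrict F (Elts A) a') (restrict F (Elts A) a))"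
   using a rep[of "F a'" a] Fa by simp
 qed (use F in auto)
 then show "\<exists>F. enriched_functor Q A C F \<and> (\<forall>c\<in>Elts C. \<forall>a\<in>Elts A. \<Phi> c a = EHom C c (F a))"
  using rep by (intro exI[of _ "restrict F (Elts A)"]) simp
qed

lemma Cat_simps [simp]:
 "Ob (Cat_cc U Q) = {A. enriched_category Q A \<and> cauchy_complete Q A}"
 "Hom (Cat_cc U Q) A B = {F. enriched_functor Q A B F}"
 "Leq (Cat_cc U Q) = functor_le Q"
 "Comp (Cat_cc U Q) A B C G F = compose (Elts A) G F"
 "Ident (Cat_cc U Q) A = (\<lambda>a\<in>Elts A. a)"
 by (simp_all add: Cat_cc_def)

lemma ple_Cat:
 "ple (Cat_cc U Q) A B F G \<longleftrightarrow> A \<in> Ob (Cat_cc U Q) \<and> B \<in> Ob (Cat_cc U Q) \<and> enriched_functor Q A B F \<and>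
   enriched_functor Q A B G \<and> (\<forall>a\<in>Elts A. eleq Q B (F a) (G a))"
 unfolding ple_def using functor_le_iff[of B A F G] by (auto simp: )

lemma pis_Cat:
 "pis (Cat_cc U Q) A B F G \<longleftrightarrow> A \<in> Ob (Cat_cc U Q) \<and> B \<in> Ob (Cat_cc U Q) \<and> enriched_functor Q A B F \<and>
   enriched_functor Q A B G \<and> (\<forall>a\<in>Elts A. eleq Q B (F a) (G a) \<and> eleq Q B (G a) (F a))"
 unfolding pis_def ple_Cat by blast

lemma locally_ordered_category_Cat: "locally_ordered_category (Cat_cc U Q)"
proof
 show "Ident (Cat_cc U Q) A \<in> Hom (Cat_cc U Q) A A" if "A \<in> Ob (Cat_cc U Q)" for A
  using that by (simp add: functor_id)
 show "Comp (Cat_cc U Q) A B C G F \<in> Hom (Cat_cc U Q) A C"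
  if "A \<in> Ob (Cat_cc U Q)" "B \<in> Ob (Cat_cc U Q)" "C \<in> Ob (Cat_cc U Q)"
   "F \<in> Hom (Cat_cc U Q) A B" "G \<in> Hom (Cat_cc U Q) B C" for A B C F G
  using that functor_comp[of A B C F G] by simp
 show "Comp (Cat_cc U Q) A A B F (Ident (Cat_cc U Q) A) = F"
  "Comp (Cat_cc U Q) A B B (Ident (Cat_cc U Q) B) F = F"
  if "A \<in> Ob (Cat_cc U Q)" "B \<in> Ob (Cat_cc U Q)" "F \<in> Hom (Cat_cc U Q) A B" for A B F
 proof -
  have F: "F \<in> Elts A \<rightarrow>\<^sub>E Elts B" using that(3) by (simp add: enriched_functor_def)
  show "Comp (Cat_cc U Q) A A B F (Ident (Cat_cc U Q) A) = F"
   "Comp (Cat_cc U Q) A B B (Ident (Cat_cc U Q) B) F = F"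
   using F by (auto simp: compose_def fun_eq_iff PiE_iff extensional_def)
 qed
 show "Comp (Cat_cc U Q) A B D (Comp (Cat_cc U Q) B C D H G) F = Comp (Cat_cc U Q) A C D H (Comp (Cat_cc U Q) A B C G F)"
  if "F \<in> Hom (Cat_cc U Q) A B" for A B C D F G H
  using functor_in[of A B F] that by (auto simp: compose_def fun_eq_iff)
 show "Leq (Cat_cc U Q) A B F F" if "A \<in> Ob (Cat_cc U Q)" "B \<in> Ob (Cat_cc U Q)" "F \<in> Hom (Cat_cc U Q) A B" for A B F
  using that functor_le_iff[of B A F F] functor_in[of A B F] by (auto intro: eleq_refl)
 show "Leq (Cat_cc U Q) A B F H"
  if "A \<in> Ob (Cat_cc U Q)" "B \<in> Ob (Cat_cc U Q)" "F \<in> Hom (Cat_cc U Q) A B" "G \<in> Hom (Cat_cc U Q) A B" "H \<in> Hom (Cat_cc U Q) A B"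
   "Leq (Cat_cc U Q) A B F G" "Leq (Cat_cc U Q) A B G H" for A B F G H
  using that functor_le_iff[of B A] by (auto intro: eleq_trans)
 show "Leq (Cat_cc U Q) A C (Comp (Cat_cc U Q) A B C G F) (Comp (Cat_cc U Q) A B C G' F')"
  if "A \<in> Ob (Cat_cc U Q)" "B \<in> Ob (Cat_cc U Q)" "C \<in> Ob (Cat_cc U Q)"
   "F \<in> Hom (Cat_cc U Q) A B" "F' \<in> Hom (Cat_cc U Q) A B" "G \<in> Hom (Cat_cc U Q) B C" "G' \<in> Hom (Cat_cc U Q) B C"
   and le: "Leq (Cat_cc U Q) A B F F'" "Leq (Cat_cc U Q) B C G G'" for A B C F F' G G'
 proof -
  have A: "enriched_category Q A" and B: "enriched_category Q B" and C: "enriched_category Q C"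
   and F: "enriched_functor Q A B F" "enriched_functor Q A B F'"
   and G: "enriched_functor Q B C G" "enriched_functor Q B C G'" using that by simp_all
  have "eleq Q C (G (F a)) (G' (F' a))" if a: "a \<in> Elts A" for a
  proof (rule eleq_trans[OF C])
   show "eleq Q C (G (F a)) (G (F' a))"
    using le(1) a functor_le_iff[OF B F A] by (intro functor_eleq[OF B C G(1)]) simp
   show "eleq Q C (G (F' a)) (G' (F' a))"
    using le(2) functor_le_iff[OF C G B] functor_in[OF F(2) a] by simp
  qed
  then show ?thesis
   using functor_le_iff[OF C functor_comp[OF A B C F(1) G(1)] functor_comp[OF A B C F(2) G(2)] A]
   by (simp add: compose_def)
 qed
qed

end

section \<open>Change of base along a fully faithful homomorphism\<close>

locale pullback = R: quantaloid R + S: quantaloid S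
 for R :: "('o, 'a) locat" and S :: "('p, 'b) locat" +
 fixes P :: "('p, 'b, 'o, 'a) arrow_map" and p :: "'u \<times> 'p => 'u"
 assumes hom: "homomorphism S R P"
  and bij: "[|X \<in> Ob S; Y \<in> Ob S|] ==> bij_betw (FArr P X Y) (Hom S X Y) (Hom R (FOb P X) (FOb P Y))"
  and refl: "[|X \<in> Ob S; Y \<in> Ob S; f \<in> Hom S X Y; g \<in> Hom S X Y;
    ple R (FOb P X) (FOb P Y) (FArr P X Y f) (FArr P X Y g)|] ==> ple S X Y f g"
  and universe: "grothendieck_universe TYPE('u)"
  and small_Ob: "small TYPE('u) (Ob S)"
  and pairing: "inj_on p (UNIV \<times> Ob S)"
begin

lemma P_ob [simp]: "X \<in> Ob S ==> FOb P X \<in> Ob R"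
 by (rule homomorphismD(1)[OF hom])

lemma P_arr [simp]: "[|X \<in> Ob S; Y \<in> Ob S; f \<in> Hom S X Y|] ==> FArr P X Y f \<in> Hom R (FOb P X) (FOb P Y)"
 by (rule homomorphismD(2)[OF hom])

definition lift :: "'p => 'p => 'a => 'b" where
 "lift X Y = inv_into (Hom S X Y) (FArr P X Y)"

lemma lift:
 assumes "X \<in> Ob S" "Y \<in> Ob S" "g \<in> Hom R (FOb P X) (FOb P Y)"
 shows "lift X Y g \<in> Hom S X Y" "FArr P X Y (lift X Y g) = g"
 using bij[OF assms(1,2)] assms(3) by (auto simp: lift_def bij_betw_def inv_into_into f_inv_into_f)

definition base :: "'u => 'u" where "base u = fst (inv_into (UNIV \<times> Ob S) p u)"
definition pty :: "'u => 'p" where "pty u = snd (inv_into (UNIV \<times> Ob S) p u)"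

lemma base_pair [simp]: "X \<in> Ob S ==> base (p (a, X)) = a"
 and pty_pair [simp]: "X \<in> Ob S ==> pty (p (a, X)) = X"
 using pairing by (simp_all add: base_def pty_def)

text \<open>The pairs \<open>(a, X)\<close> with \<open>t a = P X\<close>; hom-arrows are those of
 \<open>A\<close>, moved along the bijections of hom-sets.\<close>

definition pb :: "('u, 'o, 'a) ecat => ('u, 'p, 'b) ecat" where
 "pb A = \<lparr>Elts = p ` {(a, X). a \<in> Elts A \<and> X \<in> Ob S \<and> Typ A a = FOb P X}, Typ = pty,
      EHom = (\<lambda>u' u. lift (pty u) (pty u') (EHom A (base u') (base u)))\<rparr>"

lemma Typ_pb [simp]: "Typ (pb A) = pty"
 by (simp add: pb_def)

lemma pb_elt [simp]: "[|a \<in> Elts A; X \<in> Ob S; Typ A a = FOb P X|] ==> p (a, X) \<in> Elts (pb A)"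
 by (auto simp: pb_def)

lemma pb_eltD:
 assumes "u \<in> Elts (pb A)"
 shows "base u \<in> Elts A" "pty u \<in> Ob S" "Typ A (base u) = FOb P (pty u)" "p (base u, pty u) = u"
 using assms by (auto simp: pb_def)

lemma pb_hom:
 assumes "enriched_category R A" "u' \<in> Elts (pb A)" "u \<in> Elts (pb A)"
 shows "EHom (pb A) u' u \<in> Hom S (pty u) (pty u')"
  "FArr P (pty u) (pty u') (EHom (pb A) u' u) = EHom A (base u') (base u)"
 using lift[OF pb_eltD(2)[OF assms(3)] pb_eltD(2)[OF assms(2)], of "EHom A (base u') (base u)"]
  ecatD(3)[OF assms(1) pb_eltD(1)[OF assms(2)] pb_eltD(1)[OF assms(3)]] pb_eltD(3)[OF assms(2)] pb_eltD(3)[OF assms(3)]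
 by (simp_all add: pb_def)

lemma ple_P_iff:
 assumes "X \<in> Ob S" "Y \<in> Ob S" "f \<in> Hom S X Y" "g \<in> Hom S X Y"
 shows "ple S X Y f g \<longleftrightarrow> ple R (FOb P X) (FOb P Y) (FArr P X Y f) (FArr P X Y g)"
 using refl[OF assms] homomorphism_mono[OF hom] by blast

lemma ple_pb_iff:
 assumes "enriched_category R A" "u' \<in> Elts (pb A)" "u \<in> Elts (pb A)" "f \<in> Hom S (pty u) (pty u')"
 shows "ple S (pty u) (pty u') f (EHom (pb A) u' u) \<longleftrightarrow>
  ple R (FOb P (pty u)) (FOb P (pty u')) (FArr P (pty u) (pty u') f) (EHom A (base u') (base u))"
 using ple_P_iff[OF pb_eltD(2)[OF assms(3)] pb_eltD(2)[OF assms(2)] assms(4) pb_hom(1)[OF assms(1-3)]]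
  pb_hom(2)[OF assms(1-3)] by simp

lemma pb_enriched:
 assumes A: "enriched_category R A" shows "enriched_category S (pb A)"
proof (rule S.enriched_categoryI)
 have "small TYPE('u) (Elts A \<times> Ob S)"
  using ecatD(1)[OF A] small_Ob by (intro small_Sigma[OF universe]) auto
 then have "small TYPE('u) (p ` (Elts A \<times> Ob S))" by (rule small_image)
 then show "small TYPE('u) (Elts (pb A))" by (rule small_subset) (auto simp: pb_def)
next
 fix u'' u' u assume u: "u'' \<in> Elts (pb A)" "u' \<in> Elts (pb A)" "u \<in> Elts (pb A)"
 note D = pb_eltD[OF u(1)] pb_eltD[OF u(2)] pb_eltD[OF u(3)]
 note h = pb_hom[OF A u(1,2)] pb_hom[OF A u(2,3)] pb_hom[OF A u(1,3)]
 have "Comp S (pty u) (pty u') (pty u'') (EHom (pb A) u'' u') (EHom (pb A) u' u) \<in> Hom S (pty u) (pty u'')"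
  using h D by simp
 then show "ple S (Typ (pb A) u) (Typ (pb A) u'') (Comp S (Typ (pb A) u) (Typ (pb A) u') (Typ (pb A) u'')
   (EHom (pb A) u'' u') (EHom (pb A) u' u)) (EHom (pb A) u'' u)"
  using R.ecat_comp[OF A, of "base u''" "base u'" "base u"] D h
  by (simp add: ple_pb_iff[OF A u(1,3)] homomorphismD(4)[OF hom])
next
 fix u assume u: "u \<in> Elts (pb A)"
 note D = pb_eltD[OF u]
 show "ple S (Typ (pb A) u) (Typ (pb A) u) (Ident S (Typ (pb A) u)) (EHom (pb A) u u)"
  using R.ecat_id[OF A D(1)] D by (simp add: ple_pb_iff[OF A u u] homomorphismD(3)[OF hom])
qed (use pb_eltD(2) pb_hom(1)[OF A] in auto)

lemma pb_eleq:
 assumes A: "enriched_category R A" and u: "u \<in> Elts (pb A)" "v \<in> Elts (pb A)"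
 shows "eleq S (pb A) u v \<longleftrightarrow> pty u = pty v \<and> eleq R A (base u) (base v)"
proof (cases "pty u = pty v")
 case True
 note D = pb_eltD[OF u(1)] pb_eltD[OF u(2)]
 show ?thesis using True D u by (simp add: eleq_def ple_pb_iff[OF A u, unfolded True] homomorphismD(3)[OF hom])
qed (simp add: eleq_def)

text \<open>Cauchy completeness is inherited because a generating family for a left adjoint into the
 pulled back category is sent by \<open>P\<close> to one in \<open>A\<close>, and the element that it generates there
 has type \<open>P X\<close>, hence lies over \<open>X\<close>.\<close>

lemma pb_cauchy_complete:
 assumes A: "enriched_category R A" and cc: "cauchy_complete R A"
 shows "cauchy_complete S (pb A)"
proof (rule S.cauchy_completeI[OF pb_enriched[OF A]])
 fix X \<phi> \<psi> assume ad: "S.adj_family (Elts (pb A)) (\<lambda>c. c) (pb A) X \<phi> \<psi>"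
 note D = S.adj_familyD[OF ad, simplified] and u = pb_eltD[of _ A]
 let ?\<phi> = "\<lambda>u. FArr P X (pty u) (\<phi> u)" and ?\<psi> = "\<lambda>u. FArr P (pty u) X (\<psi> u)"
 have "R.adj_family (Elts (pb A)) base A (FOb P X) ?\<phi> ?\<psi>"
  unfolding R.adj_family_def
 proof (intro conjI ballI)
  let ?U = "(\<lambda>u. Comp S X (pty u) X (\<psi> u) (\<phi> u)) ` Elts (pb A)"
  have "FArr P X X (hsup S X X ?U) = hsup R (FOb P X) (FOb P X) (FArr P X X ` ?U)"
   using homomorphismD(5)[OF hom D(1,1)] D(1,3,4) u unfolding sup_pres_def by (auto simp: image_subset_iff)
  also have "FArr P X X ` ?U = (\<lambda>u. Comp R (FOb P X) (Typ A (base u)) (FOb P X) (?\<psi> u) (?\<phi> u)) ` Elts (pb A)"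
   unfolding image_image using D(1,3,4) u by (intro image_cong) (auto simp: homomorphismD(4)[OF hom])
  finally show "ple R (FOb P X) (FOb P X) (Ident R (FOb P X)) (hsup R (FOb P X) (FOb P X)
    ((\<lambda>u. Comp R (FOb P X) (Typ A (base u)) (FOb P X) (?\<psi> u) (?\<phi> u)) ` Elts (pb A)))"
   using homomorphism_mono[OF hom D(5)] D(1) by (simp add: homomorphismD(3)[OF hom])
  fix v w assume e: "v \<in> Elts (pb A)" "w \<in> Elts (pb A)"
  show "ple R (Typ A (base w)) (Typ A (base v)) (Comp R (Typ A (base w)) (FOb P X) (Typ A (base v)) (?\<phi> v) (?\<psi> w)) (EHom A (base v) (base w))"
   using homomorphism_mono[OF hom D(6)[OF e]] D(1,3,4) u(2,3) e pb_hom(2)[OF A e] by (simp add: homomorphismD(4)[OF hom])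
 qed (use D(1,3,4) u in auto)
 from R.cauchy_complete_family[OF universe cc A this] obtain c where c: "c \<in> Elts A" "Typ A c = FOb P X"
  "\<And>u. u \<in> Elts (pb A) ==> ple R (FOb P X) (Typ A (base u)) (?\<phi> u) (EHom A (base u) c)"
  "\<And>u. u \<in> Elts (pb A) ==> ple R (Typ A (base u)) (FOb P X) (?\<psi> u) (EHom A c (base u))" by blast
 have e: "p (c, X) \<in> Elts (pb A)" using c D(1) by simp
 show "\<exists>c\<in>Elts (pb A). Typ (pb A) c = X \<and> (\<forall>b\<in>Elts (pb A). ple S X (Typ (pb A) b) (\<phi> b) (EHom (pb A) b c) \<and>
   ple S (Typ (pb A) b) X (\<psi> b) (EHom (pb A) c b))"
 proof (intro bexI[OF _ e] conjI ballI)
  fix v assume v: "v \<in> Elts (pb A)"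
  show "ple S X (Typ (pb A) v) (\<phi> v) (EHom (pb A) v (p (c, X)))" "ple S (Typ (pb A) v) X (\<psi> v) (EHom (pb A) (p (c, X)) v)"
   using ple_pb_iff[OF A v e] ple_pb_iff[OF A e v] c(3,4)[OF v] D(1,3,4) v u(3)[OF v] by simp_all
 qed (use D(1) in simp)
qed

definition pbF :: "(('u, 'o, 'a) ecat, 'u => 'u, ('u, 'p, 'b) ecat, 'u => 'u) arrow_map" where
 "pbF = \<lparr>FOb = pb, FArr = (\<lambda>A B H. \<lambda>u\<in>Elts (pb A). p (H (base u), pty u))\<rparr>"

lemma pbF_simps [simp]: "FOb pbF = pb" "FArr pbF A B H = (\<lambda>u\<in>Elts (pb A). p (H (base u), pty u))"
 by (simp_all add: pbF_def)

lemma pb_map_elt: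
 assumes "enriched_functor R A B H" "u \<in> Elts (pb A)"
 shows "p (H (base u), pty u) \<in> Elts (pb B)"
 using R.functor_in[OF assms(1)] R.functor_typ[OF assms(1)] pb_eltD[OF assms(2)] by simp

lemma pb_map_functor:
 assumes A: "enriched_category R A" and B: "enriched_category R B" and H: "enriched_functor R A B H"
 shows "enriched_functor S (pb A) (pb B) (\<lambda>u\<in>Elts (pb A). p (H (base u), pty u))"
proof (rule S.functorI)
 fix u' u assume u: "u' \<in> Elts (pb A)" "u \<in> Elts (pb A)"
 note D = pb_eltD[OF u(1)] pb_eltD[OF u(2)]
 have "ple S (pty u) (pty u') (EHom (pb A) u' u) (EHom (pb B) (p (H (base u'), pty u')) (p (H (base u), pty u)))"
  using ple_pb_iff[OF B pb_map_elt[OF H u(1)] pb_map_elt[OF H u(2)], of "EHom (pb A) u' u"]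
   pb_hom[OF A u] R.functor_ple[OF A B H D(1) D(5)] D by simp
 then show "ple S (Typ (pb A) u) (Typ (pb A) u') (EHom (pb A) u' u)
   (EHom (pb B) ((\<lambda>u\<in>Elts (pb A). p (H (base u), pty u)) u') ((\<lambda>u\<in>Elts (pb A). p (H (base u), pty u)) u))"
  using u by simp
qed (use pb_map_elt[OF H] pb_eltD in auto)

lemma pbF_pseudofunctor: "pseudofunctor (Cat_cc TYPE('u) R) (Cat_cc TYPE('u) S) pbF"
proof -
 interpret KS: locally_ordered_category "Cat_cc TYPE('u) S" by (rule S.locally_ordered_category_Cat)
 have ob: "pb A \<in> Ob (Cat_cc TYPE('u) S)" if "A \<in> Ob (Cat_cc TYPE('u) R)" for A
  using that pb_enriched pb_cauchy_complete by simp
 moreover have "FArr pbF A B \<in> Hom (Cat_cc TYPE('u) R) A B \<rightarrow> Hom (Cat_cc TYPE('u) S) (pb A) (pb B)"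
  if "A \<in> Ob (Cat_cc TYPE('u) R)" "B \<in> Ob (Cat_cc TYPE('u) R)" for A B
  using that pb_map_functor[of A B] by auto
 moreover have "Leq (Cat_cc TYPE('u) S) (pb A) (pb B) (FArr pbF A B H) (FArr pbF A B H')"
  if A: "A \<in> Ob (Cat_cc TYPE('u) R)" and B: "B \<in> Ob (Cat_cc TYPE('u) R)" and H: "H \<in> Hom (Cat_cc TYPE('u) R) A B"
   "H' \<in> Hom (Cat_cc TYPE('u) R) A B" and le: "Leq (Cat_cc TYPE('u) R) A B H H'" for A B H H'
 proof -
  have A': "enriched_category R A" and B': "enriched_category R B" and H': "enriched_functor R A B H" "enriched_functor R A B H'"
   using A B H by simp_all
  have "eleq R B (H a) (H' a)" if "a \<in> Elts A" for a using le R.functor_le_iff[OF B' H' A'] that by simp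
  then have "eleq S (pb B) (p (H (base u), pty u)) (p (H' (base u), pty u))" if "u \<in> Elts (pb A)" for u
   using pb_eleq[OF B' pb_map_elt[OF H'(1) that] pb_map_elt[OF H'(2) that]] pb_eltD[OF that] by simp
  then show ?thesis
   using S.functor_le_iff[OF pb_enriched[OF B'] pb_map_functor[OF A' B' H'(1)] pb_map_functor[OF A' B' H'(2)] pb_enriched[OF A']] by simp
 qed
 moreover have "iso2 (Cat_cc TYPE('u) S) (pb A) (pb A) (FArr pbF A A (Ident (Cat_cc TYPE('u) R) A)) (Ident (Cat_cc TYPE('u) S) (pb A))"
  if A: "A \<in> Ob (Cat_cc TYPE('u) R)" for A
 proof -
  have "FArr pbF A A (Ident (Cat_cc TYPE('u) R) A) = Ident (Cat_cc TYPE('u) S) (pb A)"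
   using pb_eltD by (auto simp: fun_eq_iff restrict_def)
  then show ?thesis
   using pis_iso2[OF KS.pis_refl[OF ob[OF A] ob[OF A] KS.Ident_in_Hom[OF ob[OF A]]]] by simp
 qed
 moreover have "iso2 (Cat_cc TYPE('u) S) (pb A) (pb C) (FArr pbF A C (Comp (Cat_cc TYPE('u) R) A B C K H))
   (Comp (Cat_cc TYPE('u) S) (pb A) (pb B) (pb C) (FArr pbF B C K) (FArr pbF A B H))"
  if A: "A \<in> Ob (Cat_cc TYPE('u) R)" "B \<in> Ob (Cat_cc TYPE('u) R)" "C \<in> Ob (Cat_cc TYPE('u) R)"
   and H: "H \<in> Hom (Cat_cc TYPE('u) R) A B" "K \<in> Hom (Cat_cc TYPE('u) R) B C" for A B C H K
 proof -
  have Hf: "enriched_functor R A B H" and Kf: "enriched_functor R B C K" using H by simp_all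
  have eq: "FArr pbF A C (Comp (Cat_cc TYPE('u) R) A B C K H)
   = Comp (Cat_cc TYPE('u) S) (pb A) (pb B) (pb C) (FArr pbF B C K) (FArr pbF A B H)"
  proof
   fix u
   show "FArr pbF A C (Comp (Cat_cc TYPE('u) R) A B C K H) u
    = Comp (Cat_cc TYPE('u) S) (pb A) (pb B) (pb C) (FArr pbF B C K) (FArr pbF A B H) u"
   proof (cases "u \<in> Elts (pb A)")
    case True
    then show ?thesis using pb_map_elt[OF Hf True] pb_eltD[OF True] by (simp add: compose_def)
   qed (simp add: compose_def)
  qed
  have "Comp (Cat_cc TYPE('u) S) (pb A) (pb B) (pb C) (FArr pbF B C K) (FArr pbF A B H) \<in> Hom (Cat_cc TYPE('u) S) (pb A) (pb C)"
   using A H ob pb_map_functor by (intro KS.Comp_in_Hom) auto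
  then show ?thesis unfolding eq using ob A by (intro pis_iso2 KS.pis_refl) auto
 qed
 ultimately show ?thesis unfolding pseudofunctor_def by simp
qed

end

section \<open>Transport of objects along isomorphisms of types\<close>

text \<open>When \<open>i\<close> and \<open>j\<close> are mutually inverse, \<open>c\<close> is a copy of
 \<open>a\<close> whose type has been changed along \<open>i\<close>.\<close>

definition twist :: "('o, 'a) locat => ('u, 'o, 'a) ecat => 'a => 'a => 'u => 'u => bool" where
 "twist R A i j a c \<longleftrightarrow> a \<in> Elts A \<and> c \<in> Elts A \<and>
   ple R (Typ A a) (Typ A c) i (EHom A c a) \<and> ple R (Typ A c) (Typ A a) j (EHom A a c)"

lemma twist_sym: "twist R A i j a c ==> twist R A j i c a"
 by (auto simp: twist_def)

context quantaloid
begin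

text \<open>The one-element family \<open>(j, i)\<close> at \<open>a\<close> generates an adjoint pair of
 distributors, since \<open>i\<close> and \<open>j\<close> are mutually inverse.\<close>

lemma twist_exists:
 fixes A :: "('u, 'o, 'a) ecat"
 assumes U: "grothendieck_universe TYPE('u)" and A: "enriched_category Q A" and cc: "cauchy_complete Q A"
  and a: "a \<in> Elts A" and Y: "Y \<in> Ob Q" and i: "i \<in> Hom Q (Typ A a) Y" and j: "j \<in> Hom Q Y (Typ A a)"
  and ij: "Comp Q Y (Typ A a) Y i j = Ident Q Y" and ji: "Comp Q (Typ A a) Y (Typ A a) j i = Ident Q (Typ A a)"
 shows "\<exists>c. twist Q A i j a c \<and> Typ A c = Y"
proof -
 note AD = ecatD(2,3)[OF A]
 let ?X = "Typ A a"
 have X: "?X \<in> Ob Q" by (rule AD(1)[OF a])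
 have "ple Q Y Y (Ident Q Y) (hsup Q Y Y ((\<lambda>_. Ident Q Y) ` {a}))"
  using Y by (intro hsup_upper) auto
 then have "adj_family {a} (\<lambda>x. x) A Y (\<lambda>_. j) (\<lambda>_. i)"
  using a Y i j ij ji ecat_id[OF A a] by (simp add: adj_family_def)
 from cauchy_complete_family[OF U cc A this] show ?thesis using a by (auto simp: twist_def)
qed

lemma twist_hom:
 assumes A: "enriched_category Q A" and t: "twist Q A i j a c" and t': "twist Q A i' j' a' c'"
 shows "ple Q (Typ A c) (Typ A c') (Comp Q (Typ A c) (Typ A a') (Typ A c') i'
   (Comp Q (Typ A c) (Typ A a) (Typ A a') (EHom A a' a) j)) (EHom A c' c)"
proof -
 have e: "a \<in> Elts A" "c \<in> Elts A" "a' \<in> Elts A" "c' \<in> Elts A" using t t' by (auto simp: twist_def)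
 have j: "ple Q (Typ A c) (Typ A a) j (EHom A a c)" and i': "ple Q (Typ A a') (Typ A c') i' (EHom A c' a')"
  using t t' by (auto simp: twist_def)
 note AD = ecatD(2,3)[OF A]
 have "ple Q (Typ A c) (Typ A a') (Comp Q (Typ A c) (Typ A a) (Typ A a') (EHom A a' a) j)
   (Comp Q (Typ A c) (Typ A a) (Typ A a') (EHom A a' a) (EHom A a c))"
  using j e AD by (intro ple_comp_right) auto
 also have "ple Q (Typ A c) (Typ A a') \<dots> (EHom A a' c)" by (rule ecat_comp[OF A e(3,1,2)])
 finally have "ple Q (Typ A c) (Typ A a') (Comp Q (Typ A c) (Typ A a) (Typ A a') (EHom A a' a) j) (EHom A a' c)" .
 then have "ple Q (Typ A c) (Typ A c') (Comp Q (Typ A c) (Typ A a') (Typ A c') i'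
   (Comp Q (Typ A c) (Typ A a) (Typ A a') (EHom A a' a) j)) (Comp Q (Typ A c) (Typ A a') (Typ A c') (EHom A c' a') (EHom A a' c))"
  using i' by (intro ple_comp)
 also have "ple Q (Typ A c) (Typ A c') \<dots> (EHom A c' c)" by (rule ecat_comp[OF A e(4,3,2)])
 finally show ?thesis .
qed

lemma twist_unique:
 assumes A: "enriched_category Q A" and t: "twist Q A i j a c" and t': "twist Q A i j a d"
  and ty: "Typ A c = Typ A d" and ij: "Comp Q (Typ A c) (Typ A a) (Typ A c) i j = Ident Q (Typ A c)"
 shows "eleq Q A c d"
proof -
 have e: "a \<in> Elts A" "c \<in> Elts A" "d \<in> Elts A" using t t' by (auto simp: twist_def)
 have "Ident Q (Typ A c) = Comp Q (Typ A c) (Typ A a) (Typ A c) i j" by (rule ij[symmetric])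
 also have "ple Q (Typ A c) (Typ A c) \<dots> (Comp Q (Typ A c) (Typ A a) (Typ A c) (EHom A c a) (EHom A a d))"
  using t t' ty by (intro ple_comp) (auto simp: twist_def)
 also have "ple Q (Typ A c) (Typ A c) \<dots> (EHom A c d)" using ecat_comp[OF A e(2,1,3)] ty by simp
 finally show ?thesis using e ty by (simp add: eleq_def)
qed

lemma twist_functor:
 assumes A: "enriched_category Q A" and B: "enriched_category Q B" and H: "enriched_functor Q A B H"
  and t: "twist Q A i j a c"
 shows "twist Q B i j (H a) (H c)"
proof -
 have e: "a \<in> Elts A" "c \<in> Elts A" using t by (auto simp: twist_def)
 show ?thesis
  using t functor_in[OF H] functor_typ[OF H] functor_ple[OF A B H e(1,2)] functor_ple[OF A B H e(2,1)] e
  unfolding twist_def by (auto intro: ple_trans)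
qed

end


section \<open>Equivalent quantaloids have biequivalent categories of Cauchy complete categories\<close>

locale two_pullbacks = G: pullback R S G p + F: pullback S R F q
 for R :: "('o, 'a) locat" and S :: "('p, 'b) locat"
  and G :: "('p, 'b, 'o, 'a) arrow_map" and F :: "('o, 'a, 'p, 'b) arrow_map"
  and p :: "'u \<times> 'p => 'u" and q :: "'u \<times> 'o => 'u" +
 fixes \<eta> \<eta>i
 assumes unit: "pseudonat_pair R R identity_map (comp_map G F) \<eta> \<eta>i"
begin

abbreviation "GF X \<equiv> FOb G (FOb F X)"
abbreviation "GFa X Y f \<equiv> FArr G (FOb F X) (FOb F Y) (FArr F X Y f)"

lemma eta:
 assumes "X \<in> Ob R"
 shows "\<eta> X \<in> Hom R X (GF X)" "\<eta>i X \<in> Hom R (GF X) X"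
  "Comp R X (GF X) X (\<eta>i X) (\<eta> X) = Ident R X" "Comp R (GF X) X (GF X) (\<eta> X) (\<eta>i X) = Ident R (GF X)"
 using unit assms by (auto simp: pseudonat_pair_def equiv_pair_def intro: G.R.pis_eq)

lemma eta_nat:
 assumes "X \<in> Ob R" "Y \<in> Ob R" "f \<in> Hom R X Y"
 shows "Comp R X Y (GF Y) (\<eta> Y) f = Comp R X (GF X) (GF Y) (GFa X Y f) (\<eta> X)"
 using unit assms by (intro G.R.pis_eq[of X "GF Y"]) (simp add: pseudonat_pair_def)

text \<open>Naturality of the unit, so that hom-arrows of the twice pulled back category are conjugates of
 those of \<open>A\<close>.\<close>

lemma GFa_conj:
 assumes "X \<in> Ob R" "Y \<in> Ob R" "f \<in> Hom R X Y"
 shows "GFa X Y f = Comp R (GF X) Y (GF Y) (\<eta> Y) (Comp R (GF X) X Y f (\<eta>i X))"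
proof -
 have in_Hom: "GFa X Y f \<in> Hom R (GF X) (GF Y)" using assms by simp
 have "GFa X Y f = Comp R (GF X) (GF X) (GF Y) (GFa X Y f) (Comp R (GF X) X (GF X) (\<eta> X) (\<eta>i X))"
  using assms in_Hom by (simp add: eta(4))
 also have "\<dots> = Comp R (GF X) X (GF Y) (Comp R X (GF X) (GF Y) (GFa X Y f) (\<eta> X)) (\<eta>i X)"
  using assms in_Hom eta(1,2) by (simp add: G.R.Comp_assoc)
 also have "\<dots> = Comp R (GF X) Y (GF Y) (\<eta> Y) (Comp R (GF X) X Y f (\<eta>i X))"
  using assms eta(1,2) by (simp add: G.R.Comp_assoc flip: eta_nat)
 finally show ?thesis .
qed

lemma GFa_conj':
 assumes "X \<in> Ob R" "Y \<in> Ob R" "f \<in> Hom R X Y"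
 shows "f = Comp R X (GF Y) Y (\<eta>i Y) (Comp R X (GF X) (GF Y) (GFa X Y f) (\<eta> X))"
proof -
 have "f = Comp R X Y Y (Comp R Y (GF Y) Y (\<eta>i Y) (\<eta> Y)) f" using assms by (simp add: eta(3))
 also have "\<dots> = Comp R X (GF Y) Y (\<eta>i Y) (Comp R X Y (GF Y) (\<eta> Y) f)"
  using assms eta(1,2) by (simp add: G.R.Comp_assoc)
 finally show ?thesis using assms by (simp add: eta_nat)
qed

abbreviation "hat A \<equiv> F.pb (G.pb A)"
abbreviation "ground u \<equiv> G.base (F.base u)"

lemma hat_eltD:
 assumes "u \<in> Elts (hat A)"
 shows "F.pty u \<in> Ob R" "ground u \<in> Elts A" "Typ A (ground u) = GF (F.pty u)"
  "G.pty (F.base u) = FOb F (F.pty u)" "F.base u \<in> Elts (G.pb A)"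
 using F.pb_eltD[OF assms] G.pb_eltD[OF F.pb_eltD(1)[OF assms]] by simp_all

lemma hat_enriched: "enriched_category R A ==> enriched_category R (hat A)"
 by (intro F.pb_enriched G.pb_enriched)

lemma hat_ple_iff:
 assumes A: "enriched_category R A" and u: "u' \<in> Elts (hat A)" "u \<in> Elts (hat A)"
  and f: "f \<in> Hom R (F.pty u) (F.pty u')"
 shows "ple R (F.pty u) (F.pty u') f (EHom (hat A) u' u) \<longleftrightarrow>
  ple R (GF (F.pty u)) (GF (F.pty u')) (GFa (F.pty u) (F.pty u') f) (EHom A (ground u') (ground u))"
 using F.ple_pb_iff[OF G.pb_enriched[OF A] u f]
  G.ple_pb_iff[OF A hat_eltD(5)[OF u(1)] hat_eltD(5)[OF u(2)], of "FArr F (F.pty u) (F.pty u') f"]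
  hat_eltD[OF u(1)] hat_eltD[OF u(2)] f by simp

lemma hat_eleq:
 assumes A: "enriched_category R A" and u: "u \<in> Elts (hat A)" "v \<in> Elts (hat A)"
 shows "eleq R (hat A) u v \<longleftrightarrow> F.pty u = F.pty v \<and> eleq R A (ground u) (ground v)"
 using F.pb_eleq[OF G.pb_enriched[OF A] u] G.pb_eleq[OF A hat_eltD(5)[OF u(1)] hat_eltD(5)[OF u(2)]]
  hat_eltD[OF u(1)] hat_eltD[OF u(2)] by auto

text \<open>The element \<open>a\<close> of type \<open>X\<close> is moved to type \<open>G F X\<close>
 along the unit; \<open>down\<close> moves back. By uniqueness of copies the resulting functors
 \<open>tau\<close> and \<open>sigma\<close> are mutually inverse up to equivalence.\<close>

definition up :: "('u, 'o, 'a) ecat => 'u => 'u" where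
 "up A a = (SOME c. twist R A (\<eta> (Typ A a)) (\<eta>i (Typ A a)) a c \<and> Typ A c = GF (Typ A a))"

definition down :: "('u, 'o, 'a) ecat => 'u => 'u" where
 "down A u = (SOME d. twist R A (\<eta>i (F.pty u)) (\<eta> (F.pty u)) (ground u) d \<and> Typ A d = F.pty u)"

definition tau :: "('u, 'o, 'a) ecat => 'u => 'u" where
 "tau A = (\<lambda>a\<in>Elts A. q (p (up A a, FOb F (Typ A a)), Typ A a))"

definition sigma :: "('u, 'o, 'a) ecat => 'u => 'u" where
 "sigma A = (\<lambda>u\<in>Elts (hat A). down A u)"

context
 fixes A :: "('u, 'o, 'a) ecat"
 assumes A: "enriched_category R A" and cc: "cauchy_complete R A"
begin

lemma up: assumes a: "a \<in> Elts A"
 shows "twist R A (\<eta> (Typ A a)) (\<eta>i (Typ A a)) a (up A a)" "Typ A (up A a) = GF (Typ A a)" "up A a \<in> Elts A"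
proof -
 have X: "Typ A a \<in> Ob R" by (rule ecatD(2)[OF A a])
 have "\<exists>c. twist R A (\<eta> (Typ A a)) (\<eta>i (Typ A a)) a c \<and> Typ A c = GF (Typ A a)"
  using X eta[OF X] by (intro G.R.twist_exists[OF G.universe A cc a]) auto
 from someI_ex[OF this] show "twist R A (\<eta> (Typ A a)) (\<eta>i (Typ A a)) a (up A a)" "Typ A (up A a) = GF (Typ A a)"
  unfolding up_def by blast+
 then show "up A a \<in> Elts A" by (simp add: twist_def)
qed

lemma down: assumes u: "u \<in> Elts (hat A)"
 shows "twist R A (\<eta>i (F.pty u)) (\<eta> (F.pty u)) (ground u) (down A u)" "Typ A (down A u) = F.pty u" "down A u \<in> Elts A"
proof -
 note D = hat_eltD[OF u]
 have "\<exists>d. twist R A (\<eta>i (F.pty u)) (\<eta> (F.pty u)) (ground u) d \<and> Typ A d = F.pty u"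
  using D eta[OF D(1)] by (intro G.R.twist_exists[OF G.universe A cc]) auto
 from someI_ex[OF this] show "twist R A (\<eta>i (F.pty u)) (\<eta> (F.pty u)) (ground u) (down A u)" "Typ A (down A u) = F.pty u"
  unfolding down_def by blast+
 then show "down A u \<in> Elts A" by (simp add: twist_def)
qed

lemma tau_elt: assumes a: "a \<in> Elts A"
 shows "tau A a \<in> Elts (hat A)" "F.pty (tau A a) = Typ A a" "ground (tau A a) = up A a"
 using a up[OF a] ecatD(2)[OF A a] by (simp_all add: tau_def)

lemma tau_functor: "enriched_functor R A (hat A) (tau A)"
proof (rule G.R.functorI)
 fix a' a assume a: "a' \<in> Elts A" "a \<in> Elts A"
 have X: "Typ A a \<in> Ob R" "Typ A a' \<in> Ob R" and f: "EHom A a' a \<in> Hom R (Typ A a) (Typ A a')"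
  using ecatD(2,3)[OF A] a by auto
 have "ple R (GF (Typ A a)) (GF (Typ A a')) (GFa (Typ A a) (Typ A a') (EHom A a' a)) (EHom A (up A a') (up A a))"
  using G.R.twist_hom[OF A up(1)[OF a(2)] up(1)[OF a(1)]] up(2)[OF a(1)] up(2)[OF a(2)] GFa_conj[OF X f] by simp
 then have "ple R (Typ A a) (Typ A a') (EHom A a' a) (EHom (hat A) (tau A a') (tau A a))"
  using hat_ple_iff[OF A tau_elt(1)[OF a(1)] tau_elt(1)[OF a(2)], of "EHom A a' a"] tau_elt[OF a(1)] tau_elt[OF a(2)] f by simp
 then show "ple R (Typ A a) (Typ A a') (EHom A a' a) (EHom (hat A) (tau A a') (tau A a))" .
qed (use tau_elt in \<open>auto simp: tau_def\<close>)

lemma sigma_functor: "enriched_functor R (hat A) A (sigma A)"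
proof (rule G.R.functorI)
 fix u' u assume u: "u' \<in> Elts (hat A)" "u \<in> Elts (hat A)"
 note D' = hat_eltD[OF u(1)] and D = hat_eltD[OF u(2)]
 let ?X = "F.pty u" and ?Y = "F.pty u'" and ?f = "EHom (hat A) u' u"
 have f: "?f \<in> Hom R ?X ?Y" using ecatD(3)[OF hat_enriched[OF A] u] by simp
 have eq: "GFa ?X ?Y ?f = EHom A (ground u') (ground u)"
  using F.pb_hom(2)[OF G.pb_enriched[OF A] u] G.pb_hom(2)[OF A D'(5) D(5)] D' D by simp
 have "ple R ?X ?Y ?f (EHom A (down A u') (down A u))"
  using G.R.twist_hom[OF A down(1)[OF u(2)] down(1)[OF u(1)]] down(2)[OF u(1)] down(2)[OF u(2)] D' D
   GFa_conj'[OF D(1) D'(1) f] by (simp add: eq)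
 then show "ple R (Typ (hat A) u) (Typ (hat A) u') ?f (EHom A (sigma A u') (sigma A u))"
  using u by (simp add: sigma_def)
qed (use down in \<open>auto simp: sigma_def\<close>)

lemma sigma_tau: assumes a: "a \<in> Elts A"
 shows "eleq R A (sigma A (tau A a)) a" "eleq R A a (sigma A (tau A a))"
proof -
 let ?X = "Typ A a"
 have X: "?X \<in> Ob R" by (rule ecatD(2)[OF A a])
 note e = eta[OF X]
 note u = tau_elt[OF a]
 have d: "twist R A (\<eta>i ?X) (\<eta> ?X) (up A a) (down A (tau A a))" "Typ A (down A (tau A a)) = ?X"
  using down[OF u(1)] u by simp_all
 have t: "twist R A (\<eta>i ?X) (\<eta> ?X) (up A a) a" by (rule twist_sym[OF up(1)[OF a]])
 have "eleq R A a (down A (tau A a))" "eleq R A (down A (tau A a)) a"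
  using G.R.twist_unique[OF A t d(1)] G.R.twist_unique[OF A d(1) t] d(2) up(2)[OF a] e(3) by simp_all
 then show "eleq R A (sigma A (tau A a)) a" "eleq R A a (sigma A (tau A a))" using u by (simp_all add: sigma_def)
qed

lemma tau_sigma: assumes u: "u \<in> Elts (hat A)"
 shows "eleq R (hat A) (tau A (sigma A u)) u" "eleq R (hat A) u (tau A (sigma A u))"
proof -
 let ?X = "F.pty u"
 note D = hat_eltD[OF u]
 note e = eta[OF D(1)]
 note d = down[OF u]
 have su: "sigma A u = down A u" using u by (simp add: sigma_def)
 note v = tau_elt[OF d(3)]
 have c: "twist R A (\<eta> ?X) (\<eta>i ?X) (down A u) (up A (down A u))" "Typ A (up A (down A u)) = GF ?X"
  using up[OF d(3)] d(2) by simp_all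
 have t: "twist R A (\<eta> ?X) (\<eta>i ?X) (down A u) (ground u)" by (rule twist_sym[OF d(1)])
 have "eleq R A (ground u) (up A (down A u))" "eleq R A (up A (down A u)) (ground u)"
  using G.R.twist_unique[OF A t c(1)] G.R.twist_unique[OF A c(1) t] c(2) d(2) D(3) e(4) by simp_all
 then show "eleq R (hat A) (tau A (sigma A u)) u" "eleq R (hat A) u (tau A (sigma A u))"
  using hat_eleq[OF A v(1) u] hat_eleq[OF A u v(1)] v d(2) by (simp_all add: su)
qed

end

lemma tau_natural:
 assumes A: "enriched_category R A" "cauchy_complete R A" and B: "enriched_category R B" "cauchy_complete R B"
  and H: "enriched_functor R A B H" and a: "a \<in> Elts A"
 shows "eleq R (hat B) (tau B (H a)) (q (p (H (ground (tau A a)), G.pty (F.base (tau A a))), F.pty (tau A a)))"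
  "eleq R (hat B) (q (p (H (ground (tau A a)), G.pty (F.base (tau A a))), F.pty (tau A a))) (tau B (H a))"
proof -
 let ?X = "Typ A a"
 have X: "?X \<in> Ob R" by (rule ecatD(2)[OF A(1) a])
 have Ha: "H a \<in> Elts B" "Typ B (H a) = ?X" using G.R.functor_in[OF H a] G.R.functor_typ[OF H a] by simp_all
 note u = tau_elt[OF A a] and v = tau_elt[OF B Ha(1)]
 have pt: "G.pty (F.base (tau A a)) = FOb F ?X" using hat_eltD(4)[OF u(1)] u by simp
 have Hup: "H (up A a) \<in> Elts B" "Typ B (H (up A a)) = GF ?X"
  using G.R.functor_in[OF H up(3)[OF A a]] G.R.functor_typ[OF H up(3)[OF A a]] up(2)[OF A a] by simp_all
 have w: "q (p (H (up A a), FOb F ?X), ?X) \<in> Elts (hat B)" using Hup X by simp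
 have t: "twist R B (\<eta> ?X) (\<eta>i ?X) (H a) (H (up A a))"
  by (rule G.R.twist_functor[OF A(1) B(1) H up(1)[OF A a]])
 have t': "twist R B (\<eta> ?X) (\<eta>i ?X) (H a) (up B (H a))" "Typ B (up B (H a)) = GF ?X"
  using up[OF B Ha(1)] Ha(2) by simp_all
 have "eleq R B (up B (H a)) (H (up A a))" "eleq R B (H (up A a)) (up B (H a))"
  using G.R.twist_unique[OF B(1) t t'(1)] G.R.twist_unique[OF B(1) t'(1) t] t'(2) Hup(2) Ha(2) eta(4)[OF X] by simp_all
 then show "eleq R (hat B) (tau B (H a)) (q (p (H (ground (tau A a)), G.pty (F.base (tau A a))), F.pty (tau A a)))"
  "eleq R (hat B) (q (p (H (ground (tau A a)), G.pty (F.base (tau A a))), F.pty (tau A a))) (tau B (H a))"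
  using hat_eleq[OF B(1) v(1) w] hat_eleq[OF B(1) w v(1)] v u X Ha by (simp_all add: pt)
qed

lemma hat_cauchy: "enriched_category R A ==> cauchy_complete R A ==> cauchy_complete R (hat A)"
 by (intro F.pb_cauchy_complete G.pb_enriched G.pb_cauchy_complete)

lemma unit_equivalence:
 "pseudonaturally_equivalent (Cat_cc TYPE('u) R) (Cat_cc TYPE('u) R) identity_map (comp_map F.pbF G.pbF)"
proof -
 interpret K: locally_ordered_category "Cat_cc TYPE('u) R" by (rule G.R.locally_ordered_category_Cat)
 have "equiv_pair (Cat_cc TYPE('u) R) A (hat A) (tau A) (sigma A)" if "A \<in> Ob (Cat_cc TYPE('u) R)" for A
 proof -
  have A: "enriched_category R A" "cauchy_complete R A" using that by simp_all
  note fs = tau_functor[OF A] sigma_functor[OF A]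
  have "pis (Cat_cc TYPE('u) R) A A (compose (Elts A) (sigma A) (tau A)) (\<lambda>a\<in>Elts A. a)"
   unfolding G.R.pis_Cat
   using A sigma_tau[OF A] G.R.functor_id[OF A(1)] G.R.functor_comp[OF A(1) hat_enriched[OF A(1)] A(1) fs]
   by (simp add: compose_def)
  moreover have "pis (Cat_cc TYPE('u) R) (hat A) (hat A) (compose (Elts (hat A)) (tau A) (sigma A)) (\<lambda>a\<in>Elts (hat A). a)"
   unfolding G.R.pis_Cat
   using hat_enriched[OF A(1)] hat_cauchy[OF A] tau_sigma[OF A] G.R.functor_id[OF hat_enriched[OF A(1)]]
    G.R.functor_comp[OF hat_enriched[OF A(1)] A(1) hat_enriched[OF A(1)] fs(2,1)]
   by (simp add: compose_def)
  ultimately show ?thesis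
   unfolding equiv_pair_def using A fs hat_enriched[OF A(1)] hat_cauchy[OF A] by simp
 qed
 moreover have "pis (Cat_cc TYPE('u) R) A (hat B) (compose (Elts A) (tau B) H)
   (compose (Elts A) (FArr F.pbF (G.pb A) (G.pb B) (FArr G.pbF A B H)) (tau A))"
  if "A \<in> Ob (Cat_cc TYPE('u) R)" "B \<in> Ob (Cat_cc TYPE('u) R)" "H \<in> Hom (Cat_cc TYPE('u) R) A B" for A B H
 proof -
  have A: "enriched_category R A" "cauchy_complete R A" and B: "enriched_category R B" "cauchy_complete R B"
   and H: "enriched_functor R A B H" using that by simp_all
  have hH: "enriched_functor R (hat A) (hat B) (FArr F.pbF (G.pb A) (G.pb B) (FArr G.pbF A B H))"
   using F.pb_map_functor[OF G.pb_enriched[OF A(1)] G.pb_enriched[OF B(1)] G.pb_map_functor[OF A(1) B(1) H]] by simp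
  have val: "FArr F.pbF (G.pb A) (G.pb B) (FArr G.pbF A B H) (tau A a)
   = q (p (H (ground (tau A a)), G.pty (F.base (tau A a))), F.pty (tau A a))" if "a \<in> Elts A" for a
   using tau_elt(1)[OF A that] hat_eltD(5)[OF tau_elt(1)[OF A that]] by simp
  show ?thesis
   unfolding G.R.pis_Cat
   using A B hat_enriched[OF B(1)] hat_cauchy[OF B] tau_natural[OF A B H] val
    G.R.functor_comp[OF A(1) B(1) hat_enriched[OF B(1)] H tau_functor[OF B]]
    G.R.functor_comp[OF A(1) hat_enriched[OF A(1)] hat_enriched[OF B(1)] tau_functor[OF A] hH]
   by (simp add: compose_def del: F.pbF_simps(2) G.pbF_simps(2))
 qed
 ultimately have "pseudonat_pair (Cat_cc TYPE('u) R) (Cat_cc TYPE('u) R) identity_map (comp_map F.pbF G.pbF) tau sigma"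
  by (simp add: pseudonat_pair_def del: F.pbF_simps(2) G.pbF_simps(2) G.R.Cat_simps(1,2))
 then show ?thesis
  using pseudonaturally_equivalent_iff[OF G.R.locally_ordered_category_Cat typed_map_identity
    typed_map_comp[OF pseudofunctor_typed[OF G.pbF_pseudofunctor] pseudofunctor_typed[OF F.pbF_pseudofunctor]]] by blast
qed

end

lemma Cat_biequivalent:
 fixes R :: "('o, 'a) locat" and S :: "('p, 'b) locat"
 assumes U: "grothendieck_universe TYPE('u)" and R: "small_quantaloid TYPE('u) R" and S: "small_quantaloid TYPE('u) S"
  and b: "biequivalence_data R S F G \<eta> \<eta>i \<epsilon> \<epsilon>i"
 shows "biequivalent (Cat_cc TYPE('u) R) (Cat_cc TYPE('u) S)"
proof -
 interpret b: biequivalence_data R S F G \<eta> \<eta>i \<epsilon> \<epsilon>i by fact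
 interpret b': biequivalence_data S R G F \<epsilon> \<epsilon>i \<eta> \<eta>i by (rule b.swap)
 have qR: "quantaloid R" and qS: "quantaloid S" and sR: "small TYPE('u) (Ob R)" and sS: "small TYPE('u) (Ob S)"
  using R S by (simp_all add: small_quantaloid_def)
 obtain p :: "'u \<times> 'p => 'u" where p: "inj_on p (UNIV \<times> Ob S)" by (rule universe_pairing_small[OF U sS])
 obtain q :: "'u \<times> 'o => 'u" where q: "inj_on q (UNIV \<times> Ob R)" by (rule universe_pairing_small[OF U sR])
 note hF = biequivalence_homomorphism[OF qR qS b] and hG = biequivalence_homomorphism[OF qS qR b.swap]
 have G: "pullback R S G p"
  using qR qS hG b'.reflects U sS p by (intro pullback.intro pullback_axioms.intro) auto
 have F: "pullback S R F q"
  using qR qS hF b.reflects U sR q by (intro pullback.intro pullback_axioms.intro) auto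
 interpret RS: two_pullbacks R S G F p q \<eta> \<eta>i
  using G F b.unit by (intro two_pullbacks.intro two_pullbacks_axioms.intro)
 interpret SR: two_pullbacks S R F G q p \<epsilon> \<epsilon>i
  using G F b.counit by (intro two_pullbacks.intro two_pullbacks_axioms.intro)
 have "pseudonaturally_equivalent (Cat_cc TYPE('u) S) (Cat_cc TYPE('u) S) (comp_map RS.G.pbF RS.F.pbF) identity_map"
  by (rule pseudonaturally_equivalent_sym[OF RS.G.S.locally_ordered_category_Cat typed_map_identity
    typed_map_comp[OF pseudofunctor_typed[OF RS.F.pbF_pseudofunctor] pseudofunctor_typed[OF RS.G.pbF_pseudofunctor]]
    SR.unit_equivalence])
 then show ?thesis
  unfolding biequivalent_def using RS.G.pbF_pseudofunctor RS.F.pbF_pseudofunctor RS.unit_equivalence by blast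
qed

theorem equivalent_imp_Ord_biequivalent:
 fixes Q :: "('o, 'a) locat" and Q' :: "('p, 'b) locat"
 assumes U: "grothendieck_universe TYPE('u)" and Q: "small_quantaloid TYPE('u) Q" and Q': "small_quantaloid TYPE('u) Q'"
  and eq: "quantaloid_equivalent Q Q'"
 shows "biequivalent (Ord_cat TYPE('u) Q) (Ord_cat TYPE('u) Q')"
proof -
 have qQ: "quantaloid Q" and qQ': "quantaloid Q'" using Q Q' by (simp_all add: small_quantaloid_def)
 obtain F where F: "weak_equivalence Q Q' F" by (rule equivalent_weak_equivalence[OF qQ qQ' eq])
 have "quantaloid (Idm Q)" "quantaloid (Idm Q')" using qQ qQ' by (auto intro: quantaloid.quantaloid_Idm)
 from weak_equivalence_inverse[OF this Idm_map_weak_equivalence[OF qQ qQ' F]]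
 obtain G \<eta> \<eta>i \<epsilon> \<epsilon>i where "biequivalence_data (Idm Q) (Idm Q') (Idm_map F) G \<eta> \<eta>i \<epsilon> \<epsilon>i" by blast
 then show ?thesis
  unfolding Ord_cat_def by (rule Cat_biequivalent[OF U small_quantaloid_Idm[OF U Q] small_quantaloid_Idm[OF U Q']])
qed

section \<open>Inserters and absolute retracts\<close>

text \<open>The inserter of \<open>f\<close> and \<open>g\<close>, with its universal property up to
 isomorphism: the largest subobject on which \<open>f \<le> g\<close>.\<close>

definition inserter :: "('k, 'c) locat => 'k => 'k => 'k => 'c => 'c => 'c => bool" where
 "inserter K A B C j f g \<longleftrightarrow> A \<in> Ob K \<and> B \<in> Ob K \<and> C \<in> Ob K \<and>
   j \<in> Hom K A B \<and> f \<in> Hom K B C \<and> g \<in> Hom K B C \<and>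
   ple K A C (Comp K A B C f j) (Comp K A B C g j) \<and>
   (\<forall>Z\<in>Ob K. \<forall>h\<in>Hom K Z B. ple K Z C (Comp K Z B C f h) (Comp K Z B C g h) -->
    (\<exists>k\<in>Hom K Z A. pis K Z B (Comp K Z A B j k) h)) \<and>
   (\<forall>Z\<in>Ob K. \<forall>k\<in>Hom K Z A. \<forall>k'\<in>Hom K Z A.
    ple K Z B (Comp K Z A B j k) (Comp K Z A B j k') --> ple K Z A k k')"

text \<open>A condition on \<open>I\<close> that mentions only arrows of \<open>K\<close> up to isomorphism,
 and is therefore invariant under biequivalence.\<close>

definition absolute_retract :: "('k, 'c) locat => 'k => bool" where
 "absolute_retract K I \<longleftrightarrow> I \<in> Ob K \<and>
   (\<forall>B C j f g. inserter K I B C j f g -->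
    (\<exists>h\<in>Hom K B I. pis K I I (Comp K I B I h j) (Ident K I)))"

context biequivalence_data
begin

text \<open>A cone in \<open>C\<close> is moved to \<open>D\<close> by \<open>F\<close>, factorised there,
 and moved back by fullness; conjugation by the counit replaces \<open>F G B\<close> by
 \<open>B\<close>.\<close>

lemma inserter_transfer:
 assumes I: "I \<in> Ob C" and ins: "inserter D (FOb F I) B T j f g"
 shows "inserter C I (FOb G B) (FOb G T)
   (Comp C I (FOb G (FOb F I)) (FOb G B) (FArr G (FOb F I) B j) (\<eta> I)) (FArr G B T f) (FArr G B T g)"
proof -
 interpret swap: biequivalence_data D C G F \<epsilon> \<epsilon>i \<eta> \<eta>i by (rule swap)
 have ob: "FOb F I \<in> Ob D" "B \<in> Ob D" "T \<in> Ob D" and j: "j \<in> Hom D (FOb F I) B"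
  and fg: "f \<in> Hom D B T" "g \<in> Hom D B T"
  and fj: "ple D (FOb F I) T (Comp D (FOb F I) B T f j) (Comp D (FOb F I) B T g j)"
  and univ: "\<And>Z h. [|Z \<in> Ob D; h \<in> Hom D Z B; ple D Z T (Comp D Z B T f h) (Comp D Z B T g h)|] ==>
    \<exists>k\<in>Hom D Z (FOb F I). pis D Z B (Comp D Z (FOb F I) B j k) h"
  and refl: "\<And>Z k k'. [|Z \<in> Ob D; k \<in> Hom D Z (FOb F I); k' \<in> Hom D Z (FOb F I);
    ple D Z B (Comp D Z (FOb F I) B j k) (Comp D Z (FOb F I) B j k')|] ==> ple D Z (FOb F I) k k'"
  using ins unfolding inserter_def by blast+
 let ?GF = "\<lambda>X. FOb G (FOb F X)" and ?GB = "FOb G B" and ?GT = "FOb G T"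
 let ?Gj = "FArr G (FOb F I) B j" and ?Gf = "FArr G B T f" and ?Gg = "FArr G B T g"
 let ?e = "\<eta> I"
 let ?j = "Comp C I (?GF I) ?GB ?Gj ?e"
 have obC: "?GF I \<in> Ob C" "?GB \<in> Ob C" "?GT \<in> Ob C" using ob by simp_all
 have Gin: "?Gj \<in> Hom C (?GF I) ?GB" "?Gf \<in> Hom C ?GB ?GT" "?Gg \<in> Hom C ?GB ?GT" using ob j fg by simp_all
 note eI = equiv_pairD[OF unit_equiv[OF I]]
 have jin: "?j \<in> Hom C I ?GB" using I obC Gin eI by simp
 have "ple C I ?GT (Comp C I ?GB ?GT ?Gf ?j) (Comp C I ?GB ?GT ?Gg ?j)"
 proof -
  have "Comp C I ?GB ?GT ?Gf ?j = Comp C I (?GF I) ?GT (Comp C (?GF I) ?GB ?GT ?Gf ?Gj) ?e"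
   using I obC Gin eI by (simp add: F.C.Comp_assoc)
  also have "pis C I ?GT \<dots> (Comp C I (?GF I) ?GT (FArr G (FOb F I) T (Comp D (FOb F I) B T f j)) ?e)"
   using I ob j fg eI by (intro F.C.pis_comp_left G.comp_sym) auto
  also have "ple C I ?GT \<dots> (Comp C I (?GF I) ?GT (FArr G (FOb F I) T (Comp D (FOb F I) B T g j)) ?e)"
   by (rule F.C.ple_comp_left[OF G.mono[OF fj] I eI(3)])
  also have "pis C I ?GT \<dots> (Comp C I (?GF I) ?GT (Comp C (?GF I) ?GB ?GT ?Gg ?Gj) ?e)"
   using I ob j fg eI by (intro F.C.pis_comp_left G.comp) auto
  also have "\<dots> = Comp C I ?GB ?GT ?Gg ?j" using I obC Gin eI by (simp add: F.C.Comp_assoc)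
  finally show ?thesis .
 qed
 moreover have "\<exists>k\<in>Hom C Z I. pis C Z ?GB (Comp C Z I ?GB ?j k) h"
  if Z: "Z \<in> Ob C" and h: "h \<in> Hom C Z ?GB" and le: "ple C Z ?GT (Comp C Z ?GB ?GT ?Gf h) (Comp C Z ?GB ?GT ?Gg h)" for Z h
 proof -
  note eZ = equiv_pairD[OF unit_equiv[OF Z]]
  have FZ: "FOb F Z \<in> Ob D" using Z by simp
  let ?h = "Comp C (?GF Z) Z ?GB h (\<eta>i Z)"
  have "?h \<in> Hom C (?GF Z) ?GB" using Z h eZ obC by simp
  from swap.full[OF FZ ob(2) this]
  obtain l where l: "l \<in> Hom D (FOb F Z) B" "pis C (?GF Z) ?GB (FArr G (FOb F Z) B l) ?h" by blast
  have Gl: "FArr G (FOb F Z) B l \<in> Hom C (?GF Z) ?GB" using l FZ ob by simp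
  have Fl: "pis C (?GF Z) ?GT (FArr G (FOb F Z) T (Comp D (FOb F Z) B T x l))
    (Comp C (?GF Z) Z ?GT (Comp C Z ?GB ?GT (FArr G B T x) h) (\<eta>i Z))" if x: "x \<in> Hom D B T" for x
  proof -
   have "pis C (?GF Z) ?GT (FArr G (FOb F Z) T (Comp D (FOb F Z) B T x l))
    (Comp C (?GF Z) ?GB ?GT (FArr G B T x) (FArr G (FOb F Z) B l))"
    using x l FZ ob by (intro G.comp) auto
   also have "pis C (?GF Z) ?GT \<dots> (Comp C (?GF Z) ?GB ?GT (FArr G B T x) ?h)"
    using x ob l(2) by (intro F.C.pis_comp_right) auto
   also have "\<dots> = Comp C (?GF Z) Z ?GT (Comp C Z ?GB ?GT (FArr G B T x) h) (\<eta>i Z)"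
    using x ob Z h eZ obC by (simp add: F.C.Comp_assoc)
   finally show ?thesis .
  qed
  have "ple C (?GF Z) ?GT (FArr G (FOb F Z) T (Comp D (FOb F Z) B T f l)) (FArr G (FOb F Z) T (Comp D (FOb F Z) B T g l))"
   by (rule F.C.pis_ple_trans[OF Fl[OF fg(1)] F.C.ple_pis_trans[OF F.C.ple_comp_left[OF le eZ(2,4)] pis_sym[OF Fl[OF fg(2)]]]])
  then have "ple D (FOb F Z) T (Comp D (FOb F Z) B T f l) (Comp D (FOb F Z) B T g l)"
   using FZ ob l fg by (intro swap.reflects) auto
  from univ[OF FZ l(1) this]
  obtain m where m: "m \<in> Hom D (FOb F Z) (FOb F I)" "pis D (FOb F Z) B (Comp D (FOb F Z) (FOb F I) B j m) l" by blast
  from full[OF Z I m(1)] obtain k where k: "k \<in> Hom C Z I" "pis D (FOb F Z) (FOb F I) (FArr F Z I k) m" by blast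
  have Fk: "FArr F Z I k \<in> Hom D (FOb F Z) (FOb F I)" "FArr G (FOb F Z) (FOb F I) (FArr F Z I k) \<in> Hom C (?GF Z) (?GF I)"
   using k Z I by simp_all
  have "Comp C Z I ?GB ?j k = Comp C Z (?GF I) ?GB ?Gj (Comp C Z I (?GF I) ?e k)"
   using Z I k obC Gin eI by (simp add: F.C.Comp_assoc)
  also have "pis C Z ?GB \<dots> (Comp C Z (?GF I) ?GB ?Gj (Comp C Z (?GF Z) (?GF I) (FArr G (FOb F Z) (FOb F I) (FArr F Z I k)) (\<eta> Z)))"
   using obC Gin by (intro F.C.pis_comp_right unit_nat[OF Z I k(1)]) auto
  also have "\<dots> = Comp C Z (?GF Z) ?GB (Comp C (?GF Z) (?GF I) ?GB ?Gj (FArr G (FOb F Z) (FOb F I) (FArr F Z I k))) (\<eta> Z)"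
   using Z obC Gin Fk eZ by (simp add: F.C.Comp_assoc)
  also have "pis C Z ?GB \<dots> (Comp C Z (?GF Z) ?GB (FArr G (FOb F Z) B (Comp D (FOb F Z) (FOb F I) B j (FArr F Z I k))) (\<eta> Z))"
   using Z FZ ob j Fk eZ by (intro F.C.pis_comp_left G.comp_sym) auto
  also have "pis C Z ?GB \<dots> (Comp C Z (?GF Z) ?GB (FArr G (FOb F Z) B l) (\<eta> Z))"
  proof (intro F.C.pis_comp_left G.iso)
   show "pis D (FOb F Z) B (Comp D (FOb F Z) (FOb F I) B j (FArr F Z I k)) l"
    by (rule F.D.pis_trans[OF F.D.pis_comp_right[OF k(2) ob(2) j] m(2)])
  qed (use Z eZ in auto)
  also have "pis C Z ?GB \<dots> (Comp C Z (?GF Z) ?GB ?h (\<eta> Z))"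
   by (rule F.C.pis_comp_left[OF l(2) Z eZ(3)])
  also have "\<dots> = Comp C Z Z ?GB h (Comp C Z (?GF Z) Z (\<eta>i Z) (\<eta> Z))" using Z h eZ obC by (simp add: F.C.Comp_assoc)
  also have "pis C Z ?GB \<dots> (Comp C Z Z ?GB h (Ident C Z))" by (rule F.C.pis_comp_right[OF eZ(5) obC(2) h])
  also have "\<dots> = h" using Z obC h by simp
  finally show ?thesis using k(1) by blast
 qed
 moreover have "ple C Z I k k'"
  if Z: "Z \<in> Ob C" and k: "k \<in> Hom C Z I" "k' \<in> Hom C Z I" and le: "ple C Z ?GB (Comp C Z I ?GB ?j k) (Comp C Z I ?GB ?j k')" for Z k k'
 proof -
  note eZ = equiv_pairD[OF unit_equiv[OF Z]]
  have FZ: "FOb F Z \<in> Ob D" using Z by simp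
  have jk: "pis C Z ?GB (Comp C Z I ?GB ?j x)
   (Comp C Z (?GF Z) ?GB (FArr G (FOb F Z) B (Comp D (FOb F Z) (FOb F I) B j (FArr F Z I x))) (\<eta> Z))"
   if x: "x \<in> Hom C Z I" for x
  proof -
   have Fx: "FArr F Z I x \<in> Hom D (FOb F Z) (FOb F I)" "FArr G (FOb F Z) (FOb F I) (FArr F Z I x) \<in> Hom C (?GF Z) (?GF I)"
    using x Z I by simp_all
   have "Comp C Z I ?GB ?j x = Comp C Z (?GF I) ?GB ?Gj (Comp C Z I (?GF I) ?e x)"
    using Z I x obC Gin eI by (simp add: F.C.Comp_assoc)
   also have "pis C Z ?GB \<dots> (Comp C Z (?GF I) ?GB ?Gj (Comp C Z (?GF Z) (?GF I) (FArr G (FOb F Z) (FOb F I) (FArr F Z I x)) (\<eta> Z)))"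
    using obC Gin by (intro F.C.pis_comp_right unit_nat[OF Z I x]) auto
   also have "\<dots> = Comp C Z (?GF Z) ?GB (Comp C (?GF Z) (?GF I) ?GB ?Gj (FArr G (FOb F Z) (FOb F I) (FArr F Z I x))) (\<eta> Z)"
    using Z obC Gin Fx eZ by (simp add: F.C.Comp_assoc)
   also have "pis C Z ?GB \<dots> (Comp C Z (?GF Z) ?GB (FArr G (FOb F Z) B (Comp D (FOb F Z) (FOb F I) B j (FArr F Z I x))) (\<eta> Z))"
    using Z FZ ob j Fx eZ by (intro F.C.pis_comp_left G.comp_sym) auto
   finally show ?thesis .
  qed
  let ?F = "\<lambda>x. Comp D (FOb F Z) (FOb F I) B j (FArr F Z I x)"
  have Fin: "?F x \<in> Hom D (FOb F Z) B" if "x \<in> Hom C Z I" for x using that Z I ob j by simp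
  have "ple C Z ?GB (Comp C Z (?GF Z) ?GB (FArr G (FOb F Z) B (?F k)) (\<eta> Z)) (Comp C Z (?GF Z) ?GB (FArr G (FOb F Z) B (?F k')) (\<eta> Z))"
   by (rule F.C.pis_ple_trans[OF pis_sym[OF jk[OF k(1)]] F.C.ple_pis_trans[OF le jk[OF k(2)]]])
  then have "ple C (?GF Z) ?GB (FArr G (FOb F Z) B (?F k)) (FArr G (FOb F Z) B (?F k'))"
   using obC Fin k FZ ob by (intro F.C.equiv_pair_cancel_right[OF unit_equiv[OF Z]]) auto
  then have "ple D (FOb F Z) B (?F k) (?F k')" using FZ ob Fin k by (intro swap.reflects) auto
  then have "ple D (FOb F Z) (FOb F I) (FArr F Z I k) (FArr F Z I k')" using FZ Z I k by (intro refl) auto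
  then show ?thesis using Z I k by (intro reflects) auto
 qed
 ultimately show ?thesis unfolding inserter_def using I obC jin Gin by blast
qed

lemma absolute_retract_transfer:
 assumes ar: "absolute_retract C I"
 shows "absolute_retract D (FOb F I)"
proof -
 interpret swap: biequivalence_data D C G F \<epsilon> \<epsilon>i \<eta> \<eta>i by (rule swap)
 have I: "I \<in> Ob C" using ar by (simp add: absolute_retract_def)
 have "\<exists>h\<in>Hom D B (FOb F I). pis D (FOb F I) (FOb F I) (Comp D (FOb F I) B (FOb F I) h j) (Ident D (FOb F I))"
  if ins: "inserter D (FOb F I) B T j f g" for B T j f g
 proof -
  let ?GFI = "FOb G (FOb F I)" and ?GB = "FOb G B" and ?Gj = "FArr G (FOb F I) B j"
  have ob: "FOb F I \<in> Ob D" "B \<in> Ob D" and j: "j \<in> Hom D (FOb F I) B" using ins by (simp_all add: inserter_def)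
  have obC: "?GFI \<in> Ob C" "?GB \<in> Ob C" and Gj: "?Gj \<in> Hom C ?GFI ?GB" using ob j by simp_all
  note e = equiv_pairD[OF unit_equiv[OF I]]
  obtain r where r: "r \<in> Hom C ?GB I"
   "pis C I I (Comp C I ?GB I r (Comp C I ?GFI ?GB ?Gj (\<eta> I))) (Ident C I)"
   using ar inserter_transfer[OF I ins] unfolding absolute_retract_def by blast
  have er: "Comp C ?GB I ?GFI (\<eta> I) r \<in> Hom C ?GB ?GFI" using I obC e r by simp
  from swap.full[OF ob(2,1) er]
  obtain h where h: "h \<in> Hom D B (FOb F I)" "pis C ?GB ?GFI (FArr G B (FOb F I) h) (Comp C ?GB I ?GFI (\<eta> I) r)" by blast
  let ?hj = "Comp D (FOb F I) B (FOb F I) h j"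
  have hj: "?hj \<in> Hom D (FOb F I) (FOb F I)" using h j ob by simp
  have "pis C I ?GFI (Comp C I ?GFI ?GFI (FArr G (FOb F I) (FOb F I) ?hj) (\<eta> I))
   (Comp C I ?GFI ?GFI (Comp C ?GFI ?GB ?GFI (FArr G B (FOb F I) h) ?Gj) (\<eta> I))"
   using I e h j ob by (intro F.C.pis_comp_left G.comp) auto
  also have "pis C I ?GFI \<dots> (Comp C I ?GFI ?GFI (Comp C ?GFI ?GB ?GFI (Comp C ?GB I ?GFI (\<eta> I) r) ?Gj) (\<eta> I))"
   by (rule F.C.pis_comp_left[OF F.C.pis_comp_left[OF h(2) obC(1) Gj] I e(3)])
  also have "\<dots> = Comp C I I ?GFI (\<eta> I) (Comp C I ?GB I r (Comp C I ?GFI ?GB ?Gj (\<eta> I)))"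
   using I obC e r Gj by (simp add: F.C.Comp_assoc)
  also have "pis C I ?GFI \<dots> (Comp C I I ?GFI (\<eta> I) (Ident C I))"
   by (rule F.C.pis_comp_right[OF r(2) obC(1) e(3)])
  also have "\<dots> = Comp C I ?GFI ?GFI (Ident C ?GFI) (\<eta> I)" using I obC e by simp
  also have "pis C I ?GFI \<dots> (Comp C I ?GFI ?GFI (FArr G (FOb F I) (FOb F I) (Ident D (FOb F I))) (\<eta> I))"
   by (rule F.C.pis_comp_left[OF pis_sym[OF G.ident[OF ob(1)]] I e(3)])
  finally have *: "pis C I ?GFI (Comp C I ?GFI ?GFI (FArr G (FOb F I) (FOb F I) ?hj) (\<eta> I))
   (Comp C I ?GFI ?GFI (FArr G (FOb F I) (FOb F I) (Ident D (FOb F I))) (\<eta> I))" .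
  have id: "Ident D (FOb F I) \<in> Hom D (FOb F I) (FOb F I)" using ob by simp
  have "pis C ?GFI ?GFI (FArr G (FOb F I) (FOb F I) ?hj) (FArr G (FOb F I) (FOb F I) (Ident D (FOb F I)))"
   using * obC G.arr[OF ob(1,1) hj] G.arr[OF ob(1,1) id] unfolding pis_def
   by (blast intro: F.C.equiv_pair_cancel_right[OF unit_equiv[OF I]])
  then have "pis D (FOb F I) (FOb F I) ?hj (Ident D (FOb F I))"
   by (rule swap.reflects_pis[OF ob(1,1) hj id])
  then show ?thesis using h by blast
 qed
 then show ?thesis using I by (simp add: absolute_retract_def)
qed

end


section \<open>The enriched category of elements of a module\<close>

context sup_module
begin

definition mle :: "'o => 'x => 'x => bool" where
 "mle X x y \<longleftrightarrow> X \<in> Ob Q \<and> x \<in> carrier (lat X) \<and> y \<in> carrier (lat X) \<and> le (lat X) x y"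

lemma mle_refl: "X \<in> Ob Q ==> x \<in> carrier (lat X) ==> mle X x x"
 by (simp add: mle_def complete_lattice_refl lat)

lemma mle_trans [trans]: "mle X x y ==> mle X y z ==> mle X x z"
 unfolding mle_def using complete_lattice_trans[OF lat, of X x y z] by blast

lemma mle_antisym: "mle X x y ==> mle X y x ==> x = y"
 unfolding mle_def using complete_lattice_antisym[OF lat, of X x y] by blast

lemma act_mle: "[|X \<in> Ob Q; f \<in> Hom Q X Y; mle Y y z|] ==> mle X (act X Y f y) (act X Y f z)"
proof -
 assume X: "X \<in> Ob Q" and f: "f \<in> Hom Q X Y" and yz: "mle Y y z"
 have Y: "Y \<in> Ob Q" "y \<in> carrier (lat Y)" "z \<in> carrier (lat Y)" using yz by (simp_all add: mle_def)
 have "lub_in (lat Y) {y, z} z" using yz complete_lattice_refl[OF lat] by (auto simp: mle_def lub_in_def)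
 from act_sup[OF X Y(1) f this] show ?thesis using X Y f by (auto simp: mle_def lub_in_def act_in)
qed

lemma act_ple: "[|ple Q X Y f g; y \<in> carrier (lat Y)|] ==> mle X (act X Y f y) (act X Y g y)"
proof -
 assume fg: "ple Q X Y f g" and y: "y \<in> carrier (lat Y)"
 have X: "X \<in> Ob Q" "Y \<in> Ob Q" "f \<in> Hom Q X Y" "g \<in> Hom Q X Y" using fg by (auto simp: ple_def)
 have "lub_in (homlat Q X Y) {f, g} g" using fg by (auto simp: ple_def lub_in_def Leq_refl)
 from act_hsup[OF X(1,2) y this] show ?thesis using X y by (auto simp: mle_def lub_in_def act_in)
qed

text \<open>The largest arrow taking \<open>x'\<close> below \<open>x\<close>.\<close>

definition mhom :: "'o => 'x => 'o => 'x => 'a" where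
 "mhom X' x' X x = hsup Q X X' {f \<in> Hom Q X X'. mle X (act X X' f x') x}"

lemma mhom_in [simp]: "[|X \<in> Ob Q; X' \<in> Ob Q|] ==> mhom X' x' X x \<in> Hom Q X X'"
 unfolding mhom_def by (intro hsup_in) auto

lemma mhom_act:
 assumes X: "X \<in> Ob Q" "X' \<in> Ob Q" and x: "x' \<in> carrier (lat X')" "x \<in> carrier (lat X)"
 shows "mle X (act X X' (mhom X' x' X x) x') x"
proof -
 let ?S = "{f \<in> Hom Q X X'. mle X (act X X' f x') x}"
 have "lub_in (homlat Q X X') ?S (mhom X' x' X x)" unfolding mhom_def using X by (intro hsup_lub) auto
 from act_hsup[OF X x(1) this] show ?thesis using X x by (auto simp: lub_in_def mle_def act_in)
qed

lemma mhom_iff: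
 assumes X: "X \<in> Ob Q" "X' \<in> Ob Q" and x: "x' \<in> carrier (lat X')" "x \<in> carrier (lat X)" and f: "f \<in> Hom Q X X'"
 shows "ple Q X X' f (mhom X' x' X x) \<longleftrightarrow> mle X (act X X' f x') x"
proof
 assume "ple Q X X' f (mhom X' x' X x)"
 from mle_trans[OF act_ple[OF this x(1)] mhom_act[OF X x]] show "mle X (act X X' f x') x" .
next
 assume "mle X (act X X' f x') x"
 then show "ple Q X X' f (mhom X' x' X x)" unfolding mhom_def using X f by (intro hsup_upper) auto
qed

definition msup :: "'o => 'x set => 'x" where
 "msup X A = \<Squnion>\<^bsub>lat X\<^esub> A"

lemma msup_lub: "[|X \<in> Ob Q; A \<subseteq> carrier (lat X)|] ==> lub_in (lat X) A (msup X A)"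
 unfolding msup_def by (rule sup_lub_in[OF lat])

lemma msup_in: "[|X \<in> Ob Q; A \<subseteq> carrier (lat X)|] ==> msup X A \<in> carrier (lat X)"
 using msup_lub by (simp add: lub_in_def)

lemma msup_upper: "[|X \<in> Ob Q; A \<subseteq> carrier (lat X); a \<in> A|] ==> mle X a (msup X A)"
 using msup_lub[of X A] unfolding lub_in_def mle_def by blast

lemma msup_least:
 assumes "X \<in> Ob Q" "y \<in> carrier (lat X)" "\<And>a. a \<in> A ==> mle X a y"
 shows "mle X (msup X A) y"
proof -
 have "A \<subseteq> carrier (lat X)" using assms(3) by (auto simp: mle_def)
 then show ?thesis using msup_lub[of X A] assms unfolding lub_in_def mle_def by blast
qed

lemma act_msup_le:
 assumes X: "X \<in> Ob Q" "Y \<in> Ob Q" and f: "f \<in> Hom Q X Y" and A: "A \<subseteq> carrier (lat Y)" and z: "z \<in> carrier (lat X)"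
  and le: "\<And>a. a \<in> A ==> mle X (act X Y f a) z"
 shows "mle X (act X Y f (msup Y A)) z"
 using act_sup[OF X f msup_lub[OF X(2) A]] le X z unfolding lub_in_def mle_def by blast

end

locale module_cat = sup_module Q lat act
 for Q :: "('o, 'a) locat" and lat :: "'o => 'x gorder" and act +
 fixes k :: "'o \<times> 'x => 'u"
 assumes universe: "grothendieck_universe TYPE('u)"
  and small_Ob: "small TYPE('u) (Ob Q)"
  and small_car: "X \<in> Ob Q ==> small TYPE('u) (carrier (lat X))"
  and k: "inj_on k (SIGMA X:Ob Q. carrier (lat X))"
begin

definition ty :: "'u => 'o" where "ty u = fst (inv_into (SIGMA X:Ob Q. carrier (lat X)) k u)"
definition val :: "'u => 'x" where "val u = snd (inv_into (SIGMA X:Ob Q. carrier (lat X)) k u)"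

lemma ty_k [simp]: "[|X \<in> Ob Q; x \<in> carrier (lat X)|] ==> ty (k (X, x)) = X"
 and val_k [simp]: "[|X \<in> Ob Q; x \<in> carrier (lat X)|] ==> val (k (X, x)) = x"
 using k by (simp_all add: ty_def val_def)

definition elements :: "('u, 'o, 'a) ecat" where
 "elements = \<lparr>Elts = k ` (SIGMA X:Ob Q. carrier (lat X)), Typ = ty,
   EHom = (\<lambda>u' u. mhom (ty u') (val u') (ty u) (val u))\<rparr>"

lemma Typ_elements [simp]: "Typ elements = ty"
 by (simp add: elements_def)

lemma elt [simp]: "[|X \<in> Ob Q; x \<in> carrier (lat X)|] ==> k (X, x) \<in> Elts elements"
 by (auto simp: elements_def)

lemma eltD:
 assumes "u \<in> Elts elements"
 shows "ty u \<in> Ob Q" "val u \<in> carrier (lat (ty u))" "k (ty u, val u) = u"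
 using assms by (auto simp: elements_def)

lemma ehom_iff:
 assumes "u' \<in> Elts elements" "u \<in> Elts elements" "f \<in> Hom Q (ty u) (ty u')"
 shows "ple Q (ty u) (ty u') f (EHom elements u' u) \<longleftrightarrow> mle (ty u) (act (ty u) (ty u') f (val u')) (val u)"
 using mhom_iff eltD[OF assms(1)] eltD[OF assms(2)] assms(3) by (simp add: elements_def)

lemma ehom_in: "[|u' \<in> Elts elements; u \<in> Elts elements|] ==> EHom elements u' u \<in> Hom Q (ty u) (ty u')"
 using eltD by (simp add: elements_def)

lemma ehom_act:
 "[|u' \<in> Elts elements; u \<in> Elts elements|] ==> mle (ty u) (act (ty u) (ty u') (EHom elements u' u) (val u')) (val u)"
 using mhom_act eltD by (simp add: elements_def)

lemma elements_enriched: "enriched_category Q elements"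
proof (rule enriched_categoryI)
 have "small TYPE('u) (SIGMA X:Ob Q. carrier (lat X))"
  using small_car by (intro small_Sigma[OF universe small_Ob]) auto
 then show "small TYPE('u) (Elts elements)" by (simp add: elements_def small_image)
next
 fix u'' u' u assume u: "u'' \<in> Elts elements" "u' \<in> Elts elements" "u \<in> Elts elements"
 note D = eltD[OF u(1)] eltD[OF u(2)] eltD[OF u(3)]
 note h = ehom_in[OF u(1,2)] ehom_in[OF u(2,3)]
 have "mle (ty u) (act (ty u) (ty u') (EHom elements u' u) (act (ty u') (ty u'') (EHom elements u'' u') (val u''))) (val u)"
  by (rule mle_trans[OF act_mle[OF D(7) h(2) ehom_act[OF u(1,2)]] ehom_act[OF u(2,3)]])
 then show "ple Q (Typ elements u) (Typ elements u'') (Comp Q (Typ elements u) (Typ elements u') (Typ elements u'')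
   (EHom elements u'' u') (EHom elements u' u)) (EHom elements u'' u)"
  using D h by (simp add: ehom_iff[OF u(1,3)] act_comp)
next
 fix u assume u: "u \<in> Elts elements"
 note D = eltD[OF u]
 show "ple Q (Typ elements u) (Typ elements u) (Ident Q (Typ elements u)) (EHom elements u u)"
  using D by (simp add: ehom_iff[OF u u] act_id mle_refl)
qed (use eltD ehom_in in auto)

lemma eleq_elements:
 assumes "u \<in> Elts elements" "v \<in> Elts elements"
 shows "eleq Q elements u v \<longleftrightarrow> ty u = ty v \<and> mle (ty u) (val u) (val v)"
proof (cases "ty u = ty v")
 case True
 then show ?thesis using eltD[OF assms(1)] eltD[OF assms(2)] assms ehom_iff[OF assms, of "Ident Q (ty u)"]
  by (simp add: eleq_def act_id)
qed (simp add: eleq_def)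

text \<open>The element generated by a family \<open>\<phi>\<close> is the supremum of the elements \<open>v \<cdot> \<phi> v\<close>.\<close>

lemma elements_cauchy_complete: "cauchy_complete Q elements"
proof (rule cauchy_completeI[OF elements_enriched])
 fix X \<phi> \<psi> assume ad: "adj_family (Elts elements) (\<lambda>c. c) elements X \<phi> \<psi>"
 note D = adj_familyD[OF ad, simplified]
 let ?S = "(\<lambda>v. act X (ty v) (\<phi> v) (val v)) ` Elts elements"
 have S: "?S \<subseteq> carrier (lat X)" using D(1,3) eltD by (auto intro!: act_in)
 let ?c = "k (X, msup X ?S)"
 have c: "?c \<in> Elts elements" "ty ?c = X" "val ?c = msup X ?S" using D(1) S by (simp_all add: msup_in)
 show "\<exists>c\<in>Elts elements. Typ elements c = X \<and> (\<forall>b\<in>Elts elements.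
   ple Q X (Typ elements b) (\<phi> b) (EHom elements b c) \<and> ple Q (Typ elements b) X (\<psi> b) (EHom elements c b))"
 proof (intro bexI[OF _ c(1)] conjI ballI)
  fix b assume b: "b \<in> Elts elements"
  note bD = eltD[OF b]
  have "mle X (act X (ty b) (\<phi> b) (val b)) (msup X ?S)" using D(1) S b by (intro msup_upper) auto
  then show "ple Q X (Typ elements b) (\<phi> b) (EHom elements b ?c)"
   using ehom_iff[OF b c(1), of "\<phi> b"] D(3)[OF b] c by simp
  have "mle (ty b) (act (ty b) X (\<psi> b) (msup X ?S)) (val b)"
  proof (rule act_msup_le[OF bD(1) D(1) D(4)[OF b] S bD(2)])
   fix y assume "y \<in> ?S"
   then obtain v where v: "v \<in> Elts elements" "y = act X (ty v) (\<phi> v) (val v)" by blast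
   have "act (ty b) X (\<psi> b) y = act (ty b) (ty v) (Comp Q (ty b) X (ty v) (\<phi> v) (\<psi> b)) (val v)"
    using v eltD[OF v(1)] bD D(1) D(3)[OF v(1)] D(4)[OF b] by (simp add: act_comp)
   also have "mle (ty b) \<dots> (act (ty b) (ty v) (EHom elements v b) (val v))"
    by (rule act_ple[OF D(6)[OF v(1) b] eltD(2)[OF v(1)]])
   also have "mle (ty b) \<dots> (val b)" by (rule ehom_act[OF v(1) b])
   finally show "mle (ty b) (act (ty b) X (\<psi> b) y) (val b)" .
  qed
  then show "ple Q (Typ elements b) X (\<psi> b) (EHom elements ?c b)"
   using ehom_iff[OF c(1) b, of "\<psi> b"] D(4)[OF b] c by simp
 qed (use c in simp)
qed

lemma elements_Ob: "elements \<in> Ob (Cat_cc TYPE('u) Q)"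
 by (simp add: elements_enriched elements_cauchy_complete)

text \<open>The left Kan extension of the identity along \<open>j\<close>: an element \<open>b\<close> is sent to the supremum of
 the elements \<open>u \<cdot> B(j u, b)\<close>, and full faithfulness of \<open>j\<close> makes this \<open>u\<close> at \<open>j u\<close>.\<close>

lemma elements_retract:
 assumes B: "enriched_category Q B" and j: "enriched_functor Q elements B j"
  and ff: "\<And>u' u. [|u' \<in> Elts elements; u \<in> Elts elements|] ==> EHom elements u' u = EHom B (j u') (j u)"
 obtains h where "enriched_functor Q B elements h" "\<And>u. u \<in> Elts elements ==> h (j u) = u"
proof -
 note BD = ecatD(2,3)[OF B]
 have jin: "j u \<in> Elts B" "Typ B (j u) = ty u" if "u \<in> Elts elements" for u
  using functor_in[OF j that] functor_typ[OF j that] by simp_all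
 have bj: "EHom B (j u) b \<in> Hom Q (Typ B b) (ty u)" if "u \<in> Elts elements" "b \<in> Elts B" for u b
  using BD(2)[OF jin(1)[OF that(1)] that(2)] jin(2)[OF that(1)] by simp
 let ?S = "\<lambda>b. (\<lambda>u. act (Typ B b) (ty u) (EHom B (j u) b) (val u)) ` Elts elements"
 define H where "H b = msup (Typ B b) (?S b)" for b
 have S: "?S b \<subseteq> carrier (lat (Typ B b))" if "b \<in> Elts B" for b
  using that BD(1) eltD bj by (auto intro!: act_in)
 have H_in: "H b \<in> carrier (lat (Typ B b))" if "b \<in> Elts B" for b
  unfolding H_def using that BD(1) S by (intro msup_in)
 have H_up: "mle (Typ B b) (act (Typ B b) (ty u) (EHom B (j u) b) (val u)) (H b)" if "b \<in> Elts B" "u \<in> Elts elements" for b u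
  unfolding H_def using that BD(1) S by (intro msup_upper) auto
 let ?h = "\<lambda>b\<in>Elts B. k (Typ B b, H b)"
 have h: "?h b \<in> Elts elements" "ty (?h b) = Typ B b" "val (?h b) = H b" if "b \<in> Elts B" for b
  using that BD(1) H_in by simp_all
 have "enriched_functor Q B elements ?h"
 proof (rule functorI)
  fix b' b assume b: "b' \<in> Elts B" "b \<in> Elts B"
  have "mle (Typ B b) (act (Typ B b) (Typ B b') (EHom B b' b) (H b')) (H b)"
   unfolding H_def[of b']
  proof (rule act_msup_le[OF BD(1)[OF b(2)] BD(1)[OF b(1)] BD(2)[OF b] S[OF b(1)] H_in[OF b(2)]])
   fix y assume "y \<in> ?S b'"
   then obtain u where u: "u \<in> Elts elements" "y = act (Typ B b') (ty u) (EHom B (j u) b') (val u)" by blast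
   have "act (Typ B b) (Typ B b') (EHom B b' b) y
    = act (Typ B b) (ty u) (Comp Q (Typ B b) (Typ B b') (ty u) (EHom B (j u) b') (EHom B b' b)) (val u)"
    using u eltD[OF u(1)] BD b bj by (simp add: act_comp)
   also have "mle (Typ B b) \<dots> (act (Typ B b) (ty u) (EHom B (j u) b) (val u))"
    using ecat_comp[OF B jin(1)[OF u(1)] b] jin(2)[OF u(1)] eltD[OF u(1)] by (intro act_ple) simp_all
   also have "mle (Typ B b) \<dots> (H b)" by (rule H_up[OF b(2) u(1)])
   finally show "mle (Typ B b) (act (Typ B b) (Typ B b') (EHom B b' b) y) (H b)" .
  qed
  then show "ple Q (Typ B b) (Typ B b') (EHom B b' b) (EHom elements (?h b') (?h b))"
   using ehom_iff[OF h(1)[OF b(1)] h(1)[OF b(2)], of "EHom B b' b"] h(2,3)[OF b(1)] h(2,3)[OF b(2)] BD(2)[OF b] by simp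
 qed (use h in auto)
 moreover have "?h (j u) = u" if u: "u \<in> Elts elements" for u
 proof -
  note uD = eltD[OF u]
  have "mle (ty u) (H (j u)) (val u)"
   unfolding H_def jin(2)[OF u]
  proof (rule msup_least[OF uD(1,2)])
   fix y assume "y \<in> (\<lambda>v. act (ty u) (ty v) (EHom B (j v) (j u)) (val v)) ` Elts elements"
   then obtain v where v: "v \<in> Elts elements" "y = act (ty u) (ty v) (EHom elements v u) (val v)" using ff u by auto
   then show "mle (ty u) y (val u)" using ehom_act[OF v(1) u] by simp
  qed
  moreover have "mle (ty u) (val u) (H (j u))"
  proof -
   have i: "ple Q (ty u) (ty u) (Ident Q (ty u)) (EHom B (j u) (j u))"
    using ecat_id[OF B jin(1)[OF u]] jin(2)[OF u] by simp
   have "val u = act (ty u) (ty u) (Ident Q (ty u)) (val u)" using uD by (simp add: act_id)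
   also have "mle (ty u) \<dots> (act (ty u) (ty u) (EHom B (j u) (j u)) (val u))" by (rule act_ple[OF i uD(2)])
   also have "mle (ty u) \<dots> (H (j u))" using H_up[OF jin(1)[OF u] u] jin(2)[OF u] by simp
   finally show ?thesis .
  qed
  ultimately have "H (j u) = val u" by (rule mle_antisym)
  then show ?thesis using jin[OF u] uD by simp
 qed
 ultimately show thesis by (rule that)
qed

end

section \<open>Fully faithful functors are the inserters\<close>

context quantaloid
begin

text \<open>The elements with \<open>F b \<le> G b\<close> are closed under the weighted colimits that all functors
 preserve; hence they form a Cauchy complete category.\<close>

definition inserter_of :: "('u, 'o, 'a) ecat => ('u, 'o, 'a) ecat => ('u => 'u) => ('u => 'u) => ('u, 'o, 'a) ecat" where
 "inserter_of B C F G = \<lparr>Elts = {b \<in> Elts B. eleq Q C (F b) (G b)}, Typ = Typ B, EHom = EHom B\<rparr>"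

lemma inserter_of_simps [simp]:
 "Elts (inserter_of B C F G) = {b \<in> Elts B. eleq Q C (F b) (G b)}"
 "Typ (inserter_of B C F G) = Typ B" "EHom (inserter_of B C F G) = EHom B"
 by (simp_all add: inserter_of_def)

lemma inserter_of_Ob:
 fixes B C :: "('u, 'o, 'a) ecat"
 assumes U: "grothendieck_universe TYPE('u)" and B: "B \<in> Ob (Cat_cc TYPE('u) Q)" and C: "C \<in> Ob (Cat_cc TYPE('u) Q)"
  and F: "enriched_functor Q B C F" and G: "enriched_functor Q B C G"
 shows "inserter_of B C F G \<in> Ob (Cat_cc TYPE('u) Q)"
  and "enriched_functor Q (inserter_of B C F G) B (\<lambda>b\<in>Elts (inserter_of B C F G). b)"
proof -
 let ?E = "inserter_of B C F G"
 have eB: "enriched_category Q B" and cB: "cauchy_complete Q B" and eC: "enriched_category Q C" using B C by simp_all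
 have E: "enriched_category Q ?E"
 proof (rule enriched_categoryI)
  show "small TYPE('u) (Elts ?E)" by (rule small_subset[OF ecatD(1)[OF eB]]) auto
 qed (use ecatD(2,3)[OF eB] ecat_comp[OF eB] ecat_id[OF eB] in auto)
 show J: "enriched_functor Q ?E B (\<lambda>b\<in>Elts ?E. b)"
  using ecatD(2,3)[OF eB] by (intro functorI) (auto intro!: ple_refl)
 have "cauchy_complete Q ?E"
 proof (rule cauchy_completeI[OF E])
  fix X \<phi> \<psi> assume ad: "adj_family (Elts ?E) (\<lambda>c. c) ?E X \<phi> \<psi>"
  then have ad: "adj_family (Elts ?E) (\<lambda>c. c) B X \<phi> \<psi>" by (simp add: adj_family_def)
  note D = adj_familyD[OF ad]
  obtain c where c: "c \<in> Elts B" "Typ B c = X"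
   and \<phi>: "\<And>b. b \<in> Elts ?E ==> ple Q X (Typ B b) (\<phi> b) (EHom B b c)"
   and \<psi>: "\<And>b. b \<in> Elts ?E ==> ple Q (Typ B b) X (\<psi> b) (EHom B c b)"
   using cauchy_complete_family[OF U cB eB ad] by blast
  have C: "F b \<in> Elts C" "G b \<in> Elts C" "Typ C (F b) = Typ B b" "Typ C (G b) = Typ B b" if "b \<in> Elts B" for b
   using functor_in[OF F that] functor_in[OF G that] functor_typ[OF F that] functor_typ[OF G that] by simp_all
  have FG: "EHom C (F c) (G c) \<in> Hom Q X X" using ecatD(3)[OF eC C(1,2)[OF c(1)]] C[OF c(1)] c(2) by simp
  have "ple Q X X (Ident Q X) (EHom C (F c) (G c))"
  proof (rule adj_family_unit[OF eB ad D(1) _ FG])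
   fix b assume b: "b \<in> Elts ?E"
   then have bB: "b \<in> Elts B" and Fb: "eleq Q C (F b) (G b)" by simp_all
   note Cb = C[OF bB] and Cc = C[OF c(1)]
   have "ple Q (Typ B b) X (\<psi> b) (EHom B c b)" by (rule \<psi>[OF b])
   also have "ple Q (Typ B b) X \<dots> (EHom C (F c) (F b))" using functor_ple[OF eB eC F c(1) bB] c(2) by simp
   also have "ple Q (Typ B b) X \<dots> (EHom C (F c) (G b))" using eleq_right[OF eC Fb Cc(1)] Cb Cc c(2) by simp
   finally have 1: "ple Q (Typ B b) X (\<psi> b) (EHom C (F c) (G b))" .
   have "ple Q X (Typ B b) (\<phi> b) (EHom B b c)" by (rule \<phi>[OF b])
   also have "ple Q X (Typ B b) \<dots> (EHom C (G b) (G c))" using functor_ple[OF eB eC G bB c(1)] c(2) by simp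
   finally have "ple Q X X (Comp Q X (Typ B b) X (\<psi> b) (\<phi> b))
    (Comp Q X (Typ B b) X (EHom C (F c) (G b)) (EHom C (G b) (G c)))" using 1 by (rule ple_comp)
   also have "ple Q X X \<dots> (EHom C (F c) (G c))" using ecat_comp[OF eC Cc(1) Cb(2) Cc(2)] Cb Cc c(2) by simp
   finally show "ple Q X X (Comp Q X (Typ B b) X (Comp Q (Typ B b) X X (Ident Q X) (\<psi> b)) (\<phi> b)) (EHom C (F c) (G c))"
    using D(1) D(4)[OF b] ecatD(2)[OF eB bB] by simp
  qed (use D(1) in simp)
  then have "c \<in> Elts ?E" using c C[OF c(1)] by (simp add: eleq_def)
  then show "\<exists>c\<in>Elts ?E. Typ ?E c = X \<and> (\<forall>b\<in>Elts ?E. ple Q X (Typ ?E b) (\<phi> b) (EHom ?E b c) \<and>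
    ple Q (Typ ?E b) X (\<psi> b) (EHom ?E c b))"
   using c(2) \<phi> \<psi> by (intro bexI[of _ c]) auto
 qed
 then show "?E \<in> Ob (Cat_cc TYPE('u) Q)" using E by simp
qed

text \<open>By its universal property \<open>j\<close> is equivalent to the inclusion of the full
 subcategory on the elements with \<open>F b \<le> G b\<close>, which is fully faithful.\<close>

lemma inserter_fully_faithful:
 fixes A B C :: "('u, 'o, 'a) ecat"
 assumes U: "grothendieck_universe TYPE('u)" and ins: "inserter (Cat_cc TYPE('u) Q) A B C j F G"
  and a: "a' \<in> Elts A" "a \<in> Elts A"
 shows "EHom A a' a = EHom B (j a') (j a)"
proof -
 let ?K = "Cat_cc TYPE('u) Q"
 interpret K: locally_ordered_category ?K by (rule locally_ordered_category_Cat)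
 have ob: "A \<in> Ob ?K" "B \<in> Ob ?K" "C \<in> Ob ?K" and j: "enriched_functor Q A B j"
  and F: "enriched_functor Q B C F" and G: "enriched_functor Q B C G"
  and Fj: "ple ?K A C (compose (Elts A) F j) (compose (Elts A) G j)"
  and univ: "\<And>Z h. [|Z \<in> Ob ?K; enriched_functor Q Z B h; ple ?K Z C (compose (Elts Z) F h) (compose (Elts Z) G h)|] ==>
    \<exists>k. enriched_functor Q Z A k \<and> pis ?K Z B (compose (Elts Z) j k) h"
  and refl: "\<And>Z k k'. [|Z \<in> Ob ?K; enriched_functor Q Z A k; enriched_functor Q Z A k';
    ple ?K Z B (compose (Elts Z) j k) (compose (Elts Z) j k')|] ==> ple ?K Z A k k'"
  using ins unfolding inserter_def by (simp_all del: Cat_simps(1))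
 have eA: "enriched_category Q A" and eB: "enriched_category Q B" and eC: "enriched_category Q C" using ob by simp_all
 let ?E = "inserter_of B C F G" and ?h = "\<lambda>b\<in>Elts (inserter_of B C F G). b"
 note E = inserter_of_Ob[OF U ob(2,3) F G]
 have eE: "enriched_category Q ?E" using E(1) by simp
 have "ple ?K ?E C (compose (Elts ?E) F ?h) (compose (Elts ?E) G ?h)"
  unfolding ple_Cat using E ob functor_comp[OF eE eB eC E(2) F] functor_comp[OF eE eB eC E(2) G]
  by (simp add: compose_def)
 from univ[OF E this]
 obtain k where k: "enriched_functor Q ?E A k" "pis ?K ?E B (compose (Elts ?E) j k) ?h" by blast
 have jE: "j x \<in> Elts ?E" if "x \<in> Elts A" for x
  using Fj that functor_in[OF j that] by (simp add: ple_Cat compose_def)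
 have j': "enriched_functor Q A ?E j"
  using j jE by (auto simp: enriched_functor_def PiE_iff)
 have kj: "enriched_functor Q A A (compose (Elts A) k j)" by (rule functor_comp[OF eA eE eA j' k(1)])
 have id: "enriched_functor Q A A (\<lambda>a\<in>Elts A. a)" by (rule functor_id[OF eA])
 have jkj: "eleq Q B (j (k (j x))) (j x)" "eleq Q B (j x) (j (k (j x)))" if "x \<in> Elts A" for x
  using k(2) jE[OF that] unfolding pis_Cat by (auto simp: compose_def)
 have "pis ?K A B (compose (Elts A) j (compose (Elts A) k j)) (compose (Elts A) j (\<lambda>a\<in>Elts A. a))"
  unfolding pis_Cat using ob functor_comp[OF eA eA eB kj j] functor_comp[OF eA eA eB id j] jkj
  by (simp add: compose_def)
 then have "pis ?K A A (compose (Elts A) k j) (\<lambda>a\<in>Elts A. a)"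
  using refl[OF ob(1) kj id] refl[OF ob(1) id kj] by (auto simp: pis_def)
 then have kj_eq: "eleq Q A (k (j x)) x" "eleq Q A x (k (j x))" if "x \<in> Elts A" for x
  using that by (simp_all add: pis_Cat compose_def)
 have t: "Typ A (k (j x)) = Typ A x" "k (j x) \<in> Elts A" "Typ B (j x) = Typ A x" if "x \<in> Elts A" for x
  using functor_typ[OF kj that] functor_in[OF kj that] functor_typ[OF j that] that by (simp_all add: compose_def)
 have "ple Q (Typ A a) (Typ A a') (EHom B (j a') (j a)) (EHom A (k (j a')) (k (j a)))"
  using functor_ple[OF eE eA k(1) jE[OF a(1)] jE[OF a(2)]] t[OF a(1)] t[OF a(2)] by simp
 also have "ple Q (Typ A a) (Typ A a') \<dots> (EHom A (k (j a')) a)"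
  using eleq_right[OF eA kj_eq(1)[OF a(2)] t(2)[OF a(1)]] t[OF a(1)] t[OF a(2)] by simp
 also have "ple Q (Typ A a) (Typ A a') \<dots> (EHom A a' a)"
  using eleq_left[OF eA kj_eq(2)[OF a(1)] a(2)] by simp
 finally have "ple Q (Typ A a) (Typ A a') (EHom B (j a') (j a)) (EHom A a' a)" .
 from ple_antisym[OF functor_ple[OF eA eB j a] this] show ?thesis .
qed

end


section \<open>Presheaves\<close>

locale presheaves = quantaloid Q for Q :: "('o, 'a) locat" +
 fixes B :: "('u, 'o, 'a) ecat"
 assumes B: "enriched_category Q B"
begin

definition presheaf :: "'o => ('u => 'a) => bool" where
 "presheaf X \<phi> \<longleftrightarrow> \<phi> \<in> (\<Pi>\<^sub>E b\<in>Elts B. Hom Q X (Typ B b)) \<and>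
   (\<forall>b\<in>Elts B. \<forall>b'\<in>Elts B. ple Q X (Typ B b) (Comp Q X (Typ B b') (Typ B b) (EHom B b b') (\<phi> b')) (\<phi> b))"

text \<open>The module of presheaves on \<open>B\<close>: suprema are elementwise, and arrows act by
 precomposition.\<close>

definition plat :: "'o => ('u => 'a) gorder" where
 "plat X = \<lparr>carrier = {\<phi>. presheaf X \<phi>}, eq = (=), le = (\<lambda>\<phi> \<psi>. \<forall>b\<in>Elts B. Leq Q X (Typ B b) (\<phi> b) (\<psi> b))\<rparr>"

definition pact :: "'o => 'o => 'a => ('u => 'a) => 'u => 'a" where
 "pact X Y f \<phi> = (\<lambda>b\<in>Elts B. Comp Q X Y (Typ B b) (\<phi> b) f)"

lemma plat_simps [simp]:
 "carrier (plat X) = {\<phi>. presheaf X \<phi>}" "eq (plat X) = (=)"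
 "le (plat X) \<phi> \<psi> \<longleftrightarrow> (\<forall>b\<in>Elts B. Leq Q X (Typ B b) (\<phi> b) (\<psi> b))"
 by (simp_all add: plat_def)

lemma pact_app [simp]: "b \<in> Elts B ==> pact X Y f \<phi> b = Comp Q X Y (Typ B b) (\<phi> b) f"
 by (simp add: pact_def)

lemmas BD = ecatD(2,3)[OF B]

lemma presheafD:
 assumes "presheaf X \<phi>"
 shows "b \<in> Elts B ==> \<phi> b \<in> Hom Q X (Typ B b)" "\<phi> \<in> extensional (Elts B)"
  "[|b \<in> Elts B; b' \<in> Elts B|] ==> ple Q X (Typ B b) (Comp Q X (Typ B b') (Typ B b) (EHom B b b') (\<phi> b')) (\<phi> b)"
 using assms by (auto simp: presheaf_def PiE_def)

lemma presheafI:
 assumes "\<phi> \<in> extensional (Elts B)" "\<And>b. b \<in> Elts B ==> \<phi> b \<in> Hom Q X (Typ B b)"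
  "\<And>b b'. [|b \<in> Elts B; b' \<in> Elts B|] ==> ple Q X (Typ B b) (Comp Q X (Typ B b') (Typ B b) (EHom B b b') (\<phi> b')) (\<phi> b)"
 shows "presheaf X \<phi>"
 using assms by (simp add: presheaf_def PiE_def Pi_iff)

definition pleq :: "'o => ('u => 'a) => ('u => 'a) => bool" where
 "pleq X \<phi> \<psi> \<longleftrightarrow> presheaf X \<phi> \<and> presheaf X \<psi> \<and> (\<forall>b\<in>Elts B. ple Q X (Typ B b) (\<phi> b) (\<psi> b))"

lemma pleq_iff: "X \<in> Ob Q ==> pleq X \<phi> \<psi> \<longleftrightarrow> presheaf X \<phi> \<and> presheaf X \<psi> \<and> le (plat X) \<phi> \<psi>"
 using BD(1) presheafD(1) by (auto simp: pleq_def ple_def)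

lemma pleq_antisym: "pleq X \<phi> \<psi> ==> pleq X \<psi> \<phi> ==> \<phi> = \<psi>"
 unfolding pleq_def by (auto intro!: extensionalityI[of _ "Elts B"] ple_antisym dest: presheafD(2))

lemma pleq_trans [trans]: "pleq X \<phi> \<psi> ==> pleq X \<psi> \<chi> ==> pleq X \<phi> \<chi>"
 unfolding pleq_def by (auto intro: ple_trans)

lemma pleq_refl: "X \<in> Ob Q ==> presheaf X \<phi> ==> pleq X \<phi> \<phi>"
 unfolding pleq_def using BD(1) presheafD(1) by (auto intro: ple_refl)

definition psup :: "'o => ('u => 'a) set => 'u => 'a" where
 "psup X A = (\<lambda>b\<in>Elts B. hsup Q X (Typ B b) ((\<lambda>\<phi>. \<phi> b) ` A))"

lemma psup_app: "b \<in> Elts B ==> psup X A b = hsup Q X (Typ B b) ((\<lambda>\<phi>. \<phi> b) ` A)"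
 by (simp add: psup_def)

lemma psup_img:
 assumes "\<And>\<phi>. \<phi> \<in> A ==> presheaf X \<phi>" "b \<in> Elts B"
 shows "(\<lambda>\<phi>. \<phi> b) ` A \<subseteq> Hom Q X (Typ B b)"
 using assms presheafD(1) by blast

lemma psup_presheaf:
 assumes X: "X \<in> Ob Q" and A: "\<And>\<phi>. \<phi> \<in> A ==> presheaf X \<phi>"
 shows "presheaf X (psup X A)"
proof (rule presheafI)
 show in_Hom: "psup X A b \<in> Hom Q X (Typ B b)" if "b \<in> Elts B" for b
  using that X BD psup_img[OF A that] by (simp add: psup_app)
 fix b b' assume b: "b \<in> Elts B" "b' \<in> Elts B"
 show "ple Q X (Typ B b) (Comp Q X (Typ B b') (Typ B b) (EHom B b b') (psup X A b')) (psup X A b)"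
  unfolding psup_app[OF b(2)]
 proof (rule comp_hsup_right_le)
  fix f assume "f \<in> (\<lambda>\<phi>. \<phi> b') ` A"
  then obtain \<phi> where \<phi>: "\<phi> \<in> A" "f = \<phi> b'" by blast
  have "ple Q X (Typ B b) (Comp Q X (Typ B b') (Typ B b) (EHom B b b') (\<phi> b')) (\<phi> b)"
   by (rule presheafD(3)[OF A[OF \<phi>(1)] b])
  also have "ple Q X (Typ B b) \<dots> (psup X A b)"
   unfolding psup_app[OF b(1)] using \<phi>(1) by (intro hsup_upper[OF X BD(1)[OF b(1)] psup_img[OF A b(1)]]) auto
  finally show "ple Q X (Typ B b) (Comp Q X (Typ B b') (Typ B b) (EHom B b b') f) (psup X A b)" by (simp add: \<phi>(2))
 qed (use X b BD in_Hom psup_img[OF A b(2)] in auto)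
qed (simp add: psup_def)

lemma psup_upper: "[|X \<in> Ob Q; \<And>\<phi>. \<phi> \<in> A ==> presheaf X \<phi>; \<phi> \<in> A|] ==> pleq X \<phi> (psup X A)"
 unfolding pleq_def using psup_presheaf[of X A] psup_img[of A X] BD(1)
 by (auto simp: psup_app intro!: hsup_upper)

lemma psup_least:
 assumes "X \<in> Ob Q" "presheaf X \<psi>" "\<And>\<phi>. \<phi> \<in> A ==> pleq X \<phi> \<psi>"
 shows "pleq X (psup X A) \<psi>"
proof -
 have "presheaf X \<phi>" if "\<phi> \<in> A" for \<phi> using assms(3)[OF that] by (simp add: pleq_def)
 then show ?thesis
  unfolding pleq_def using assms psup_presheaf[OF assms(1)] BD(1) presheafD(1)[OF assms(2)]
  by (auto simp: psup_app pleq_def intro!: hsup_least)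
qed

lemma psup_lub: "X \<in> Ob Q ==> A \<subseteq> carrier (plat X) ==> lub_in (plat X) A (psup X A)"
 using psup_presheaf[of X A] psup_upper[of X A] psup_least[of X _ A]
 unfolding lub_in_def by (auto simp: pleq_iff subset_iff)

lemma plat_complete: "X \<in> Ob Q ==> complete_lattice (plat X)"
proof (rule complete_lattice_of_lubs)
 assume X: "X \<in> Ob Q"
 show "le (plat X) \<phi> \<phi>" if "\<phi> \<in> carrier (plat X)" for \<phi>
  using pleq_refl[OF X, of \<phi>] that unfolding pleq_iff[OF X] by simp
 show "\<phi> = \<psi>" if "\<phi> \<in> carrier (plat X)" "\<psi> \<in> carrier (plat X)" "le (plat X) \<phi> \<psi>" "le (plat X) \<psi> \<phi>" for \<phi> \<psi>
  using pleq_antisym[of X \<phi> \<psi>] that unfolding pleq_iff[OF X] by simp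
 show "le (plat X) \<phi> \<chi>" if "\<phi> \<in> carrier (plat X)" "\<psi> \<in> carrier (plat X)" "\<chi> \<in> carrier (plat X)"
  "le (plat X) \<phi> \<psi>" "le (plat X) \<psi> \<chi>" for \<phi> \<psi> \<chi>
  using pleq_trans[of X \<phi> \<psi> \<chi>] that unfolding pleq_iff[OF X] by simp
 show "\<exists>s. lub_in (plat X) A s" if "A \<subseteq> carrier (plat X)" for A
  using psup_lub[OF X that] by blast
qed simp

lemma plat_lub_eq: "[|X \<in> Ob Q; lub_in (plat X) A \<phi>|] ==> \<phi> = psup X A"
 using lub_in_eq_sup[OF plat_complete] psup_lub[of X A] unfolding lub_in_def by metis

lemma pact_presheaf:
 assumes X: "X \<in> Ob Q" "Y \<in> Ob Q" "f \<in> Hom Q X Y" and \<phi>: "presheaf Y \<phi>"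
 shows "presheaf X (pact X Y f \<phi>)"
proof (rule presheafI)
 note \<phi>i = presheafD(1)[OF \<phi>]
 fix b b' assume b: "b \<in> Elts B" "b' \<in> Elts B"
 have "Comp Q X (Typ B b') (Typ B b) (EHom B b b') (pact X Y f \<phi> b')
  = Comp Q X Y (Typ B b) (Comp Q Y (Typ B b') (Typ B b) (EHom B b b') (\<phi> b')) f"
  using X b BD \<phi>i by (simp add: Comp_assoc)
 also have "ple Q X (Typ B b) \<dots> (pact X Y f \<phi> b)"
  using X b presheafD(3)[OF \<phi> b] by (auto intro: ple_comp_left)
 finally show "ple Q X (Typ B b) (Comp Q X (Typ B b') (Typ B b) (EHom B b b') (pact X Y f \<phi> b')) (pact X Y f \<phi> b)" .
qed (use assms BD presheafD(1)[OF \<phi>] in \<open>auto simp: pact_def\<close>)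

lemma pact_psup:
 assumes "X \<in> Ob Q" "Y \<in> Ob Q" "f \<in> Hom Q X Y" "\<And>\<phi>. \<phi> \<in> A ==> presheaf Y \<phi>"
 shows "pact X Y f (psup Y A) = psup X (pact X Y f ` A)"
 using assms psup_img[OF assms(4)] BD(1)
 by (auto simp: pact_def psup_def fun_eq_iff comp_hsup_left image_image)

lemma pact_hsup:
 assumes "X \<in> Ob Q" "Y \<in> Ob Q" "S \<subseteq> Hom Q X Y" "presheaf Y \<phi>"
 shows "pact X Y (hsup Q X Y S) \<phi> = psup X ((\<lambda>f. pact X Y f \<phi>) ` S)"
 using assms presheafD(1)[OF assms(4)] BD(1)
 by (auto simp: pact_def psup_def fun_eq_iff comp_hsup_right image_image)

lemma hom_lub_eq: "[|X \<in> Ob Q; Y \<in> Ob Q; lub_in (homlat Q X Y) S s|] ==> s = hsup Q X Y S"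
 using lub_in_eq_sup[OF homlat_complete] by metis

lemma presheaf_module: "sup_module Q plat pact"
proof (intro sup_module.intro sup_module_axioms.intro quantaloid_axioms)
 show "complete_lattice (plat X)" if "X \<in> Ob Q" for X by (rule plat_complete[OF that])
 show "pact X Y f y \<in> carrier (plat X)" if "X \<in> Ob Q" "Y \<in> Ob Q" "f \<in> Hom Q X Y" "y \<in> carrier (plat Y)" for X Y f y
  using that by (simp add: pact_presheaf)
 show "pact X X (Ident Q X) x = x" if "X \<in> Ob Q" "x \<in> carrier (plat X)" for X x
  using that BD(1) presheafD(1,2)[of X x] by (auto intro!: extensionalityI[of _ "Elts B"] simp: pact_def)
 show "pact X Z (Comp Q X Y Z g f) z = pact X Y f (pact Y Z g z)"
  if "X \<in> Ob Q" "Y \<in> Ob Q" "Z \<in> Ob Q" "f \<in> Hom Q X Y" "g \<in> Hom Q Y Z" "z \<in> carrier (plat Z)" for X Y Z f g z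
  using that BD(1) presheafD(1)[of Z z] by (auto simp: pact_def fun_eq_iff Comp_assoc)
 show "lub_in (plat X) (pact X Y f ` A) (pact X Y f y)"
  if X: "X \<in> Ob Q" "Y \<in> Ob Q" "f \<in> Hom Q X Y" and y: "lub_in (plat Y) A y" for X Y f A y
 proof -
  have A: "presheaf Y \<phi>" if "\<phi> \<in> A" for \<phi> using y that by (auto simp: lub_in_def)
  have "pact X Y f y = psup X (pact X Y f ` A)"
   unfolding plat_lub_eq[OF X(2) y] by (rule pact_psup[OF X A])
  then show ?thesis using A pact_presheaf[OF X] by (auto intro: psup_lub[OF X(1)])
 qed
 show "lub_in (plat X) ((\<lambda>f. pact X Y f y) ` S) (pact X Y s y)"
  if X: "X \<in> Ob Q" "Y \<in> Ob Q" and y: "y \<in> carrier (plat Y)" and s: "lub_in (homlat Q X Y) S s" for X Y y S s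
 proof -
  have S: "S \<subseteq> Hom Q X Y" using s by (simp add: lub_in_def)
  have "pact X Y s y = psup X ((\<lambda>f. pact X Y f y) ` S)"
   unfolding hom_lub_eq[OF X s] using y by (intro pact_hsup[OF X S]) simp
  then show ?thesis using y S pact_presheaf[OF X] by (auto intro!: psup_lub[OF X(1)])
 qed
qed

definition yon :: "'u => 'u => 'a" where
 "yon b = (\<lambda>x\<in>Elts B. EHom B x b)"

lemma yon_presheaf: "b \<in> Elts B ==> presheaf (Typ B b) (yon b)"
 using BD ecat_comp[OF B] by (intro presheafI) (auto simp: yon_def)

lemma yoneda:
 assumes b: "b \<in> Elts B" and X: "X \<in> Ob Q" and \<phi>: "presheaf X \<phi>" and f: "f \<in> Hom Q X (Typ B b)"
 shows "pleq X (pact X (Typ B b) f (yon b)) \<phi> \<longleftrightarrow> ple Q X (Typ B b) f (\<phi> b)"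
proof
 assume le: "pleq X (pact X (Typ B b) f (yon b)) \<phi>"
 have "f = Comp Q X (Typ B b) (Typ B b) (Ident Q (Typ B b)) f" using X f b BD by simp
 also have "ple Q X (Typ B b) \<dots> (Comp Q X (Typ B b) (Typ B b) (EHom B b b) f)"
  using X f b ecat_id[OF B b] by (intro ple_comp_left) auto
 also have "ple Q X (Typ B b) \<dots> (\<phi> b)" using le b by (auto simp: pleq_def yon_def)
 finally show "ple Q X (Typ B b) f (\<phi> b)" .
next
 assume le: "ple Q X (Typ B b) f (\<phi> b)"
 have "ple Q X (Typ B x) (Comp Q X (Typ B b) (Typ B x) (EHom B x b) f) (\<phi> x)" if x: "x \<in> Elts B" for x
  by (rule ple_trans[OF ple_comp_right[OF le BD(1)[OF x] BD(2)[OF x b]] presheafD(3)[OF \<phi> x b]])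
 then show "pleq X (pact X (Typ B b) f (yon b)) \<phi>"
  unfolding pleq_def using pact_presheaf[OF X BD(1)[OF b] f yon_presheaf[OF b]] \<phi> by (simp add: yon_def)
qed

end

lemma small_presheaves:
 assumes U: "grothendieck_universe TYPE('u)" and Q: "small_quantaloid TYPE('u) Q"
  and B: "enriched_category Q (B :: ('u, 'o, 'a) ecat)" and X: "X \<in> Ob Q"
 shows "small TYPE('u) (carrier (presheaves.plat Q B X))"
proof -
 have qQ: "quantaloid Q" using Q by (simp add: small_quantaloid_def)
 interpret presheaves Q B using qQ B by (intro presheaves.intro presheaves_axioms.intro)
 have "small TYPE('u) (\<Pi>\<^sub>E b\<in>Elts B. Hom Q X (Typ B b))"
  using Q X BD(1) by (intro small_PiE[OF U ecatD(1)[OF B]]) (auto simp: small_quantaloid_def)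
 then show ?thesis by (rule small_subset) (auto simp: presheaf_def)
qed

locale presheaf_category = presheaves Q B + P: module_cat Q plat pact k
 for Q :: "('o, 'a) locat" and B :: "('u, 'o, 'a) ecat" and k :: "'o \<times> ('u => 'a) => 'u"
begin

abbreviation "PB \<equiv> P.elements"

lemma mle_pleq: "P.mle X \<phi> \<psi> \<longleftrightarrow> X \<in> Ob Q \<and> pleq X \<phi> \<psi>"
 by (auto simp: P.mle_def pleq_iff)

lemma PB_eltD:
 assumes "u \<in> Elts PB"
 shows "P.ty u \<in> Ob Q" "presheaf (P.ty u) (P.val u)"
 using P.eltD[OF assms] by simp_all

lemma PB_elt: "[|X \<in> Ob Q; presheaf X \<phi>|] ==> k (X, \<phi>) \<in> Elts PB" "[|X \<in> Ob Q; presheaf X \<phi>|] ==> P.ty (k (X, \<phi>)) = X"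
  "[|X \<in> Ob Q; presheaf X \<phi>|] ==> P.val (k (X, \<phi>)) = \<phi>"
 by simp_all

definition Yo :: "'u => 'u" where
 "Yo = (\<lambda>b\<in>Elts B. k (Typ B b, yon b))"

lemma Yo: "b \<in> Elts B ==> Yo b \<in> Elts PB" "b \<in> Elts B ==> P.ty (Yo b) = Typ B b" "b \<in> Elts B ==> P.val (Yo b) = yon b"
 using yon_presheaf BD(1) by (simp_all add: Yo_def)

lemma EHom_Yo:
 assumes b: "b \<in> Elts B" and u: "u \<in> Elts PB"
 shows "EHom PB (Yo b) u = P.val u b"
proof -
 note uD = PB_eltD[OF u]
 have h: "EHom PB (Yo b) u \<in> Hom Q (P.ty u) (Typ B b)" using P.ehom_in[OF Yo(1)[OF b] u] Yo(2)[OF b] by simp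
 have v: "P.val u b \<in> Hom Q (P.ty u) (Typ B b)" by (rule presheafD(1)[OF uD(2) b])
 have *: "ple Q (P.ty u) (Typ B b) f (EHom PB (Yo b) u) \<longleftrightarrow> ple Q (P.ty u) (Typ B b) f (P.val u b)"
  if "f \<in> Hom Q (P.ty u) (Typ B b)" for f
  using P.ehom_iff[OF Yo(1)[OF b] u, of f] that yoneda[OF b uD(1,2) that] Yo[OF b] uD by (simp add: mle_pleq)
 show ?thesis
  using *[OF h] *[OF v] ple_refl[OF uD(1) BD(1)[OF b]] h v by (intro ple_antisym) auto
qed

lemma Yo_ff: "[|b' \<in> Elts B; b \<in> Elts B|] ==> EHom PB (Yo b') (Yo b) = EHom B b' b"
 using EHom_Yo[of b' "Yo b"] Yo by (simp add: yon_def)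

lemma Yo_functor: "enriched_functor Q B PB Yo"
proof (rule functorI)
 fix b' b assume b: "b' \<in> Elts B" "b \<in> Elts B"
 then show "ple Q (Typ B b) (Typ B b') (EHom B b' b) (EHom PB (Yo b') (Yo b))"
  using BD by (simp add: Yo_ff ple_refl)
qed (use Yo in \<open>auto simp: Yo_def\<close>)

text \<open>A fully faithful functor \<open>j\<close> out of a Cauchy complete category is the inserter of the Yoneda
 embedding and its approximation \<open>b \<mapsto> B(-,j) \<otimes> B(j,b)\<close>: an object \<open>b\<close> with
 \<open>B(-,b) \<le> B(-,j) \<otimes> B(j,b)\<close> yields a left adjoint presheaf \<open>B(j,b)\<close>, represented by an object
 that \<open>j\<close> sends to \<open>b\<close>.\<close>

lemma fully_faithful_inserter:
 assumes A: "A \<in> Ob (Cat_cc TYPE('u) Q)" and ccB: "cauchy_complete Q B" and j: "enriched_functor Q A B j"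
  and ff: "\<And>a' a. [|a' \<in> Elts A; a \<in> Elts A|] ==> EHom A a' a = EHom B (j a') (j a)"
 shows "\<exists>G. inserter (Cat_cc TYPE('u) Q) A B PB j Yo G"
proof -
 let ?K = "Cat_cc TYPE('u) Q"
 have eA: "enriched_category Q A" and cA: "cauchy_complete Q A" using A by simp_all
 have BK: "B \<in> Ob ?K" using B ccB by simp
 note AD = ecatD(2,3)[OF eA]
 have jin: "j a \<in> Elts B" "Typ B (j a) = Typ A a" if "a \<in> Elts A" for a
  using functor_in[OF j that] functor_typ[OF j that] by simp_all
 have bj: "EHom B x (j a) \<in> Hom Q (Typ A a) (Typ B x)" "EHom B (j a) x \<in> Hom Q (Typ B x) (Typ A a)"
  if "x \<in> Elts B" "a \<in> Elts A" for x a
  using BD(2)[OF that(1) jin(1)[OF that(2)]] BD(2)[OF jin(1)[OF that(2)] that(1)] jin(2)[OF that(2)] by simp_all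
 define \<theta> where "\<theta> b = psup (Typ B b) ((\<lambda>a. pact (Typ B b) (Typ A a) (EHom B (j a) b) (yon (j a))) ` Elts A)" for b
 have yj: "presheaf (Typ A a) (yon (j a))" if "a \<in> Elts A" for a
  using yon_presheaf[OF jin(1)[OF that]] jin(2)[OF that] by simp
 have pj: "presheaf (Typ B b) (pact (Typ B b) (Typ A a) (EHom B (j a) b) (yon (j a)))" if "b \<in> Elts B" "a \<in> Elts A" for b a
  using that BD AD bj yj by (intro pact_presheaf) auto
 have \<theta>: "presheaf (Typ B b) (\<theta> b)" if "b \<in> Elts B" for b
  unfolding \<theta>_def using that BD pj by (intro psup_presheaf) auto
 have \<theta>_upper: "pleq (Typ B b) (pact (Typ B b) (Typ A a) (EHom B (j a) b) (yon (j a))) (\<theta> b)"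
  if b: "b \<in> Elts B" and a: "a \<in> Elts A" for b a
 proof -
  let ?T = "(\<lambda>a. pact (Typ B b) (Typ A a) (EHom B (j a) b) (yon (j a))) ` Elts A"
  have mem: "pact (Typ B b) (Typ A a) (EHom B (j a) b) (yon (j a)) \<in> ?T" using a by blast
  have T: "presheaf (Typ B b) \<psi>" if "\<psi> \<in> ?T" for \<psi> using that pj[OF b] by blast
  show ?thesis unfolding \<theta>_def by (rule psup_upper[OF BD(1)[OF b] T mem])
 qed
 let ?S = "\<lambda>x b. (\<lambda>a. Comp Q (Typ B b) (Typ A a) (Typ B x) (EHom B x (j a)) (EHom B (j a) b)) ` Elts A"
 have \<theta>_app: "\<theta> b x = hsup Q (Typ B b) (Typ B x) (?S x b)" if "x \<in> Elts B" for x b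
  unfolding \<theta>_def using that by (simp add: psup_app image_image yon_def)
 have S: "?S x b \<subseteq> Hom Q (Typ B b) (Typ B x)" if "b \<in> Elts B" "x \<in> Elts B" for x b
  using that BD AD bj by auto
 define G where "G = (\<lambda>b\<in>Elts B. k (Typ B b, \<theta> b))"
 have G: "G b \<in> Elts PB" "P.ty (G b) = Typ B b" "P.val (G b) = \<theta> b" if "b \<in> Elts B" for b
  using that BD \<theta> by (simp_all add: G_def)
 have Gf: "enriched_functor Q B PB G"
 proof (rule functorI)
  fix b' b assume b: "b' \<in> Elts B" "b \<in> Elts B"
  have eq0: "pact (Typ B b) (Typ B b') (EHom B b' b) (\<theta> b')
   = psup (Typ B b) (pact (Typ B b) (Typ B b') (EHom B b' b) ` (\<lambda>a. pact (Typ B b') (Typ A a) (EHom B (j a) b') (yon (j a))) ` Elts A)"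
   unfolding \<theta>_def using b BD pj[OF b(1)] by (intro pact_psup) auto
  have "pleq (Typ B b) (pact (Typ B b) (Typ B b') (EHom B b' b) (\<theta> b')) (\<theta> b)"
   unfolding eq0
  proof (rule psup_least[OF BD(1)[OF b(2)] \<theta>[OF b(2)]])
   fix \<phi> assume "\<phi> \<in> pact (Typ B b) (Typ B b') (EHom B b' b) ` (\<lambda>a. pact (Typ B b') (Typ A a) (EHom B (j a) b') (yon (j a))) ` Elts A"
   then obtain a where a: "a \<in> Elts A" "\<phi> = pact (Typ B b) (Typ B b') (EHom B b' b) (pact (Typ B b') (Typ A a) (EHom B (j a) b') (yon (j a)))"
    by blast
   have eq: "\<phi> = pact (Typ B b) (Typ A a) (Comp Q (Typ B b) (Typ B b') (Typ A a) (EHom B (j a) b') (EHom B b' b)) (yon (j a))"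
    unfolding a(2) using a(1) b BD AD bj yj by (intro P.act_comp[symmetric]) auto
   have "pleq (Typ B b) \<phi> (pact (Typ B b) (Typ A a) (EHom B (j a) b) (yon (j a)))"
    unfolding eq
    using P.act_ple[of "Typ B b" "Typ A a" _ "EHom B (j a) b" "yon (j a)"] ecat_comp[OF B jin(1)[OF a(1)] b] jin(2)[OF a(1)] yj[OF a(1)]
    by (simp add: mle_pleq)
   then show "pleq (Typ B b) \<phi> (\<theta> b)" by (rule pleq_trans[OF _ \<theta>_upper[OF b(2) a(1)]])
  qed
  then show "ple Q (Typ B b) (Typ B b') (EHom B b' b) (EHom PB (G b') (G b))"
   using P.ehom_iff[OF G(1)[OF b(1)] G(1)[OF b(2)], of "EHom B b' b"] G[OF b(1)] G[OF b(2)] b BD by (simp add: mle_pleq)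
 qed (use G in \<open>auto simp: G_def\<close>)
 have YG: "eleq Q PB (Yo b) (G b) \<longleftrightarrow> ple Q (Typ B b) (Typ B b) (Ident Q (Typ B b)) (hsup Q (Typ B b) (Typ B b) (?S b b))"
  if b: "b \<in> Elts B" for b
  using Yo[OF b] G[OF b] EHom_Yo[OF b G(1)[OF b]] \<theta>_app[OF b] by (simp add: eleq_def)
 have cPB: "PB \<in> Ob ?K" by (rule P.elements_Ob)
 have ePB: "enriched_category Q PB" using cPB by simp
 have "ple ?K A PB (compose (Elts A) Yo j) (compose (Elts A) G j)"
 proof -
  have "eleq Q PB (Yo (j a)) (G (j a))" if a: "a \<in> Elts A" for a
  proof -
   have i: "ple Q (Typ A a) (Typ A a) (Ident Q (Typ A a)) (EHom B (j a) (j a))"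
    using ecat_id[OF B jin(1)[OF a]] jin(2)[OF a] by simp
   have "Ident Q (Typ A a) = Comp Q (Typ A a) (Typ A a) (Typ A a) (Ident Q (Typ A a)) (Ident Q (Typ A a))"
    using AD(1)[OF a] by simp
   also have "ple Q (Typ A a) (Typ A a) \<dots> (Comp Q (Typ A a) (Typ A a) (Typ A a) (EHom B (j a) (j a)) (EHom B (j a) (j a)))"
    by (rule ple_comp[OF i i])
   also have "ple Q (Typ A a) (Typ A a) \<dots> (hsup Q (Typ A a) (Typ A a) (?S (j a) (j a)))"
    using S[OF jin(1)[OF a] jin(1)[OF a]] a AD(1)[OF a] by (intro hsup_upper) (auto simp: jin(2)[OF a])
   finally show ?thesis using YG[OF jin(1)[OF a]] jin(2)[OF a] by simp
  qed
  then show ?thesis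
   unfolding ple_Cat using A cPB functor_comp[OF eA B ePB j Yo_functor] functor_comp[OF eA B ePB j Gf]
   by (simp add: compose_def)
 qed
 moreover have "\<exists>l. enriched_functor Q Z A l \<and> pis ?K Z B (compose (Elts Z) j l) h"
  if Z: "Z \<in> Ob ?K" and h: "enriched_functor Q Z B h" and le: "ple ?K Z PB (compose (Elts Z) Yo h) (compose (Elts Z) G h)" for Z h
 proof -
  have eZ: "enriched_category Q Z" using Z by simp
  note ZD = ecatD(2,3)[OF eZ]
  have hin: "h z \<in> Elts B" "Typ B (h z) = Typ Z z" if "z \<in> Elts Z" for z
   using functor_in[OF h that] functor_typ[OF h that] by simp_all
  have hj: "EHom B (j a) (h z) \<in> Hom Q (Typ Z z) (Typ A a)" "EHom B (h z) (j a) \<in> Hom Q (Typ A a) (Typ Z z)"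
   if "a \<in> Elts A" "z \<in> Elts Z" for a z using bj[OF hin(1)[OF that(2)] that(1)] hin(2)[OF that(2)] by simp_all
  have ad: "adj_family (Elts A) (\<lambda>a. a) A (Typ Z z) (\<lambda>a. EHom B (j a) (h z)) (\<lambda>a. EHom B (h z) (j a))" if z: "z \<in> Elts Z" for z
   unfolding adj_family_def
  proof (intro conjI ballI)
   have "eleq Q PB (Yo (h z)) (G (h z))" using le z by (simp add: ple_Cat compose_def)
   then show "ple Q (Typ Z z) (Typ Z z) (Ident Q (Typ Z z))
    (hsup Q (Typ Z z) (Typ Z z) ((\<lambda>a. Comp Q (Typ Z z) (Typ A a) (Typ Z z) (EHom B (h z) (j a)) (EHom B (j a) (h z))) ` Elts A))"
    using YG[OF hin(1)[OF z]] hin(2)[OF z] by simp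
   fix a a' assume e: "a \<in> Elts A" "a' \<in> Elts A"
   show "ple Q (Typ A a') (Typ A a) (Comp Q (Typ A a') (Typ Z z) (Typ A a) (EHom B (j a) (h z)) (EHom B (h z) (j a'))) (EHom A a a')"
    using ecat_comp[OF B jin(1)[OF e(1)] hin(1)[OF z] jin(1)[OF e(2)]] jin(2)[OF e(1)] jin(2)[OF e(2)] hin(2)[OF z] ff[OF e] by simp
  qed (use z hj ZD(1) in auto)
  have "\<forall>z\<in>Elts Z. \<exists>c\<in>Elts A. Typ A c = Typ Z z \<and> (\<forall>a\<in>Elts A. ple Q (Typ Z z) (Typ A a) (EHom B (j a) (h z)) (EHom A a c) \<and>
    ple Q (Typ A a) (Typ Z z) (EHom B (h z) (j a)) (EHom A c a))"
   using cauchy_complete_family[OF P.universe cA eA ad] by blast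
  then obtain l where lin: "\<And>z. z \<in> Elts Z ==> l z \<in> Elts A" "\<And>z. z \<in> Elts Z ==> Typ A (l z) = Typ Z z"
   and l: "\<And>z a. [|z \<in> Elts Z; a \<in> Elts A|] ==> ple Q (Typ Z z) (Typ A a) (EHom B (j a) (h z)) (EHom A a (l z))"
    "\<And>z a. [|z \<in> Elts Z; a \<in> Elts A|] ==> ple Q (Typ A a) (Typ Z z) (EHom B (h z) (j a)) (EHom A (l z) a)"
   by metis
  have jl: "j (l z) \<in> Elts B" "Typ B (j (l z)) = Typ Z z" if "z \<in> Elts Z" for z
   using jin[OF lin(1)[OF that]] lin(2)[OF that] by simp_all
  have unit: "eleq Q B b c" if z: "z \<in> Elts Z" and b: "b \<in> Elts B" "Typ B b = Typ Z z" and c: "c \<in> Elts B" "Typ B c = Typ Z z"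
   and le: "\<And>a. a \<in> Elts A ==> ple Q (Typ A a) (Typ Z z) (EHom B (h z) (j a)) (EHom B b (j a))"
    "\<And>a. a \<in> Elts A ==> ple Q (Typ Z z) (Typ A a) (EHom B (j a) (h z)) (EHom B (j a) c)" for z b c
  proof -
   note zO = ZD(1)[OF z]
   have "ple Q (Typ Z z) (Typ Z z) (Ident Q (Typ Z z)) (EHom B b c)"
   proof (rule adj_family_unit[OF eA ad[OF z] zO])
    fix a assume a: "a \<in> Elts A"
    have "ple Q (Typ Z z) (Typ Z z) (Comp Q (Typ Z z) (Typ A a) (Typ Z z) (EHom B (h z) (j a)) (EHom B (j a) (h z)))
     (Comp Q (Typ Z z) (Typ A a) (Typ Z z) (EHom B b (j a)) (EHom B (j a) c))"
     by (rule ple_comp[OF le(2,1)[OF a]])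
    also have "ple Q (Typ Z z) (Typ Z z) \<dots> (EHom B b c)" using ecat_comp[OF B b(1) jin(1)[OF a] c(1)] b c jin(2)[OF a] by simp
    finally show "ple Q (Typ Z z) (Typ Z z) (Comp Q (Typ Z z) (Typ A a) (Typ Z z) (Comp Q (Typ A a) (Typ Z z) (Typ Z z)
      (Ident Q (Typ Z z)) (EHom B (h z) (j a))) (EHom B (j a) (h z))) (EHom B b c)" using hj(2)[OF a z] zO AD(1)[OF a] by simp
   qed (use zO BD(2)[OF b(1) c(1)] b c in auto)
   then show ?thesis using b c by (simp add: eleq_def)
  qed
  have 1: "eleq Q B (j (l z)) (h z)" and 2: "eleq Q B (h z) (j (l z))" if z: "z \<in> Elts Z" for z
   using unit[OF z jl[OF z] hin[OF z]] unit[OF z hin[OF z] jl[OF z]] l[OF z] ff[OF lin(1)[OF z]] ff[OF _ lin(1)[OF z]]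
    hj[OF _ z] AD(1) ZD(1)[OF z] by (simp_all add: ple_refl)
  have l: "enriched_functor Q Z A (restrict l (Elts Z))"
  proof (rule functorI)
   fix z' z assume z: "z' \<in> Elts Z" "z \<in> Elts Z"
   have "ple Q (Typ Z z) (Typ Z z') (EHom Z z' z) (EHom B (h z') (h z))" by (rule functor_ple[OF eZ B h z])
   also have "ple Q (Typ Z z) (Typ Z z') \<dots> (EHom B (j (l z')) (h z))"
    using eleq_left[OF B 1[OF z(1)] hin(1)[OF z(2)]] hin(2)[OF z(2)] jl(2)[OF z(1)] by simp
   also have "ple Q (Typ Z z) (Typ Z z') \<dots> (EHom B (j (l z')) (j (l z)))"
    using eleq_right[OF B 2[OF z(2)] jl(1)[OF z(1)]] hin(2)[OF z(2)] jl(2)[OF z(1)] by simp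
   finally show "ple Q (Typ Z z) (Typ Z z') (EHom Z z' z) (EHom A (restrict l (Elts Z) z') (restrict l (Elts Z) z))"
    using z ff[OF lin(1)[OF z(1)] lin(1)[OF z(2)]] by simp
  qed (use lin in auto)
  have "pis ?K Z B (compose (Elts Z) j (restrict l (Elts Z))) h"
   unfolding pis_Cat using Z BK h functor_comp[OF eZ eA B l j] 1 2 by (simp add: compose_def)
  then show ?thesis using l by blast
 qed
 moreover have "ple ?K Z A l l'"
  if Z: "Z \<in> Ob ?K" and l: "enriched_functor Q Z A l" "enriched_functor Q Z A l'"
   and le: "ple ?K Z B (compose (Elts Z) j l) (compose (Elts Z) j l')" for Z l l'
 proof -
  have "eleq Q A (l z) (l' z)" if z: "z \<in> Elts Z" for z
  proof -
   have "eleq Q B (j (l z)) (j (l' z))" using le z by (simp add: ple_Cat compose_def)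
   then show ?thesis
    using functor_in[OF l(1) z] functor_in[OF l(2) z] functor_typ[OF l(1) z] functor_typ[OF l(2) z] jin ff by (simp add: eleq_def)
  qed
  then show ?thesis using Z A l by (simp add: ple_Cat)
 qed
 ultimately have "inserter ?K A B PB j Yo G"
  unfolding inserter_def using A BK cPB j Yo_functor Gf by (simp del: Cat_simps(1))
 then show ?thesis by blast
qed

end

section \<open>Absolute retracts are categories of elements\<close>

context quantaloid
begin

text \<open>Any section of \<open>J\<close> is a functor because \<open>J\<close> is fully faithful.\<close>

lemma surjective_fully_faithful_equivalence:
 assumes A: "A \<in> Ob (Cat_cc U Q)" and B: "B \<in> Ob (Cat_cc U Q)" and J: "enriched_functor Q A B J"
  and ff: "\<And>a' a. [|a' \<in> Elts A; a \<in> Elts A|] ==> EHom A a' a = EHom B (J a') (J a)"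
  and surj: "\<And>b. b \<in> Elts B ==> \<exists>a\<in>Elts A. J a = b"
 shows "\<exists>d. equiv_pair (Cat_cc U Q) A B J d"
proof -
 have eA: "enriched_category Q A" and eB: "enriched_category Q B" using A B by simp_all
 obtain s where s: "\<And>b. b \<in> Elts B ==> s b \<in> Elts A \<and> J (s b) = b" using surj by metis
 let ?d = "\<lambda>b\<in>Elts B. s b"
 have ty: "Typ A (s b) = Typ B b" if "b \<in> Elts B" for b using functor_typ[OF J, of "s b"] s[OF that] by simp
 have d: "enriched_functor Q B A ?d"
 proof (rule functorI)
  fix b' b assume b: "b' \<in> Elts B" "b \<in> Elts B"
  then show "ple Q (Typ B b) (Typ B b') (EHom B b' b) (EHom A (?d b') (?d b))"
   using s ff ecatD(2,3)[OF eB] by (simp add: ple_refl)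
 qed (use s ty in auto)
 have "eleq Q A (s (J a)) a \<and> eleq Q A a (s (J a))" if a: "a \<in> Elts A" for a
 proof -
  have Ja: "J a \<in> Elts B" "Typ B (J a) = Typ A a" using functor_in[OF J a] functor_typ[OF J a] by simp_all
  show ?thesis
   using s[OF Ja(1)] ty[OF Ja(1)] Ja a ff ecat_id[OF eB Ja(1)] by (simp add: eleq_def)
 qed
 then have "pis (Cat_cc U Q) A A (compose (Elts A) ?d J) (\<lambda>a\<in>Elts A. a)"
  unfolding pis_Cat using A functor_comp[OF eA eB eA J d] functor_id[OF eA] functor_in[OF J] by (simp add: compose_def)
 moreover have "pis (Cat_cc U Q) B B (compose (Elts B) J ?d) (\<lambda>b\<in>Elts B. b)"
  unfolding pis_Cat using B functor_comp[OF eB eA eB d J] functor_id[OF eB] s eleq_refl[OF eB] by (simp add: compose_def)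
 ultimately show ?thesis unfolding equiv_pair_def using A B J d by (intro exI[of _ ?d]) simp
qed

end

context module_cat
begin

text \<open>The category of elements is characterised by a parametrisation of the elements that turns
 hom-arrows into the action.\<close>

lemma elements_equivalence:
 assumes I: "I \<in> Ob (Cat_cc TYPE('u) Q)"
  and e: "\<And>x. x \<in> Elts I ==> e x \<in> carrier (lat (Typ I x))"
  and surj: "\<And>X y. [|X \<in> Ob Q; y \<in> carrier (lat X)|] ==> \<exists>x\<in>Elts I. Typ I x = X \<and> e x = y"
  and hom: "\<And>x' x f. [|x' \<in> Elts I; x \<in> Elts I; f \<in> Hom Q (Typ I x) (Typ I x')|] ==>
   mle (Typ I x) (act (Typ I x) (Typ I x') f (e x')) (e x) \<longleftrightarrow> ple Q (Typ I x) (Typ I x') f (EHom I x' x)"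
 shows "\<exists>j d. equiv_pair (Cat_cc TYPE('u) Q) I elements j d"
proof -
 have eI: "enriched_category Q I" using I by simp
 note ID = ecatD(2,3)[OF eI]
 let ?J = "\<lambda>x\<in>Elts I. k (Typ I x, e x)"
 have J: "?J x \<in> Elts elements" "ty (?J x) = Typ I x" "val (?J x) = e x" if "x \<in> Elts I" for x
  using that ID(1) e by simp_all
 have ff: "EHom I x' x = EHom elements (?J x') (?J x)" if x: "x' \<in> Elts I" "x \<in> Elts I" for x' x
 proof -
  have h: "EHom elements (?J x') (?J x) \<in> Hom Q (Typ I x) (Typ I x')" using ehom_in[OF J(1)[OF x(1)] J(1)[OF x(2)]] J x by simp
  have *: "ple Q (Typ I x) (Typ I x') f (EHom elements (?J x') (?J x)) \<longleftrightarrow> ple Q (Typ I x) (Typ I x') f (EHom I x' x)"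
   if "f \<in> Hom Q (Typ I x) (Typ I x')" for f
   using ehom_iff[OF J(1)[OF x(1)] J(1)[OF x(2)], of f] hom[OF x that] J[OF x(1)] J[OF x(2)] that by simp
  show ?thesis
   using *[OF h] *[OF ID(2)[OF x]] ple_refl[OF ID(1)[OF x(2)] ID(1)[OF x(1)]] h ID(2)[OF x] by (intro ple_antisym) auto
 qed
 have "enriched_functor Q I elements ?J"
 proof (rule functorI)
  fix x' x assume x: "x' \<in> Elts I" "x \<in> Elts I"
  show "ple Q (Typ I x) (Typ I x') (EHom I x' x) (EHom elements (?J x') (?J x))"
   unfolding ff[OF x, symmetric] using x ID by (intro ple_refl)
 qed (use J in auto)
 moreover have "\<exists>x\<in>Elts I. ?J x = u" if u: "u \<in> Elts elements" for u
  proof -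
  obtain x where "x \<in> Elts I" "Typ I x = ty u" "e x = val u" using surj[OF eltD(1,2)[OF u]] by blast
  then show ?thesis using eltD(3)[OF u] by (intro bexI[of _ x]) simp_all
 qed
 ultimately show ?thesis
  using surjective_fully_faithful_equivalence[OF I elements_Ob, of ?J] ff by blast
qed

end

text \<open>A retraction of the Yoneda embedding gives a closure operator on presheaves whose closed
 elements are the representables; so these form a quotient module of the module of presheaves.\<close>

locale yoneda_retract = presheaf_category Q B k
 for Q :: "('o, 'a) locat" and B :: "('u, 'o, 'a) ecat" and k :: "'o \<times> ('u => 'a) => 'u" +
 fixes r :: "'u => 'u"
 assumes r: "enriched_functor Q PB B r"
  and rY: "b \<in> Elts B ==> eleq Q B (r (Yo b)) b" "b \<in> Elts B ==> eleq Q B b (r (Yo b))"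
begin

definition colim :: "'o => ('u => 'a) => 'u" where "colim X \<phi> = r (k (X, \<phi>))"
definition cl :: "'o => ('u => 'a) => 'u => 'a" where "cl X \<phi> = yon (colim X \<phi>)"

lemma colim:
 assumes "X \<in> Ob Q" "presheaf X \<phi>"
 shows "colim X \<phi> \<in> Elts B" "Typ B (colim X \<phi>) = X"
 using functor_in[OF r PB_elt(1)[OF assms]] functor_typ[OF r PB_elt(1)[OF assms]] PB_elt(2)[OF assms]
 by (simp_all add: colim_def)

lemma cl_presheaf: "X \<in> Ob Q ==> presheaf X \<phi> ==> presheaf X (cl X \<phi>)"
 using yon_presheaf[of "colim X \<phi>"] colim[of X \<phi>] by (simp add: cl_def)

lemma cl_upper:
 assumes X: "X \<in> Ob Q" and \<phi>: "presheaf X \<phi>"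
 shows "pleq X \<phi> (cl X \<phi>)"
proof -
 note c = colim[OF X \<phi>] and u = PB_elt[OF X \<phi>]
 have ePB: "enriched_category Q PB" by (rule P.elements_enriched)
 have "ple Q X (Typ B b) (\<phi> b) (cl X \<phi> b)" if b: "b \<in> Elts B" for b
 proof -
  have "\<phi> b = EHom PB (Yo b) (k (X, \<phi>))" using EHom_Yo[OF b u(1)] u by simp
  also have "ple Q X (Typ B b) \<dots> (EHom B (r (Yo b)) (colim X \<phi>))"
   using functor_ple[OF ePB B r Yo(1)[OF b] u(1)] Yo(2)[OF b] u(2) by (simp add: colim_def)
  also have "ple Q X (Typ B b) \<dots> (EHom B b (colim X \<phi>))"
   using eleq_left[OF B rY(2)[OF b] c(1)] c(2) by simp
  also have "\<dots> = cl X \<phi> b" using b by (simp add: cl_def yon_def)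
  finally show ?thesis .
 qed
 then show ?thesis using \<phi> cl_presheaf[OF X \<phi>] by (simp add: pleq_def)
qed

text \<open>For an element \<open>w\<close> the inequality in the conclusion says that \<open>f\<close> lies
 below \<open>B(colim \<phi>, w)\<close>, and this follows by applying the functor
 \<open>r\<close> to the corresponding inequality between presheaves.\<close>

lemma cl_least:
 assumes X: "X \<in> Ob Q" and \<phi>: "presheaf X \<phi>" and w: "w \<in> Elts B" and f: "f \<in> Hom Q (Typ B w) X"
  and le: "pleq (Typ B w) (pact (Typ B w) X f \<phi>) (yon w)"
 shows "pleq (Typ B w) (pact (Typ B w) X f (cl X \<phi>)) (yon w)"
proof -
 note c = colim[OF X \<phi>] and u = PB_elt[OF X \<phi>]
 have ePB: "enriched_category Q PB" by (rule P.elements_enriched)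
 have W: "Typ B w \<in> Ob Q" by (rule BD(1)[OF w])
 have "ple Q (Typ B w) X f (EHom PB (k (X, \<phi>)) (Yo w))"
  using P.ehom_iff[OF u(1) Yo(1)[OF w], of f] u Yo[OF w] f le W by (simp add: mle_pleq)
 also have "ple Q (Typ B w) X \<dots> (EHom B (colim X \<phi>) (r (Yo w)))"
  using functor_ple[OF ePB B r u(1) Yo(1)[OF w]] Yo(2)[OF w] u(2) by (simp add: colim_def)
 also have "ple Q (Typ B w) X \<dots> (EHom B (colim X \<phi>) w)"
  using eleq_right[OF B rY(1)[OF w] c(1)] c(2) rY(1)[OF w] by (simp add: eleq_def)
 finally have "ple Q (Typ B w) X f (yon w (colim X \<phi>))" using c by (simp add: yon_def)
 then show ?thesis
  using yoneda[OF c(1) W yon_presheaf[OF w], of f] c f by (simp add: cl_def)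
qed

definition closed :: "'o => ('u => 'a) set" where
 "closed X = yon ` {b \<in> Elts B. Typ B b = X}"

lemma closed_presheaf: "\<phi> \<in> closed X ==> presheaf X \<phi>"
 using yon_presheaf by (auto simp: closed_def)

lemma cl_closed: "X \<in> Ob Q ==> presheaf X \<phi> ==> cl X \<phi> \<in> closed X"
 using colim[of X \<phi>] by (auto simp: closed_def cl_def)

lemma pact_id: "X \<in> Ob Q ==> presheaf X \<phi> ==> pact X X (Ident Q X) \<phi> = \<phi>"
 using P.act_id[of X \<phi>] by simp

lemma pact_cl_le:
 assumes X: "X \<in> Ob Q" "W \<in> Ob Q" and \<phi>: "presheaf X \<phi>" and \<psi>: "\<psi> \<in> closed W" and f: "f \<in> Hom Q W X"
  and le: "pleq W (pact W X f \<phi>) \<psi>"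
 shows "pleq W (pact W X f (cl X \<phi>)) \<psi>"
 using \<psi> cl_least[OF X(1) \<phi>] f le by (auto simp: closed_def)

lemma cl_le:
 assumes X: "X \<in> Ob Q" and \<phi>: "presheaf X \<phi>" and \<psi>: "\<psi> \<in> closed X" and le: "pleq X \<phi> \<psi>"
 shows "pleq X (cl X \<phi>) \<psi>"
 using pact_cl_le[OF X X \<phi> \<psi>, of "Ident Q X"] le X \<phi> by (simp add: pact_id cl_presheaf)

lemma cl_mono: "[|X \<in> Ob Q; pleq X \<phi> \<psi>|] ==> pleq X (cl X \<phi>) (cl X \<psi>)"
 using cl_le[of X \<phi> "cl X \<psi>"] cl_closed[of X \<psi>] cl_upper[of X \<psi>] pleq_trans[of X \<phi> \<psi> "cl X \<psi>"]
 by (simp add: pleq_def)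

lemma cl_id: "X \<in> Ob Q ==> \<phi> \<in> closed X ==> cl X \<phi> = \<phi>"
 using pleq_antisym[OF cl_le cl_upper] pleq_refl closed_presheaf by blast

definition clat :: "'o => ('u => 'a) gorder" where
 "clat X = \<lparr>carrier = closed X, eq = (=), le = le (plat X)\<rparr>"

definition cact :: "'o => 'o => 'a => ('u => 'a) => 'u => 'a" where
 "cact X Y f \<phi> = cl X (pact X Y f \<phi>)"

lemma clat_simps [simp]: "carrier (clat X) = closed X" "eq (clat X) = (=)" "le (clat X) = le (plat X)"
 by (simp_all add: clat_def)

lemma clat_le: "[|X \<in> Ob Q; \<phi> \<in> closed X; \<psi> \<in> closed X|] ==> le (plat X) \<phi> \<psi> \<longleftrightarrow> pleq X \<phi> \<psi>"
 using closed_presheaf pleq_iff by blast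

lemma clat_lubI:
 assumes X: "X \<in> Ob Q" and A: "A \<subseteq> closed X" and s: "s \<in> closed X"
  and up: "\<And>\<phi>. \<phi> \<in> A ==> pleq X \<phi> s"
  and least: "\<And>\<psi>. [|\<psi> \<in> closed X; \<And>\<phi>. \<phi> \<in> A ==> pleq X \<phi> \<psi>|] ==> pleq X s \<psi>"
 shows "lub_in (clat X) A s"
 unfolding lub_in_def clat_simps
proof (intro conjI ballI impI)
 show "le (plat X) \<phi> s" if "\<phi> \<in> A" for \<phi> using up[OF that] unfolding pleq_iff[OF X] by blast
 show "le (plat X) s \<psi>" if \<psi>: "\<psi> \<in> closed X" and "\<forall>\<phi>\<in>A. le (plat X) \<phi> \<psi>" for \<psi>
 proof -
  have "pleq X \<phi> \<psi>" if "\<phi> \<in> A" for \<phi>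
   using that A \<psi> \<open>\<forall>\<phi>\<in>A. le (plat X) \<phi> \<psi>\<close> clat_le[OF X] by blast
  from least[OF \<psi> this] show ?thesis unfolding pleq_iff[OF X] by blast
 qed
qed (use A s in auto)

lemma clat_lub:
 assumes X: "X \<in> Ob Q" and A: "A \<subseteq> closed X"
 shows "lub_in (clat X) A (cl X (psup X A))"
proof (rule clat_lubI[OF X A])
 have pA: "presheaf X \<phi>" if "\<phi> \<in> A" for \<phi> using that A closed_presheaf by blast
 have ps: "presheaf X (psup X A)" by (rule psup_presheaf[OF X pA])
 show "cl X (psup X A) \<in> closed X" by (rule cl_closed[OF X ps])
 show "pleq X \<phi> (cl X (psup X A))" if "\<phi> \<in> A" for \<phi>
  by (rule pleq_trans[OF psup_upper[OF X pA that] cl_upper[OF X ps]])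
 show "pleq X (cl X (psup X A)) \<psi>" if "\<psi> \<in> closed X" "\<And>\<phi>. \<phi> \<in> A ==> pleq X \<phi> \<psi>" for \<psi>
  by (rule cl_le[OF X ps that(1) psup_least[OF X closed_presheaf[OF that(1)] that(2)]])
qed

lemma clat_complete: "X \<in> Ob Q ==> complete_lattice (clat X)"
proof (rule complete_lattice_of_lubs)
 assume X: "X \<in> Ob Q"
 show "le (clat X) \<phi> \<phi>" if "\<phi> \<in> carrier (clat X)" for \<phi>
  using that clat_le[OF X, of \<phi> \<phi>] pleq_refl[OF X closed_presheaf] by simp
 show "\<phi> = \<psi>" if "\<phi> \<in> carrier (clat X)" "\<psi> \<in> carrier (clat X)" "le (clat X) \<phi> \<psi>" "le (clat X) \<psi> \<phi>" for \<phi> \<psi>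
  using that clat_le[OF X] pleq_antisym[of X \<phi> \<psi>] by (simp del: plat_simps)
 show "le (clat X) \<phi> \<chi>" if "\<phi> \<in> carrier (clat X)" "\<psi> \<in> carrier (clat X)" "\<chi> \<in> carrier (clat X)"
  "le (clat X) \<phi> \<psi>" "le (clat X) \<psi> \<chi>" for \<phi> \<psi> \<chi>
  using that clat_le[OF X] pleq_trans[of X \<phi> \<psi> \<chi>] by (simp del: plat_simps)
 show "\<exists>s. lub_in (clat X) A s" if "A \<subseteq> carrier (clat X)" for A
  using clat_lub[OF X, of A] that by auto
qed simp

lemma clat_lub_eq:
 assumes X: "X \<in> Ob Q" and s: "lub_in (clat X) A s"
 shows "s = cl X (psup X A)"
proof -
 have "A \<subseteq> closed X" using s by (simp add: lub_in_def)
 from lub_in_eq_sup[OF clat_complete[OF X] clat_lub[OF X this]] lub_in_eq_sup[OF clat_complete[OF X] s]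
 show ?thesis by simp
qed

lemma closed_module: "sup_module Q clat cact"
proof (intro sup_module.intro sup_module_axioms.intro quantaloid_axioms)
 show "complete_lattice (clat X)" if "X \<in> Ob Q" for X by (rule clat_complete[OF that])
 have act_in: "cact X Y f y \<in> closed X" if "X \<in> Ob Q" "Y \<in> Ob Q" "f \<in> Hom Q X Y" "y \<in> closed Y" for X Y f y
  unfolding cact_def using that by (intro cl_closed pact_presheaf closed_presheaf)
 then show "cact X Y f y \<in> carrier (clat X)" if "X \<in> Ob Q" "Y \<in> Ob Q" "f \<in> Hom Q X Y" "y \<in> carrier (clat Y)" for X Y f y
  using that by simp
 show "cact X X (Ident Q X) x = x" if "X \<in> Ob Q" "x \<in> carrier (clat X)" for X x
  using that closed_presheaf by (simp add: cact_def pact_id cl_id)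
 show "cact X Z (Comp Q X Y Z g f) z = cact X Y f (cact Y Z g z)"
  if X: "X \<in> Ob Q" "Y \<in> Ob Q" "Z \<in> Ob Q" and fg: "f \<in> Hom Q X Y" "g \<in> Hom Q Y Z" and "z \<in> carrier (clat Z)" for X Y Z f g z
 proof -
  have z: "presheaf Z z" using that closed_presheaf by simp
  have zg: "presheaf Y (pact Y Z g z)" by (rule pact_presheaf[OF X(2,3) fg(2) z])
  have zgf: "presheaf X (pact X Y f (pact Y Z g z))" by (rule pact_presheaf[OF X(1,2) fg(1) zg])
  have cg: "presheaf X (pact X Y f (cl Y (pact Y Z g z)))" by (rule pact_presheaf[OF X(1,2) fg(1) cl_presheaf[OF X(2) zg]])
  have eq: "pact X Z (Comp Q X Y Z g f) z = pact X Y f (pact Y Z g z)"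
   using P.act_comp[OF X fg, of z] z by simp
  have "pleq X (pact X Y f (pact Y Z g z)) (pact X Y f (cl Y (pact Y Z g z)))"
   using P.act_mle[OF X(1) fg(1), of "pact Y Z g z" "cl Y (pact Y Z g z)"] cl_upper[OF X(2) zg] X by (simp add: mle_pleq)
  then have 1: "pleq X (cl X (pact X Y f (pact Y Z g z))) (cl X (pact X Y f (cl Y (pact Y Z g z))))" by (rule cl_mono[OF X(1)])
  have "pleq X (pact X Y f (cl Y (pact Y Z g z))) (cl X (pact X Y f (pact Y Z g z)))"
   by (rule pact_cl_le[OF X(2,1) zg cl_closed[OF X(1) zgf] fg(1) cl_upper[OF X(1) zgf]])
  then have 2: "pleq X (cl X (pact X Y f (cl Y (pact Y Z g z)))) (cl X (pact X Y f (pact Y Z g z)))"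
   by (rule cl_le[OF X(1) cg cl_closed[OF X(1) zgf]])
  show ?thesis unfolding cact_def eq by (rule pleq_antisym[OF 1 2])
 qed
 show "lub_in (clat X) (cact X Y f ` A) (cact X Y f y)"
  if X: "X \<in> Ob Q" "Y \<in> Ob Q" and f: "f \<in> Hom Q X Y" and y: "lub_in (clat Y) A y" for X Y f A y
 proof (rule clat_lubI[OF X(1)])
  have A: "A \<subseteq> closed Y" "y \<in> closed Y" using y by (simp_all add: lub_in_def)
  have pA: "presheaf Y \<phi>" if "\<phi> \<in> A" for \<phi> using that A closed_presheaf by blast
  show "cact X Y f ` A \<subseteq> closed X" "cact X Y f y \<in> closed X" using A act_in[OF X f] by auto
  have "pleq X (cact X Y f \<phi>) (cact X Y f y)" if \<phi>: "\<phi> \<in> A" for \<phi>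
  proof -
   have "pleq Y \<phi> y" using y \<phi> A clat_le[OF X(2), of \<phi> y] by (auto simp: lub_in_def)
   then have "pleq X (pact X Y f \<phi>) (pact X Y f y)"
    using P.act_mle[OF X(1) f, of \<phi> y] X by (simp add: mle_pleq)
   then show ?thesis unfolding cact_def by (rule cl_mono[OF X(1)])
  qed
  then show "pleq X \<phi>' (cact X Y f y)" if "\<phi>' \<in> cact X Y f ` A" for \<phi>' using that by blast
  fix \<psi> assume \<psi>: "\<psi> \<in> closed X" and le: "\<And>\<phi>. \<phi> \<in> cact X Y f ` A ==> pleq X \<phi> \<psi>"
  have "pleq X (pact X Y f \<phi>) \<psi>" if \<phi>: "\<phi> \<in> A" for \<phi>
  proof -
   have "pleq X (cact X Y f \<phi>) \<psi>" by (rule le) (use \<phi> in blast)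
   then show ?thesis unfolding cact_def by (rule pleq_trans[OF cl_upper[OF X(1) pact_presheaf[OF X f pA[OF \<phi>]]]])
  qed
  then have "pleq X (psup X (pact X Y f ` A)) \<psi>"
   by (intro psup_least[OF X(1) closed_presheaf[OF \<psi>]]) blast
  then have "pleq X (pact X Y f (psup Y A)) \<psi>" using pact_psup[OF X f pA] by simp
  then have "pleq X (pact X Y f y) \<psi>"
   unfolding clat_lub_eq[OF X(2) y] by (intro pact_cl_le[OF X(2,1) _ \<psi> f] psup_presheaf[OF X(2)] pA)
  then show "pleq X (cact X Y f y) \<psi>"
   unfolding cact_def by (rule cl_le[OF X(1) pact_presheaf[OF X f closed_presheaf[OF A(2)]] \<psi>])
 qed
 show "lub_in (clat X) ((\<lambda>f. cact X Y f y) ` S) (cact X Y s y)"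
  if X: "X \<in> Ob Q" "Y \<in> Ob Q" and "y \<in> carrier (clat Y)" and s: "lub_in (homlat Q X Y) S s" for X Y y S s
 proof (rule clat_lubI[OF X(1)])
  have yc: "y \<in> closed Y" using that by simp
  have y: "presheaf Y y" by (rule closed_presheaf[OF yc])
  have S: "S \<subseteq> Hom Q X Y" "s \<in> Hom Q X Y" using s by (simp_all add: lub_in_def)
  show "(\<lambda>f. cact X Y f y) ` S \<subseteq> closed X" "cact X Y s y \<in> closed X" using S act_in[OF X _ yc] by auto
  have "pleq X (cact X Y f y) (cact X Y s y)" if f: "f \<in> S" for f
  proof -
   have "ple Q X Y f s" using s S f X by (auto simp: lub_in_def ple_def)
   from P.act_ple[OF this, of y] have "pleq X (pact X Y f y) (pact X Y s y)" using y by (simp add: mle_pleq)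
   then show ?thesis unfolding cact_def by (rule cl_mono[OF X(1)])
  qed
  then show "pleq X \<phi> (cact X Y s y)" if "\<phi> \<in> (\<lambda>f. cact X Y f y) ` S" for \<phi> using that by blast
  fix \<psi> assume \<psi>: "\<psi> \<in> closed X" and le: "\<And>\<phi>. \<phi> \<in> (\<lambda>f. cact X Y f y) ` S ==> pleq X \<phi> \<psi>"
  have "pleq X (pact X Y f y) \<psi>" if f: "f \<in> S" for f
  proof -
   have fH: "f \<in> Hom Q X Y" using f S by blast
   have "pleq X (cact X Y f y) \<psi>" by (rule le) (use f in blast)
   then show ?thesis unfolding cact_def by (rule pleq_trans[OF cl_upper[OF X(1) pact_presheaf[OF X fH y]]])
  qed
  then have "pleq X (psup X ((\<lambda>f. pact X Y f y) ` S)) \<psi>"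
   by (intro psup_least[OF X(1) closed_presheaf[OF \<psi>]]) blast
  then have "pleq X (pact X Y s y) \<psi>"
   unfolding hom_lub_eq[OF X s] pact_hsup[OF X S(1) y] .
  then show "pleq X (cact X Y s y) \<psi>"
   unfolding cact_def by (rule cl_le[OF X(1) pact_presheaf[OF X S(2) y] \<psi>])
 qed
qed

lemma closed_hom:
 assumes x: "x' \<in> Elts B" "x \<in> Elts B" and f: "f \<in> Hom Q (Typ B x) (Typ B x')"
 shows "pleq (Typ B x) (cact (Typ B x) (Typ B x') f (yon x')) (yon x) \<longleftrightarrow> ple Q (Typ B x) (Typ B x') f (EHom B x' x)"
proof -
 have X: "Typ B x \<in> Ob Q" "Typ B x' \<in> Ob Q" using BD(1) x by simp_all
 have p: "presheaf (Typ B x) (pact (Typ B x) (Typ B x') f (yon x'))" by (rule pact_presheaf[OF X f yon_presheaf[OF x(1)]])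
 have c: "yon x \<in> closed (Typ B x)" using x by (auto simp: closed_def)
 have "pleq (Typ B x) (cact (Typ B x) (Typ B x') f (yon x')) (yon x) \<longleftrightarrow> pleq (Typ B x) (pact (Typ B x) (Typ B x') f (yon x')) (yon x)"
  unfolding cact_def using cl_le[OF X(1) p c] pleq_trans[OF cl_upper[OF X(1) p]] by blast
 also have "\<dots> \<longleftrightarrow> ple Q (Typ B x) (Typ B x') f (yon x x')" by (rule yoneda[OF x(1) X(1) yon_presheaf[OF x(2)] f])
 finally show ?thesis using x by (simp add: yon_def)
qed

end

locale small_base = quantaloid Q for Q :: "('o, 'a) locat" +
 fixes p :: "'o \<times> 'u => 'u"
 assumes universe: "grothendieck_universe TYPE('u)"
  and small: "small_quantaloid TYPE('u) Q"
  and p: "inj_on p (Ob Q \<times> UNIV)"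
begin

abbreviation "Kcat \<equiv> Cat_cc TYPE('u) Q"
abbreviation "ModQ \<equiv> Mod_quantaloid TYPE('u) Q"

lemma small_Ob: "small TYPE('u) (Ob Q)"
 using small by (simp add: small_quantaloid_def)

lemma module_cat:
 assumes M: "homomorphism (opq Q) SL M"
 shows "module_cat Q (FOb M) (\<lambda>X Y. FArr M Y X) p"
proof (intro module_cat.intro module_cat_axioms.intro)
 show "sup_module Q (FOb M) (\<lambda>X Y. FArr M Y X)" by (rule Mod_object_sup_module[OF quantaloid_axioms M])
 show "inj_on p (SIGMA X:Ob Q. carrier (FOb M X))" by (rule inj_on_subset[OF p]) auto
 show "small TYPE('u) (carrier (FOb M X))" if "X \<in> Ob Q" for X by (rule Mod_object_small[OF M that])
qed (rule universe, rule small_Ob)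

definition El :: "('o, 'a, 'u gorder, 'u => 'u) arrow_map => ('u, 'o, 'a) ecat" where
 "El M = module_cat.elements Q (FOb M) (\<lambda>X Y. FArr M Y X) p"

text \<open>An inserter is fully faithful, and a category of elements is cocomplete, so its identity extends
 along the inserter.\<close>

lemma El_absolute_retract:
 assumes M: "homomorphism (opq Q) SL M"
 shows "absolute_retract Kcat (El M)"
proof -
 interpret M: module_cat Q "FOb M" "\<lambda>X Y. FArr M Y X" p by (rule module_cat[OF M])
 have "\<exists>h\<in>Hom Kcat B (El M). pis Kcat (El M) (El M) (Comp Kcat (El M) B (El M) h j) (Ident Kcat (El M))"
  if ins: "inserter Kcat (El M) B C j f g" for B C j f g
 proof -
  have ob: "B \<in> Ob Kcat" "El M \<in> Ob Kcat" and j: "enriched_functor Q (El M) B j"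
   using ins by (simp_all add: inserter_def)
  have eB: "enriched_category Q B" using ob by simp
  have eM: "enriched_category Q (El M)" using ob by simp
  obtain h where h: "enriched_functor Q B (El M) h" "\<And>u. u \<in> Elts (El M) ==> h (j u) = u"
   using M.elements_retract[OF eB, folded El_def, OF j] inserter_fully_faithful[OF universe ins] by metis
  have "pis Kcat (El M) (El M) (compose (Elts (El M)) h j) (\<lambda>a\<in>Elts (El M). a)"
   unfolding pis_Cat using ob functor_comp[OF eM eB eM j h(1)] functor_id[OF eM] h(2) eleq_refl[OF eM]
   by (simp add: compose_def)
  then show ?thesis using h(1) by auto
 qed
 then show ?thesis using M.elements_Ob by (simp add: absolute_retract_def El_def)
qed

text \<open>The Yoneda embedding is fully faithful, hence an inserter, so an absolute retract is a retract
 of its category of presheaves. Thereby it is the category of elements of the module of closed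
 presheaves, which is then coded in the universe.\<close>

lemma absolute_retract_El:
 assumes ar: "absolute_retract Kcat I"
 shows "\<exists>M\<in>Ob ModQ. \<exists>e d. equiv_pair Kcat I (El M) e d"
proof -
 have I: "I \<in> Ob Kcat" using ar by (simp add: absolute_retract_def)
 then have eI: "enriched_category Q I" and cI: "cauchy_complete Q I" by simp_all
 interpret presheaves Q I using eI by unfold_locales
 have small_psh: "small TYPE('u) (carrier (plat X))" if "X \<in> Ob Q" for X
  by (rule small_presheaves[OF universe small eI that])
 have "small TYPE('u) (SIGMA X:Ob Q. carrier (plat X))"
  using small_psh by (intro small_Sigma[OF universe small_Ob])
 then obtain k :: "'o \<times> ('u => 'a) => 'u" where k: "inj_on k (SIGMA X:Ob Q. carrier (plat X))"
  by (rule small_imp_inj)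
 have "module_cat Q plat pact k"
  using universe small_Ob small_psh k by (intro module_cat.intro module_cat_axioms.intro presheaf_module)
 then interpret presheaf_category Q I k by (intro presheaf_category.intro presheaves_axioms)
 obtain k' :: "'o \<times> ('u => 'a) => 'u" where "inj_on k' (SIGMA X:Ob Q. carrier (presheaves.plat Q PB X))"
 proof (rule small_imp_inj)
  show "small TYPE('u) (SIGMA X:Ob Q. carrier (presheaves.plat Q PB X))"
   using small_presheaves[OF universe small P.elements_enriched] by (intro small_Sigma[OF universe small_Ob])
 qed
 interpret PP: presheaves Q PB using P.elements_enriched by unfold_locales
 have "module_cat Q PP.plat PP.pact k'"
  using universe small_Ob small_presheaves[OF universe small P.elements_enriched] \<open>inj_on k' _\<close>
  by (intro module_cat.intro module_cat_axioms.intro PP.presheaf_module)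
 then interpret PP: presheaf_category Q PB k' by (intro presheaf_category.intro PP.presheaves_axioms)
 have "\<exists>G. inserter Kcat I PB PP.PB Yo PP.Yo G"
  by (rule PP.fully_faithful_inserter[OF I P.elements_cauchy_complete Yo_functor]) (simp add: Yo_ff)
 then obtain r where r: "enriched_functor Q PB I r" "pis Kcat I I (compose (Elts I) r Yo) (\<lambda>a\<in>Elts I. a)"
  using ar unfolding absolute_retract_def by simp blast
 interpret yoneda_retract Q I k r
 proof
  show "enriched_functor Q PB I r" by (rule r(1))
  show "eleq Q I (r (Yo b)) b" "eleq Q I b (r (Yo b))" if "b \<in> Elts I" for b
   using r(2) that by (auto simp: pis_Cat compose_def)
 qed
 have "small TYPE('u) (carrier (clat X))" for X
  by (simp add: closed_def) (intro small_image small_subset[OF ecatD(1)[OF eI]], auto)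
 then obtain code :: "'o => ('u => 'a) => 'u" where "small_sup_module Q clat cact code"
  using small_sup_module_exists[OF closed_module] by blast
 then interpret c: small_sup_module Q clat cact code .
 interpret M: module_cat Q "FOb c.coded" "\<lambda>X Y. FArr c.coded Y X" p by (rule module_cat[OF c.coded_homomorphism])
 let ?e = "\<lambda>x. code (Typ I x) (yon x)"
 have cl_yon: "yon x \<in> closed (Typ I x)" if "x \<in> Elts I" for x using that by (auto simp: closed_def)
 have "\<exists>j d. equiv_pair Kcat I M.elements j d"
 proof (rule M.elements_equivalence[OF I, of ?e])
  show "?e x \<in> carrier (FOb c.coded (Typ I x))" if "x \<in> Elts I" for x using cl_yon[OF that] by simp
  show "\<exists>x\<in>Elts I. Typ I x = X \<and> ?e x = y" if "X \<in> Ob Q" "y \<in> carrier (FOb c.coded X)" for X y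
   using that by (auto simp: closed_def)
  fix x' x f assume x: "x' \<in> Elts I" "x \<in> Elts I" and f: "f \<in> Hom Q (Typ I x) (Typ I x')"
  have X: "Typ I x \<in> Ob Q" "Typ I x' \<in> Ob Q" using BD(1) x by simp_all
  have a: "cact (Typ I x) (Typ I x') f (yon x') \<in> closed (Typ I x)" using c.act_in[OF X f, of "yon x'"] cl_yon[OF x(1)] by simp
  have "M.mle (Typ I x) (FArr c.coded (Typ I x') (Typ I x) f (?e x')) (?e x) \<longleftrightarrow>
    pleq (Typ I x) (cact (Typ I x) (Typ I x') f (yon x')) (yon x)"
   using X a cl_yon[OF x(1)] cl_yon[OF x(2)] clat_le[OF X(1) a cl_yon[OF x(2)]] by (simp add: M.mle_def del: plat_simps)
  also have "\<dots> \<longleftrightarrow> ple Q (Typ I x) (Typ I x') f (EHom I x' x)" by (rule closed_hom[OF x f])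
  finally show "M.mle (Typ I x) (FArr c.coded (Typ I x') (Typ I x) f (?e x')) (?e x) \<longleftrightarrow> ple Q (Typ I x) (Typ I x') f (EHom I x' x)" .
 qed
 then show ?thesis using c.coded_homomorphism by (auto simp: El_def)
qed

end

section \<open>Module morphisms are the left adjoint functors\<close>

locale module_pair = M: module_cat Q lat act k + N: module_cat Q lat' act' k'
 for Q :: "('o, 'a) locat" and lat :: "'o => 'x gorder" and act and lat' :: "'o => 'y gorder" and act'
  and k :: "'o \<times> 'x => 'u" and k' :: "'o \<times> 'y => 'u"
begin

abbreviation "KC \<equiv> Cat_cc TYPE('u) Q"

definition module_map :: "('o => 'x => 'y) => bool" where
 "module_map \<alpha> \<longleftrightarrow> (\<forall>X\<in>Ob Q. \<forall>x\<in>carrier (lat X). \<alpha> X x \<in> carrier (lat' X)) \<and>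
   (\<forall>X\<in>Ob Q. \<forall>A s. lub_in (lat X) A s --> lub_in (lat' X) (\<alpha> X ` A) (\<alpha> X s)) \<and>
   (\<forall>X\<in>Ob Q. \<forall>Y\<in>Ob Q. \<forall>f\<in>Hom Q X Y. \<forall>y\<in>carrier (lat Y). \<alpha> X (act X Y f y) = act' X Y f (\<alpha> Y y))"

definition emap :: "('o => 'x => 'y) => 'u => 'u" where
 "emap \<alpha> = (\<lambda>u\<in>Elts M.elements. k' (M.ty u, \<alpha> (M.ty u) (M.val u)))"

lemma module_mapD:
 assumes "module_map \<alpha>"
 shows "[|X \<in> Ob Q; x \<in> carrier (lat X)|] ==> \<alpha> X x \<in> carrier (lat' X)"
  and "[|X \<in> Ob Q; lub_in (lat X) A s|] ==> lub_in (lat' X) (\<alpha> X ` A) (\<alpha> X s)"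
  and "[|X \<in> Ob Q; Y \<in> Ob Q; f \<in> Hom Q X Y; y \<in> carrier (lat Y)|] ==> \<alpha> X (act X Y f y) = act' X Y f (\<alpha> Y y)"
 using assms unfolding module_map_def by blast+

lemma module_map_mono:
 assumes \<alpha>: "module_map \<alpha>" and xy: "M.mle X x y"
 shows "N.mle X (\<alpha> X x) (\<alpha> X y)"
proof -
 have X: "X \<in> Ob Q" "x \<in> carrier (lat X)" "y \<in> carrier (lat X)" using xy by (simp_all add: M.mle_def)
 have "lub_in (lat X) {x, y} y" using xy M.mle_refl[OF X(1,3)] by (auto simp: M.mle_def lub_in_def)
 from module_mapD(2)[OF \<alpha> X(1) this] show ?thesis using X module_mapD(1)[OF \<alpha>] by (auto simp: N.mle_def lub_in_def)
qed

lemma emap: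
 assumes "module_map \<alpha>" "u \<in> Elts M.elements"
 shows "emap \<alpha> u \<in> Elts N.elements" "N.ty (emap \<alpha> u) = M.ty u" "N.val (emap \<alpha> u) = \<alpha> (M.ty u) (M.val u)"
 using M.eltD[OF assms(2)] module_mapD(1)[OF assms(1)] assms(2) by (simp_all add: emap_def)

lemma emap_functor:
 assumes \<alpha>: "module_map \<alpha>"
 shows "enriched_functor Q M.elements N.elements (emap \<alpha>)"
proof (rule M.functorI)
 fix u' u assume u: "u' \<in> Elts M.elements" "u \<in> Elts M.elements"
 note D = M.eltD[OF u(1)] M.eltD[OF u(2)] and e = emap[OF \<alpha> u(1)] emap[OF \<alpha> u(2)]
 have h: "EHom M.elements u' u \<in> Hom Q (M.ty u) (M.ty u')" by (rule M.ehom_in[OF u])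
 have "N.mle (M.ty u) (act' (M.ty u) (M.ty u') (EHom M.elements u' u) (\<alpha> (M.ty u') (M.val u'))) (\<alpha> (M.ty u) (M.val u))"
  using module_map_mono[OF \<alpha> M.ehom_act[OF u]] module_mapD(3)[OF \<alpha> D(4) D(1) h D(2)] by simp
 then show "ple Q (Typ M.elements u) (Typ M.elements u') (EHom M.elements u' u) (EHom N.elements (emap \<alpha> u') (emap \<alpha> u))"
  using N.ehom_iff[OF e(1) e(4), of "EHom M.elements u' u"] e h by simp
qed (use emap[OF \<alpha>] in \<open>auto simp: emap_def\<close>)

lemma emap_ple:
 assumes \<alpha>: "module_map \<alpha>" and \<beta>: "module_map \<beta>"
 shows "ple KC M.elements N.elements (emap \<alpha>) (emap \<beta>) \<longleftrightarrow>
  (\<forall>X\<in>Ob Q. \<forall>x\<in>carrier (lat X). le (lat' X) (\<alpha> X x) (\<beta> X x))" (is "?L \<longleftrightarrow> ?R")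
proof -
 have "?L \<longleftrightarrow> (\<forall>u\<in>Elts M.elements. eleq Q N.elements (emap \<alpha> u) (emap \<beta> u))"
  unfolding M.ple_Cat using M.elements_Ob N.elements_Ob emap_functor[OF \<alpha>] emap_functor[OF \<beta>] by blast
 also have "\<dots> \<longleftrightarrow> (\<forall>u\<in>Elts M.elements. N.mle (M.ty u) (\<alpha> (M.ty u) (M.val u)) (\<beta> (M.ty u) (M.val u)))"
  using N.eleq_elements emap[OF \<alpha>] emap[OF \<beta>] by simp
 also have "\<dots> \<longleftrightarrow> (\<forall>u\<in>Elts M.elements. le (lat' (M.ty u)) (\<alpha> (M.ty u) (M.val u)) (\<beta> (M.ty u) (M.val u)))"
  using M.eltD module_mapD(1)[OF \<alpha>] module_mapD(1)[OF \<beta>] by (simp add: N.mle_def)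
 also have "\<dots> \<longleftrightarrow> ?R"
 proof (intro iffI ballI)
  fix X x assume "\<forall>u\<in>Elts M.elements. le (lat' (M.ty u)) (\<alpha> (M.ty u) (M.val u)) (\<beta> (M.ty u) (M.val u))"
   and X: "X \<in> Ob Q" "x \<in> carrier (lat X)"
  then show "le (lat' X) (\<alpha> X x) (\<beta> X x)" using M.elt[OF X] M.ty_k[OF X] M.val_k[OF X] by metis
 qed (use M.eltD in blast)
 finally show ?thesis .
qed

text \<open>A map of modules preserves suprema, so it has a pointwise right adjoint; this is lax for the
 action because the map itself commutes with the action.\<close>

lemma emap_left_adjoint:
 assumes \<alpha>: "module_map \<alpha>"
 shows "left_adjoint_in KC M.elements N.elements (emap \<alpha>)"
proof -
 define S where "S X y = {x \<in> carrier (lat X). N.mle X (\<alpha> X x) y}" for X y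
 define \<rho> where "\<rho> X y = M.msup X (S X y)" for X y
 have S: "S X y \<subseteq> carrier (lat X)" for X y by (auto simp: S_def)
 have \<rho>: "\<rho> X y \<in> carrier (lat X)" if "X \<in> Ob Q" for X y unfolding \<rho>_def by (rule M.msup_in[OF that S])
 have unit: "M.mle X x (\<rho> X y)" if "X \<in> Ob Q" "x \<in> carrier (lat X)" "N.mle X (\<alpha> X x) y" for X x y
  unfolding \<rho>_def by (rule M.msup_upper[OF that(1) S]) (use that in \<open>simp add: S_def\<close>)
 have counit: "N.mle X (\<alpha> X (\<rho> X y)) y" if X: "X \<in> Ob Q" and y: "y \<in> carrier (lat' X)" for X y
 proof -
  have l: "lub_in (lat' X) (\<alpha> X ` S X y) (\<alpha> X (\<rho> X y))"
   unfolding \<rho>_def by (rule module_mapD(2)[OF \<alpha> X M.msup_lub[OF X S]])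
  have "le (lat' X) b y" if "b \<in> \<alpha> X ` S X y" for b using that by (auto simp: S_def N.mle_def)
  then show ?thesis using l X y unfolding lub_in_def N.mle_def by blast
 qed
 have \<rho>_mono: "M.mle X (\<rho> X y) (\<rho> X z)" if yz: "N.mle X y z" for X y z
 proof -
  have X: "X \<in> Ob Q" "y \<in> carrier (lat' X)" using yz by (simp_all add: N.mle_def)
  show ?thesis by (rule unit[OF X(1) \<rho>[OF X(1)] N.mle_trans[OF counit[OF X] yz]])
 qed
 have \<rho>_lax: "M.mle X (act X Y f (\<rho> Y y)) (\<rho> X (act' X Y f y))"
  if X: "X \<in> Ob Q" "Y \<in> Ob Q" and f: "f \<in> Hom Q X Y" and y: "y \<in> carrier (lat' Y)" for X Y f y
  using N.act_mle[OF X(1) f counit[OF X(2) y]] module_mapD(3)[OF \<alpha> X f \<rho>[OF X(2)]]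
  by (intro unit M.act_in[OF X f] \<rho> X) simp
 let ?G = "\<lambda>v\<in>Elts N.elements. k (N.ty v, \<rho> (N.ty v) (N.val v))"
 have G: "?G v \<in> Elts M.elements" "M.ty (?G v) = N.ty v" "M.val (?G v) = \<rho> (N.ty v) (N.val v)" if "v \<in> Elts N.elements" for v
  using N.eltD[OF that] \<rho> that by simp_all
 have Gf: "enriched_functor Q N.elements M.elements ?G"
 proof (rule M.functorI)
  fix v' v assume v: "v' \<in> Elts N.elements" "v \<in> Elts N.elements"
  note D = N.eltD[OF v(1)] N.eltD[OF v(2)]
  have h: "EHom N.elements v' v \<in> Hom Q (N.ty v) (N.ty v')" by (rule N.ehom_in[OF v])
  have "M.mle (N.ty v) (act (N.ty v) (N.ty v') (EHom N.elements v' v) (\<rho> (N.ty v') (N.val v'))) (\<rho> (N.ty v) (N.val v))"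
   by (rule M.mle_trans[OF \<rho>_lax[OF D(4,1) h D(2)] \<rho>_mono[OF N.ehom_act[OF v]]])
  then show "ple Q (Typ N.elements v) (Typ N.elements v') (EHom N.elements v' v) (EHom M.elements (?G v') (?G v))"
   using M.ehom_iff[OF G(1)[OF v(1)] G(1)[OF v(2)], of "EHom N.elements v' v"] G[OF v(1)] G[OF v(2)] h
   by (simp del: restrict_apply)
 qed (use G in \<open>auto simp del: restrict_apply\<close>)
 note fs = emap_functor[OF \<alpha>] Gf
 note en = M.elements_enriched N.elements_enriched
 have "eleq Q M.elements u (?G (emap \<alpha> u))" if u: "u \<in> Elts M.elements" for u
  using M.eleq_elements[OF u G(1)] emap[OF \<alpha> u] G[of "emap \<alpha> u"] M.eltD[OF u] module_mapD(1)[OF \<alpha>]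
  by (simp add: unit N.mle_refl del: restrict_apply)
 then have "ple KC M.elements M.elements (\<lambda>a\<in>Elts M.elements. a) (compose (Elts M.elements) ?G (emap \<alpha>))"
  unfolding M.ple_Cat using M.elements_Ob M.functor_comp[OF en(1,2,1) fs] M.functor_id[OF en(1)]
  by (simp add: compose_def del: M.Cat_simps(1))
 moreover have "eleq Q N.elements (emap \<alpha> (?G v)) v" if v: "v \<in> Elts N.elements" for v
  using N.eleq_elements[OF emap(1)[OF \<alpha> G(1)[OF v]] v] emap[OF \<alpha> G(1)[OF v]] G[OF v] N.eltD[OF v]
  by (simp add: counit del: restrict_apply)
 then have "ple KC N.elements N.elements (compose (Elts N.elements) (emap \<alpha>) ?G) (\<lambda>a\<in>Elts N.elements. a)"
  unfolding M.ple_Cat using N.elements_Ob M.functor_comp[OF en(2,1,2) fs(2,1)] M.functor_id[OF en(2)]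
  by (simp add: compose_def del: M.Cat_simps(1))
 ultimately show ?thesis unfolding left_adjoint_in_def using fs by (auto simp del: M.Cat_simps(1))
qed

lemma functor_mono:
 assumes h: "enriched_functor Q M.elements N.elements h" and xy: "M.mle X x y"
 shows "N.mle X (N.val (h (k (X, x)))) (N.val (h (k (X, y))))"
proof -
 have X: "X \<in> Ob Q" "x \<in> carrier (lat X)" "y \<in> carrier (lat X)" using xy by (simp_all add: M.mle_def)
 have "eleq Q M.elements (k (X, x)) (k (X, y))" using M.eleq_elements[of "k (X, x)" "k (X, y)"] X xy by simp
 then have "eleq Q N.elements (h (k (X, x))) (h (k (X, y)))"
  by (rule M.functor_eleq[OF M.elements_enriched N.elements_enriched h])
 then show ?thesis
  using N.eleq_elements M.functor_in[OF h M.elt] M.functor_typ[OF h M.elt] X by simp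
qed

lemma functor_lax:
 assumes h: "enriched_functor Q M.elements N.elements h"
  and X: "X \<in> Ob Q" "Y \<in> Ob Q" and f: "f \<in> Hom Q X Y" and y: "y \<in> carrier (lat Y)"
 shows "N.mle X (act' X Y f (N.val (h (k (Y, y))))) (N.val (h (k (X, act X Y f y))))"
proof -
 let ?u' = "k (Y, y)" and ?u = "k (X, act X Y f y)"
 have a: "act X Y f y \<in> carrier (lat X)" by (rule M.act_in[OF X f y])
 have u: "?u' \<in> Elts M.elements" "?u \<in> Elts M.elements" using X y a by simp_all
 have hu: "h ?u' \<in> Elts N.elements" "h ?u \<in> Elts N.elements" "N.ty (h ?u') = Y" "N.ty (h ?u) = X"
  using M.functor_in[OF h u(1)] M.functor_in[OF h u(2)] M.functor_typ[OF h u(1)] M.functor_typ[OF h u(2)] X y a by simp_all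
 have "ple Q X Y f (EHom M.elements ?u' ?u)"
  using M.ehom_iff[OF u, of f] M.mle_refl[OF X(1) a] X y a f by simp
 also have "ple Q X Y \<dots> (EHom N.elements (h ?u') (h ?u))"
  using M.functor_ple[OF M.elements_enriched N.elements_enriched h u] X y a by simp
 finally show ?thesis using N.ehom_iff[OF hu(1,2), of f] hu f by simp
qed

end

context module_pair
begin

text \<open>Conversely a left adjoint functor preserves suprema because it is a left adjoint on fibres,
 and preserves the action strictly, since both adjoints preserve it laxly.\<close>

lemma left_adjoint_emap:
 assumes adj: "left_adjoint_in KC M.elements N.elements h"
 shows "\<exists>\<alpha>. module_map \<alpha> \<and> \<alpha> \<in> extensional (Ob Q) \<and> (\<forall>X\<in>Ob Q. \<alpha> X \<in> extensional (carrier (lat X))) \<and> emap \<alpha> = h"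
proof -
 interpret op: module_pair Q lat' act' lat act k' k ..
 obtain g where h: "enriched_functor Q M.elements N.elements h" and g: "enriched_functor Q N.elements M.elements g"
  and unit: "\<And>u. u \<in> Elts M.elements ==> eleq Q M.elements u (g (h u))"
  and counit: "\<And>v. v \<in> Elts N.elements ==> eleq Q N.elements (h (g v)) v"
  using adj unfolding left_adjoint_in_def M.ple_Cat by (auto simp: compose_def)
 define \<alpha> where "\<alpha> = (\<lambda>X\<in>Ob Q. \<lambda>x\<in>carrier (lat X). N.val (h (k (X, x))))"
 define \<beta> where "\<beta> X y = M.val (g (k' (X, y)))" for X y
 have hk: "h (k (X, x)) = k' (X, \<alpha> X x)" "\<alpha> X x \<in> carrier (lat' X)" if X: "X \<in> Ob Q" and x: "x \<in> carrier (lat X)" for X x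
  using N.eltD[OF M.functor_in[OF h M.elt[OF X x]]] M.functor_typ[OF h M.elt[OF X x]] X x by (simp_all add: \<alpha>_def)
 have gk: "g (k' (X, y)) = k (X, \<beta> X y)" "\<beta> X y \<in> carrier (lat X)" if X: "X \<in> Ob Q" and y: "y \<in> carrier (lat' X)" for X y
  using M.eltD[OF M.functor_in[OF g N.elt[OF X y]]] M.functor_typ[OF g N.elt[OF X y]] X y by (simp_all add: \<beta>_def)
 have mono: "N.mle X (\<alpha> X x) (\<alpha> X y)" if "M.mle X x y" for X x y
  using functor_mono[OF h that] that by (simp add: \<alpha>_def M.mle_def)
 have mono': "M.mle X (\<beta> X x) (\<beta> X y)" if "N.mle X x y" for X x y
  using op.functor_mono[OF g that] by (simp add: \<beta>_def)
 have un: "M.mle X x (\<beta> X (\<alpha> X x))" if X: "X \<in> Ob Q" "x \<in> carrier (lat X)" for X x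
  using unit[OF M.elt[OF X]] M.eleq_elements[OF M.elt[OF X] M.elt[OF X(1) gk(2)[OF X(1) hk(2)[OF X]]]]
   hk[OF X] gk[OF X(1) hk(2)[OF X]] X by simp
 have co: "N.mle X (\<alpha> X (\<beta> X y)) y" if X: "X \<in> Ob Q" "y \<in> carrier (lat' X)" for X y
  using counit[OF N.elt[OF X]] N.eleq_elements[OF N.elt[OF X(1) hk(2)[OF X(1) gk(2)[OF X]]] N.elt[OF X]]
   gk[OF X] hk[OF X(1) gk(2)[OF X]] X by simp
 have galois: "N.mle X (\<alpha> X x) y" if x: "M.mle X x (\<beta> X y)" and y: "y \<in> carrier (lat' X)" for X x y
  using N.mle_trans[OF mono[OF x] co[OF _ y]] x by (simp add: M.mle_def)
 have "\<alpha> X (act X Y f y) = act' X Y f (\<alpha> Y y)"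
  if X: "X \<in> Ob Q" "Y \<in> Ob Q" and f: "f \<in> Hom Q X Y" and y: "y \<in> carrier (lat Y)" for X Y f y
 proof (rule N.mle_antisym)
  have \<alpha>y: "\<alpha> Y y \<in> carrier (lat' Y)" by (rule hk(2)[OF X(2) y])
  have "M.mle X (act X Y f y) (act X Y f (\<beta> Y (\<alpha> Y y)))" by (rule M.act_mle[OF X(1) f un[OF X(2) y]])
  also have "M.mle X \<dots> (\<beta> X (act' X Y f (\<alpha> Y y)))" using op.functor_lax[OF g X f \<alpha>y] by (simp add: \<beta>_def)
  finally show "N.mle X (\<alpha> X (act X Y f y)) (act' X Y f (\<alpha> Y y))" by (rule galois[OF _ N.act_in[OF X f \<alpha>y]])
  show "N.mle X (act' X Y f (\<alpha> Y y)) (\<alpha> X (act X Y f y))"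
   using functor_lax[OF h X f y] X y M.act_in[OF X f y] by (simp add: \<alpha>_def)
 qed
 moreover have "lub_in (lat' X) (\<alpha> X ` A) (\<alpha> X s)" if X: "X \<in> Ob Q" and s: "lub_in (lat X) A s" for X A s
  unfolding lub_in_def
 proof (intro conjI ballI impI)
  have A: "A \<subseteq> carrier (lat X)" "s \<in> carrier (lat X)" using s by (simp_all add: lub_in_def)
  show "\<alpha> X ` A \<subseteq> carrier (lat' X)" "\<alpha> X s \<in> carrier (lat' X)" using hk(2)[OF X] A by blast+
  show "le (lat' X) b (\<alpha> X s)" if "b \<in> \<alpha> X ` A" for b
   using that mono[of X _ s] s A X by (auto simp: lub_in_def M.mle_def N.mle_def)
  fix u assume u: "u \<in> carrier (lat' X)" "\<forall>b\<in>\<alpha> X ` A. le (lat' X) b u"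
  have "le (lat X) a (\<beta> X u)" if a: "a \<in> A" for a
  proof -
   have "N.mle X (\<alpha> X a) u" using u a A hk(2)[OF X] X unfolding N.mle_def by blast
   moreover have "M.mle X a (\<beta> X (\<alpha> X a))" using un X a A by blast
   ultimately have "M.mle X a (\<beta> X u)" by (blast intro: M.mle_trans mono')
   then show ?thesis by (simp add: M.mle_def)
  qed
  then have "M.mle X s (\<beta> X u)" using s gk(2)[OF X u(1)] X by (auto simp: lub_in_def M.mle_def)
  from galois[OF this u(1)] show "le (lat' X) (\<alpha> X s) u" by (simp add: N.mle_def)
 qed
 ultimately have "module_map \<alpha>" unfolding module_map_def using hk(2) by blast
 moreover have "emap \<alpha> = h"
 proof
  fix u show "emap \<alpha> u = h u"
  proof (cases "u \<in> Elts M.elements")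
   case True
   then show ?thesis using hk(1)[OF M.eltD(1,2)[OF True]] M.eltD(3)[OF True] by (simp add: emap_def)
  next
   case False
   then show ?thesis using h by (auto simp: emap_def enriched_functor_def PiE_def extensional_def)
  qed
 qed
 ultimately show ?thesis by (intro exI[of _ \<alpha>]) (simp add: \<alpha>_def)
qed

end

context small_base
begin

definition Elmap :: "(('o, 'a, 'u gorder, 'u => 'u) arrow_map, 'o => 'u => 'u, ('u, 'o, 'a) ecat, 'u => 'u) arrow_map" where
 "Elmap = \<lparr>FOb = El, FArr = (\<lambda>M N. module_pair.emap Q (FOb M) (\<lambda>X Y. FArr M Y X) p p)\<rparr>"

lemma module_pair:
 assumes "M \<in> Ob ModQ" "N \<in> Ob ModQ"
 shows "module_pair Q (FOb M) (\<lambda>X Y. FArr M Y X) (FOb N) (\<lambda>X Y. FArr N Y X) p p"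
 using assms module_cat by (intro module_pair.intro) auto

lemma Mod_hom_module_map:
 assumes M: "M \<in> Ob ModQ" "N \<in> Ob ModQ"
 shows "\<alpha> \<in> Hom ModQ M N \<longleftrightarrow> \<alpha> \<in> extensional (Ob Q) \<and> (\<forall>X\<in>Ob Q. \<alpha> X \<in> extensional (carrier (FOb M X))) \<and>
  module_pair.module_map Q (FOb M) (\<lambda>X Y. FArr M Y X) (FOb N) (\<lambda>X Y. FArr N Y X) \<alpha>"
proof -
 interpret module_pair Q "FOb M" "\<lambda>X Y. FArr M Y X" "FOb N" "\<lambda>X Y. FArr N Y X" p p by (rule module_pair[OF M])
 show ?thesis
  using Mod_hom_iff[OF quantaloid_axioms, of M N \<alpha>] M unfolding module_map_def by (auto simp: PiE_def Pi_def)
qed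

text \<open>Module morphisms are compared pointwise and so are the induced functors, hence the order is
 reflected; that the functors obtained are exactly the left adjoints was shown above.\<close>

theorem Elmap_realization: "realization ModQ Kcat Elmap"
proof -
 have Tob: "FOb Elmap M = El M" for M by (simp add: Elmap_def)
 have Elob: "El M \<in> Ob Kcat" if M: "M \<in> Ob ModQ" for M
  using El_absolute_retract[of M] M by (simp add: absolute_retract_def)
 have all: "FArr Elmap M N \<alpha> \<in> Hom Kcat (El M) (El N)" "left_adjoint_in Kcat (El M) (El N) (FArr Elmap M N \<alpha>)"
  if M: "M \<in> Ob ModQ" "N \<in> Ob ModQ" and \<alpha>: "\<alpha> \<in> Hom ModQ M N" for M N \<alpha>
 proof -
  interpret module_pair Q "FOb M" "\<lambda>X Y. FArr M Y X" "FOb N" "\<lambda>X Y. FArr N Y X" p p by (rule module_pair[OF M])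
  have "module_map \<alpha>" using Mod_hom_module_map[OF M] \<alpha> by blast
  then show "FArr Elmap M N \<alpha> \<in> Hom Kcat (El M) (El N)" "left_adjoint_in Kcat (El M) (El N) (FArr Elmap M N \<alpha>)"
   using emap_functor emap_left_adjoint by (simp_all add: Elmap_def El_def)
 qed
 have ple: "ple Kcat (El M) (El N) (FArr Elmap M N \<alpha>) (FArr Elmap M N \<beta>) \<longleftrightarrow> Leq ModQ M N \<alpha> \<beta>"
  if M: "M \<in> Ob ModQ" "N \<in> Ob ModQ" and \<alpha>: "\<alpha> \<in> Hom ModQ M N" "\<beta> \<in> Hom ModQ M N" for M N \<alpha> \<beta>
 proof -
  interpret module_pair Q "FOb M" "\<lambda>X Y. FArr M Y X" "FOb N" "\<lambda>X Y. FArr N Y X" p p by (rule module_pair[OF M])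
  show ?thesis using emap_ple Mod_hom_module_map[OF M] \<alpha> by (simp add: Elmap_def El_def)
 qed
 have lift: "\<exists>\<alpha>\<in>Hom ModQ M N. FArr Elmap M N \<alpha> = h"
  if M: "M \<in> Ob ModQ" "N \<in> Ob ModQ" and h: "left_adjoint_in Kcat (El M) (El N) h" for M N h
 proof -
  interpret module_pair Q "FOb M" "\<lambda>X Y. FArr M Y X" "FOb N" "\<lambda>X Y. FArr N Y X" p p by (rule module_pair[OF M])
  show ?thesis
   using left_adjoint_emap[of h] h Mod_hom_module_map[OF M] unfolding Elmap_def El_def by (auto simp del: Mod_simps)
 qed
 have pr: "pis Kcat A B f f" if "A \<in> Ob Kcat" "B \<in> Ob Kcat" "f \<in> Hom Kcat A B" for A B f
  by (rule locally_ordered_category.pis_refl[OF locally_ordered_category_Cat that])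
 interpret MQ: quantaloid ModQ by (rule quantaloid_Mod)
 have ident: "FArr Elmap M M (Ident ModQ M) = Ident Kcat (El M)" if M: "M \<in> Ob ModQ" for M
 proof
  interpret M: module_pair Q "FOb M" "\<lambda>X Y. FArr M Y X" "FOb M" "\<lambda>X Y. FArr M Y X" p p by (rule module_pair[OF M M])
  fix u show "FArr Elmap M M (Ident ModQ M) u = Ident Kcat (El M) u"
   using M.M.eltD[of u] by (simp add: Elmap_def El_def M.emap_def restrict_def)
 qed
 have comp: "FArr Elmap M P (Comp ModQ M N P \<beta> \<alpha>) = Comp Kcat (El M) (El N) (El P) (FArr Elmap N P \<beta>) (FArr Elmap M N \<alpha>)"
  if M: "M \<in> Ob ModQ" "N \<in> Ob ModQ" "P \<in> Ob ModQ" and \<alpha>: "\<alpha> \<in> Hom ModQ M N" "\<beta> \<in> Hom ModQ N P" for M N P \<alpha> \<beta>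
 proof
  interpret MN: module_pair Q "FOb M" "\<lambda>X Y. FArr M Y X" "FOb N" "\<lambda>X Y. FArr N Y X" p p by (rule module_pair[OF M(1,2)])
  interpret NP: module_pair Q "FOb N" "\<lambda>X Y. FArr N Y X" "FOb P" "\<lambda>X Y. FArr P Y X" p p by (rule module_pair[OF M(2,3)])
  interpret MP: module_pair Q "FOb M" "\<lambda>X Y. FArr M Y X" "FOb P" "\<lambda>X Y. FArr P Y X" p p by (rule module_pair[OF M(1,3)])
  have mm: "MN.module_map \<alpha>" using Mod_hom_module_map[OF M(1,2)] \<alpha> by blast
  fix u show "FArr Elmap M P (Comp ModQ M N P \<beta> \<alpha>) u
   = Comp Kcat (El M) (El N) (El P) (FArr Elmap N P \<beta>) (FArr Elmap M N \<alpha>) u"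
  proof (cases "u \<in> Elts MN.M.elements")
   case True
   then show ?thesis
    using MN.M.eltD[OF True] MN.emap[OF mm True] by (simp add: Elmap_def El_def MP.emap_def NP.emap_def compose_def)
  qed (simp add: Elmap_def El_def MP.emap_def compose_def)
 qed
 have "pseudofunctor ModQ Kcat Elmap"
  unfolding pseudofunctor_def Tob
 proof (intro conjI ballI impI funcsetI)
  fix M N \<alpha> \<beta> assume M: "M \<in> Ob ModQ" "N \<in> Ob ModQ" and \<alpha>: "\<alpha> \<in> Hom ModQ M N" "\<beta> \<in> Hom ModQ M N" "Leq ModQ M N \<alpha> \<beta>"
  show "Leq Kcat (El M) (El N) (FArr Elmap M N \<alpha>) (FArr Elmap M N \<beta>)"
   using iffD2[OF ple[OF M \<alpha>(1,2)] \<alpha>(3)] by (rule pleD)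
 next
  fix M assume M: "M \<in> Ob ModQ"
  show "iso2 Kcat (El M) (El M) (FArr Elmap M M (Ident ModQ M)) (Ident Kcat (El M))"
   unfolding ident[OF M, symmetric] using pr[OF Elob[OF M] Elob[OF M] all(1)[OF M M MQ.Ident_in_Hom[OF M]]]
   by (simp add: iso2_def pis_def ple_def)
 next
  fix M N P \<alpha> \<beta> assume M: "M \<in> Ob ModQ" "N \<in> Ob ModQ" "P \<in> Ob ModQ" and \<alpha>: "\<alpha> \<in> Hom ModQ M N" "\<beta> \<in> Hom ModQ N P"
  show "iso2 Kcat (El M) (El P) (FArr Elmap M P (Comp ModQ M N P \<beta> \<alpha>))
    (Comp Kcat (El M) (El N) (El P) (FArr Elmap N P \<beta>) (FArr Elmap M N \<alpha>))"
   unfolding comp[OF M \<alpha>, symmetric]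
   using pr[OF Elob[OF M(1)] Elob[OF M(3)] all(1)[OF M(1,3) MQ.Comp_in_Hom[OF M \<alpha>]]]
   by (simp add: iso2_def pis_def ple_def)
 qed (fact Elob all(1))+
 moreover have "\<exists>\<alpha>\<in>Hom ModQ M N. pis Kcat (El M) (El N) (FArr Elmap M N \<alpha>) h"
  if M: "M \<in> Ob ModQ" "N \<in> Ob ModQ" and h: "left_adjoint_in Kcat (El M) (El N) h" for M N h
 proof -
  obtain \<alpha> where \<alpha>: "\<alpha> \<in> Hom ModQ M N" "FArr Elmap M N \<alpha> = h" using lift[OF M h] by blast
  have "pis Kcat (El M) (El N) (FArr Elmap M N \<alpha>) h"
   using pr[OF Elob[OF M(1)] Elob[OF M(2)] all(1)[OF M \<alpha>(1)]] \<alpha>(2) by simp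
  then show ?thesis using \<alpha>(1) by blast
 qed
 moreover have "ple ModQ M N \<alpha> \<beta>"
  if "M \<in> Ob ModQ" "N \<in> Ob ModQ" "\<alpha> \<in> Hom ModQ M N" "\<beta> \<in> Hom ModQ M N"
   "ple Kcat (El M) (El N) (FArr Elmap M N \<alpha>) (FArr Elmap M N \<beta>)" for M N \<alpha> \<beta>
  unfolding ple_def using that ple[OF that(1-4)] by blast
 ultimately have "realizes ModQ Kcat Elmap" unfolding realizes_def Tob using all(2) by blast
 then show ?thesis
  using MQ.locally_ordered_category_axioms locally_ordered_category_Cat \<open>pseudofunctor ModQ Kcat Elmap\<close>
  by (simp add: realization_def realization_axioms_def psf_def psf_axioms_def)
qed

end

section \<open>Modules on the split idempotents\<close>

context sup_module
begin

definition fixlat :: "'o \<times> 'a => 'x gorder" where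
 "fixlat p = \<lparr>carrier = {x \<in> carrier (lat (fst p)). act (fst p) (fst p) (snd p) x = x}, eq = (=), le = le (lat (fst p))\<rparr>"

lemma fixlat_simps [simp]:
 "carrier (fixlat p) = {x \<in> carrier (lat (fst p)). act (fst p) (fst p) (snd p) x = x}"
 "eq (fixlat p) = (=)" "le (fixlat p) = le (lat (fst p))"
 by (simp_all add: fixlat_def)

lemma fixlat_lub:
 assumes p: "p \<in> Ob (Idm Q)" and A: "A \<subseteq> carrier (fixlat p)" and s: "lub_in (lat (fst p)) A s"
 shows "lub_in (fixlat p) A s"
proof -
 have X: "fst p \<in> Ob Q" "snd p \<in> Hom Q (fst p) (fst p)" using p by simp_all
 have "act (fst p) (fst p) (snd p) ` A = A" using A by (auto simp: image_iff subset_iff)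
 then have "lub_in (lat (fst p)) A (act (fst p) (fst p) (snd p) s)" using act_sup[OF X(1,1,2) s] by simp
 then have "act (fst p) (fst p) (snd p) s = s" using lub_in_eq_sup[OF lat[OF X(1)]] s by metis
 then show ?thesis using s A by (auto simp: lub_in_def)
qed

lemma fixlat_complete: "p \<in> Ob (Idm Q) ==> complete_lattice (fixlat p)"
proof (rule complete_lattice_of_lubs)
 assume p: "p \<in> Ob (Idm Q)"
 then have c: "complete_lattice (lat (fst p))" by (simp add: lat)
 show "le (fixlat p) x x" if "x \<in> carrier (fixlat p)" for x using that complete_lattice_refl[OF c] by simp
 show "x = y" if "x \<in> carrier (fixlat p)" "y \<in> carrier (fixlat p)" "le (fixlat p) x y" "le (fixlat p) y x" for x y
  using that complete_lattice_antisym[OF c] by simp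
 show "le (fixlat p) x z" if "x \<in> carrier (fixlat p)" "y \<in> carrier (fixlat p)" "z \<in> carrier (fixlat p)"
  "le (fixlat p) x y" "le (fixlat p) y z" for x y z
  using that complete_lattice_trans[OF c, of x y z] by simp
 show "\<exists>s. lub_in (fixlat p) A s" if "A \<subseteq> carrier (fixlat p)" for A
 proof -
  have "A \<subseteq> carrier (lat (fst p))" using that by auto
  then show ?thesis using fixlat_lub[OF p that] sup_lub_in[OF c] by blast
 qed
qed simp

lemma fixlat_lub_iff:
 assumes p: "p \<in> Ob (Idm Q)"
 shows "lub_in (fixlat p) A s \<longleftrightarrow> A \<subseteq> carrier (fixlat p) \<and> lub_in (lat (fst p)) A s"
proof
 assume s: "lub_in (fixlat p) A s"
 have A: "A \<subseteq> carrier (fixlat p)" using s by (simp add: lub_in_def)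
 then have "A \<subseteq> carrier (lat (fst p))" by auto
 moreover have c: "complete_lattice (lat (fst p))" using p by (simp add: lat)
 ultimately have l: "lub_in (lat (fst p)) A (\<Squnion>\<^bsub>lat (fst p)\<^esub> A)" by (rule sup_lub_in[rotated])
 then have "s = \<Squnion>\<^bsub>lat (fst p)\<^esub> A"
  using lub_in_eq_sup[OF fixlat_complete[OF p]] fixlat_lub[OF p A l] s by metis
 then show "A \<subseteq> carrier (fixlat p) \<and> lub_in (lat (fst p)) A s" using A l by simp
qed (simp add: fixlat_lub[OF p])

lemma fixlat_module: "sup_module (Idm Q) fixlat (\<lambda>p q. act (fst p) (fst q))"
proof (intro sup_module.intro sup_module_axioms.intro quantaloid_Idm)
 have act_fix: "act (fst p) (fst q) b y \<in> carrier (fixlat p)"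
  if "p \<in> Ob (Idm Q)" "q \<in> Ob (Idm Q)" and b: "b \<in> Hom (Idm Q) p q" and y: "y \<in> carrier (fixlat q)" for p q b y
  using that act_comp[of "fst p" "fst p" "fst q" "snd p" b y] by (simp add: act_in)
 then show "act (fst p) (fst q) b y \<in> carrier (fixlat p)"
  if "p \<in> Ob (Idm Q)" "q \<in> Ob (Idm Q)" "b \<in> Hom (Idm Q) p q" "y \<in> carrier (fixlat q)" for p q b y
  using that by blast
 show "act (fst p) (fst p) (Ident (Idm Q) p) x = x" if "p \<in> Ob (Idm Q)" "x \<in> carrier (fixlat p)" for p x
  using that by simp
 show "act (fst p) (fst r) (Comp (Idm Q) p q r g f) z = act (fst p) (fst q) f (act (fst q) (fst r) g z)"
  if "p \<in> Ob (Idm Q)" "q \<in> Ob (Idm Q)" "r \<in> Ob (Idm Q)" "f \<in> Hom (Idm Q) p q" "g \<in> Hom (Idm Q) q r"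
   "z \<in> carrier (fixlat r)" for p q r f g z
  using that by (simp add: act_comp)
 show "lub_in (fixlat p) (act (fst p) (fst q) f ` A) (act (fst p) (fst q) f y)"
  if p: "p \<in> Ob (Idm Q)" "q \<in> Ob (Idm Q)" and f: "f \<in> Hom (Idm Q) p q" and y: "lub_in (fixlat q) A y" for p q f A y
 proof (rule fixlat_lub[OF p(1)])
  show "act (fst p) (fst q) f ` A \<subseteq> carrier (fixlat p)" using act_fix[OF p f] y unfolding lub_in_def by blast
  have "lub_in (lat (fst q)) A y" using y fixlat_lub_iff[OF p(2)] by blast
  then show "lub_in (lat (fst p)) (act (fst p) (fst q) f ` A) (act (fst p) (fst q) f y)"
   using p f by (intro act_sup) simp_all
 qed
 show "lub_in (fixlat p) ((\<lambda>f. act (fst p) (fst q) f y) ` S) (act (fst p) (fst q) s y)"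
  if p: "p \<in> Ob (Idm Q)" "q \<in> Ob (Idm Q)" and y: "y \<in> carrier (fixlat q)" and s: "lub_in (homlat (Idm Q) p q) S s" for p q y S s
 proof (rule fixlat_lub[OF p(1)])
  have "S \<subseteq> Hom (Idm Q) p q" using s by (simp add: lub_in_def)
  then show "(\<lambda>f. act (fst p) (fst q) f y) ` S \<subseteq> carrier (fixlat p)" using act_fix[OF p _ y] by blast
  show "lub_in (lat (fst p)) ((\<lambda>f. act (fst p) (fst q) f y) ` S) (act (fst p) (fst q) s y)"
   using p y Idm_lub[OF p s] by (intro act_hsup) simp_all
 qed
qed (rule fixlat_complete)

end

text \<open>The extension of a module on \<open>Q\<close> to the idempotents sends \<open>e\<close> to the fixed points of
 its action. Fixed points already lie in
 the universe, so they are coded by themselves.\<close>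

definition extend :: "('o, 'a) locat => ('o, 'a, 'u gorder, 'u => 'u) arrow_map => ('o \<times> 'a, 'a, 'u gorder, 'u => 'u) arrow_map" where
 "extend Q M = small_sup_module.coded (sup_module.fixlat (FOb M) (\<lambda>X Y. FArr M Y X))
   (\<lambda>p q. FArr M (fst q) (fst p)) (\<lambda>_ x. x)"

locale extension = quantaloid Q for Q :: "('o, 'a) locat" +
 fixes M :: "('o, 'a, 'u gorder, 'u => 'u) arrow_map"
 assumes M: "homomorphism (opq Q) SL M"
begin

sublocale M: sup_module Q "FOb M" "\<lambda>X Y. FArr M Y X"
 by (rule Mod_object_sup_module[OF quantaloid_axioms M])

sublocale c: small_sup_module "Idm Q" M.fixlat "\<lambda>p q. FArr M (fst q) (fst p)" "\<lambda>_ x. x"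
proof (intro small_sup_module.intro small_sup_module_axioms.intro M.fixlat_module)
 show "small TYPE('u) (carrier (M.fixlat p))" if "p \<in> Ob (Idm Q)" for p
  using Mod_object_small[OF M, of "fst p"] that by (auto intro: small_subset)
qed simp

lemma extend_homomorphism: "homomorphism (opq (Idm Q)) SL (extend Q M)"
 unfolding extend_def by (rule c.coded_homomorphism)

lemma extend_simps:
 shows extend_carrier: "carrier (FOb (extend Q M) p) = {x \<in> carrier (FOb M (fst p)). FArr M (fst p) (fst p) (snd p) x = x}"
  and extend_le: "[|p \<in> Ob (Idm Q); x \<in> carrier (FOb (extend Q M) p); y \<in> carrier (FOb (extend Q M) p)|] ==>
   le (FOb (extend Q M) p) x y \<longleftrightarrow> le (FOb M (fst p)) x y"
  and extend_act: "[|q \<in> Ob (Idm Q); y \<in> carrier (FOb (extend Q M) q)|] ==>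
   FArr (extend Q M) q p b y = FArr M (fst q) (fst p) b y"
 using c.decode_code c.coded_act[of q y p b] by (simp_all add: extend_def)

lemma extend_lub:
 assumes p: "p \<in> Ob (Idm Q)"
 shows "lub_in (FOb (extend Q M) p) A s \<longleftrightarrow> A \<subseteq> carrier (FOb (extend Q M) p) \<and> lub_in (FOb M (fst p)) A s"
proof -
 have "lub_in (FOb (extend Q M) p) A s \<longleftrightarrow> lub_in (M.fixlat p) A s"
  using extend_le[OF p] by (auto simp: lub_in_def extend_carrier subset_iff)
 then show ?thesis using M.fixlat_lub_iff[OF p] by (simp add: extend_carrier)
qed

end

context quantaloid
begin

abbreviation "base X \<equiv> (X, Ident Q X)"

definition restriction :: "(('o \<times> 'a, 'a, 'u gorder, 'u => 'u) arrow_map, 'o \<times> 'a => 'u => 'u,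
  ('o, 'a, 'u gorder, 'u => 'u) arrow_map, 'o => 'u => 'u) arrow_map" where
 "restriction = \<lparr>FOb = (\<lambda>N. comp_map N \<lparr>FOb = base, FArr = \<lambda>X Y f. f\<rparr>), FArr = (\<lambda>M N \<gamma>. \<lambda>X\<in>Ob Q. \<gamma> (base X))\<rparr>"

lemma restriction_simps [simp]:
 "FOb (FOb restriction N) X = FOb N (base X)" "FArr (FOb restriction N) Y X f = FArr N (base Y) (base X) f"
 "FArr restriction M N \<gamma> = (\<lambda>X\<in>Ob Q. \<gamma> (base X))"
 by (simp_all add: restriction_def comp_map_def)

lemma base_homomorphism: "homomorphism (opq Q) (opq (Idm Q)) \<lparr>FOb = base, FArr = \<lambda>X Y f. f\<rparr>"
proof -
 interpret I: quantaloid "Idm Q" by (rule quantaloid_Idm)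
 have "sup_pres (homlat Q X Y) (homlat (Idm Q) (base X) (base Y)) (\<lambda>f. f)" if X: "X \<in> Ob Q" "Y \<in> Ob Q" for X Y
  using X homlat_complete[OF X] I.homlat_complete[of "base X" "base Y"]
  by (intro sup_presI) (auto simp: lub_in_def)
 then show ?thesis unfolding homomorphism_def by (auto simp: homlat_def)
qed

lemma restriction_module: "homomorphism (opq (Idm Q)) SL N ==> homomorphism (opq Q) SL (FOb restriction N)"
 using homomorphism_comp[OF base_homomorphism] by (simp add: restriction_def)

lemma Idm_arrows:
 assumes "p \<in> Ob (Idm Q)" "q \<in> Ob (Idm Q)" "b \<in> Hom (Idm Q) p q"
 shows "base (fst p) \<in> Ob (Idm Q)" "snd p \<in> Hom (Idm Q) p (base (fst p))" "snd p \<in> Hom (Idm Q) (base (fst p)) p"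
  "b \<in> Hom (Idm Q) (base (fst p)) (base (fst q))" "b \<in> Hom (Idm Q) p (base (fst q))" "b \<in> Hom (Idm Q) (base (fst p)) q"
  "Comp Q (fst p) (fst p) (fst p) (snd p) (snd p) = snd p" "snd p \<in> Hom (Idm Q) p p"
  "Comp Q (fst p) (fst p) (fst q) b (snd p) = b" "Comp Q (fst p) (fst q) (fst q) (snd q) b = b"
 using assms by auto

text \<open>An idempotent \<open>e\<close> on \<open>X\<close> is an arrow both ways between \<open>e\<close> and \<open>1\<^sub>X\<close> that splits \<open>e\<close>;
 so a morphism of modules on the idempotents is determined by, and extends from, its components at
 identities.\<close>

lemma restriction_determines:
 assumes M: "homomorphism (opq (Idm Q)) SL M" and N: "homomorphism (opq (Idm Q)) SL N"
  and \<gamma>: "\<gamma> \<in> nat_trans (opq (Idm Q)) SL M N" and p: "p \<in> Ob (Idm Q)" and x: "x \<in> carrier (FOb M p)"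
 shows "\<gamma> p x = FArr N (base (fst p)) p (snd p) (\<gamma> (base (fst p)) (FArr M p (base (fst p)) (snd p) x))"
proof -
 interpret M: sup_module "Idm Q" "FOb M" "\<lambda>p q. FArr M q p" by (rule Mod_object_sup_module[OF quantaloid_Idm M])
 have "snd p \<in> Hom (Idm Q) p p" using p by simp
 note e = Idm_arrows[OF p p this]
 have "x = FArr M (base (fst p)) p (snd p) (FArr M p (base (fst p)) (snd p) x)"
  using M.act_comp[OF p e(1) p e(2,3) x] M.act_id[OF p x] e(7) by simp
 then show ?thesis
  using Mod_homD(5)[OF quantaloid_Idm M N \<gamma> p e(1,2) M.act_in[OF e(1) p e(3) x]] by simp
qed

lemma restriction_full:
 fixes M N :: "('o \<times> 'a, 'a, 'u gorder, 'u => 'u) arrow_map"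
 assumes M: "homomorphism (opq (Idm Q)) SL M" and N: "homomorphism (opq (Idm Q)) SL N"
  and \<alpha>: "\<alpha> \<in> nat_trans (opq Q) SL (FOb restriction M) (FOb restriction N)"
 shows "\<exists>\<gamma>\<in>nat_trans (opq (Idm Q)) SL M N. FArr restriction M N \<gamma> = \<alpha>"
proof
 interpret M: sup_module "Idm Q" "FOb M" "\<lambda>p q. FArr M q p" by (rule Mod_object_sup_module[OF quantaloid_Idm M])
 interpret N: sup_module "Idm Q" "FOb N" "\<lambda>p q. FArr N q p" by (rule Mod_object_sup_module[OF quantaloid_Idm N])
 note \<alpha>D = Mod_homD[OF quantaloid_axioms restriction_module[OF M] restriction_module[OF N] \<alpha>, unfolded restriction_simps]
 define \<gamma> where "\<gamma> = (\<lambda>p\<in>Ob (Idm Q). \<lambda>x\<in>carrier (FOb M p).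
   FArr N (base (fst p)) p (snd p) (\<alpha> (fst p) (FArr M p (base (fst p)) (snd p) x)))"
 have \<gamma>: "\<gamma> p x = FArr N (base (fst p)) p (snd p) (\<alpha> (fst p) (FArr M p (base (fst p)) (snd p) x))"
  if "p \<in> Ob (Idm Q)" "x \<in> carrier (FOb M p)" for p x using that by (simp add: \<gamma>_def del: Idm_simps)
 have ob: "fst p \<in> Ob Q" "snd p \<in> Hom (Idm Q) p p" if "p \<in> Ob (Idm Q)" for p using that by simp_all
 have base: "base X \<in> Ob (Idm Q)" if "X \<in> Ob Q" for X using that by simp
 show "\<gamma> \<in> nat_trans (opq (Idm Q)) SL M N"
  unfolding Mod_hom_iff[OF quantaloid_Idm M N]
 proof (intro conjI ballI allI impI)
  fix p assume p: "p \<in> Ob (Idm Q)"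
  note e = Idm_arrows[OF p p ob(2)[OF p]] and X = ob(1)[OF p]
  show "\<gamma> p \<in> carrier (FOb M p) \<rightarrow>\<^sub>E carrier (FOb N p)"
  proof (rule PiE_I)
   fix x assume x: "x \<in> carrier (FOb M p)"
   show "\<gamma> p x \<in> carrier (FOb N p)" unfolding \<gamma>[OF p x] by (intro N.act_in[OF p e(1,2)] \<alpha>D(3)[OF X] M.act_in[OF e(1) p e(3) x])
  qed (use p in \<open>simp add: \<gamma>_def del: Idm_simps\<close>)
  fix A s assume s: "lub_in (FOb M p) A s"
  then have A: "A \<subseteq> carrier (FOb M p)" "s \<in> carrier (FOb M p)" by (simp_all add: lub_in_def)
  have eq: "\<gamma> p ` A = FArr N (base (fst p)) p (snd p) ` \<alpha> (fst p) ` FArr M p (base (fst p)) (snd p) ` A"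
   unfolding image_image using A \<gamma>[OF p] by (intro image_cong) auto
  show "lub_in (FOb N p) (\<gamma> p ` A) (\<gamma> p s)"
   unfolding eq \<gamma>[OF p A(2)] by (intro N.act_sup[OF p e(1,2)] \<alpha>D(4)[OF X] M.act_sup[OF e(1) p e(3) s])
 next
  fix p q b y assume p: "p \<in> Ob (Idm Q)" "q \<in> Ob (Idm Q)" and b: "b \<in> Hom (Idm Q) p q" and y: "y \<in> carrier (FOb M q)"
  note e = Idm_arrows[OF p b] and f = Idm_arrows[OF p(2,2) ob(2)[OF p(2)]]
  let ?x = "FArr M q (base (fst q)) (snd q) y"
  have x: "?x \<in> carrier (FOb M (base (fst q)))" by (rule M.act_in[OF f(1) p(2) f(3) y])
  have \<alpha>x: "\<alpha> (fst q) ?x \<in> carrier (FOb N (base (fst q)))" by (rule \<alpha>D(3)[OF ob(1)[OF p(2)] x])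
  have bQ: "b \<in> Hom Q (fst p) (fst q)" using b by simp
  have "FArr M p (base (fst p)) (snd p) (FArr M q p b y) = FArr M q (base (fst p)) b y"
   using M.act_comp[OF e(1) p e(3) b y] e(9) by simp
  also have "\<dots> = FArr M (base (fst q)) (base (fst p)) b ?x"
   using M.act_comp[OF e(1) f(1) p(2) e(4) f(3) y] e(10) by simp
  finally have "\<gamma> p (FArr M q p b y) = FArr N (base (fst p)) p (snd p) (FArr N (base (fst q)) (base (fst p)) b (\<alpha> (fst q) ?x))"
   using \<gamma>[OF p(1) M.act_in[OF p b y]] \<alpha>D(5)[OF ob(1)[OF p(1)] ob(1)[OF p(2)] bQ x] by simp
  also have "\<dots> = FArr N (base (fst q)) p b (\<alpha> (fst q) ?x)"
   using N.act_comp[OF p(1) e(1) f(1) e(2,4) \<alpha>x] e(9) by simp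
  also have "\<dots> = FArr N q p b (\<gamma> q y)"
   using N.act_comp[OF p f(1) b f(2) \<alpha>x] \<gamma>[OF p(2) y] e(10) by simp
  finally show "\<gamma> p (FArr M q p b y) = FArr N q p b (\<gamma> q y)" .
 qed (simp add: \<gamma>_def)
 have "\<gamma> (base X) x = \<alpha> X x" if X: "X \<in> Ob Q" and x: "x \<in> carrier (FOb M (base X))" for X x
  using \<gamma>[OF base[OF X] x] M.act_id[OF base[OF X] x] N.act_id[OF base[OF X] \<alpha>D(3)[OF X x]] by simp
 moreover have "\<gamma> (base X) \<in> extensional (carrier (FOb M (base X)))" if "X \<in> Ob Q" for X
  using base[OF that] by (simp add: \<gamma>_def del: Idm_simps)
 ultimately have "\<gamma> (base X) = \<alpha> X" if X: "X \<in> Ob Q" for X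
  using \<alpha>D(2)[OF X] X by (intro extensionalityI[of _ "carrier (FOb M (base X))"]) (auto simp: PiE_def)
 then show "FArr restriction M N \<gamma> = \<alpha>" using \<alpha>D(1) by (auto simp: restrict_def extensional_def fun_eq_iff)
qed

lemma restriction_extend:
 fixes M :: "('o, 'a, 'u gorder, 'u => 'u) arrow_map"
 assumes M: "homomorphism (opq Q) SL M"
 shows "\<exists>i j. equiv_pair (Mod_quantaloid TYPE('u) Q) M (FOb restriction (extend Q M)) i j"
proof -
 let ?K = "Mod_quantaloid TYPE('u) Q" and ?N = "FOb restriction (extend Q M)"
 interpret M: extension Q M using M by unfold_locales
 interpret K: quantaloid ?K by (rule quantaloid_Mod)
 have N: "homomorphism (opq Q) SL ?N" by (rule restriction_module[OF M.extend_homomorphism])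
 have base: "base X \<in> Ob (Idm Q)" if "X \<in> Ob Q" for X using that by simp
 have car: "carrier (FOb (extend Q M) (base X)) = carrier (FOb M X)" if "X \<in> Ob Q" for X
  using M.M.act_id[OF that] by (auto simp: M.extend_carrier)
 have lub: "lub_in (FOb (extend Q M) (base X)) A s \<longleftrightarrow> lub_in (FOb M X) A s" if "X \<in> Ob Q" for X A s
  using M.extend_lub[OF base[OF that]] car[OF that] by (auto simp: lub_in_def[of "FOb M X"])
 have act: "FArr (extend Q M) (base Y) (base X) f y = FArr M Y X f y" if "Y \<in> Ob Q" "y \<in> carrier (FOb M Y)" for X Y f y
  using M.extend_act[OF base[OF that(1)]] car that by simp
 let ?i = "\<lambda>X\<in>Ob Q. \<lambda>x\<in>carrier (FOb M X). x"
 have im: "(\<lambda>x\<in>carrier (FOb M X). x) ` A = A" "s \<in> carrier (FOb M X)" if "lub_in (FOb M X) A s" for X A s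
  using that by (auto simp: lub_in_def image_iff subset_iff)
 have "?i \<in> nat_trans (opq Q) SL M ?N" "?i \<in> nat_trans (opq Q) SL ?N M"
  unfolding Mod_hom_iff[OF quantaloid_axioms M N] Mod_hom_iff[OF quantaloid_axioms N M]
  using car lub act M.M.act_in im by auto
 then have "equiv_pair ?K M ?N ?i ?i"
  unfolding equiv_pair_def using M N car K.pis_refl[of M M "Ident ?K M"] K.pis_refl[of ?N ?N "Ident ?K ?N"] K.Ident_in_Hom[of M] K.Ident_in_Hom[of ?N]
  by (simp add: compose_def restrict_def cong: if_cong)
 then show ?thesis by blast
qed

lemma weak_equivalence_restriction: "weak_equivalence (Mod_quantaloid TYPE('u) (Idm Q)) (Mod_quantaloid TYPE('u) Q) restriction"
proof (rule weak_equivalenceI[OF quantaloid_Mod quantaloid_Mod])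
 let ?I = "Mod_quantaloid TYPE('u) (Idm Q)"
 have base: "base X \<in> Ob (Idm Q)" if "X \<in> Ob Q" for X using that by simp
 show "FOb restriction N \<in> Ob (Mod_quantaloid TYPE('u) Q)" if "N \<in> Ob ?I" for N using that restriction_module by simp
 fix M N :: "('o \<times> 'a, 'a, 'u gorder, 'u => 'u) arrow_map" assume "M \<in> Ob ?I" "N \<in> Ob ?I"
 then have M: "homomorphism (opq (Idm Q)) SL M" and N: "homomorphism (opq (Idm Q)) SL N" by simp_all
 note D = Mod_homD[OF quantaloid_Idm M N]
 show "FArr restriction M N \<gamma> \<in> Hom (Mod_quantaloid TYPE('u) Q) (FOb restriction M) (FOb restriction N)" if \<gamma>: "\<gamma> \<in> Hom ?I M N" for \<gamma>
  unfolding Mod_simps Mod_hom_iff[OF quantaloid_axioms restriction_module[OF M] restriction_module[OF N]]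
  using D(2,4)[OF \<gamma>[unfolded Mod_simps] base] D(5)[OF \<gamma>[unfolded Mod_simps] base base] by simp
 show "\<exists>\<gamma>\<in>Hom ?I M N. FArr restriction M N \<gamma> = \<alpha>"
  if "\<alpha> \<in> Hom (Mod_quantaloid TYPE('u) Q) (FOb restriction M) (FOb restriction N)" for \<alpha>
  using restriction_full[OF M N] that by simp
 fix \<gamma> \<delta> assume g: "\<gamma> \<in> Hom ?I M N" "\<delta> \<in> Hom ?I M N"
 interpret M: sup_module "Idm Q" "FOb M" "\<lambda>p q. FArr M q p" by (rule Mod_object_sup_module[OF quantaloid_Idm M])
 interpret N: sup_module "Idm Q" "FOb N" "\<lambda>p q. FArr N q p" by (rule Mod_object_sup_module[OF quantaloid_Idm N])
 have "le (FOb N p) (\<gamma> p x) (\<delta> p x)"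
  if le: "\<forall>X\<in>Ob Q. \<forall>x\<in>carrier (FOb M (base X)). le (FOb N (base X)) (\<gamma> (base X) x) (\<delta> (base X) x)"
   and p: "p \<in> Ob (Idm Q)" and x: "x \<in> carrier (FOb M p)" for p x
 proof -
  have X: "fst p \<in> Ob Q" "snd p \<in> Hom (Idm Q) p p" using p by simp_all
  note e = Idm_arrows[OF p p X(2)]
  have y: "FArr M p (base (fst p)) (snd p) x \<in> carrier (FOb M (base (fst p)))" by (rule M.act_in[OF e(1) p e(3) x])
  have "N.mle (base (fst p)) (\<gamma> (base (fst p)) (FArr M p (base (fst p)) (snd p) x)) (\<delta> (base (fst p)) (FArr M p (base (fst p)) (snd p) x))"
   using le X(1) y D(3)[OF _ e(1) y] g e(1) unfolding N.mle_def Mod_simps by blast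
  from N.act_mle[OF p e(2) this] show ?thesis
   using restriction_determines[OF M N _ p x] g unfolding N.mle_def Mod_simps by metis
 qed
 then have "(\<forall>p\<in>Ob (Idm Q). \<forall>x\<in>carrier (FOb M p). le (FOb N p) (\<gamma> p x) (\<delta> p x)) \<longleftrightarrow>
  (\<forall>X\<in>Ob Q. \<forall>x\<in>carrier (FOb M (base X)). le (FOb N (base X)) (\<gamma> (base X) x) (\<delta> (base X) x))"
  using base by blast
 moreover have "FArr restriction M N \<epsilon> \<in> nat_trans (opq Q) SL (FOb restriction M) (FOb restriction N)"
  if \<epsilon>: "\<epsilon> \<in> nat_trans (opq (Idm Q)) SL M N" for \<epsilon>
  unfolding Mod_hom_iff[OF quantaloid_axioms restriction_module[OF M] restriction_module[OF N]]
  using D(2,4)[OF \<epsilon> base] D(5)[OF \<epsilon> base base] by simp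
 moreover note restriction_module[OF M] restriction_module[OF N]
 ultimately show "ple (Mod_quantaloid TYPE('u) Q) (FOb restriction M) (FOb restriction N) (FArr restriction M N \<gamma>) (FArr restriction M N \<delta>)
   \<longleftrightarrow> ple ?I M N \<gamma> \<delta>"
  using g M N unfolding ple_def Mod_simps mem_Collect_eq by (simp add: restriction_simps(1,3) del: Idm_simps cong: ball_cong)
next
 fix X :: "('o, 'a, 'u gorder, 'u => 'u) arrow_map" assume "X \<in> Ob (Mod_quantaloid TYPE('u) Q)"
 then have X: "homomorphism (opq Q) SL X" by simp
 interpret X: extension Q X using X by unfold_locales
 show "\<exists>N\<in>Ob (Mod_quantaloid TYPE('u) (Idm Q)). \<exists>i j. equiv_pair (Mod_quantaloid TYPE('u) Q) X (FOb restriction N) i j"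
  using restriction_extend[OF X] X.extend_homomorphism by auto
qed (auto simp: fun_eq_iff restrict_def)

end

lemma realization_after_full:
 assumes F: "psf C D F" and U: "realization D K U"
  and reflects: "\<And>X Y f g. [|X \<in> Ob C; Y \<in> Ob C; f \<in> Hom C X Y; g \<in> Hom C X Y;
   ple D (FOb F X) (FOb F Y) (FArr F X Y f) (FArr F X Y g)|] ==> ple C X Y f g"
  and full: "\<And>X Y h. [|X \<in> Ob C; Y \<in> Ob C; h \<in> Hom D (FOb F X) (FOb F Y)|] ==> \<exists>f\<in>Hom C X Y. FArr F X Y f = h"
 shows "realization C K (comp_map U F)"
proof -
 interpret F: psf C D F by fact
 interpret U: realization D K U by fact
 have ps: "pseudofunctor C K (comp_map U F)"
  by (rule pseudofunctor_comp[OF F.C.locally_ordered_category_axioms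
     F.D.locally_ordered_category_axioms U.U.D.locally_ordered_category_axioms F.pseudo U.U.pseudo])
 have "ple C X Y f g" if X: "X \<in> Ob C" "Y \<in> Ob C" "f \<in> Hom C X Y" "g \<in> Hom C X Y"
  and le: "ple K (FOb U (FOb F X)) (FOb U (FOb F Y)) (FArr U (FOb F X) (FOb F Y) (FArr F X Y f))
    (FArr U (FOb F X) (FOb F Y) (FArr F X Y g))" for X Y f g
  by (rule reflects[OF X U.reflects[OF F.ob F.ob F.arr F.arr le]]) (use X in auto)
 moreover have "\<exists>f\<in>Hom C X Y. pis K (FOb U (FOb F X)) (FOb U (FOb F Y)) (FArr U (FOb F X) (FOb F Y) (FArr F X Y f)) h"
  if X: "X \<in> Ob C" "Y \<in> Ob C" and h: "left_adjoint_in K (FOb U (FOb F X)) (FOb U (FOb F Y)) h" for X Y h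
  using U.lift[OF F.ob[OF X(1)] F.ob[OF X(2)] h] full[OF X] by metis
 ultimately have "realizes C K (comp_map U F)"
  unfolding realizes_def using ps U.adj F.ob F.arr by (simp add: comp_map_def)
 then show ?thesis
  using ps F.C.locally_ordered_category_axioms U.U.D.locally_ordered_category_axioms
  by (simp add: realization_def realization_axioms_def psf_def psf_axioms_def)
qed

section \<open>The modules recovered from the ordered sheaves\<close>

text \<open>Modules on \<open>Q\<close> are realized by the categories of elements of their extensions to
 \<open>Idm(Q)\<close>, and up to equivalence these are exactly the absolute retracts.\<close>

theorem Mod_realization:
 fixes Q :: "('o, 'a) locat"
 assumes U: "grothendieck_universe TYPE('u)" and Q: "small_quantaloid TYPE('u) Q"
 shows "\<exists>T. realization (Mod_quantaloid TYPE('u) Q) (Ord_cat TYPE('u) Q) T \<and>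
  (\<forall>M\<in>Ob (Mod_quantaloid TYPE('u) Q). absolute_retract (Ord_cat TYPE('u) Q) (FOb T M)) \<and>
  (\<forall>I. absolute_retract (Ord_cat TYPE('u) Q) I -->
    (\<exists>M\<in>Ob (Mod_quantaloid TYPE('u) Q). \<exists>e d. equiv_pair (Ord_cat TYPE('u) Q) I (FOb T M) e d))"
proof -
 let ?MQ = "Mod_quantaloid TYPE('u) Q" and ?MI = "Mod_quantaloid TYPE('u) (Idm Q)" and ?K = "Ord_cat TYPE('u) Q"
 interpret quantaloid Q using Q by (simp add: small_quantaloid_def)
 have I: "small_quantaloid TYPE('u) (Idm Q)" by (rule small_quantaloid_Idm[OF U Q])
 then have "small TYPE('u) (Ob (Idm Q))" by (simp add: small_quantaloid_def del: Idm_simps)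
 then obtain r :: "'u \<times> 'o \<times> 'a => 'u" where r: "inj_on r (UNIV \<times> Ob (Idm Q))" by (rule universe_pairing_small[OF U])
 have "inj_on (\<lambda>z. r (snd z, fst z)) (Ob (Idm Q) \<times> UNIV)"
 proof (rule inj_onI)
  fix z w assume zw: "z \<in> Ob (Idm Q) \<times> UNIV" "w \<in> Ob (Idm Q) \<times> UNIV" "r (snd z, fst z) = r (snd w, fst w)"
  have "(snd z, fst z) = (snd w, fst w)" by (rule inj_onD[OF r zw(3)]) (use zw(1,2) in \<open>auto simp del: Idm_simps\<close>)
  then show "z = w" by (simp add: prod_eq_iff)
 qed
 then interpret S: small_base "Idm Q" "\<lambda>z. r (snd z, fst z)"
  using U I quantaloid_Idm by (simp add: small_base_def small_base_axioms_def)
 have K: "?K = S.Kcat" by (simp add: Ord_cat_def)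
 interpret L: realization ?MI S.Kcat S.Elmap by (rule S.Elmap_realization)
 interpret MQ: quantaloid ?MQ by (rule quantaloid_Mod)
 obtain G where G: "weak_equivalence ?MQ ?MI G"
  using weak_equivalence_inverse[OF quantaloid_Mod quantaloid_Mod weak_equivalence_restriction] by blast
 note GD = weak_equivalenceD[OF G]
 have E: "psf ?MQ ?MI G"
  using homomorphism_pseudofunctor[OF GD(1)] MQ.locally_ordered_category_axioms L.U.C.locally_ordered_category_axioms
  by (simp add: psf_def psf_axioms_def)
 then interpret E: psf ?MQ ?MI G .
 have ob: "FOb S.Elmap N = S.El N" for N by (simp add: S.Elmap_def)
 let ?T = "comp_map S.Elmap G"
 have Tob: "FOb ?T M = S.El (FOb G M)" for M by (simp add: comp_map_def ob)
 show ?thesis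
 proof (intro exI[of _ ?T] conjI ballI allI impI)
  show "realization ?MQ ?K ?T"
   unfolding K
  proof (rule realization_after_full[OF E S.Elmap_realization GD(3)])
   show "\<exists>f\<in>Hom ?MQ M N. FArr G M N f = h" if M: "M \<in> Ob ?MQ" "N \<in> Ob ?MQ" and h: "h \<in> Hom ?MI (FOb G M) (FOb G N)" for M N h
    using GD(2)[OF M] h unfolding bij_betw_def by (metis imageE)
  qed
  show "absolute_retract ?K (FOb ?T M)" if "M \<in> Ob ?MQ" for M
   unfolding K Tob by (rule S.El_absolute_retract) (use E.ob[OF that] in simp)
  show "\<exists>M\<in>Ob ?MQ. \<exists>e d. equiv_pair ?K I (FOb ?T M) e d" if ar: "absolute_retract ?K I" for I
  proof -
   obtain N e d where N: "N \<in> Ob ?MI" "equiv_pair S.Kcat I (S.El N) e d"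
    using S.absolute_retract_El[OF ar[unfolded K]] by blast
   obtain M e' d' where M: "M \<in> Ob ?MQ" "equiv_pair ?MI N (FOb G M) e' d'"
    using GD(4)[OF N(1)] by blast
   show ?thesis
    using L.U.D.equiv_pair_comp[OF N(2) L.U.equiv_pair[OF M(2), unfolded ob]] M(1) unfolding K Tob by blast
  qed
 qed
qed

text \<open>A biequivalence preserves absolute retracts, so it carries the realization of the modules on
 \<open>Q\<close> to one with the same image as that of the modules on \<open>Q'\<close>.\<close>

theorem Ord_biequivalent_imp_Mod_equivalent:
 fixes Q :: "('o, 'a) locat" and Q' :: "('p, 'b) locat"
 assumes U: "grothendieck_universe TYPE('u)" and Q: "small_quantaloid TYPE('u) Q" and Q': "small_quantaloid TYPE('u) Q'"
  and bi: "biequivalent (Ord_cat TYPE('u) Q) (Ord_cat TYPE('u) Q')"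
 shows "quantaloid_equivalent (Mod_quantaloid TYPE('u) Q) (Mod_quantaloid TYPE('u) Q')"
proof -
 let ?K = "Ord_cat TYPE('u) Q" and ?K' = "Ord_cat TYPE('u) Q'"
 obtain T where T: "realization (Mod_quantaloid TYPE('u) Q) ?K T"
   "\<And>M. M \<in> Ob (Mod_quantaloid TYPE('u) Q) ==> absolute_retract ?K (FOb T M)"
   "\<And>I. absolute_retract ?K I ==> \<exists>M\<in>Ob (Mod_quantaloid TYPE('u) Q). \<exists>e d. equiv_pair ?K I (FOb T M) e d"
  using Mod_realization[OF U Q] by blast
 obtain T' where T': "realization (Mod_quantaloid TYPE('u) Q') ?K' T'"
   "\<And>M. M \<in> Ob (Mod_quantaloid TYPE('u) Q') ==> absolute_retract ?K' (FOb T' M)"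
   "\<And>I. absolute_retract ?K' I ==> \<exists>M\<in>Ob (Mod_quantaloid TYPE('u) Q'). \<exists>e d. equiv_pair ?K' I (FOb T' M) e d"
  using Mod_realization[OF U Q'] by blast
 interpret T: realization "Mod_quantaloid TYPE('u) Q" ?K T by (rule T(1))
 interpret T': realization "Mod_quantaloid TYPE('u) Q'" ?K' T' by (rule T'(1))
 obtain F G \<eta> \<eta>i \<epsilon> \<epsilon>i where b: "biequivalence_data ?K ?K' F G \<eta> \<eta>i \<epsilon> \<epsilon>i"
  using biequivalent_data[OF T.U.D.locally_ordered_category_axioms T'.U.D.locally_ordered_category_axioms bi] .
 interpret b: biequivalence_data ?K ?K' F G \<eta> \<eta>i \<epsilon> \<epsilon>i by (rule b)
 interpret b': biequivalence_data ?K' ?K G F \<epsilon> \<epsilon>i \<eta> \<eta>i by (rule b.swap)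
 show ?thesis
 proof (rule same_image_equivalent[OF quantaloid_Mod quantaloid_Mod realization_after_biequivalence[OF T(1) b] T'(1)])
  fix M assume "M \<in> Ob (Mod_quantaloid TYPE('u) Q)"
  then show "\<exists>N\<in>Ob (Mod_quantaloid TYPE('u) Q'). \<exists>e d. equiv_pair ?K' (FOb (comp_map F T) M) (FOb T' N) e d"
   using T'(3)[OF b.absolute_retract_transfer[OF T(2)]] by (simp add: comp_map_def)
 next
  fix N assume N: "N \<in> Ob (Mod_quantaloid TYPE('u) Q')"
  obtain M e d where M: "M \<in> Ob (Mod_quantaloid TYPE('u) Q)" "equiv_pair ?K (FOb G (FOb T' N)) (FOb T M) e d"
   using T(3)[OF b'.absolute_retract_transfer[OF T'(2)[OF N]]] by blast
  show "\<exists>M\<in>Ob (Mod_quantaloid TYPE('u) Q). \<exists>e d. equiv_pair ?K' (FOb T' N) (FOb (comp_map F T) M) e d"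
   using T'.U.D.equiv_pair_comp[OF b.surjective[OF T'.U.ob[OF N]] b.F.equiv_pair[OF M(2)]] M(1)
   unfolding comp_map_def by auto
 qed
qed

theorem proposition4p2:
  fixes Q :: "('o, 'a) locat" and Q' :: "('p, 'b) locat"
  assumes "grothendieck_universe TYPE('u)"
    and "small_quantaloid TYPE('u) Q"
    and "small_quantaloid TYPE('u) Q'"
  shows "(quantaloid_equivalent Q Q' \<longrightarrow>
            biequivalent (Ord_cat TYPE('u) Q) (Ord_cat TYPE('u) Q')) \<and>
         (biequivalent (Ord_cat TYPE('u) Q) (Ord_cat TYPE('u) Q') \<longrightarrow>
            quantaloid_equivalent (Mod_quantaloid TYPE('u) Q) (Mod_quantaloid TYPE('u) Q')) \<and>
         (quantaloid_equivalent (Mod_quantaloid TYPE('u) Q) (Mod_quantaloid TYPE('u) Q') \<longrightarrow>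
            quantale_isomorphic (Centre Q) (Centre Q'))"
  using equivalent_imp_Ord_biequivalent[OF assms] Ord_biequivalent_imp_Mod_equivalent[OF assms]
    Mod_equivalent_imp_Centre_isomorphic[OF assms(2,3)] by blast

end
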